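(* Let $\gamma\ge 0$, $p\in(1,\infty)$ and $m\ge 1$ an integer. Let $\sigma:\mathbb{R}\to\mathbb{R}$ be a function which is not identically zero and satisfies $\sigma\in H_p^{\gamma}(\mathbb{R})$. Let $S$ be the set of all functions $F:\mathbb{R}^m\to\mathbb{R}$ of the form \[ F(x)=\sum_{j=1}^{n}\alpha_j\prod_{i=1}^{m}\sigma\!\left(w_{ij}^{T}x+b_{ij}\right), \] where $n\in\{1,2,\dots\}$, $\alpha_j\in\mathbb{R}$, $w_{ij}\in\mathbb{R}^m$, $b_{ij}\in\mathbb{R}$, and for each $j$ the $m\times m$ matrix whose rows are $w_{1j}^T,w_{2j}^T,\dots,w_{mj}^T$ (i.e. $\begin{bmatrix} w_{1j} & w_{2j} & \cdots & w_{mj}\end{bmatrix}^{T}$) is invertible. Then $S$ is dense in $H_p^{\gamma}(\mathbb{R}^m)$: for every $f\in H_p^{\gamma}(\mathbb{R}^m)$ and every $\varepsilon>0$ there exists $F\in S$ with \[ \|F-f\|_{H_p^{\gamma}(\mathbb{R}^m)}\le\varepsilon . \] In particular, if $\gamma-\frac{m}{p}>0$, then every $f\in H_p^{\gamma}(\mathbb{R}^m)$ (identified with its continuous representative) belongs to the Zygmund space $\mathcal{C}^{\gamma-\frac{m}{p}}(\mathbb{R}^m)$, and for every $\varepsilon>0$ there exists $F\in S$ with \[ \|F-f\|_{\mathcal{C}^{\gamma-\frac{m}{p}}(\mathbb{R}^m)}\le\varepsilon . \]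
   Context: For $p>1$ and $\gamma\in\mathbb{R}$, the Bessel potential space $H_p^{\gamma}(\mathbb{R}^m)$ is the class of tempered distributions $f$ on $\mathbb{R}^m$ with \[ \|f\|_{H_p^{\gamma}(\mathbb{R}^m)}:=\|(1-\Delta)^{\gamma/2}f\|_{L_p(\mathbb{R}^m)}=\left\|\mathcal{F}^{-1}\!\left[(1+|\cdot|^2)^{\gamma/2}\mathcal{F}[f]\right]\right\|_{L_p(\mathbb{R}^m)}<\infty, \] where $\mathcal{F}$, $\mathcal{F}^{-1}$ denote the $m$-dimensional Fourier transform and its inverse. Zygmund spaces: write a number $s>0$ as $s=k+\alpha$ with $k\in\{0,1,2,\dots\}$ and $\alpha\in(0,1]$. For a function $f$ on $\mathbb{R}^m$ set \[ |f|_{\mathcal{C}^{k}(\mathbb{R}^m)}:=\sum_{j=0}^{k}\sup_{|\beta|=j}\sup_{x\in\mathbb{R}^m}|D^{\beta}f(x)|,\qquad [f]_{\mathcal{C}^{k+\alpha}(\mathbb{R}^m)}:=\sup_{|\beta|=k}\ \sup_{x\in\mathbb{R}^m,\,h\in\mathbb{R}^m\setminus\{0\}}\frac{|D^{\beta}f(x+h)+D^{\beta}f(x-h)-2D^{\beta}f(x)|}{|h|^{\alpha}}, \] with $\beta$ ranging over multi-indices, and $\|f\|_{\mathcal{C}^{k+\alpha}(\mathbb{R}^m)}:=|f|_{\mathcal{C}^{k}(\mathbb{R}^m)}+[f]_{\mathcal{C}^{k+\alpha}(\mathbb{R}^m)}$. The Zygmund space $\mathcal{C}^{k+\alpha}(\mathbb{R}^m)$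 is the set of bounded continuous functions on $\mathbb{R}^m$ (with continuous derivatives up to order $k$) for which this norm is finite.
   Formalization: "Not identically zero" is read as "not zero almost everywhere", since a σ vanishing a.e. but nonzero at one point makes every F zero a.e.; the Fourier transform is normalized with exp(-2πi x·ξ), so the norm is the stated one up to the dilation x ↦ 2πx. *)

theory Defs
  imports "HOL-Analysis.Analysis"
begin

text \<open>Directional (partial) derivative in direction v and iterated partial derivatives
  along a list of basis directions (a list of basis vectors encodes a multi-index).\<close>
definition pdiff :: "'a::euclidean_space \<Rightarrow> ('a \<Rightarrow> 'b::real_normed_vector) \<Rightarrow> 'a \<Rightarrow> 'b" where
  "pdiff v f x = frechet_derivative f (at x) v"

fun iter_pdiff :: "'a::euclidean_space list \<Rightarrow> ('a \<Rightarrow> 'b::real_normed_vector) \<Rightarrow> 'a \<Rightarrow> 'b" where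
  "iter_pdiff [] f = f"
| "iter_pdiff (v # vs) f = pdiff v (iter_pdiff vs f)"

definition schwartz :: "('a::euclidean_space \<Rightarrow> complex) \<Rightarrow> bool" where
  "schwartz \<phi> \<longleftrightarrow>
     (\<forall>bs. set bs \<subseteq> Basis \<longrightarrow> (\<forall>x. iter_pdiff bs \<phi> differentiable (at x))) \<and>
     (\<forall>bs (N::nat). set bs \<subseteq> Basis \<longrightarrow>
        bounded (range (\<lambda>x. (1 + norm x) ^ N * norm (iter_pdiff bs \<phi> x))))"

definition fourier :: "('a::euclidean_space \<Rightarrow> complex) \<Rightarrow> 'a \<Rightarrow> complex" where
  "fourier \<phi> \<xi> = (LINT x|lborel. \<phi> x * exp (- (2 * of_real pi * \<i> * of_real (x \<bullet> \<xi>))))"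

definition inv_fourier :: "('a::euclidean_space \<Rightarrow> complex) \<Rightarrow> 'a \<Rightarrow> complex" where
  "inv_fourier \<psi> x = (LINT \<xi>|lborel. \<psi> \<xi> * exp (2 * of_real pi * \<i> * of_real (x \<bullet> \<xi>)))"

definition bessel_op :: "real \<Rightarrow> ('a::euclidean_space \<Rightarrow> complex) \<Rightarrow> 'a \<Rightarrow> complex" where
  "bessel_op \<gamma> \<phi> = inv_fourier (\<lambda>\<xi>. of_real ((1 + (norm \<xi>)\<^sup>2) powr (\<gamma> / 2)) * fourier \<phi> \<xi>)"

definition Lp_fun :: "real \<Rightarrow> ('a::euclidean_space \<Rightarrow> real) \<Rightarrow> bool" where
  "Lp_fun p f \<longleftrightarrow> f \<in> borel_measurable lborel \<and> integrable lborel (\<lambda>x. \<bar>f x\<bar> powr p)"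

definition Lp_norm :: "real \<Rightarrow> ('a::euclidean_space \<Rightarrow> real) \<Rightarrow> real" where
  "Lp_norm p g = (LINT x|lborel. \<bar>g x\<bar> powr p) powr (1 / p)"

text \<open>g = (1-Laplacian)^(gamma/2) f in the sense of tempered distributions, with f, g in L_p.\<close>
definition bessel_rep :: "real \<Rightarrow> real \<Rightarrow> ('a::euclidean_space \<Rightarrow> real) \<Rightarrow> ('a \<Rightarrow> real) \<Rightarrow> bool" where
  "bessel_rep \<gamma> p f g \<longleftrightarrow> Lp_fun p f \<and> Lp_fun p g \<and>
     (\<forall>\<phi>. schwartz \<phi> \<longrightarrow>
        (LINT x|lborel. complex_of_real (f x) * bessel_op \<gamma> \<phi> x)
          = (LINT x|lborel. complex_of_real (g x) * \<phi> x))"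

definition bessel_space :: "real \<Rightarrow> real \<Rightarrow> ('a::euclidean_space \<Rightarrow> real) \<Rightarrow> bool" where
  "bessel_space \<gamma> p f \<longleftrightarrow> (\<exists>g. bessel_rep \<gamma> p f g)"

text \<open>Zygmund spaces: s = k + alpha, k natural, alpha in (0,1].\<close>
definition zyg_k :: "real \<Rightarrow> nat" where
  "zyg_k s = nat (\<lceil>s\<rceil> - 1)"

definition zyg_alpha :: "real \<Rightarrow> real" where
  "zyg_alpha s = s - real (zyg_k s)"

definition multi_idx :: "nat \<Rightarrow> 'a::euclidean_space list set" where
  "multi_idx j = {bs. length bs = j \<and> set bs \<subseteq> Basis}"

definition zyg_diff2 :: "real \<Rightarrow> ('a::euclidean_space \<Rightarrow> real) \<Rightarrow> 'a list \<Rightarrow> 'a \<Rightarrow> 'a \<Rightarrow> real" where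
  "zyg_diff2 s f bs x h =
     \<bar>iter_pdiff bs f (x + h) + iter_pdiff bs f (x - h) - 2 * iter_pdiff bs f x\<bar> / norm h powr zyg_alpha s"

definition zygmund :: "real \<Rightarrow> ('a::euclidean_space \<Rightarrow> real) \<Rightarrow> bool" where
  "zygmund s f \<longleftrightarrow>
     (\<forall>bs. length bs < zyg_k s \<longrightarrow> set bs \<subseteq> Basis \<longrightarrow> (\<forall>x. iter_pdiff bs f differentiable (at x))) \<and>
     (\<forall>bs. length bs \<le> zyg_k s \<longrightarrow> set bs \<subseteq> Basis \<longrightarrow>
        continuous_on UNIV (iter_pdiff bs f) \<and> bounded (range (iter_pdiff bs f))) \<and>
     bdd_above {zyg_diff2 s f bs x h | bs x h. bs \<in> multi_idx (zyg_k s) \<and> h \<noteq> 0}"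

definition zyg_norm :: "real \<Rightarrow> ('a::euclidean_space \<Rightarrow> real) \<Rightarrow> real" where
  "zyg_norm s f =
     (\<Sum>j\<le>zyg_k s. Sup {\<bar>iter_pdiff bs f x\<bar> | bs x. bs \<in> multi_idx j})
     + Sup {zyg_diff2 s f bs x h | bs x h. bs \<in> multi_idx (zyg_k s) \<and> h \<noteq> 0}"

definition nn_class :: "(real \<Rightarrow> real) \<Rightarrow> ((real^'m) \<Rightarrow> real) set" where
  "nn_class \<sigma> = {F. \<exists>(n::nat) (\<alpha>::nat \<Rightarrow> real) (w::'m \<Rightarrow> nat \<Rightarrow> real^'m) (b::'m \<Rightarrow> nat \<Rightarrow> real).
      n \<ge> 1 \<and> (\<forall>j\<in>{1..n}. invertible (\<chi> i. w i j)) \<and>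
      F = (\<lambda>x. \<Sum>j=1..n. \<alpha> j * (\<Prod>i\<in>UNIV. \<sigma> (w i j \<bullet> x + b i j)))}"

end

theory Submission
  imports Defs "HOL-Probability.Probability"
begin

text \<open>Call \<open>m\<close> a symbol if it is the Fourier transform of a finite signed measure; convolution with the measure
  then acts on \<open>L\<^sub>p\<close>. Writing powers of \<open>1 + |\<xi>|\<^sup>2\<close> as Gaussian mixtures shows that \<open>(1 + |\<xi>|\<^sup>2)\<^sup>-\<^sup>s\<close>, the dilation
  quotients \<open>((1 + c|\<xi>|\<^sup>2)/(1 + |\<xi>|\<^sup>2))\<^sup>s\<close> and the tensor quotient \<open>(1 + |\<xi>|\<^sup>2)\<^sup>s / (\<Prod>i. (1 + \<xi>\<^sub>i\<^sup>2)\<^sup>s)\<close> are symbols. So it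
  suffices to show that the \<open>L\<^sub>p\<close>-closure of \<open>{(1 - \<Delta>)\<^sup>\<gamma>\<^sup>/\<^sup>2 F}\<close> is everything.

  In dimension one this closure contains all \<open>g (l x + b)\<close> with \<open>l \<noteq> 0\<close>, where \<open>g = (1 - \<Delta>)\<^sup>\<gamma>\<^sup>/\<^sup>2 \<sigma>\<close>, and integrating
  these against \<open>Re (|l| + s - i b)\<^sup>-\<^sup>2\<close> over \<open>(l, b)\<close> gives a multiple of \<open>1 / (1 + x\<^sup>2)\<close>, the multiple being a
  Poisson integral of \<open>g\<close> and thus nonzero for some translate and some \<open>s\<close>. The dilates of this kernel
  form an approximate identity. In dimension \<open>m\<close>, the tensor symbol bounds the norm of a product of functions
  of single coordinates by the product of their norms, so Gaussians are limits of products of one-dimensional sums.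

  For the Zygmund estimate, \<open>f\<close> is the integral over \<open>t\<close> of \<open>t\<^sup>\<gamma>\<^sup>/\<^sup>2\<^sup>-\<^sup>1 e\<^sup>-\<^sup>t\<close> times the heat semigroup applied to
  \<open>(1 - \<Delta>)\<^sup>\<gamma>\<^sup>/\<^sup>2 f\<close>, whose \<open>j\<close>-th derivatives are \<open>O(t\<^sup>-\<^sup>j\<^sup>/\<^sup>2\<^sup>-\<^sup>m\<^sup>/\<^sup>2\<^sup>p)\<close>.\<close>

section \<open>Functions in $L_p$\<close>

text \<open>Two obstacles shape the proof. For fractional \<open>\<gamma>\<close> there is no
  derivative to compute with, and membership is only tested on Schwartz functions. So every operator
  is bounded on L_p by an explicit finite measure; such operators also preserve closed
  translation-invariant subspaces. This is why g (l x + b) lies in the closure although it does not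
  represent \<open>\<sigma>\<close> (l x + b): the two differ by a dilation quotient whose inverse
  is again a symbol. The second obstacle: \<open>\<sigma>\<close> need not be integrable, and if it
  is, its integral may vanish, so its own dilates need not form an approximate identity. The remedy
  is to superpose over l and b with a kernel whose integral along each line b = v - l x is a
  function of x times a function of v. A dilate has norm |l|^(-1/p) times a constant and the kernel
  has mass O(1 / (|l| + s)) in b, so the superposition converges: near l = 0 because p > 1, at
  infinity because 1/p > 0. Elements of the network class may be discontinuous, so the Zygmund norm
  is taken of the continuous version of a difference.\<close>

definition np :: "real \<Rightarrow> ('a::euclidean_space \<Rightarrow> real) \<Rightarrow> real" where
  "np p g = (LINT x|lborel. \<bar>g x\<bar> powr p)"

lemma abs_add_powr_le:
  fixes a b p :: real assumes "p \<ge> 0"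
  shows "\<bar>a + b\<bar> powr p \<le> 2 powr p * (\<bar>a\<bar> powr p + \<bar>b\<bar> powr p)"
proof -
  have "\<bar>a + b\<bar> powr p \<le> (2 * max \<bar>a\<bar> \<bar>b\<bar>) powr p"
    using assms by (intro powr_mono2) auto
  also have "\<dots> = 2 powr p * max \<bar>a\<bar> \<bar>b\<bar> powr p"
    by (simp add: powr_mult)
  also have "max \<bar>a\<bar> \<bar>b\<bar> powr p \<le> \<bar>a\<bar> powr p + \<bar>b\<bar> powr p"
    by (auto simp: max_def)
  finally show ?thesis by simp
qed

lemma np_nonneg [simp]: "np p g \<ge> 0"
  by (simp add: np_def)

lemma np_cong_AE:
  "f \<in> borel_measurable lborel \<Longrightarrow> g \<in> borel_measurable lborel \<Longrightarrow> AE x in lborel. f x = g x \<Longrightarrow> np p f = np p g"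
  unfolding np_def by (intro integral_cong_AE) auto

lemma Lp_fun_dominated:
  assumes "g \<in> borel_measurable borel" "integrable lborel B" "AE x in lborel. \<bar>g x\<bar> powr p \<le> B x"
  shows "Lp_fun p g" "np p g \<le> integral\<^sup>L lborel B"
proof -
  have [measurable]: "g \<in> borel_measurable borel" by fact
  show *: "Lp_fun p g"
    unfolding Lp_fun_def using assms
    by (auto intro!: Bochner_Integration.integrable_bound[OF assms(2)] elim!: eventually_mono)
  show "np p g \<le> integral\<^sup>L lborel B"
    unfolding np_def using assms * by (intro integral_mono_AE) (auto simp: Lp_fun_def)
qed

lemma Lp_fun_cong_AE:
  assumes "Lp_fun p f" "g \<in> borel_measurable borel" "AE x in lborel. f x = g x"
  shows "Lp_fun p g"
  by (rule Lp_fun_dominated[where B="\<lambda>x. \<bar>f x\<bar> powr p"])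
     (use assms in \<open>auto simp: Lp_fun_def elim!: eventually_mono\<close>)

lemma Lp_fun_zero [simp]: "Lp_fun p (\<lambda>_. 0)"
  by (simp add: Lp_fun_def)

lemma np_zero [simp]: "np p (\<lambda>_. 0) = 0"
  by (simp add: np_def)

lemma
  assumes "Lp_fun p f"
  shows Lp_fun_cmult: "Lp_fun p (\<lambda>x. c * f x)"
    and np_cmult: "np p (\<lambda>x. c * f x) = \<bar>c\<bar> powr p * np p f"
  using assms by (auto simp: Lp_fun_def np_def abs_mult powr_mult)

text \<open>\<open>np\<close> is the p-th power of the norm, so this inequality with factor 2^p
  stands in for Minkowski's. It is the origin of the recurring choice
  \<open>d = e / (2 * 2 powr p)\<close>: two errors below d add up to one below e.\<close>

lemma
  assumes f: "Lp_fun p f" and g: "Lp_fun p g" and p: "p \<ge> 0"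
  shows Lp_fun_add: "Lp_fun p (\<lambda>x. f x + g x)"
    and np_add_le: "np p (\<lambda>x. f x + g x) \<le> 2 powr p * (np p f + np p g)"
proof -
  have [measurable]: "f \<in> borel_measurable borel" "g \<in> borel_measurable borel"
    using f g by (auto simp: Lp_fun_def)
  have I: "integrable lborel (\<lambda>x. 2 powr p * (\<bar>f x\<bar> powr p + \<bar>g x\<bar> powr p))"
    using f g by (auto simp: Lp_fun_def)
  have le: "AE x in lborel. \<bar>f x + g x\<bar> powr p \<le> 2 powr p * (\<bar>f x\<bar> powr p + \<bar>g x\<bar> powr p)"
    using abs_add_powr_le[OF p] by auto
  show "Lp_fun p (\<lambda>x. f x + g x)"
    by (rule Lp_fun_dominated(1)[OF _ I le]) simp
  have "np p (\<lambda>x. f x + g x) \<le> (\<integral>x. 2 powr p * (\<bar>f x\<bar> powr p + \<bar>g x\<bar> powr p) \<partial>lborel)"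
    by (rule Lp_fun_dominated(2)[OF _ I le]) simp
  also have "\<dots> = 2 powr p * (np p f + np p g)"
    using f g by (simp add: np_def Lp_fun_def)
  finally show "np p (\<lambda>x. f x + g x) \<le> 2 powr p * (np p f + np p g)" .
qed

lemma
  assumes f: "Lp_fun p f" and g: "Lp_fun p g" and p: "p \<ge> 0"
  shows Lp_fun_diff: "Lp_fun p (\<lambda>x. f x - g x)"
    and np_diff_le: "np p (\<lambda>x. f x - g x) \<le> 2 powr p * (np p f + np p g)"
  using Lp_fun_add[OF f Lp_fun_cmult[OF g, of "-1"] p] np_add_le[OF f Lp_fun_cmult[OF g, of "-1"] p]
    np_cmult[OF g, of "-1"] by simp_all

lemma np_minus_commute: "np p (\<lambda>x. f x - g x) = np p (\<lambda>x. g x - f x)"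
  by (simp add: np_def abs_minus_commute)

lemma np_eq_0D:
  assumes "Lp_fun p f" "np p f = 0" shows "AE x in lborel. f x = 0"
proof -
  have "AE x in lborel. \<bar>f x\<bar> powr p = 0"
    using assms by (subst (asm) np_def) (subst (asm) integral_nonneg_eq_0_iff_AE, auto simp: Lp_fun_def)
  then show ?thesis by auto
qed

lemma Lp_norm_np: "Lp_norm p g = np p g powr (1/p)"
  by (simp add: Lp_norm_def np_def)

lemma
  fixes f :: "'a::euclidean_space \<Rightarrow> 'b::{banach, second_countable_topology}"
  assumes c: "c \<noteq> 0" and [measurable]: "f \<in> borel_measurable borel"
  shows integral_affine: "(LINT x|lborel. f (c *\<^sub>R x + t)) = (1 / \<bar>c\<bar> ^ DIM('a)) *\<^sub>R (LINT x|lborel. f x)"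
    and integrable_affine_iff: "integrable lborel (\<lambda>x. f (c *\<^sub>R x + t)) \<longleftrightarrow> integrable lborel f"
proof -
  have "(LINT x|lborel. f x) = \<bar>c\<bar> ^ DIM('a) *\<^sub>R (LINT x|lborel. f (t + c *\<^sub>R x))"
    by (subst lborel_affine[OF c, of t], subst integral_density) (auto simp: integral_distr)
  then show "(LINT x|lborel. f (c *\<^sub>R x + t)) = (1 / \<bar>c\<bar> ^ DIM('a)) *\<^sub>R (LINT x|lborel. f x)"
    using c by (simp add: add.commute)
  have "integrable lborel f \<longleftrightarrow> integrable lborel (\<lambda>x. \<bar>c\<bar> ^ DIM('a) *\<^sub>R f (t + c *\<^sub>R x))"
    by (subst lborel_affine[OF c, of t], subst integrable_density) (auto simp: integrable_distr_eq)
  also have "\<dots> \<longleftrightarrow> integrable lborel (\<lambda>x. f (t + c *\<^sub>R x))"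
    using c integrable_scaleR_right[of "1 / \<bar>c\<bar> ^ DIM('a)" lborel "\<lambda>x. \<bar>c\<bar> ^ DIM('a) *\<^sub>R f (t + c *\<^sub>R x)"]
    by auto
  finally have "integrable lborel f \<longleftrightarrow> integrable lborel (\<lambda>x. f (t + c *\<^sub>R x))" .
  then show "integrable lborel (\<lambda>x. f (c *\<^sub>R x + t)) \<longleftrightarrow> integrable lborel f"
    by (simp add: add.commute)
qed

lemma AE_affine:
  fixes t :: "'a::euclidean_space"
  assumes c: "c \<noteq> 0" and P: "AE x in lborel. P x"
  shows "AE x in lborel. P (c *\<^sub>R x + t)"
proof -
  from P obtain N where N: "{x. \<not> P x} \<subseteq> N" "emeasure lborel N = 0" "N \<in> sets lborel"
    by (auto elim!: AE_E)
  have "AE x in lborel. x \<notin> N" using N by (intro AE_not_in) auto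
  then have "AE x in density (distr lborel borel (\<lambda>x. t + c *\<^sub>R x)) (\<lambda>_. \<bar>c\<bar>^DIM('a)). x \<notin> N"
    by (subst (asm) lborel_affine[OF c, of t])
  then have "AE x in distr lborel borel (\<lambda>x. t + c *\<^sub>R x). x \<notin> N"
    using c by (subst (asm) AE_density) auto
  then have "AE x in lborel. t + c *\<^sub>R x \<notin> N"
    using N(3) by (subst (asm) AE_distr_iff) auto
  then show ?thesis using N(1) by (auto elim!: eventually_mono simp: add.commute)
qed

lemma
  fixes g :: "'a::euclidean_space \<Rightarrow> real"
  assumes c: "c \<noteq> 0" and g: "Lp_fun p g"
  shows Lp_fun_affine: "Lp_fun p (\<lambda>x. g (c *\<^sub>R x + t))"
    and np_affine: "np p (\<lambda>x. g (c *\<^sub>R x + t)) = np p g / \<bar>c\<bar> ^ DIM('a)"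
proof -
  have [measurable]: "g \<in> borel_measurable borel" using g by (auto simp: Lp_fun_def)
  show "Lp_fun p (\<lambda>x. g (c *\<^sub>R x + t))"
    using g integrable_affine_iff[OF c, of "\<lambda>x. \<bar>g x\<bar> powr p" t] by (simp add: Lp_fun_def)
  show "np p (\<lambda>x. g (c *\<^sub>R x + t)) = np p g / \<bar>c\<bar> ^ DIM('a)"
    using integral_affine[OF c, of "\<lambda>x. \<bar>g x\<bar> powr p" t] by (simp add: np_def)
qed

lemma
  fixes g :: "'a::euclidean_space \<Rightarrow> real"
  assumes g: "Lp_fun p g"
  shows Lp_fun_translate: "Lp_fun p (\<lambda>x. g (x + t))"
    and np_translate: "np p (\<lambda>x. g (x + t)) = np p g"
  using Lp_fun_affine[OF _ g, of 1 t] np_affine[OF _ g, of 1 t] by auto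

section \<open>Jensen's inequality and mixtures of L_p functions\<close>

lemma powr_above_tangent:
  fixes p c G :: real assumes p: "p > 1" and "c \<ge> 0" "G \<ge> 0"
  shows "G powr p \<ge> c powr p + p * c powr (p - 1) * (G - c)"
proof (cases "c = 0")
  case True then show ?thesis using p by simp
next
  case False
  then have c: "c > 0" using assms by simp
  show ?thesis
  \<comment> \<open>The convexity lemma is applied on the open half-line; at the endpoint the
    tangent has the value (1 - p) c^p, which is at most 0.\<close>
  proof (cases "G = 0")
    case True
    have "c powr (p - 1) * c = c powr p"
      using c by (simp add: powr_diff)
    then have "c powr p + p * c powr (p - 1) * (0 - c) = (1 - p) * c powr p"
      by (simp add: algebra_simps)
    also have "\<dots> \<le> 0" using p by (intro mult_nonpos_nonneg) auto
    finally show ?thesis using True p by simp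
  next
    case False
    then have G: "G > 0" using assms by simp
    have "G powr p - c powr p \<ge> (p * c powr (p - 1)) * (G - c)"
    proof (rule convex_on_imp_above_tangent[where A="{0<..}"])
      show "convex_on {0<..} (\<lambda>x. x powr p)" using p by (intro powr_convex) simp
      show "((\<lambda>x. x powr p) has_real_derivative p * c powr (p - 1)) (at c within {0<..})"
        using c by (auto intro!: derivative_eq_intros)
    qed (use c G in \<open>auto simp: interior_open\<close>)
    then show ?thesis by simp
  qed
qed

text \<open>The weight \<open>k\<close> may have any finite total mass. The tangent of y^p at the
  weighted mean of G is integrated, and undoing the normalisation produces the power p - 1 of the
  mass.\<close>

lemma
  fixes k G :: "'w \<Rightarrow> real"
  assumes p: "p > 1" and k: "integrable M k" "\<And>w. k w \<ge> 0"
    and G[measurable]: "G \<in> borel_measurable M" "\<And>w. G w \<ge> 0"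
    and I: "integrable M (\<lambda>w. k w * G w powr p)"
  shows jensen_integrable: "integrable M (\<lambda>w. k w * G w)"
    and jensen_powr: "(\<integral>w. k w * G w \<partial>M) powr p \<le> (\<integral>w. k w \<partial>M) powr (p - 1) * (\<integral>w. k w * G w powr p \<partial>M)"
proof -
  have [measurable]: "k \<in> borel_measurable M" using k by simp
  have le: "y \<le> 1 + y powr p" if "y \<ge> 0" for y :: real
  proof (cases "y \<le> 1")
    case False
    then have "y powr 1 \<le> y powr p" using p by (intro powr_mono) auto
    then show ?thesis using False by simp
  qed (use powr_ge_zero[of y p] in linarith)
  show int: "integrable M (\<lambda>w. k w * G w)"
  proof (rule Bochner_Integration.integrable_bound)
    show "integrable M (\<lambda>w. k w + k w * G w powr p)" using k I by simp
    have "k w * G w \<le> k w * (1 + G w powr p)" for w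
      using le[OF G(2)] k(2) by (intro mult_left_mono) auto
    then show "AE w in M. norm (k w * G w) \<le> norm (k w + k w * G w powr p)"
      using k(2) G(2) by (auto simp: algebra_simps)
  qed simp
  define K where "K = (\<integral>w. k w \<partial>M)"
  \<comment> \<open>The weighted mean of G: for this base point the linear term of the tangent
    integrates to zero.\<close>
  define c where "c = (\<integral>w. k w * G w \<partial>M) / K"
  have K0: "K \<ge> 0" using k(2) by (simp add: K_def)
  show "(\<integral>w. k w * G w \<partial>M) powr p \<le> (\<integral>w. k w \<partial>M) powr (p - 1) * (\<integral>w. k w * G w powr p \<partial>M)"
  proof (cases "K = 0")
    case True
    then have "AE w in M. k w = 0"
      using k integral_nonneg_eq_0_iff_AE[of M k] by (auto simp: K_def)
    then have "(\<integral>w. k w * G w \<partial>M) = (\<integral>w. 0 \<partial>M)"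
      by (intro integral_cong_AE) auto
    then show ?thesis using p k(2) by simp
  next
    case False
    then have K: "K > 0" using K0 by simp
    have c0: "c \<ge> 0" using K k(2) G(2) by (auto simp: c_def)
    have "(\<integral>w. k w * (c powr p + p * c powr (p - 1) * (G w - c)) \<partial>M) \<le> (\<integral>w. k w * G w powr p \<partial>M)"
    proof (intro integral_mono mult_left_mono powr_above_tangent)
      have "integrable M (\<lambda>w. (c powr p - p * c powr (p - 1) * c) * k w + (p * c powr (p - 1)) * (k w * G w))"
        using k int by simp
      then show "integrable M (\<lambda>w. k w * (c powr p + p * c powr (p - 1) * (G w - c)))"
        by (rule back_subst[of "integrable M"]) (auto simp: algebra_simps)
    qed (use p c0 G k I in auto)
    also have "(\<integral>w. k w * (c powr p + p * c powr (p - 1) * (G w - c)) \<partial>M)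
        = (\<integral>w. (c powr p - p * c powr (p - 1) * c) * k w + (p * c powr (p - 1)) * (k w * G w) \<partial>M)"
      by (intro Bochner_Integration.integral_cong) (auto simp: algebra_simps)
    also have "\<dots> = (c powr p - p * c powr (p - 1) * c) * K + p * c powr (p - 1) * (c * K)"
      using k int K by (simp add: K_def c_def)
    also have "\<dots> = c powr p * K" by (simp add: algebra_simps)
    finally have "c powr p * K \<le> (\<integral>w. k w * G w powr p \<partial>M)" .
    then have "K powr (p - 1) * (c powr p * K) \<le> K powr (p - 1) * (\<integral>w. k w * G w powr p \<partial>M)"
      by (intro mult_left_mono) auto
    also have "K powr (p - 1) * (c powr p * K) = (c * K) powr p"
      using K c0 by (simp add: powr_mult powr_diff)
    also have "c * K = (\<integral>w. k w * G w \<partial>M)" using K by (simp add: c_def)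
    finally show ?thesis by (simp add: K_def)
  qed
qed

text \<open>Jensen is applied at almost every x, and Tonelli then exchanges the integrals. The L_p
  bounds for convolutions and superpositions below are instances of it, in place of integrals with
  values in L_p.\<close>

lemma
  fixes h :: "'w \<Rightarrow> 'a::euclidean_space \<Rightarrow> real" and k :: "'w \<Rightarrow> real"
  assumes p: "p > 1" and N: "sigma_finite_measure N"
    and h[measurable]: "(\<lambda>(w, x). h w x) \<in> borel_measurable (N \<Otimes>\<^sub>M borel)"
    and k: "integrable N k"
    and hp: "\<And>w. w \<in> space N \<Longrightarrow> Lp_fun p (h w)"
    and int: "integrable N (\<lambda>w. \<bar>k w\<bar> * np p (h w))"
  shows Lp_fun_mixture: "Lp_fun p (\<lambda>x. \<integral>w. k w * h w x \<partial>N)"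
    and AE_integrable_mixture: "AE x in lborel. integrable N (\<lambda>w. k w * h w x)"
    and np_mixture_le: "np p (\<lambda>x. \<integral>w. k w * h w x \<partial>N)
       \<le> (\<integral>w. \<bar>k w\<bar> \<partial>N) powr (p - 1) * (\<integral>w. \<bar>k w\<bar> * np p (h w) \<partial>N)"
proof -
  interpret N: sigma_finite_measure N by fact
  interpret pair_sigma_finite N lborel by unfold_locales
  have [measurable]: "k \<in> borel_measurable N" using k by simp
  have [measurable_cong]: "sets (lborel :: 'a measure) = sets borel" by simp
  let ?f = "\<lambda>(w, x). \<bar>k w\<bar> * \<bar>h w x\<bar> powr p"
  have I: "integrable (N \<Otimes>\<^sub>M lborel) ?f"
  proof (rule Fubini_integrable)
    show "?f \<in> borel_measurable (N \<Otimes>\<^sub>M lborel)" by measurable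
    show "integrable N (\<lambda>w. \<integral>x. norm (?f (w, x)) \<partial>lborel)"
      using int by (simp add: np_def abs_mult)
    show "AE w in N. integrable lborel (\<lambda>x. ?f (w, x))"
      using hp by (auto simp: Lp_fun_def)
  qed
  have I2: "integrable lborel (\<lambda>x. \<integral>w. \<bar>k w\<bar> * \<bar>h w x\<bar> powr p \<partial>N)"
    using integrable_snd[OF I] by simp
  have AE1: "AE x in lborel. integrable N (\<lambda>w. \<bar>k w\<bar> * \<bar>h w x\<bar> powr p)"
    using AE_integrable_snd[OF I] by simp
  have meas[measurable]: "(\<lambda>w. h w x) \<in> borel_measurable N" for x by measurable
  have J: "integrable N (\<lambda>w. k w * h w x) \<and> \<bar>\<integral>w. k w * h w x \<partial>N\<bar> powr p
     \<le> (\<integral>w. \<bar>k w\<bar> \<partial>N) powr (p - 1) * (\<integral>w. \<bar>k w\<bar> * \<bar>h w x\<bar> powr p \<partial>N)"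
    if "integrable N (\<lambda>w. \<bar>k w\<bar> * \<bar>h w x\<bar> powr p)" for x
  proof -
    have i: "integrable N (\<lambda>w. \<bar>k w\<bar> * \<bar>h w x\<bar>)"
      by (rule jensen_integrable[OF p integrable_abs[OF k] _ _ _ that]) simp_all
    have i2: "integrable N (\<lambda>w. k w * h w x)"
      by (rule Bochner_Integration.integrable_bound[OF i]) (auto simp: abs_mult)
    have "\<bar>\<integral>w. k w * h w x \<partial>N\<bar> \<le> (\<integral>w. \<bar>k w\<bar> * \<bar>h w x\<bar> \<partial>N)"
      using integral_abs_bound[of N "\<lambda>w. k w * h w x"] by (simp add: abs_mult)
    then have "\<bar>\<integral>w. k w * h w x \<partial>N\<bar> powr p \<le> (\<integral>w. \<bar>k w\<bar> * \<bar>h w x\<bar> \<partial>N) powr p"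
      using p by (intro powr_mono2) auto
    also have "\<dots> \<le> (\<integral>w. \<bar>k w\<bar> \<partial>N) powr (p - 1) * (\<integral>w. \<bar>k w\<bar> * \<bar>h w x\<bar> powr p \<partial>N)"
      by (rule jensen_powr[OF p integrable_abs[OF k] _ _ _ that]) simp_all
    finally show ?thesis using i2 by simp
  qed
  show "AE x in lborel. integrable N (\<lambda>w. k w * h w x)"
    using AE1 J by (auto elim!: eventually_mono)
  have m: "(\<lambda>x. \<integral>w. k w * h w x \<partial>N) \<in> borel_measurable borel"
    by measurable
  have I3: "integrable lborel (\<lambda>x. (\<integral>w. \<bar>k w\<bar> \<partial>N) powr (p - 1) * (\<integral>w. \<bar>k w\<bar> * \<bar>h w x\<bar> powr p \<partial>N))"
    using I2 by simp
  have le: "AE x in lborel. \<bar>\<integral>w. k w * h w x \<partial>N\<bar> powr p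
     \<le> (\<integral>w. \<bar>k w\<bar> \<partial>N) powr (p - 1) * (\<integral>w. \<bar>k w\<bar> * \<bar>h w x\<bar> powr p \<partial>N)"
    using AE1 J by (auto elim!: eventually_mono)
  show "Lp_fun p (\<lambda>x. \<integral>w. k w * h w x \<partial>N)"
    by (rule Lp_fun_dominated(1)[OF m I3 le])
  have "np p (\<lambda>x. \<integral>w. k w * h w x \<partial>N) \<le> (\<integral>x. (\<integral>w. \<bar>k w\<bar> \<partial>N) powr (p - 1) * (\<integral>w. \<bar>k w\<bar> * \<bar>h w x\<bar> powr p \<partial>N) \<partial>lborel)"
    by (rule Lp_fun_dominated(2)[OF m I3 le])
  also have "\<dots> = (\<integral>w. \<bar>k w\<bar> \<partial>N) powr (p - 1) * (\<integral>x. \<integral>w. \<bar>k w\<bar> * \<bar>h w x\<bar> powr p \<partial>N \<partial>lborel)"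
    by simp
  also have "(\<integral>x. \<integral>w. \<bar>k w\<bar> * \<bar>h w x\<bar> powr p \<partial>N \<partial>lborel) = (\<integral>w. \<integral>x. \<bar>k w\<bar> * \<bar>h w x\<bar> powr p \<partial>lborel \<partial>N)"
    using Fubini_integral[OF I] by simp
  also have "\<dots> = (\<integral>w. \<bar>k w\<bar> * np p (h w) \<partial>N)"
    by (simp add: np_def)
  finally show "np p (\<lambda>x. \<integral>w. k w * h w x \<partial>N)
       \<le> (\<integral>w. \<bar>k w\<bar> \<partial>N) powr (p - 1) * (\<integral>w. \<bar>k w\<bar> * np p (h w) \<partial>N)" .
qed

section \<open>Closed subspaces of $L_p$\<close>

definition Cc :: "('a::euclidean_space \<Rightarrow> real) \<Rightarrow> bool" where
  "Cc \<theta> \<longleftrightarrow> continuous_on UNIV \<theta> \<and> (\<exists>R. \<forall>x. R < norm x \<longrightarrow> \<theta> x = 0)"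

lemma Cc_measurable: "Cc \<theta> \<Longrightarrow> \<theta> \<in> borel_measurable borel"
  by (auto simp: Cc_def intro: borel_measurable_continuous_onI)

lemma Cc_integrable: assumes "Cc \<theta>" shows "integrable lborel \<theta>"
proof -
  obtain R where R: "\<And>x. R < norm x \<Longrightarrow> \<theta> x = 0" and c: "continuous_on UNIV \<theta>"
    using assms by (auto simp: Cc_def)
  have "integrable lborel (\<lambda>x. indicator (cball 0 R) x *\<^sub>R \<theta> x)"
    using c by (intro borel_integrable_compact) (auto intro: continuous_on_subset)
  also have "(\<lambda>x. indicator (cball 0 R) x *\<^sub>R \<theta> x) = \<theta>"
    using R by (auto simp: fun_eq_iff indicator_def)
  finally show ?thesis .
qed

lemma Cc_bounded: assumes "Cc \<theta>" obtains M where "M > 0" "\<And>x. \<bar>\<theta> x\<bar> \<le> M"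
proof -
  obtain R where R: "\<And>x. R < norm x \<Longrightarrow> \<theta> x = 0" and c: "continuous_on UNIV \<theta>"
    using assms by (auto simp: Cc_def)
  have "bounded (\<theta> ` cball 0 R)"
    using c by (intro compact_imp_bounded compact_continuous_image) (auto intro: continuous_on_subset)
  then obtain M where M: "M > 0" "\<And>x. norm x \<le> R \<Longrightarrow> \<bar>\<theta> x\<bar> \<le> M"
    by (auto simp: bounded_pos)
  show thesis
  proof (rule that[OF M(1)])
    fix x show "\<bar>\<theta> x\<bar> \<le> M" using M R[of x] by (cases "norm x \<le> R") auto
  qed
qed

text \<open>Induction over integrable functions. An indicator is squeezed between a closed set
  inside and an open set outside that differ by little, and a Urysohn function between them replaces
  it; sums and dominated limits follow.\<close>

lemma L1_approx_continuous:
  fixes g :: "'a::euclidean_space \<Rightarrow> real"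
  assumes "integrable lborel g"
  shows "\<forall>e>0. \<exists>\<theta>. continuous_on UNIV \<theta> \<and> integrable lborel \<theta> \<and> (LINT x|lborel. \<bar>g x - \<theta> x\<bar>) < e"
  using assms
proof (induction rule: integrable_induct)
  case (base A c)
  show ?case
  proof (intro allI impI)
    fix e :: real assume e: "e > 0"
    \<comment> \<open>The error will be at most |c| times the measure 2 d of the gap; the summand 1
      covers c = 0.\<close>
    define d where "d = e / (2 * (\<bar>c\<bar> + 1))"
    have d: "d > 0" using e by (auto simp: d_def)
    have [measurable]: "A \<in> sets borel" using base by simp
    have Al: "A \<in> sets lebesgue" by simp
    obtain U where U: "open U" "A \<subseteq> U" "emeasure lebesgue (U - A) < ennreal d"
      using sets_lebesgue_outer_open[OF Al d] by metis
    obtain T where T: "closed T" "T \<subseteq> A" "emeasure lebesgue (A - T) < ennreal d"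
      using sets_lebesgue_inner_closed[OF Al d] by metis
    have [measurable]: "U \<in> sets borel" "T \<in> sets borel" using U T by auto
    have U': "emeasure lborel (U - A) < ennreal d" and T': "emeasure lborel (A - T) < ennreal d"
      using U T by auto
    have eq: "U - T = (U - A) \<union> (A - T)" using U T by auto
    have UT: "emeasure lborel (U - T) < ennreal (2 * d)"
    proof -
      have "emeasure lborel (U - T) \<le> emeasure lborel (U - A) + emeasure lborel (A - T)"
        unfolding eq by (intro emeasure_subadditive) auto
      also have "\<dots> < ennreal d + ennreal d" using U' T' by (intro add_strict_mono)
      also have "\<dots> = ennreal (2 * d)" using d by (subst ennreal_plus[symmetric]) auto
      finally show ?thesis .
    qed
    have fin: "emeasure lborel U < \<infinity>"
    proof -
      have "U = A \<union> (U - A)" using U by auto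
      then have "emeasure lborel U \<le> emeasure lborel A + emeasure lborel (U - A)"
        by (metis \<open>A \<in> sets borel\<close> \<open>U \<in> sets borel\<close> emeasure_subadditive sets.Diff sets_lborel)
      also have "\<dots> < \<infinity>" using base(2) order.strict_trans[OF U' ennreal_less_top] by simp
      finally show ?thesis .
    qed
    obtain f :: "'a \<Rightarrow> real" where f: "continuous_on UNIV f" "\<And>x. f x \<in> closed_segment 1 0"
        "\<And>x. x \<in> T \<Longrightarrow> f x = 1" "\<And>x. x \<in> - U \<Longrightarrow> f x = 0"
      using Urysohn[of T "-U" 1 0] U T by (auto simp: closed_Compl)
    have f01: "0 \<le> f x" "f x \<le> 1" for x
      using f(2)[of x] by (auto simp: closed_segment_eq_real_ivl)
    have [measurable]: "f \<in> borel_measurable borel" using f(1) by (rule borel_measurable_continuous_onI)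
    have If: "integrable lborel f"
    proof (rule Bochner_Integration.integrable_bound)
      show "integrable lborel (indicator U :: 'a \<Rightarrow> real)" using fin by simp
      show "AE x in lborel. norm (f x) \<le> norm (indicator U x :: real)"
        using f01 f(4) by (auto simp: indicator_def)
    qed simp
    show "\<exists>\<theta>. continuous_on UNIV \<theta> \<and> integrable lborel \<theta> \<and> (LINT x|lborel. \<bar>indicator A x *\<^sub>R c - \<theta> x\<bar>) < e"
    proof (intro exI conjI)
      show "continuous_on UNIV (\<lambda>x. c * f x)" using f(1) by (intro continuous_intros)
      show "integrable lborel (\<lambda>x. c * f x)" using If by simp
      have iUT: "integrable lborel (\<lambda>x. \<bar>c\<bar> * indicator (U - T) x :: real)"
        using order.strict_trans[OF UT ennreal_less_top]
        by (intro integrable_mult_right integrable_real_indicator) auto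
      have "(LINT x|lborel. \<bar>indicator A x *\<^sub>R c - c * f x\<bar>) \<le> (LINT x|lborel. \<bar>c\<bar> * indicator (U - T) x)"
      proof (rule integral_mono)
        show "integrable lborel (\<lambda>x. \<bar>indicator A x *\<^sub>R c - c * f x\<bar>)"
          using base(2) If by (intro integrable_abs Bochner_Integration.integrable_diff) auto
        fix x
        have "\<bar>indicator A x - f x\<bar> \<le> indicator (U - T) x"
          using f01[of x] f(3,4)[of x] U(2) T(2) by (auto simp: indicator_def)
        then have "\<bar>c\<bar> * \<bar>indicator A x - f x\<bar> \<le> \<bar>c\<bar> * indicator (U - T) x"
          by (intro mult_left_mono) auto
        also have "\<bar>c\<bar> * \<bar>indicator A x - f x\<bar> = \<bar>indicator A x *\<^sub>R c - c * f x\<bar>"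
          by (simp add: abs_mult[symmetric] algebra_simps)
        finally show "\<bar>indicator A x *\<^sub>R c - c * f x\<bar> \<le> \<bar>c\<bar> * indicator (U - T) x" .
      qed (rule iUT)
      also have "\<dots> = \<bar>c\<bar> * measure lborel (U - T)" by simp
      also have "\<dots> \<le> \<bar>c\<bar> * (2 * d)"
        using UT d by (intro mult_left_mono) (auto simp: measure_def enn2real_leI)
      also have "\<dots> < e"
        using e by (simp add: d_def field_simps)
      finally show "(LINT x|lborel. \<bar>indicator A x *\<^sub>R c - c * f x\<bar>) < e" .
    qed
  qed
next
  case (add f g)
  show ?case
  proof (intro allI impI)
    fix e :: real assume "e > 0"
    then obtain s t where s: "continuous_on UNIV s" "integrable lborel s" "(LINT x|lborel. \<bar>f x - s x\<bar>) < e/2"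
      and t: "continuous_on UNIV t" "integrable lborel t" "(LINT x|lborel. \<bar>g x - t x\<bar>) < e/2"
      using add(3,4) by (meson half_gt_zero)
    have "(LINT x|lborel. \<bar>(f x + g x) - (s x + t x)\<bar>) \<le> (LINT x|lborel. \<bar>f x - s x\<bar> + \<bar>g x - t x\<bar>)"
      using add(1,2) s t by (intro integral_mono) auto
    also have "\<dots> < e" using add(1,2) s t by simp
    finally show "\<exists>\<theta>. continuous_on UNIV \<theta> \<and> integrable lborel \<theta> \<and> (LINT x|lborel. \<bar>(f x + g x) - \<theta> x\<bar>) < e"
      using s t by (intro exI[of _ "\<lambda>x. s x + t x"]) (auto intro!: continuous_intros)
  qed
next
  case (lim f s)
  show ?case
  proof (intro allI impI)
    fix e :: real assume e: "e > 0"
    have [measurable]: "f \<in> borel_measurable lborel" "\<And>i. s i \<in> borel_measurable lborel"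
      using lim by auto
    have "(\<lambda>i. LINT x|lborel. \<bar>f x - s i x\<bar>) \<longlonglongrightarrow> (LINT x|lborel. \<bar>f x - f x\<bar>)"
    proof (rule integral_dominated_convergence[where w="\<lambda>x. 3 * \<bar>f x\<bar>"])
      show "AE x in lborel. (\<lambda>i. \<bar>f x - s i x\<bar>) \<longlonglongrightarrow> \<bar>f x - f x\<bar>"
        by (rule AE_I2) (intro tendsto_intros lim.hyps(2), simp_all)
      show "AE x in lborel. norm \<bar>f x - s i x\<bar> \<le> 3 * \<bar>f x\<bar>" for i
      proof (rule AE_I2)
        fix x :: 'a
        show "norm \<bar>f x - s i x\<bar> \<le> 3 * \<bar>f x\<bar>" using lim.hyps(3)[of x i] by auto
      qed
    qed (use lim in auto)
    then have "(\<lambda>i. LINT x|lborel. \<bar>f x - s i x\<bar>) \<longlonglongrightarrow> 0" by simp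
    then obtain i where i: "(LINT x|lborel. \<bar>f x - s i x\<bar>) < e/2"
      using order_tendstoD(2)[of _ 0 sequentially "e/2"] e by (auto simp: eventually_sequentially)
    obtain t where t: "continuous_on UNIV t" "integrable lborel t" "(LINT x|lborel. \<bar>s i x - t x\<bar>) < e/2"
      using lim.IH[of i] e by (meson half_gt_zero)
    have "(LINT x|lborel. \<bar>f x - t x\<bar>) \<le> (LINT x|lborel. \<bar>f x - s i x\<bar> + \<bar>s i x - t x\<bar>)"
      using lim.hyps(1,4) t by (intro integral_mono) auto
    also have "\<dots> < e" using lim.hyps(1,4) t i by simp
    finally show "\<exists>\<theta>. continuous_on UNIV \<theta> \<and> integrable lborel \<theta> \<and> (LINT x|lborel. \<bar>f x - \<theta> x\<bar>) < e"
      using t by auto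
  qed
qed

lemma L1_approx_Cc:
  fixes g :: "'a::euclidean_space \<Rightarrow> real"
  assumes g: "integrable lborel g" and e: "e > 0"
  shows "\<exists>\<theta>. Cc \<theta> \<and> (LINT x|lborel. \<bar>g x - \<theta> x\<bar>) < e"
proof -
  obtain t where t: "continuous_on UNIV t" "integrable lborel t" "(LINT x|lborel. \<bar>g x - t x\<bar>) < e/2"
    using L1_approx_continuous[OF g] e by (meson half_gt_zero)
  \<comment> \<open>A continuous cutoff, equal to 1 on the ball of radius n and to 0 outside the
    ball of radius n + 1.\<close>
  define ct where "ct = (\<lambda>n (x::'a). max 0 (min 1 (real n + 1 - norm x)))"
  have cct: "continuous_on UNIV (ct n)" for n unfolding ct_def by (intro continuous_intros)
  have [measurable]: "t \<in> borel_measurable borel" "\<And>n. ct n \<in> borel_measurable borel"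
    using t cct by (auto intro: borel_measurable_continuous_onI)
  have lim: "(\<lambda>n. LINT x|lborel. \<bar>t x - ct n x * t x\<bar>) \<longlonglongrightarrow> (LINT x|(lborel :: 'a measure). \<bar>0::real\<bar>)"
  proof (rule integral_dominated_convergence[where w="\<lambda>x. \<bar>t x\<bar>"])
    show "AE x in lborel. (\<lambda>n. \<bar>t x - ct n x * t x\<bar>) \<longlonglongrightarrow> \<bar>0\<bar>"
    proof (rule AE_I2)
      fix x :: 'a
      obtain k :: nat where "norm x \<le> k" using real_arch_simple by blast
      then have "\<forall>\<^sub>F n in sequentially. \<bar>t x - ct n x * t x\<bar> = \<bar>0\<bar>"
        by (intro eventually_sequentiallyI[of k]) (auto simp: ct_def)
      then show "(\<lambda>n. \<bar>t x - ct n x * t x\<bar>) \<longlonglongrightarrow> \<bar>0\<bar>" by (rule tendsto_eventually)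
    qed
    show "AE x in lborel. norm \<bar>t x - ct n x * t x\<bar> \<le> \<bar>t x\<bar>" for n
    proof (rule AE_I2)
      fix x :: 'a
      have "\<bar>1 - ct n x\<bar> * \<bar>t x\<bar> \<le> 1 * \<bar>t x\<bar>"
        by (intro mult_right_mono) (auto simp: ct_def)
      then show "norm \<bar>t x - ct n x * t x\<bar> \<le> \<bar>t x\<bar>"
        by (simp add: abs_mult[symmetric] algebra_simps)
    qed
  qed (use t in auto)
  then obtain n where n: "(LINT x|lborel. \<bar>t x - ct n x * t x\<bar>) < e/2"
    using order_tendstoD(2)[of _ 0 sequentially "e/2"] e by (auto simp: eventually_sequentially)
  have cc: "Cc (\<lambda>x. ct n x * t x)"
    unfolding Cc_def using t cct by (auto intro!: continuous_intros exI[of _ "real n + 1"] simp: ct_def)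
  have "(LINT x|lborel. \<bar>g x - ct n x * t x\<bar>) \<le> (LINT x|lborel. \<bar>g x - t x\<bar> + \<bar>t x - ct n x * t x\<bar>)"
    using g t Cc_integrable[OF cc] by (intro integral_mono) auto
  also have "\<dots> < e" using g t n Cc_integrable[OF cc] by simp
  finally show ?thesis using cc by blast
qed

lemma Cc_Lp:
  assumes "Cc \<theta>" "p > 1" shows "Lp_fun p \<theta>"
proof -
  obtain M where M: "M > 0" "\<And>x. \<bar>\<theta> x\<bar> \<le> M" using Cc_bounded[OF assms(1)] by blast
  show ?thesis
  proof (rule Lp_fun_dominated)
    show "integrable lborel (\<lambda>x. M powr (p - 1) * \<bar>\<theta> x\<bar>)" using Cc_integrable[OF assms(1)] by simp
    show "AE x in lborel. \<bar>\<theta> x\<bar> powr p \<le> M powr (p - 1) * \<bar>\<theta> x\<bar>"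
    proof (rule AE_I2)
      fix x
      have "\<bar>\<theta> x\<bar> powr p = \<bar>\<theta> x\<bar> powr (p - 1) * \<bar>\<theta> x\<bar>" by (simp add: powr_diff)
      also have "\<dots> \<le> M powr (p - 1) * \<bar>\<theta> x\<bar>" using M assms(2) by (intro mult_right_mono powr_mono2) auto
      finally show "\<bar>\<theta> x\<bar> powr p \<le> M powr (p - 1) * \<bar>\<theta> x\<bar>" .
    qed
  qed (rule Cc_measurable[OF assms(1)])
qed

text \<open>Truncating g in size and in support makes it integrable. Between functions bounded by n,
  the p-th power of a difference is at most (2 n)^(p - 1) times the difference, so the L_1
  approximation suffices.\<close>

lemma Lp_approx_Cc:
  fixes g :: "'a::euclidean_space \<Rightarrow> real"
  assumes g: "Lp_fun p g" and p: "p > 1" and e: "e > 0"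
  shows "\<exists>\<theta>. Cc \<theta> \<and> np p (\<lambda>x. g x - \<theta> x) < e"
proof -
  have [measurable]: "g \<in> borel_measurable borel" using g by (simp add: Lp_fun_def)
  define t where "t = (\<lambda>n x. indicator (cball 0 (real n)) x * max (- real n) (min (real n) (g x)))"
  have [measurable]: "cball (0::'a) r \<in> sets borel" for r by simp
  have [measurable]: "t n \<in> borel_measurable borel" for n unfolding t_def by measurable
  have le: "\<bar>g x - t n x\<bar> \<le> \<bar>g x\<bar>" for n x by (auto simp: t_def indicator_def)
  have "(\<lambda>n. LINT x|lborel. \<bar>g x - t n x\<bar> powr p) \<longlonglongrightarrow> (LINT x|(lborel :: 'a measure). 0::real)"
  proof (rule integral_dominated_convergence[where w="\<lambda>x. \<bar>g x\<bar> powr p"])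
    show "AE x in lborel. (\<lambda>n. \<bar>g x - t n x\<bar> powr p) \<longlonglongrightarrow> 0"
    proof (rule AE_I2)
      fix x :: 'a
      obtain k :: nat where k: "max (norm x) \<bar>g x\<bar> \<le> k" using real_arch_simple by blast
      have "\<forall>\<^sub>F n in sequentially. \<bar>g x - t n x\<bar> powr p = 0"
      proof (rule eventually_sequentiallyI[of k])
        fix n assume "k \<le> n" then have "real k \<le> real n" by simp
        with k show "\<bar>g x - t n x\<bar> powr p = 0" using p by (auto simp: t_def)
      qed
      then show "(\<lambda>n. \<bar>g x - t n x\<bar> powr p) \<longlonglongrightarrow> 0" by (rule tendsto_eventually)
    qed
    show "AE x in lborel. norm (\<bar>g x - t n x\<bar> powr p) \<le> \<bar>g x\<bar> powr p" for n
      using le p by (auto intro!: powr_mono2)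
  qed (use g in \<open>auto simp: Lp_fun_def\<close>)
  then have "(\<lambda>n. np p (\<lambda>x. g x - t n x)) \<longlonglongrightarrow> 0" by (simp add: np_def)
  moreover define e1 where "e1 = e / (2 * 2 powr p)"
  then have e1: "e1 > 0" using e by simp
  ultimately obtain n where n: "np p (\<lambda>x. g x - t n x) < e1"
    using order_tendstoD(2)[of _ 0 sequentially e1] by (auto simp: eventually_sequentially)
  have It: "integrable lborel (t n)"
  proof (rule Bochner_Integration.integrable_bound)
    show "integrable lborel (\<lambda>x::'a. real n * indicator (cball 0 (real n)) x)"
      by (intro integrable_mult_right integrable_real_indicator) (auto simp: emeasure_bounded_finite[unfolded infinity_ennreal_def])
  qed (auto simp: t_def indicator_def)
  define e2 where "e2 = e1 / ((2 * real n) powr (p - 1) + 1)"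
  have den: "(2 * real n) powr (p - 1) + 1 > 0" using powr_ge_zero[of "2 * real n" "p - 1"] by linarith
  have e2: "e2 > 0" using e1 den by (simp add: e2_def)
  obtain \<theta>0 where \<theta>0: "Cc \<theta>0" "(LINT x|lborel. \<bar>t n x - \<theta>0 x\<bar>) < e2"
    using L1_approx_Cc[OF It e2] by blast
  \<comment> \<open>Clipping to [-n, n] does not increase the distance to \<open>t n\<close>, which
    already lies there, and it supplies the bound that compares the exponents p and 1.\<close>
  define \<theta> where "\<theta> = (\<lambda>x. max (- real n) (min (real n) (\<theta>0 x)))"
  have cc: "Cc \<theta>"
  proof -
    obtain R where "continuous_on UNIV \<theta>0" "\<And>x. R < norm x \<Longrightarrow> \<theta>0 x = 0"
      using \<theta>0(1) by (auto simp: Cc_def)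
    then show ?thesis
      unfolding Cc_def \<theta>_def by (intro conjI exI[of _ R] continuous_intros) auto
  qed
  have [measurable]: "\<theta> \<in> borel_measurable borel" "\<theta>0 \<in> borel_measurable borel"
    using cc \<theta>0 by (auto simp: Cc_measurable)
  have L\<theta>: "Lp_fun p \<theta>" by (rule Cc_Lp[OF cc p])
  have i\<theta>: "integrable lborel (\<lambda>x. \<bar>t n x - \<theta>0 x\<bar>)" using It Cc_integrable[OF \<theta>0(1)] by auto
  have b: "AE x in lborel. \<bar>t n x - \<theta> x\<bar> powr p \<le> (2 * real n) powr (p - 1) * \<bar>t n x - \<theta>0 x\<bar>"
  proof (rule AE_I2)
    fix x
    have tn: "\<bar>t n x\<bar> \<le> real n" by (auto simp: t_def indicator_def)
    have 1: "\<bar>t n x - \<theta> x\<bar> \<le> \<bar>t n x - \<theta>0 x\<bar>" using tn by (auto simp: \<theta>_def)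
    have 2: "\<bar>t n x - \<theta> x\<bar> \<le> 2 * real n" using tn by (auto simp: \<theta>_def)
    have "\<bar>t n x - \<theta> x\<bar> powr p = \<bar>t n x - \<theta> x\<bar> powr (p - 1) * \<bar>t n x - \<theta> x\<bar>" by (simp add: powr_diff)
    also have "\<dots> \<le> (2 * real n) powr (p - 1) * \<bar>t n x - \<theta>0 x\<bar>"
      using 1 2 p by (intro mult_mono powr_mono2) auto
    finally show "\<bar>t n x - \<theta> x\<bar> powr p \<le> (2 * real n) powr (p - 1) * \<bar>t n x - \<theta>0 x\<bar>" .
  qed
  have ib: "integrable lborel (\<lambda>x. (2 * real n) powr (p - 1) * \<bar>t n x - \<theta>0 x\<bar>)" using i\<theta> by simp
  have L2: "Lp_fun p (\<lambda>x. t n x - \<theta> x)" by (rule Lp_fun_dominated(1)[OF _ ib b]) measurable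
  have "np p (\<lambda>x. t n x - \<theta> x) \<le> (LINT x|lborel. (2 * real n) powr (p - 1) * \<bar>t n x - \<theta>0 x\<bar>)"
    by (rule Lp_fun_dominated(2)[OF _ ib b]) measurable
  also have "\<dots> \<le> ((2 * real n) powr (p - 1) + 1) * (LINT x|lborel. \<bar>t n x - \<theta>0 x\<bar>)"
    by (simp add: algebra_simps)
  also have "\<dots> < ((2 * real n) powr (p - 1) + 1) * e2" using \<theta>0(2) den by (intro mult_strict_left_mono)
  also have "\<dots> = e1" using den by (simp add: e2_def)
  finally have n2: "np p (\<lambda>x. t n x - \<theta> x) < e1" .
  have tnp: "Lp_fun p (t n)" using Lp_fun_add[OF L2 L\<theta>] p by simp
  have "np p (\<lambda>x. (g x - t n x) + (t n x - \<theta> x)) \<le> 2 powr p * (np p (\<lambda>x. g x - t n x) + np p (\<lambda>x. t n x - \<theta> x))"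
    using p by (intro np_add_le Lp_fun_diff g L2 tnp) auto
  also have "\<dots> < 2 powr p * (e1 + e1)" using n n2 by (intro mult_strict_left_mono) auto
  also have "\<dots> = e" by (simp add: e1_def)
  finally show ?thesis using cc by auto
qed

section \<open>Continuity in affine parameters and approximate identities\<close>

lemma Cc_affine_tendsto:
  fixes \<theta> :: "'a::euclidean_space \<Rightarrow> real"
  assumes \<theta>: "Cc \<theta>" and p: "p > 1" and L: "L \<longlonglongrightarrow> l" "l \<noteq> 0" and B: "B \<longlonglongrightarrow> b"
  shows "(\<lambda>n. np p (\<lambda>x. \<theta> (L n *\<^sub>R x + B n) - \<theta> (l *\<^sub>R x + b))) \<longlonglongrightarrow> 0"
proof -
  obtain R where R: "\<And>x. R < norm x \<Longrightarrow> \<theta> x = 0" and c: "continuous_on UNIV \<theta>"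
    using \<theta> by (auto simp: Cc_def)
  obtain M where M: "M > 0" "\<And>x. \<bar>\<theta> x\<bar> \<le> M" using Cc_bounded[OF \<theta>] by blast
  have [measurable]: "\<theta> \<in> borel_measurable borel" using \<theta> by (rule Cc_measurable)
  \<comment> \<open>Chosen so that |s| > |l|/2, |t| < |b| + 1 and |x| > R' force |s x + t| > R. The
    supports then lie in one ball for all large n, which gives the dominating function.\<close>
  define R' where "R' = (\<bar>R\<bar> + norm b + 1) * 2 / \<bar>l\<bar>"
  have "\<forall>\<^sub>F n in sequentially. \<bar>L n\<bar> > \<bar>l\<bar> / 2"
    using tendsto_rabs[OF L(1)] L(2) by (intro order_tendstoD) auto
  moreover have "\<forall>\<^sub>F n in sequentially. norm (B n) < norm b + 1"
    using tendsto_norm[OF B] by (intro order_tendstoD) auto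
  ultimately have "\<forall>\<^sub>F n in sequentially. \<bar>L n\<bar> > \<bar>l\<bar> / 2 \<and> norm (B n) < norm b + 1"
    by (rule eventually_conj)
  then obtain n0 where n0: "\<And>n. n \<ge> n0 \<Longrightarrow> \<bar>L n\<bar> > \<bar>l\<bar> / 2 \<and> norm (B n) < norm b + 1"
    by (auto simp: eventually_sequentially)
  have supp: "\<theta> (s *\<^sub>R x + t) = 0" if "\<bar>s\<bar> > \<bar>l\<bar> / 2" "norm t < norm b + 1" "norm x > R'" for s t x
  proof (rule R)
    have "\<bar>R\<bar> + norm b + 1 = \<bar>l\<bar> / 2 * R'" using L(2) by (simp add: R'_def)
    also have "\<dots> \<le> \<bar>s\<bar> * norm x" using that L(2) by (intro mult_mono) (auto simp: R'_def)
    finally have "\<bar>R\<bar> + norm b + 1 \<le> norm (s *\<^sub>R x)" by simp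
    moreover have "norm (s *\<^sub>R x) \<le> norm (s *\<^sub>R x + t) + norm t"
      using norm_triangle_ineq4[of "s *\<^sub>R x + t" t] by simp
    ultimately show "R < norm (s *\<^sub>R x + t)" using that(2) by linarith
  qed
  have "(\<lambda>n. LINT x|lborel. \<bar>\<theta> (L (n + n0) *\<^sub>R x + B (n + n0)) - \<theta> (l *\<^sub>R x + b)\<bar> powr p) \<longlonglongrightarrow> (LINT x|(lborel :: 'a measure). 0::real)"
  proof (rule integral_dominated_convergence[where w="\<lambda>x. (2 * M) powr p * indicator (cball 0 R') x"])
    show "AE x in lborel. (\<lambda>n. \<bar>\<theta> (L (n + n0) *\<^sub>R x + B (n + n0)) - \<theta> (l *\<^sub>R x + b)\<bar> powr p) \<longlonglongrightarrow> 0"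
    proof (rule AE_I2)
      fix x :: 'a
      have "(\<lambda>n. L (n + n0) *\<^sub>R x + B (n + n0)) \<longlonglongrightarrow> l *\<^sub>R x + b"
        using LIMSEQ_ignore_initial_segment[OF L(1), of n0] LIMSEQ_ignore_initial_segment[OF B, of n0]
        by (intro tendsto_intros)
      then have "(\<lambda>n. \<theta> (L (n + n0) *\<^sub>R x + B (n + n0))) \<longlonglongrightarrow> \<theta> (l *\<^sub>R x + b)"
        using c by (auto simp: continuous_on_eq_continuous_at intro: isCont_tendsto_compose)
      then have "(\<lambda>n. \<bar>\<theta> (L (n + n0) *\<^sub>R x + B (n + n0)) - \<theta> (l *\<^sub>R x + b)\<bar> powr p) \<longlonglongrightarrow> \<bar>\<theta> (l *\<^sub>R x + b) - \<theta> (l *\<^sub>R x + b)\<bar> powr p"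
        using p by (intro tendsto_powr' tendsto_intros) auto
      then show "(\<lambda>n. \<bar>\<theta> (L (n + n0) *\<^sub>R x + B (n + n0)) - \<theta> (l *\<^sub>R x + b)\<bar> powr p) \<longlonglongrightarrow> 0"
        using p by simp
    qed
    show "AE x in lborel. norm (\<bar>\<theta> (L (n + n0) *\<^sub>R x + B (n + n0)) - \<theta> (l *\<^sub>R x + b)\<bar> powr p) \<le> (2 * M) powr p * indicator (cball 0 R') x" for n
    proof (rule AE_I2)
      fix x :: 'a
      show "norm (\<bar>\<theta> (L (n + n0) *\<^sub>R x + B (n + n0)) - \<theta> (l *\<^sub>R x + b)\<bar> powr p) \<le> (2 * M) powr p * indicator (cball 0 R') x"
      proof (cases "norm x \<le> R'")
        case True
        have "\<bar>\<theta> (L (n + n0) *\<^sub>R x + B (n + n0)) - \<theta> (l *\<^sub>R x + b)\<bar> \<le> 2 * M"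
          using M(2)[of "L (n + n0) *\<^sub>R x + B (n + n0)"] M(2)[of "l *\<^sub>R x + b"] by linarith
        then show ?thesis using True p by (auto intro!: powr_mono2)
      next
        case False
        have "\<theta> (L (n + n0) *\<^sub>R x + B (n + n0)) = 0" using n0[of "n + n0"] False by (intro supp) auto
        moreover have "\<theta> (l *\<^sub>R x + b) = 0" using False L(2) by (intro supp) auto
        ultimately show ?thesis using p by simp
      qed
    qed
    show "integrable lborel (\<lambda>x::'a. (2 * M) powr p * indicator (cball 0 R') x)"
      by (intro integrable_mult_right integrable_real_indicator) (auto simp: emeasure_bounded_finite[unfolded infinity_ennreal_def])
  qed measurable
  then have "(\<lambda>n. np p (\<lambda>x. \<theta> (L (n + n0) *\<^sub>R x + B (n + n0)) - \<theta> (l *\<^sub>R x + b))) \<longlonglongrightarrow> 0"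
    by (simp add: np_def)
  then show ?thesis by (rule LIMSEQ_offset)
qed

lemma np_affine_tendsto:
  fixes g :: "'a::euclidean_space \<Rightarrow> real"
  assumes g: "Lp_fun p g" and p: "p > 1" and L: "L \<longlonglongrightarrow> l" "l \<noteq> 0" and B: "B \<longlonglongrightarrow> b"
  shows "(\<lambda>n. np p (\<lambda>x. g (L n *\<^sub>R x + B n) - g (l *\<^sub>R x + b))) \<longlonglongrightarrow> 0"
proof (rule LIMSEQ_I)
  fix e :: real assume e: "e > 0"
  \<comment> \<open>Collects the factors of \<open>np p r\<close>: the remainder r enters dilated by
    \<open>L n\<close>, costing at most 2^m / |l|^m for large n, and dilated by l, costing 1 /
    |l|^m.\<close>
  define C where "C = 2 powr p * (2 ^ DIM('a) / \<bar>l\<bar> ^ DIM('a) + 2 powr p * (1 / \<bar>l\<bar> ^ DIM('a)))"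
  have C: "C > 0" using L(2) by (auto simp: C_def intro!: mult_pos_pos add_pos_pos divide_pos_pos)
  define d where "d = e / (2 * C)"
  have d: "d > 0" using e C by (simp add: d_def)
  obtain \<theta> where \<theta>: "Cc \<theta>" "np p (\<lambda>x. g x - \<theta> x) < d"
    using Lp_approx_Cc[OF g p d] by blast
  have L\<theta>: "Lp_fun p \<theta>" by (rule Cc_Lp[OF \<theta>(1) p])
  define r where "r = (\<lambda>x. g x - \<theta> x)"
  have r: "Lp_fun p r" unfolding r_def using p by (intro Lp_fun_diff g L\<theta>) auto
  define d2 where "d2 = e / (2 * (2 powr p * 2 powr p))"
  have d2: "d2 > 0" using e by (simp add: d2_def)
  have "\<forall>\<^sub>F n in sequentially. np p (\<lambda>x. \<theta> (L n *\<^sub>R x + B n) - \<theta> (l *\<^sub>R x + b)) < d2"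
    using Cc_affine_tendsto[OF \<theta>(1) p L B] d2 by (rule order_tendstoD)
  moreover have "\<forall>\<^sub>F n in sequentially. \<bar>L n\<bar> > \<bar>l\<bar> / 2"
    using tendsto_rabs[OF L(1)] L(2) by (intro order_tendstoD) auto
  ultimately have "\<forall>\<^sub>F n in sequentially. norm (np p (\<lambda>x. g (L n *\<^sub>R x + B n) - g (l *\<^sub>R x + b)) - 0) < e"
  proof eventually_elim
    case (elim n)
    have Ln: "L n \<noteq> 0" using elim(2) L(2) by auto
    have P1: "Lp_fun p (\<lambda>x. r (L n *\<^sub>R x + B n))" by (rule Lp_fun_affine[OF Ln r])
    have P2: "Lp_fun p (\<lambda>x. \<theta> (L n *\<^sub>R x + B n) - \<theta> (l *\<^sub>R x + b))"
      using p by (intro Lp_fun_diff Lp_fun_affine Ln L L\<theta>) auto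
    have P3: "Lp_fun p (\<lambda>x. r (l *\<^sub>R x + b))" by (rule Lp_fun_affine[OF L(2) r])
    have "np p (\<lambda>x. g (L n *\<^sub>R x + B n) - g (l *\<^sub>R x + b))
      = np p (\<lambda>x. r (L n *\<^sub>R x + B n) + ((\<theta> (L n *\<^sub>R x + B n) - \<theta> (l *\<^sub>R x + b)) - r (l *\<^sub>R x + b)))"
      by (simp add: r_def)
    also have "\<dots> \<le> 2 powr p * (np p (\<lambda>x. r (L n *\<^sub>R x + B n)) + np p (\<lambda>x. (\<theta> (L n *\<^sub>R x + B n) - \<theta> (l *\<^sub>R x + b)) - r (l *\<^sub>R x + b)))"
      using p by (intro np_add_le P1 Lp_fun_diff P2 P3) auto
    also have "\<dots> \<le> 2 powr p * (np p (\<lambda>x. r (L n *\<^sub>R x + B n)) + 2 powr p * (np p (\<lambda>x. \<theta> (L n *\<^sub>R x + B n) - \<theta> (l *\<^sub>R x + b)) + np p (\<lambda>x. r (l *\<^sub>R x + b))))"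
      using p by (intro mult_left_mono add_left_mono np_diff_le P2 P3) auto
    also have "\<dots> = 2 powr p * (np p r / \<bar>L n\<bar> ^ DIM('a) + 2 powr p * (np p (\<lambda>x. \<theta> (L n *\<^sub>R x + B n) - \<theta> (l *\<^sub>R x + b)) + np p r / \<bar>l\<bar> ^ DIM('a)))"
      by (simp add: np_affine[OF Ln r] np_affine[OF L(2) r])
    also have "\<dots> < 2 powr p * (np p r * (2 ^ DIM('a) / \<bar>l\<bar> ^ DIM('a)) + 2 powr p * (d2 + np p r / \<bar>l\<bar> ^ DIM('a)))"
    proof (rule mult_strict_left_mono[OF add_le_less_mono])
      have "(\<bar>l\<bar> / 2) ^ DIM('a) \<le> \<bar>L n\<bar> ^ DIM('a)" using elim(2) by (intro power_mono) auto
      then have "np p r / \<bar>L n\<bar> ^ DIM('a) \<le> np p r / (\<bar>l\<bar> / 2) ^ DIM('a)"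
        using L(2) Ln by (intro divide_left_mono) auto
      then show "np p r / \<bar>L n\<bar> ^ DIM('a) \<le> np p r * (2 ^ DIM('a) / \<bar>l\<bar> ^ DIM('a))"
        by (simp add: power_divide)
    qed (use elim(1) in simp_all)
    also have "\<dots> = C * np p r + 2 powr p * 2 powr p * d2"
      by (simp add: C_def algebra_simps)
    also have "\<dots> \<le> C * d + 2 powr p * 2 powr p * d2"
      using \<theta>(2) C by (intro add_right_mono mult_left_mono) (auto simp: r_def)
    also have "\<dots> = e" using C by (simp add: d_def d2_def)
    finally show ?case by simp
  qed
  then show "\<exists>N. \<forall>n\<ge>N. norm (np p (\<lambda>x. g (L n *\<^sub>R x + B n) - g (l *\<^sub>R x + b)) - 0) < e"
    by (simp add: eventually_sequentially)
qed

lemma AE_integrable_kernel: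
  fixes g K :: "'a::euclidean_space \<Rightarrow> real"
  assumes g: "Lp_fun p g" and p: "p > 1" and K: "integrable lborel K"
  shows "AE x in lborel. integrable lborel (\<lambda>z. K z * g (x + c *\<^sub>R z))"
proof -
  have [measurable]: "g \<in> borel_measurable borel" using g by (simp add: Lp_fun_def)
  have m: "(\<lambda>(z, x). g (x + c *\<^sub>R z)) \<in> borel_measurable (lborel \<Otimes>\<^sub>M borel)" by measurable
  have i: "integrable lborel (\<lambda>z. \<bar>K z\<bar> * np p (\<lambda>x. g (x + c *\<^sub>R z)))"
    using K by (simp add: np_translate[OF g])
  show "AE x in lborel. integrable lborel (\<lambda>z. K z * g (x + c *\<^sub>R z))"
    by (rule AE_integrable_mixture[OF p sigma_finite_lborel m K Lp_fun_translate[OF g] i])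
qed

text \<open>As K has integral 1, the difference is a mixture of the functions g (x + e z) - g x.
  Their norms tend to 0 for each z by continuity of translations and are bounded in z, so dominated
  convergence applies to the mixture bound.\<close>

lemma approx_identity:
  fixes g K :: "'a::euclidean_space \<Rightarrow> real"
  assumes g: "Lp_fun p g" and p: "p > 1" and K: "integrable lborel K" "(LINT z|lborel. K z) = 1"
    and e: "e \<longlonglongrightarrow> (0::real)"
  shows "(\<lambda>n. np p (\<lambda>x. (LINT z|lborel. K z * g (x + e n *\<^sub>R z)) - g x)) \<longlonglongrightarrow> 0"
proof -
  have gm[measurable]: "g \<in> borel_measurable borel" using g by (simp add: Lp_fun_def)
  have Km[measurable]: "K \<in> borel_measurable borel" using K(1) by auto
  define h where "h = (\<lambda>n z x. g (x + e n *\<^sub>R z) - g x)"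
  have h: "Lp_fun p (h n z)" for n z
    unfolding h_def using p by (intro Lp_fun_diff Lp_fun_translate g) auto
  have hm: "(\<lambda>(z, x). h n z x) \<in> borel_measurable (lborel \<Otimes>\<^sub>M borel)" for n unfolding h_def by measurable
  have nphm[measurable]: "(\<lambda>z. np p (h n z)) \<in> borel_measurable borel" for n
    unfolding np_def h_def by measurable
  have hle: "np p (h n z) \<le> 2 powr p * (2 * np p g)" for n z
    using np_diff_le[OF Lp_fun_translate[OF g, of "e n *\<^sub>R z"] g] p by (simp add: h_def np_translate[OF g])
  have i: "integrable lborel (\<lambda>z. \<bar>K z\<bar> * np p (h n z))" for n
  proof (rule Bochner_Integration.integrable_bound)
    show "integrable lborel (\<lambda>z. \<bar>K z\<bar> * (2 powr p * (2 * np p g)))" using K by simp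
    show "AE z in lborel. norm (\<bar>K z\<bar> * np p (h n z)) \<le> norm (\<bar>K z\<bar> * (2 powr p * (2 * np p g)))"
      using hle by (auto simp: abs_mult intro!: mult_left_mono)
  qed measurable
  have hz: "(\<lambda>n. np p (h n z)) \<longlonglongrightarrow> 0" for z
  proof -
    have "(\<lambda>n. e n *\<^sub>R z) \<longlonglongrightarrow> 0 *\<^sub>R z" using e by (intro tendsto_intros)
    then show ?thesis using np_affine_tendsto[OF g p, of "\<lambda>_. 1" 1 "\<lambda>n. e n *\<^sub>R z" 0] by (simp add: h_def)
  qed
  have "(\<lambda>n. LINT z|lborel. \<bar>K z\<bar> * np p (h n z)) \<longlonglongrightarrow> (LINT z|(lborel :: 'a measure). 0::real)"
  proof (rule integral_dominated_convergence[where w="\<lambda>z. \<bar>K z\<bar> * (2 powr p * (2 * np p g))"])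
    show "AE z in lborel. (\<lambda>n. \<bar>K z\<bar> * np p (h n z)) \<longlonglongrightarrow> 0"
      using tendsto_mult_left[OF hz] by (intro AE_I2) (metis mult_zero_right)
    show "AE z in lborel. norm (\<bar>K z\<bar> * np p (h n z)) \<le> \<bar>K z\<bar> * (2 powr p * (2 * np p g))" for n
      using hle by (auto simp: abs_mult intro!: mult_left_mono)
  qed (use K in auto)
  then have lim0: "(\<lambda>n. (LINT z|lborel. \<bar>K z\<bar>) powr (p - 1) * (LINT z|lborel. \<bar>K z\<bar> * np p (h n z))) \<longlonglongrightarrow> 0"
    using tendsto_mult_left[of _ 0 sequentially "(LINT z|lborel. \<bar>K z\<bar>) powr (p - 1)"] by simp
  show ?thesis
  proof (rule tendsto_sandwich[OF _ _ tendsto_const lim0])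
    show "\<forall>\<^sub>F n in sequentially. np p (\<lambda>x. (LINT z|lborel. K z * g (x + e n *\<^sub>R z)) - g x)
      \<le> (LINT z|lborel. \<bar>K z\<bar>) powr (p - 1) * (LINT z|lborel. \<bar>K z\<bar> * np p (h n z))"
    proof (intro always_eventually allI)
      fix n
      have "np p (\<lambda>x. (LINT z|lborel. K z * g (x + e n *\<^sub>R z)) - g x) = np p (\<lambda>x. LINT z|lborel. K z * h n z x)"
      proof (rule np_cong_AE)
        show "AE x in lborel. (LINT z|lborel. K z * g (x + e n *\<^sub>R z)) - g x = (LINT z|lborel. K z * h n z x)"
          using AE_integrable_kernel[OF g p K(1), of "e n"]
        proof eventually_elim
          case (elim x)
          then have "(LINT z|lborel. K z * h n z x) = (LINT z|lborel. K z * g (x + e n *\<^sub>R z)) - (LINT z|lborel. K z * g x)"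
            using K(1) by (simp add: h_def right_diff_distrib)
          also have "(LINT z|lborel. K z * g x) = g x" using K by simp
          finally show ?case by simp
        qed
      qed (unfold h_def, measurable)
      also have "\<dots> \<le> (LINT z|lborel. \<bar>K z\<bar>) powr (p - 1) * (LINT z|lborel. \<bar>K z\<bar> * np p (h n z))"
        by (rule np_mixture_le[OF p sigma_finite_lborel hm K(1) h i])
      finally show "np p (\<lambda>x. (LINT z|lborel. K z * g (x + e n *\<^sub>R z)) - g x)
        \<le> (LINT z|lborel. \<bar>K z\<bar>) powr (p - 1) * (LINT z|lborel. \<bar>K z\<bar> * np p (h n z))" .
    qed
  qed simp
qed

text \<open>Uniqueness principle: the averages over scale c tend to F in L_p, so they cannot all
  vanish unless F does. It is applied to the Gaussian and to the Poisson kernel.\<close>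

lemma kernel_vanish_imp_zero:
  fixes F K :: "'a::euclidean_space \<Rightarrow> real"
  assumes F: "Lp_fun p F" and p: "p > 1" and K: "integrable lborel K" "(LINT z|lborel. K z) = 1"
    and z: "\<And>c. c > 0 \<Longrightarrow> AE x in lborel. (LINT z|lborel. K z * F (x + c *\<^sub>R z)) = 0"
  shows "AE x in lborel. F x = 0"
proof -
  have [measurable]: "F \<in> borel_measurable borel" "K \<in> borel_measurable borel"
    using F K by (auto simp: Lp_fun_def)
  have e: "(\<lambda>n. 1 / real (Suc n)) \<longlonglongrightarrow> 0"
    using LIMSEQ_inverse_real_of_nat by (simp add: inverse_eq_divide)
  have "np p (\<lambda>x. (LINT z|lborel. K z * F (x + (1 / real (Suc n)) *\<^sub>R z)) - F x) = np p (\<lambda>x. - 1 * F x)" for n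
    using z[of "1 / real (Suc n)"] by (intro np_cong_AE) (auto elim!: eventually_mono)
  then have "(\<lambda>n::nat. np p F) \<longlonglongrightarrow> 0"
    using approx_identity[OF F p K e] np_cmult[OF F, of "-1"] by simp
  then have "np p F = 0" by (rule LIMSEQ_unique[OF tendsto_const])
  then show ?thesis by (rule np_eq_0D[OF F])
qed


section \<open>Linear subspaces of L_p and their closures\<close>

definition Lp_lin :: "real \<Rightarrow> ('a::euclidean_space \<Rightarrow> real) set \<Rightarrow> bool" where
  "Lp_lin p X \<longleftrightarrow> (\<forall>g\<in>X. Lp_fun p g) \<and> (\<lambda>_. 0) \<in> X \<and> (\<forall>g\<in>X. \<forall>h\<in>X. (\<lambda>x. g x + h x) \<in> X)
     \<and> (\<forall>c. \<forall>g\<in>X. (\<lambda>x. c * g x) \<in> X)"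

definition Lp_cl :: "real \<Rightarrow> ('a::euclidean_space \<Rightarrow> real) set \<Rightarrow> ('a \<Rightarrow> real) set" where
  "Lp_cl p X = {g. Lp_fun p g \<and> (\<forall>e>0. \<exists>h\<in>X. np p (\<lambda>x. g x - h x) < e)}"

lemma subset_Lp_cl:
  assumes "g \<in> X" "Lp_fun p g" shows "g \<in> Lp_cl p X"
  unfolding Lp_cl_def using assms by (auto intro!: bexI[of _ g])

lemma Lp_cl_Lp: "g \<in> Lp_cl p X \<Longrightarrow> Lp_fun p g"
  by (simp add: Lp_cl_def)

lemma Lp_cl_idem:
  assumes p: "p > 1" and X: "\<forall>g\<in>X. Lp_fun p g" and g: "Lp_fun p g"
    and *: "\<And>e. e > 0 \<Longrightarrow> \<exists>h\<in>Lp_cl p X. np p (\<lambda>x. g x - h x) < e"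
  shows "g \<in> Lp_cl p X"
  unfolding Lp_cl_def
proof (intro CollectI conjI g allI impI)
  fix e :: real assume e: "e > 0"
  define d where "d = e / (2 * 2 powr p)"
  have d: "d > 0" using e by (simp add: d_def)
  obtain h where h: "h \<in> Lp_cl p X" "np p (\<lambda>x. g x - h x) < d" using *[OF d] by blast
  obtain k where k: "k \<in> X" "np p (\<lambda>x. h x - k x) < d" using h(1) d by (auto simp: Lp_cl_def)
  have "np p (\<lambda>x. (g x - h x) + (h x - k x)) \<le> 2 powr p * (np p (\<lambda>x. g x - h x) + np p (\<lambda>x. h x - k x))"
    using p X k(1) Lp_cl_Lp[OF h(1)] g by (intro np_add_le Lp_fun_diff) auto
  also have "\<dots> < 2 powr p * (d + d)" using h k by (intro mult_strict_left_mono) auto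
  also have "\<dots> = e" by (simp add: d_def)
  finally show "\<exists>h\<in>X. np p (\<lambda>x. g x - h x) < e" using k(1) by auto
qed

text \<open>Closures consist of functions rather than of classes; this makes them insensitive to
  null sets, so that identities known only almost everywhere can be used.\<close>

lemma Lp_cl_cong_AE:
  assumes "g \<in> Lp_cl p X" "AE x in lborel. g x = h x" "h \<in> borel_measurable borel"
    "\<forall>g\<in>X. Lp_fun p g"
  shows "h \<in> Lp_cl p X"
proof -
  have g: "Lp_fun p g" by (rule Lp_cl_Lp[OF assms(1)])
  have h: "Lp_fun p h" by (rule Lp_fun_cong_AE[OF g assms(3,2)])
  have "np p (\<lambda>x. h x - k x) = np p (\<lambda>x. g x - k x)" if "k \<in> X" for k
  proof (rule np_cong_AE)
    have "k \<in> borel_measurable borel" using that assms(4) by (auto simp: Lp_fun_def)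
    then show "(\<lambda>x. h x - k x) \<in> borel_measurable lborel" "(\<lambda>x. g x - k x) \<in> borel_measurable lborel"
      using g assms(3) by (auto simp: Lp_fun_def)
  qed (use assms(2) in \<open>auto elim!: eventually_mono\<close>)
  then show ?thesis using assms(1) h by (auto simp: Lp_cl_def)
qed

lemma Lp_lin_cl:
  assumes p: "p > 1" and X: "Lp_lin p X"
  shows "Lp_lin p (Lp_cl p X)"
  unfolding Lp_lin_def
proof (intro conjI ballI allI)
  show "Lp_fun p g" if "g \<in> Lp_cl p X" for g using that by (rule Lp_cl_Lp)
  show "(\<lambda>_. 0) \<in> Lp_cl p X" using X by (intro subset_Lp_cl) (auto simp: Lp_lin_def)
next
  fix g h assume g: "g \<in> Lp_cl p X" and h: "h \<in> Lp_cl p X"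
  show "(\<lambda>x. g x + h x) \<in> Lp_cl p X"
    unfolding Lp_cl_def
  proof (intro CollectI conjI allI impI)
    show "Lp_fun p (\<lambda>x. g x + h x)" using g h p by (intro Lp_fun_add Lp_cl_Lp) auto
    fix e :: real assume e: "e > 0"
    define d where "d = e / (2 * 2 powr p)"
    have d: "d > 0" using e by (simp add: d_def)
    obtain g' where g': "g' \<in> X" "np p (\<lambda>x. g x - g' x) < d" using g d by (auto simp: Lp_cl_def)
    obtain h' where h': "h' \<in> X" "np p (\<lambda>x. h x - h' x) < d" using h d by (auto simp: Lp_cl_def)
    have "np p (\<lambda>x. (g x - g' x) + (h x - h' x)) \<le> 2 powr p * (np p (\<lambda>x. g x - g' x) + np p (\<lambda>x. h x - h' x))"
      using p X g'(1) h'(1) Lp_cl_Lp[OF g] Lp_cl_Lp[OF h] by (intro np_add_le Lp_fun_diff) (auto simp: Lp_lin_def)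
    also have "\<dots> < 2 powr p * (d + d)" using h' g' by (intro mult_strict_left_mono) auto
    also have "\<dots> = e" by (simp add: d_def)
    finally show "\<exists>k\<in>X. np p (\<lambda>x. (g x + h x) - k x) < e"
      using g'(1) h'(1) X by (intro bexI[of _ "\<lambda>x. g' x + h' x"]) (auto simp: Lp_lin_def algebra_simps)
  qed
next
  fix c g assume g: "g \<in> Lp_cl p X"
  show "(\<lambda>x. c * g x) \<in> Lp_cl p X"
    unfolding Lp_cl_def
  proof (intro CollectI conjI allI impI)
    show "Lp_fun p (\<lambda>x. c * g x)" by (intro Lp_fun_cmult Lp_cl_Lp[OF g])
    fix e :: real assume e: "e > 0"
    have pos: "\<bar>c\<bar> powr p + 1 > 0" using powr_ge_zero[of "\<bar>c\<bar>" p] by linarith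
    define d where "d = e / (\<bar>c\<bar> powr p + 1)"
    have d: "d > 0" using e pos by (simp add: d_def)
    obtain g' where g': "g' \<in> X" "np p (\<lambda>x. g x - g' x) < d" using g d by (auto simp: Lp_cl_def)
    have D: "Lp_fun p (\<lambda>x. g x - g' x)"
      using p X g'(1) Lp_cl_Lp[OF g] by (intro Lp_fun_diff) (auto simp: Lp_lin_def)
    have "np p (\<lambda>x. c * (g x - g' x)) = \<bar>c\<bar> powr p * np p (\<lambda>x. g x - g' x)" by (rule np_cmult[OF D])
    also have "\<dots> \<le> (\<bar>c\<bar> powr p + 1) * np p (\<lambda>x. g x - g' x)" by (simp add: algebra_simps)
    also have "\<dots> < (\<bar>c\<bar> powr p + 1) * d" using g' pos by (intro mult_strict_left_mono) auto
    also have "\<dots> = e" using pos by (simp add: d_def)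
    finally show "\<exists>k\<in>X. np p (\<lambda>x. c * g x - k x) < e"
      using g'(1) X by (intro bexI[of _ "\<lambda>x. c * g' x"]) (auto simp: Lp_lin_def algebra_simps)
  qed
qed

lemma Lp_lin_sum:
  assumes "Lp_lin p X" "finite I" "\<And>i. i \<in> I \<Longrightarrow> g i \<in> X"
  shows "(\<lambda>x. \<Sum>i\<in>I. c i * g i x) \<in> X"
  using assms(2,3) by (induction rule: finite_induct) (use assms(1) in \<open>auto simp: Lp_lin_def\<close>)

text \<open>After normalising the affine images of \<open>g\<close> to have constant norm, the parameter space is split
  into countably many measurable cells on which they are nearly constant in norm, and all but finitely
  many cells are discarded.\<close>

lemma affine_mixture_in_Lp_cl:
  fixes g :: "'a::euclidean_space \<Rightarrow> real" and N :: "'w measure"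
  assumes p: "p > 1" and X: "Lp_lin p X" and g: "Lp_fun p g"
    and N: "sigma_finite_measure N"
    and m[measurable]: "k \<in> borel_measurable N" "L \<in> borel_measurable N" "B \<in> borel_measurable N"
    and L: "\<And>w. w \<in> space N \<Longrightarrow> L w \<noteq> 0"
    and gX: "\<And>w. w \<in> space N \<Longrightarrow> (\<lambda>x. g (L w *\<^sub>R x + B w)) \<in> Lp_cl p X"
    and int: "integrable N (\<lambda>w. k w * \<bar>L w\<bar> powr (- real DIM('a) / p))"
  shows "(\<lambda>x. \<integral>w. k w * g (L w *\<^sub>R x + B w) \<partial>N) \<in> Lp_cl p X"
proof (cases "space N = {}")
  case True
  then have "(\<integral>w. k w * g (L w *\<^sub>R x + B w) \<partial>N) = (\<integral>w. 0 \<partial>N)" for x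
    by (intro Bochner_Integration.integral_cong) auto
  then have "(\<lambda>x. \<integral>w. k w * g (L w *\<^sub>R x + B w) \<partial>N) = (\<lambda>_. 0)" by simp
  then show ?thesis using Lp_lin_cl[OF p X] by (simp add: Lp_lin_def)
next
  case False
  interpret N: sigma_finite_measure N by fact
  have [measurable]: "g \<in> borel_measurable borel" using g by (simp add: Lp_fun_def)
  have lcl: "Lp_lin p (Lp_cl p X)" by (rule Lp_lin_cl[OF p X])
  define q where "q = DIM('a) / p"
  define hh where "hh = (\<lambda>(l, b) x. \<bar>l\<bar> powr q * g (l *\<^sub>R x + b))"
  define kk where "kk = (\<lambda>w. k w * \<bar>L w\<bar> powr (- q))"
  have ikk: "integrable N kk" using int by (simp add: kk_def q_def)
  have [measurable]: "kk \<in> borel_measurable N" unfolding kk_def by measurable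
  define h where "h = (\<lambda>w. hh (L w, B w))"
  have hhLp: "Lp_fun p (hh (l, b))" "np p (hh (l, b)) = np p g" if "l \<noteq> 0" for l b
  proof -
    have 1: "Lp_fun p (\<lambda>x. g (l *\<^sub>R x + b))" by (rule Lp_fun_affine[OF that g])
    show "Lp_fun p (hh (l, b))" unfolding hh_def by (simp add: Lp_fun_cmult[OF 1])
    have "np p (hh (l, b)) = \<bar>l\<bar> powr (q * p) * (np p g / \<bar>l\<bar> ^ DIM('a))"
      unfolding hh_def by (simp add: np_cmult[OF 1] np_affine[OF that g] powr_powr)
    also have "q * p = DIM('a)" using p by (simp add: q_def)
    also have "\<bar>l\<bar> powr DIM('a) = \<bar>l\<bar> ^ DIM('a)" using that by (simp add: powr_realpow)
    finally show "np p (hh (l, b)) = np p g" using that by simp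
  qed
  \<comment> \<open>The countable set T is taken dense inside S, not inside the whole parameter
    space, so that the approximants themselves belong to the closure.\<close>
  define S where "S = {lb. fst lb \<noteq> 0 \<and> (\<lambda>x. g (fst lb *\<^sub>R x + snd lb)) \<in> Lp_cl p X}"
  have LS: "(L w, B w) \<in> S" if "w \<in> space N" for w using L[OF that] gX[OF that] by (simp add: S_def)
  obtain T where T: "countable T" "T \<subseteq> S" "S \<subseteq> closure T" using separable[of S] by blast
  have Tne: "T \<noteq> {}" using T(3) LS False by auto
  define d where "d = from_nat_into T"
  have dT: "d n \<in> T" for n unfolding d_def by (rule from_nat_into[OF Tne])
  have dS: "d n \<in> S" for n using dT T(2) by auto
  have d0: "fst (d n) \<noteq> 0" for n using dS by (simp add: S_def)
  define H where "H = (\<lambda>n. hh (d n))"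
  have HLp: "Lp_fun p (H n)" for n
    using hhLp(1)[OF d0, of n "snd (d n)"] by (simp add: H_def)
  have HX: "H n \<in> Lp_cl p X" for n
    using dS[of n] lcl unfolding H_def hh_def S_def Lp_lin_def by (auto simp: case_prod_beta)
  have [measurable]: "H n \<in> borel_measurable borel" for n using HLp by (simp add: Lp_fun_def)
  have [measurable]: "(\<lambda>(w, x). h w x) \<in> borel_measurable (N \<Otimes>\<^sub>M borel)"
    unfolding h_def hh_def prod.case by measurable
  have hLp: "Lp_fun p (h w)" "np p (h w) = np p g" if "w \<in> space N" for w
    using hhLp[OF L[OF that]] by (auto simp: h_def)
  have npm[measurable]: "(\<lambda>w. np p (\<lambda>x. h w x - H n x)) \<in> borel_measurable N" for n
    unfolding np_def by measurable
  have dense: "\<exists>n. np p (\<lambda>x. h w x - H n x) < \<delta>" if w: "w \<in> space N" and \<delta>: "\<delta> > 0" for w \<delta>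
  proof -
    have "(L w, B w) \<in> closure T" using LS[OF w] T(3) by auto
    then obtain t where t: "\<And>i::nat. t i \<in> T" "t \<longlonglongrightarrow> (L w, B w)"
      by (auto simp: closure_sequential)
    have Lt: "(\<lambda>i. fst (t i)) \<longlonglongrightarrow> L w" and Bt: "(\<lambda>i. snd (t i)) \<longlonglongrightarrow> B w"
      using tendsto_fst[OF t(2)] tendsto_snd[OF t(2)] by auto
    have t0: "fst (t i) \<noteq> 0" for i using t(1)[of i] T(2) by (auto simp: S_def)
    let ?a = "\<lambda>i. \<bar>fst (t i)\<bar> powr q" and ?b = "\<bar>L w\<bar> powr q"
    have ab: "?a \<longlonglongrightarrow> ?b"
      using L[OF w] by (intro tendsto_powr tendsto_rabs Lt tendsto_const) auto
    let ?D = "\<lambda>i. np p (\<lambda>x. g (fst (t i) *\<^sub>R x + snd (t i)) - g (L w *\<^sub>R x + B w))"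
    have D: "?D \<longlonglongrightarrow> 0" by (rule np_affine_tendsto[OF g p Lt L[OF w] Bt])
    let ?R = "\<lambda>i. 2 powr p * (\<bar>?a i\<bar> powr p * ?D i + \<bar>?a i - ?b\<bar> powr p * np p (\<lambda>x. g (L w *\<^sub>R x + B w)))"
    have "?R \<longlonglongrightarrow> 2 powr p * (\<bar>?b\<bar> powr p * 0 + \<bar>?b - ?b\<bar> powr p * np p (\<lambda>x. g (L w *\<^sub>R x + B w)))"
      using p L[OF w] by (intro tendsto_intros ab D tendsto_powr') auto
    then have R0: "?R \<longlonglongrightarrow> 0" using p by simp
    obtain i where i: "?R i < \<delta>"
      using order_tendstoD(2)[OF R0 \<delta>] by (auto simp: eventually_sequentially)
    have P1: "Lp_fun p (\<lambda>x. g (fst (t i) *\<^sub>R x + snd (t i)))" by (rule Lp_fun_affine[OF t0 g])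
    have P2: "Lp_fun p (\<lambda>x. g (L w *\<^sub>R x + B w))" by (rule Lp_fun_affine[OF L[OF w] g])
    have P3: "Lp_fun p (\<lambda>x. g (fst (t i) *\<^sub>R x + snd (t i)) - g (L w *\<^sub>R x + B w))"
      using p by (intro Lp_fun_diff P1 P2) auto
    have "np p (\<lambda>x. hh (t i) x - h w x) = np p (\<lambda>x. ?a i * (g (fst (t i) *\<^sub>R x + snd (t i)) - g (L w *\<^sub>R x + B w)) + (?a i - ?b) * g (L w *\<^sub>R x + B w))"
      by (simp add: h_def hh_def case_prod_beta algebra_simps)
    also have "\<dots> \<le> ?R i"
      using np_add_le[OF Lp_fun_cmult[OF P3, of "?a i"] Lp_fun_cmult[OF P2, of "?a i - ?b"]] p by (simp add: np_cmult[OF P3] np_cmult[OF P2])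
    finally have "np p (\<lambda>x. h w x - hh (t i) x) < \<delta>" using i by (subst np_minus_commute) simp
    moreover obtain n where "t i = d n"
      using t(1)[of i] from_nat_into_surj[OF T(1)] unfolding d_def by metis
    ultimately show ?thesis by (auto simp: H_def)
  qed
  define f where "f = (\<lambda>x. \<integral>w. k w * g (L w *\<^sub>R x + B w) \<partial>N)"
  have f: "f = (\<lambda>x. \<integral>w. kk w * h w x \<partial>N)"
    unfolding f_def kk_def h_def hh_def
    by (intro ext Bochner_Integration.integral_cong) (use L in \<open>auto simp: powr_minus\<close>)
  have int1: "integrable N (\<lambda>w. \<bar>kk w\<bar> * np p (h w))"
    using integrable_mult_left[OF integrable_abs[OF ikk], of "np p g"]
    by (subst Bochner_Integration.integrable_cong[of N N _ "\<lambda>w. \<bar>kk w\<bar> * np p g"]) (auto simp: hLp)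
  have mixh: "Lp_fun p f" "AE x in lborel. integrable N (\<lambda>w. kk w * h w x)"
    unfolding f
    by (rule Lp_fun_mixture[OF p N _ ikk hLp(1) int1], measurable)
       (rule AE_integrable_mixture[OF p N _ ikk hLp(1) int1], measurable)
  have "f \<in> Lp_cl p X"
  proof (rule Lp_cl_idem[OF p])
    show "\<forall>g\<in>X. Lp_fun p g" using X by (simp add: Lp_lin_def)
    show "Lp_fun p f" by (rule mixh)
    fix e :: real assume e: "e > 0"
    define K where "K = (\<integral>w. \<bar>kk w\<bar> \<partial>N)"
    have K0: "K \<ge> 0" by (simp add: K_def)
    \<comment> \<open>The mixture bound contributes \<open>K powr (p - 1)\<close> and the integral
      at most \<open>(K + 1) * \<delta>\<close>; the last summand keeps c positive when K =
      0.\<close>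
    define c where "c = (K powr (p - 1)) * (K + 1) + 1"
    have c: "c > 0" using K0 by (auto simp: c_def intro!: add_nonneg_pos mult_nonneg_nonneg)
    define \<delta> where "\<delta> = e / (2 * c)"
    have \<delta>: "\<delta> > 0" using e c by (simp add: \<delta>_def)
    \<comment> \<open>Taking the least admissible index makes the choice of the cell measurable in
      w.\<close>
    define I where "I = (\<lambda>w. LEAST n. np p (\<lambda>x. h w x - H n x) < \<delta>)"
    have I: "np p (\<lambda>x. h w x - H (I w) x) < \<delta>" if "w \<in> space N" for w
      unfolding I_def using dense[OF that \<delta>] by (rule LeastI_ex)
    have [measurable]: "I \<in> measurable N (count_space UNIV)"
      unfolding I_def by measurable
    define a where "a = (\<lambda>M w x. if I w < M then H (I w) x else 0)"
    have am[measurable]: "(\<lambda>(w, x). a M w x) \<in> borel_measurable (N \<Otimes>\<^sub>M borel)" for M :: nat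
    proof -
      have "(\<lambda>(w, x). a M w x) = (\<lambda>(w, x). \<Sum>n<M. (if I w = n then 1 else 0) * H n x)"
        by (auto simp: a_def fun_eq_iff if_distrib[of "\<lambda>c. c * _"] cong: if_cong)
      also have "\<dots> \<in> borel_measurable (N \<Otimes>\<^sub>M borel)" by measurable
      finally show ?thesis .
    qed
    have hae: "Lp_fun p (\<lambda>x. h w x - a M w x)" if "w \<in> space N" for w M
      using p by (intro Lp_fun_diff hLp(1) that) (cases "I w < M"; simp add: a_def HLp)+
    have nle: "np p (\<lambda>x. h w x - a M w x) \<le> \<delta> + np p g * (if I w < M then 0 else 1)" if "w \<in> space N" for w M
      using I[OF that] hLp(2)[OF that] \<delta> by (cases "I w < M") (simp_all add: a_def)
    have ham: "(\<lambda>(w, x). h w x - a M w x) \<in> borel_measurable (N \<Otimes>\<^sub>M borel)" for M by measurable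
    have [measurable]: "(\<lambda>w. np p (\<lambda>x. h w x - a M w x)) \<in> borel_measurable N" for M
      unfolding np_def by measurable
    have ib: "integrable N (\<lambda>w. \<bar>kk w\<bar> * (\<delta> + np p g * (if I w < M then 0 else 1)))" for M
    proof (rule Bochner_Integration.integrable_bound)
      show "integrable N (\<lambda>w. \<bar>kk w\<bar> * (\<delta> + np p g))" using ikk by simp
      show "AE w in N. norm (\<bar>kk w\<bar> * (\<delta> + np p g * (if I w < M then 0 else 1))) \<le> norm (\<bar>kk w\<bar> * (\<delta> + np p g))"
        using \<delta> by (auto simp: abs_mult intro!: mult_left_mono)
    qed measurable
    have ia: "integrable N (\<lambda>w. \<bar>kk w\<bar> * np p (\<lambda>x. h w x - a M w x))" for M
      by (rule Bochner_Integration.integrable_bound[OF ib[of M]])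
         (use nle[of _ M] \<delta> in \<open>auto simp: abs_mult intro!: mult_left_mono order.trans[OF nle]\<close>)
    have "(\<lambda>M. \<integral>w. \<bar>kk w\<bar> * (\<delta> + np p g * (if I w < M then 0 else 1)) \<partial>N) \<longlonglongrightarrow> (\<integral>w. \<bar>kk w\<bar> * \<delta> \<partial>N)"
    proof (rule integral_dominated_convergence[where w="\<lambda>w. \<bar>kk w\<bar> * (\<delta> + np p g)"])
      show "AE w in N. (\<lambda>M. \<bar>kk w\<bar> * (\<delta> + np p g * (if I w < M then 0 else 1))) \<longlonglongrightarrow> \<bar>kk w\<bar> * \<delta>"
      proof (rule AE_I2)
        fix w
        have "\<forall>\<^sub>F M in sequentially. \<bar>kk w\<bar> * (\<delta> + np p g * (if I w < M then 0 else 1)) = \<bar>kk w\<bar> * \<delta>"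
          by (intro eventually_sequentiallyI[of "Suc (I w)"]) auto
        then show "(\<lambda>M. \<bar>kk w\<bar> * (\<delta> + np p g * (if I w < M then 0 else 1))) \<longlonglongrightarrow> \<bar>kk w\<bar> * \<delta>"
          by (rule tendsto_eventually)
      qed
      show "AE w in N. norm (\<bar>kk w\<bar> * (\<delta> + np p g * (if I w < M then 0 else 1))) \<le> \<bar>kk w\<bar> * (\<delta> + np p g)" for M
        using \<delta> by (auto simp: abs_mult intro!: mult_left_mono)
    qed (use ikk in auto)
    moreover have "(\<integral>w. \<bar>kk w\<bar> * \<delta> \<partial>N) < (K + 1) * \<delta>" using \<delta> by (simp add: K_def)
    ultimately obtain M where M: "(\<integral>w. \<bar>kk w\<bar> * (\<delta> + np p g * (if I w < M then 0 else 1)) \<partial>N) < (K + 1) * \<delta>"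
      using order_tendstoD(2) by (fastforce simp: eventually_sequentially)
    define cc where "cc = (\<lambda>n. \<integral>w. kk w * (if I w = n then 1 else 0) \<partial>N)"
    have ikn: "integrable N (\<lambda>w. kk w * (if I w = n then 1 else 0))" for n
      by (rule Bochner_Integration.integrable_bound[OF ikk]) (auto simp: abs_mult)
    have aeq: "kk w * a M w x = (\<Sum>n<M. kk w * (if I w = n then 1 else 0) * H n x)" for w x
      by (auto simp: a_def if_distrib[of "\<lambda>c. c * _"] if_distrib[of "\<lambda>c. _ * c"] cong: if_cong)
    have iaM: "integrable N (\<lambda>w. kk w * a M w x)" for x
      unfolding aeq using ikn by (intro Bochner_Integration.integrable_sum integrable_mult_left) auto
    have inta: "(\<integral>w. kk w * a M w x \<partial>N) = (\<Sum>n<M. cc n * H n x)" for x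
      unfolding aeq cc_def using ikn by (subst Bochner_Integration.integral_sum) (auto intro!: integrable_mult_left)
    show "\<exists>h\<in>Lp_cl p X. np p (\<lambda>x. f x - h x) < e"
    proof (rule bexI)
      show "(\<lambda>x. \<Sum>n<M. cc n * H n x) \<in> Lp_cl p X"
        by (rule Lp_lin_sum[OF lcl]) (auto simp: HX)
      have fm: "f \<in> borel_measurable borel" using mixh(1) by (simp add: Lp_fun_def)
      have "np p (\<lambda>x. f x - (\<Sum>n<M. cc n * H n x)) = np p (\<lambda>x. \<integral>w. kk w * (h w x - a M w x) \<partial>N)"
      proof (rule np_cong_AE)
        show "AE x in lborel. f x - (\<Sum>n<M. cc n * H n x) = (\<integral>w. kk w * (h w x - a M w x) \<partial>N)"
          using mixh(2)
        proof eventually_elim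
          case (elim x)
          then show ?case using iaM[of x] by (simp add: f inta[symmetric] right_diff_distrib)
        qed
      qed (use fm in \<open>measurable\<close>)
      also have "\<dots> \<le> K powr (p - 1) * (\<integral>w. \<bar>kk w\<bar> * np p (\<lambda>x. h w x - a M w x) \<partial>N)"
        unfolding K_def by (rule np_mixture_le[OF p N ham ikk hae ia])
      also have "\<dots> \<le> K powr (p - 1) * ((K + 1) * \<delta>)"
      proof (intro mult_left_mono)
        have "(\<integral>w. \<bar>kk w\<bar> * np p (\<lambda>x. h w x - a M w x) \<partial>N) \<le> (\<integral>w. \<bar>kk w\<bar> * (\<delta> + np p g * (if I w < M then 0 else 1)) \<partial>N)"
          by (intro integral_mono ia ib mult_left_mono nle) auto
        also note M
        finally show "(\<integral>w. \<bar>kk w\<bar> * np p (\<lambda>x. h w x - a M w x) \<partial>N) \<le> (K + 1) * \<delta>" by simp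
      qed simp
      also have "\<dots> \<le> c * \<delta>" using \<delta> by (simp add: c_def algebra_simps)
      also have "\<dots> < e" using c e by (simp add: \<delta>_def)
      finally show "np p (\<lambda>x. f x - (\<Sum>n<M. cc n * H n x)) < e" .
    qed
  qed
  then show ?thesis by (simp add: f_def)
qed

section \<open>Gaussians, Schwartz functions and Fourier inversion\<close>

lemma
  fixes f :: "'a::euclidean_space \<Rightarrow> real \<Rightarrow> 'b::{real_normed_field,banach,second_countable_topology}"
  assumes f: "\<And>b. b \<in> Basis \<Longrightarrow> integrable lborel (f b)"
  shows integrable_prod_Basis: "integrable lborel (\<lambda>x::'a. \<Prod>b\<in>Basis. f b (x \<bullet> b))"
    and integral_prod_Basis: "(LINT x|lborel. (\<Prod>b\<in>Basis. f b (x \<bullet> b))) = (\<Prod>b\<in>(Basis :: 'a set). (LINT t|lborel. f b t))"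
proof -
  interpret product_sigma_finite "\<lambda>_::'a. lborel :: real measure" by standard
  have [measurable]: "f b \<in> borel_measurable borel" if "b \<in> Basis" for b using f[OF that] by auto
  have [measurable]: "(\<lambda>x::'a. \<Prod>b\<in>Basis. f b (x \<bullet> b)) \<in> borel_measurable borel"
    by (intro borel_measurable_prod) measurable
  have T[measurable]: "(\<lambda>x. \<Sum>b\<in>Basis. x b *\<^sub>R b) \<in> (\<Pi>\<^sub>M b\<in>(Basis::'a set). lborel) \<rightarrow>\<^sub>M borel"
    by measurable
  have eq: "(\<Prod>b\<in>Basis. f b ((\<Sum>c\<in>Basis. x c *\<^sub>R c) \<bullet> b)) = (\<Prod>b\<in>Basis. f b (x b))" for x
    by (intro prod.cong) auto
  show "integrable lborel (\<lambda>x::'a. \<Prod>b\<in>Basis. f b (x \<bullet> b))"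
    by (subst lborel_eq, subst integrable_distr_eq) (auto simp: eq intro!: product_integrable_prod f)
  show "(LINT x|lborel. (\<Prod>b\<in>Basis. f b (x \<bullet> b))) = (\<Prod>b\<in>(Basis :: 'a set). (LINT t|lborel. f b t))"
    by (subst lborel_eq, subst integral_distr) (auto simp: eq intro!: product_integral_prod f)
qed

definition gauss :: "'a::euclidean_space \<Rightarrow> real" where
  "gauss x = exp (- pi * (norm x)\<^sup>2)"

lemma gauss_measurable [measurable]: "gauss \<in> borel_measurable borel"
  unfolding gauss_def by measurable

lemma gauss_pos: "gauss x > 0" and gauss_le_1: "gauss x \<le> 1"
  by (auto simp: gauss_def)

lemma gauss_minus [simp]: "gauss (- x) = gauss x"
  by (simp add: gauss_def)

lemma gauss_0 [simp]: "gauss 0 = 1"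
  by (simp add: gauss_def)

lemma gauss_prod: "gauss x = (\<Prod>b\<in>Basis. gauss (x \<bullet> b))"
proof -
  have "(norm x)\<^sup>2 = (\<Sum>b\<in>Basis. (x \<bullet> b)\<^sup>2)"
    by (simp add: norm_eq_sqrt_inner euclidean_inner[of x x] power2_eq_square sum_nonneg)
  then show ?thesis
    by (simp add: gauss_def exp_sum[symmetric] sum_distrib_left)
qed

lemma
  fixes \<xi> :: real
  shows integrable_gauss_real: "integrable lborel (gauss :: real \<Rightarrow> real)"
    and fourier_gauss_real: "(LINT x|lborel. complex_of_real (gauss x) * cis (- (2 * pi * (x * \<xi>)))) = of_real (gauss \<xi>)"
proof -
  \<comment> \<open>Up to the dilation by sqrt (2 pi), \<open>gauss\<close> is the standard normal
    density, so its transform is read off the known characteristic function.\<close>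
  define c where "c = sqrt (2 * pi)"
  have c: "c > 0" "c \<noteq> 0" "c * c = 2 * pi" by (auto simp: c_def)
  have g: "std_normal_density (c * x) = gauss x / c" for x
  proof -
    have "(c * x)\<^sup>2 = 2 * pi * x\<^sup>2" using c by (simp add: power2_eq_square algebra_simps)
    then show ?thesis by (simp add: std_normal_density_def gauss_def c_def)
  qed
  have "integrable lborel (\<lambda>x. std_normal_density (c *\<^sub>R x + 0))"
    using c by (subst integrable_affine_iff) auto
  then have "integrable lborel (\<lambda>x::real. c * (gauss x / c))"
    by (intro integrable_mult_right) (simp add: g)
  then show "integrable lborel (gauss :: real \<Rightarrow> real)" using c by simp
  define t where "t = - c * \<xi>"
  have "of_real (exp (- t\<^sup>2 / 2)) = char std_normal_distribution t"
    by (simp add: char_std_normal_distribution)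
  also have "\<dots> = (CLINT x|lborel. std_normal_density x *\<^sub>R iexp (t * x))"
    unfolding char_def by (subst integral_density) auto
  also have "\<dots> = c *\<^sub>R (CLINT x|lborel. std_normal_density (c *\<^sub>R x + 0) *\<^sub>R iexp (t * (c *\<^sub>R x + 0)))"
    using c by (subst integral_affine[of c "\<lambda>x. std_normal_density x *\<^sub>R iexp (t * x)" 0]) auto
  also have "\<dots> = (CLINT x|lborel. of_real (gauss x) * cis (- (2 * pi * (x * \<xi>))))"
  proof -
    have "t * (c * x) = - (2 * pi * (x * \<xi>))" for x
      using c(3) by (simp add: t_def algebra_simps)
    then have "std_normal_density (c *\<^sub>R x + 0) *\<^sub>R iexp (t * (c *\<^sub>R x + 0)) = (1 / c) *\<^sub>R (of_real (gauss x) * cis (- (2 * pi * (x * \<xi>))))" for x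
      by (simp add: g cis_conv_exp scaleR_conv_of_real)
    then show ?thesis using c by simp
  qed
  finally have "(LINT x|lborel. complex_of_real (gauss x) * cis (- (2 * pi * (x * \<xi>)))) = of_real (exp (- t\<^sup>2 / 2))" ..
  moreover have "t\<^sup>2 = c * c * \<xi>\<^sup>2" by (simp add: t_def power2_eq_square)
  ultimately show "(LINT x|lborel. complex_of_real (gauss x) * cis (- (2 * pi * (x * \<xi>)))) = of_real (gauss \<xi>)"
    by (simp add: gauss_def c(3))
qed

lemma cis_inner: "cis (a * (x \<bullet> \<xi>)) = (\<Prod>b\<in>Basis. cis (a * ((x \<bullet> b) * (\<xi> \<bullet> b))))"
  by (simp add: cis_conv_exp exp_sum[symmetric] euclidean_inner[of x \<xi>] sum_distrib_left)

lemma
  shows integrable_gauss: "integrable lborel (gauss :: 'a::euclidean_space \<Rightarrow> real)"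
    and fourier_gauss: "(LINT x|lborel. complex_of_real (gauss x) * cis (- (2 * pi * (x \<bullet> \<xi>)))) = of_real (gauss (\<xi>::'a))"
    and integral_gauss: "(LINT x|lborel. gauss (x::'a)) = 1"
proof -
  have "integrable lborel (\<lambda>x::'a. \<Prod>b\<in>Basis. gauss (x \<bullet> b))"
    by (intro integrable_prod_Basis integrable_gauss_real)
  then show I: "integrable lborel (gauss :: 'a \<Rightarrow> real)" by (simp add: gauss_prod[symmetric])
  have *: "complex_of_real (gauss x) * cis (- (2 * pi * (x \<bullet> \<xi>)))
      = (\<Prod>b\<in>Basis. complex_of_real (gauss (x \<bullet> b)) * cis (- (2 * pi * ((x \<bullet> b) * (\<xi> \<bullet> b)))))" for x \<xi> :: 'a
    using cis_inner[of "- (2 * pi)" x \<xi>] by (subst gauss_prod) (simp add: prod.distrib)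
  have F: "(LINT x|lborel. complex_of_real (gauss x) * cis (- (2 * pi * (x \<bullet> \<xi>)))) = of_real (gauss \<xi>)" for \<xi> :: 'a
    unfolding *
  proof (subst integral_prod_Basis)
    show "integrable lborel (\<lambda>t. complex_of_real (gauss t) * cis (- (2 * pi * (t * (\<xi> \<bullet> b)))))" for b :: 'a
      by (rule Bochner_Integration.integrable_bound[OF integrable_gauss_real])
         (auto simp: norm_mult cis_conv_exp)
    show "(\<Prod>b\<in>Basis. (LINT t|lborel. complex_of_real (gauss t) * cis (- (2 * pi * (t * (\<xi> \<bullet> b)))))) = complex_of_real (gauss \<xi>)"
      by (simp add: fourier_gauss_real gauss_prod[of \<xi>])
  qed
  show "(LINT x|lborel. complex_of_real (gauss x) * cis (- (2 * pi * (x \<bullet> \<xi>)))) = of_real (gauss \<xi>)" by (rule F)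
  have "complex_of_real (LINT x|lborel. gauss (x::'a)) = 1"
    using F[of 0] by (simp add: I)
  then show "(LINT x|lborel. gauss (x::'a)) = 1" using of_real_eq_1_iff by blast
qed

text \<open>Polynomials times one fixed Gaussian. The class is closed under directional derivatives
  and each member decays rapidly, so rule induction yields the Schwartz bounds of all orders at
  once; later it also supplies bounds for the derivatives of the heat kernel.\<close>

inductive poly_gauss :: "real \<Rightarrow> 'a::euclidean_space \<Rightarrow> ('a \<Rightarrow> real) \<Rightarrow> bool" for \<kappa> a where
  base: "poly_gauss \<kappa> a (\<lambda>x. exp (- \<kappa> * (norm (x - a))\<^sup>2))"
| mult: "poly_gauss \<kappa> a f \<Longrightarrow> poly_gauss \<kappa> a (\<lambda>x. (x \<bullet> b) * f x)"
| scale: "poly_gauss \<kappa> a f \<Longrightarrow> poly_gauss \<kappa> a (\<lambda>x. c * f x)"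
| add: "poly_gauss \<kappa> a f \<Longrightarrow> poly_gauss \<kappa> a g \<Longrightarrow> poly_gauss \<kappa> a (\<lambda>x. f x + g x)"

lemma poly_gauss_derivative:
  assumes "poly_gauss \<kappa> a f"
  shows "\<exists>D. (\<forall>x. (f has_derivative (\<lambda>h. D h x)) (at x)) \<and> (\<forall>h. poly_gauss \<kappa> a (D h))"
  using assms
proof induction
  case base
  let ?e = "\<lambda>x. exp (- \<kappa> * (norm (x - a))\<^sup>2)"
  let ?D = "\<lambda>h x. (- 2 * \<kappa>) * ((x \<bullet> h) * ?e x) + (2 * \<kappa> * (a \<bullet> h)) * ?e x"
  have eq: "?e = (\<lambda>x. exp (- \<kappa> * ((x - a) \<bullet> (x - a))))" by (simp add: power2_norm_eq_inner)
  have "(?e has_derivative (\<lambda>h. ?D h x)) (at x)" for x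
    unfolding eq by (auto intro!: derivative_eq_intros simp: power2_norm_eq_inner inner_diff_left inner_diff_right inner_commute algebra_simps)
  moreover have "poly_gauss \<kappa> a (?D h)" for h
    by (intro poly_gauss.add poly_gauss.scale poly_gauss.mult poly_gauss.base)
  ultimately show ?case by (intro exI[of _ ?D]) blast
next
  case (mult f b)
  then obtain D where D: "\<And>x. (f has_derivative (\<lambda>h. D h x)) (at x)" "\<And>h. poly_gauss \<kappa> a (D h)" by blast
  let ?D = "\<lambda>h x. (h \<bullet> b) * f x + (x \<bullet> b) * D h x"
  have "((\<lambda>x. (x \<bullet> b) * f x) has_derivative (\<lambda>h. ?D h x)) (at x)" for x
    by (auto intro!: derivative_eq_intros D(1) simp: algebra_simps)
  moreover have "poly_gauss \<kappa> a (?D h)" for h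
    by (intro poly_gauss.add poly_gauss.scale poly_gauss.mult D mult)
  ultimately show ?case by (intro exI[of _ ?D]) blast
next
  case (scale f c)
  then obtain D where D: "\<And>x. (f has_derivative (\<lambda>h. D h x)) (at x)" "\<And>h. poly_gauss \<kappa> a (D h)" by blast
  have "((\<lambda>x. c * f x) has_derivative (\<lambda>h. c * D h x)) (at x)" for x
    by (auto intro!: derivative_eq_intros D(1))
  moreover have "poly_gauss \<kappa> a (\<lambda>x. c * D h x)" for h by (intro poly_gauss.scale D)
  ultimately show ?case by (intro exI[of _ "\<lambda>h x. c * D h x"]) blast
next
  case (add f g)
  then obtain D E where D: "\<And>x. (f has_derivative (\<lambda>h. D h x)) (at x)" "\<And>h. poly_gauss \<kappa> a (D h)"
    and E: "\<And>x. (g has_derivative (\<lambda>h. E h x)) (at x)" "\<And>h. poly_gauss \<kappa> a (E h)" by blast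
  have "((\<lambda>x. f x + g x) has_derivative (\<lambda>h. D h x + E h x)) (at x)" for x
    by (auto intro!: derivative_eq_intros D(1) E(1))
  moreover have "poly_gauss \<kappa> a (\<lambda>x. D h x + E h x)" for h by (intro poly_gauss.add D E)
  ultimately show ?case by (intro exI[of _ "\<lambda>h x. D h x + E h x"]) blast
qed

lemma
  assumes "poly_gauss \<kappa> a f"
  shows poly_gauss_differentiable: "f differentiable (at x)"
    and poly_gauss_pdiff: "poly_gauss \<kappa> a (pdiff v f)"
    and poly_gauss_has_derivative: "(f has_derivative (\<lambda>h. pdiff h f x)) (at x)"
proof -
  obtain D where D: "\<And>x. (f has_derivative (\<lambda>h. D h x)) (at x)" "\<And>h. poly_gauss \<kappa> a (D h)"
    using poly_gauss_derivative[OF assms] by blast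
  show "f differentiable (at x)" using D(1) by (auto simp: differentiable_def)
  have eq: "pdiff v f = D v" for v
    using frechet_derivative_at[OF D(1)] by (auto simp: pdiff_def fun_eq_iff)
  show "poly_gauss \<kappa> a (pdiff v f)" by (simp add: eq D)
  show "(f has_derivative (\<lambda>h. pdiff h f x)) (at x)" using D(1) by (simp add: eq)
qed

lemma poly_gauss_iter_pdiff: "poly_gauss \<kappa> a f \<Longrightarrow> poly_gauss \<kappa> a (iter_pdiff bs f)"
  by (induction bs) (auto intro: poly_gauss_pdiff)

lemma power_le_fact_exp: fixes y :: real assumes "y \<ge> 0" shows "y ^ n \<le> fact n * exp y"
proof -
  have "(\<Sum>i\<in>{n}. inverse (fact i) * y ^ i) \<le> (\<Sum>i. inverse (fact i) * y ^ i)"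
    using summable_exp[of y] assms by (intro sum_le_suminf) auto
  also have "\<dots> = exp y" by (simp add: exp_def scaleR_conv_of_real)
  finally show ?thesis by (simp add: field_simps)
qed

lemma poly_gauss_decay:
  assumes "poly_gauss \<kappa> a f" and \<kappa>: "\<kappa> > 0"
  shows "\<exists>C. \<forall>x. (1 + norm x) ^ N * \<bar>f x\<bar> \<le> C"
  using assms(1)
proof (induction arbitrary: N)
  case base
  show ?case
  proof (intro exI allI)
    fix x
    define r where "r = norm (x - a)"
    have "norm x \<le> r + norm a" unfolding r_def using norm_triangle_ineq[of "x - a" a] by simp
    then have "1 + norm x \<le> (1 + norm a) * (1 + r)"
      using mult_nonneg_nonneg[OF norm_ge_zero[of a] norm_ge_zero[of "x - a", folded r_def]]
      unfolding distrib_left distrib_right by simp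
    then have "(1 + norm x) ^ N \<le> ((1 + norm a) * (1 + r)) ^ N" by (intro power_mono) auto
    also have "\<dots> = (1 + norm a) ^ N * (1 + r) ^ N" by (simp add: power_mult_distrib)
    also have "\<dots> \<le> (1 + norm a) ^ N * (fact N * exp (1 + r))"
      by (intro mult_left_mono power_le_fact_exp) (auto simp: r_def)
    finally have 1: "(1 + norm x) ^ N * exp (- \<kappa> * r\<^sup>2) \<le> (1 + norm a) ^ N * (fact N * exp (1 + r)) * exp (- \<kappa> * r\<^sup>2)"
      by (intro mult_right_mono) auto
    \<comment> \<open>Completing the square: r - \<kappa> r^2 is at most 1 / (4 \<kappa>), so the
      Gaussian absorbs the exponential that dominates the polynomial weight.\<close>
    have "0 \<le> (2 * \<kappa> * r - 1)\<^sup>2" by simp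
    then have "r - \<kappa> * r\<^sup>2 \<le> 1 / (4 * \<kappa>)"
      using \<kappa> by (simp add: field_simps power2_eq_square)
    then have "exp (1 + r) * exp (- \<kappa> * r\<^sup>2) \<le> exp (1 + 1 / (4 * \<kappa>))"
      by (simp add: exp_add[symmetric])
    then have "(1 + norm a) ^ N * fact N * (exp (1 + r) * exp (- \<kappa> * r\<^sup>2)) \<le> (1 + norm a) ^ N * fact N * exp (1 + 1 / (4 * \<kappa>))"
      by (intro mult_left_mono) auto
    moreover have "(1 + norm a) ^ N * (fact N * exp (1 + r)) * exp (- \<kappa> * r\<^sup>2) = (1 + norm a) ^ N * fact N * (exp (1 + r) * exp (- \<kappa> * r\<^sup>2))"
      by (simp only: mult.assoc)
    ultimately show "(1 + norm x) ^ N * \<bar>exp (- \<kappa> * (norm (x - a))\<^sup>2)\<bar> \<le> (1 + norm a) ^ N * fact N * exp (1 + 1 / (4 * \<kappa>))"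
      using 1 unfolding r_def[symmetric] abs_exp_cancel by linarith
  qed
next
  case (mult f b)
  obtain C where C: "\<And>x. (1 + norm x) ^ Suc N * \<bar>f x\<bar> \<le> C" using mult.IH[of "Suc N"] by blast
  show ?case
  proof (intro exI allI)
    fix x
    have "\<bar>x \<bullet> b\<bar> \<le> norm x * norm b" by (rule Cauchy_Schwarz_ineq2)
    also have "\<dots> \<le> (1 + norm x) * norm b" by (intro mult_right_mono) auto
    finally have "(1 + norm x) ^ N * (\<bar>x \<bullet> b\<bar> * \<bar>f x\<bar>) \<le> (1 + norm x) ^ N * (((1 + norm x) * norm b) * \<bar>f x\<bar>)"
      by (intro mult_left_mono mult_right_mono) auto
    also have "\<dots> = norm b * ((1 + norm x) ^ Suc N * \<bar>f x\<bar>)" by simp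
    also have "\<dots> \<le> norm b * C" using C by (intro mult_left_mono) auto
    finally show "(1 + norm x) ^ N * \<bar>(x \<bullet> b) * f x\<bar> \<le> norm b * C" by (simp add: abs_mult)
  qed
next
  case (scale f c)
  obtain C where C: "\<And>x. (1 + norm x) ^ N * \<bar>f x\<bar> \<le> C" using scale.IH[of N] by blast
  have "(1 + norm x) ^ N * \<bar>c * f x\<bar> \<le> \<bar>c\<bar> * C" for x
    using mult_left_mono[OF C[of x], of "\<bar>c\<bar>"] by (simp add: abs_mult algebra_simps)
  then show ?case by blast
next
  case (add f g)
  obtain C D where C: "\<And>x. (1 + norm x) ^ N * \<bar>f x\<bar> \<le> C" and D: "\<And>x. (1 + norm x) ^ N * \<bar>g x\<bar> \<le> D"
    using add.IH[of N] by blast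
  have "(1 + norm x) ^ N * \<bar>f x + g x\<bar> \<le> C + D" for x
  proof -
    have "(1 + norm x) ^ N * \<bar>f x + g x\<bar> \<le> (1 + norm x) ^ N * (\<bar>f x\<bar> + \<bar>g x\<bar>)" by (intro mult_left_mono) auto
    then show ?thesis using C[of x] D[of x] by (simp add: algebra_simps)
  qed
  then show ?case by blast
qed

lemma iter_pdiff_of_real:
  assumes "poly_gauss \<kappa> a f"
  shows "iter_pdiff bs (\<lambda>x. complex_of_real (f x)) = (\<lambda>x. complex_of_real (iter_pdiff bs f x))"
proof (induction bs)
  case (Cons v bs)
  have "((\<lambda>x. complex_of_real (iter_pdiff bs f x)) has_derivative (\<lambda>h. complex_of_real (pdiff h (iter_pdiff bs f) x))) (at x)" for x
    by (intro has_derivative_of_real poly_gauss_has_derivative[OF poly_gauss_iter_pdiff[OF assms]])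
  from frechet_derivative_at[OF this] show ?case
    unfolding iter_pdiff.simps Cons by (auto simp: pdiff_def fun_eq_iff)
qed simp

lemma schwartz_poly_gauss:
  assumes "poly_gauss \<kappa> a f" "\<kappa> > 0"
  shows "schwartz (\<lambda>x. complex_of_real (f x))"
  unfolding schwartz_def iter_pdiff_of_real[OF assms(1)]
proof (intro conjI allI impI)
  fix bs x
  show "(\<lambda>x. complex_of_real (iter_pdiff bs f x)) differentiable at x"
    using has_derivative_of_real[OF poly_gauss_has_derivative[OF poly_gauss_iter_pdiff[OF assms(1)]]]
    by (auto simp: differentiable_def)
next
  fix bs and N :: nat
  obtain C where "\<And>x. (1 + norm x) ^ N * \<bar>iter_pdiff bs f x\<bar> \<le> C"
    using poly_gauss_decay[OF poly_gauss_iter_pdiff[OF assms(1)] assms(2)] by blast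
  then show "bounded (range (\<lambda>x. (1 + norm x) ^ N * norm (complex_of_real (iter_pdiff bs f x))))"
    by (auto simp: bounded_iff abs_mult intro!: exI[of _ C])
qed

lemma poly_gauss_gauss: "poly_gauss pi 0 gauss"
  using poly_gauss.base[of pi 0] by (simp add: gauss_def[abs_def])

lemma schwartz_gauss_shift:
  assumes "c > 0"
  shows "schwartz (\<lambda>x. complex_of_real (gauss ((x - a) /\<^sub>R c)))"
proof -
  have "(\<lambda>x. gauss ((x - a) /\<^sub>R c)) = (\<lambda>x. exp (- (pi / c\<^sup>2) * (norm (x - a))\<^sup>2))"
    using assms by (auto simp: gauss_def fun_eq_iff power_mult_distrib divide_simps)
  moreover have "poly_gauss (pi / c\<^sup>2) a (\<lambda>x. exp (- (pi / c\<^sup>2) * (norm (x - a))\<^sup>2))" by (rule poly_gauss.base)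
  ultimately show ?thesis using assms by (intro schwartz_poly_gauss[of "pi / c\<^sup>2" a]) auto
qed

section \<open>Schwartz functions: closure properties and integrability\<close>

lemma iter_pdiff_snoc: "iter_pdiff (bs @ [b]) \<phi> = iter_pdiff bs (pdiff b \<phi>)"
  by (induction bs) auto

text \<open>\<open>iter_pdiff\<close> applies the last element of the list first, so appending b at
  the end reduces the claim to the bounds for the longer lists.\<close>

lemma schwartz_pdiff: assumes "schwartz \<phi>" "b \<in> Basis" shows "schwartz (pdiff b \<phi>)"
  unfolding schwartz_def iter_pdiff_snoc[symmetric] using assms by (auto simp: schwartz_def)

lemma schwartz_differentiable: "schwartz \<phi> \<Longrightarrow> \<phi> differentiable (at x)"
  unfolding schwartz_def by (metis iter_pdiff.simps(1) empty_subsetI list.set(1))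

lemma schwartz_decay: assumes "schwartz \<phi>" obtains C where "C > 0" "\<And>x. (1 + norm x) ^ N * norm (\<phi> x) \<le> C"
proof -
  have "bounded (range (\<lambda>x. (1 + norm x) ^ N * norm (\<phi> x)))"
    using assms unfolding schwartz_def by (metis iter_pdiff.simps(1) empty_subsetI list.set(1))
  then obtain C where "C > 0" "\<And>x. norm ((1 + norm x) ^ N * norm (\<phi> x)) \<le> C" by (auto simp: bounded_pos)
  then show thesis by (intro that[of C]) auto
qed

lemma iter_pdiff_add:
  assumes "schwartz \<phi>" "schwartz \<psi>" "set bs \<subseteq> Basis"
  shows "iter_pdiff bs (\<lambda>x. \<phi> x + \<psi> x) = (\<lambda>x. iter_pdiff bs \<phi> x + iter_pdiff bs \<psi> x)"
  using assms(3)
proof (induction bs)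
  case (Cons v bs)
  have d: "(iter_pdiff bs \<phi>) differentiable (at x)" "(iter_pdiff bs \<psi>) differentiable (at x)" for x
    using assms Cons.prems by (auto simp: schwartz_def)
  have "((\<lambda>x. iter_pdiff bs \<phi> x + iter_pdiff bs \<psi> x) has_derivative
     (\<lambda>h. frechet_derivative (iter_pdiff bs \<phi>) (at x) h + frechet_derivative (iter_pdiff bs \<psi>) (at x) h)) (at x)" for x
    using d[of x] by (intro has_derivative_add) (simp_all add: frechet_derivative_works)
  from frechet_derivative_at[OF this]
  have *: "frechet_derivative (\<lambda>x. iter_pdiff bs \<phi> x + iter_pdiff bs \<psi> x) (at x) v
     = frechet_derivative (iter_pdiff bs \<phi>) (at x) v + frechet_derivative (iter_pdiff bs \<psi>) (at x) v" for x
    by metis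
  have "iter_pdiff bs (\<lambda>x. \<phi> x + \<psi> x) = (\<lambda>x. iter_pdiff bs \<phi> x + iter_pdiff bs \<psi> x)"
    using Cons by simp
  then show ?case by (simp add: pdiff_def[abs_def] *)
qed simp

lemma iter_pdiff_cmult:
  assumes "schwartz \<phi>" "set bs \<subseteq> Basis"
  shows "iter_pdiff bs (\<lambda>x. c * \<phi> x) = (\<lambda>x. c * iter_pdiff bs \<phi> x)"
  using assms(2)
proof (induction bs)
  case (Cons v bs)
  have d: "(iter_pdiff bs \<phi>) differentiable (at x)" for x
    using assms Cons.prems by (auto simp: schwartz_def)
  have "((\<lambda>x. c * iter_pdiff bs \<phi> x) has_derivative (\<lambda>h. c * frechet_derivative (iter_pdiff bs \<phi>) (at x) h)) (at x)" for x
    using d[of x] by (intro has_derivative_mult_right) (simp add: frechet_derivative_works)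
  from frechet_derivative_at[OF this]
  have *: "frechet_derivative (\<lambda>x. c * iter_pdiff bs \<phi> x) (at x) v = c * frechet_derivative (iter_pdiff bs \<phi>) (at x) v" for x
    by metis
  have "iter_pdiff bs (\<lambda>x. c * \<phi> x) = (\<lambda>x. c * iter_pdiff bs \<phi> x)" using Cons by simp
  then show ?case by (simp add: pdiff_def[abs_def] *)
qed simp

lemma schwartz_add: assumes "schwartz \<phi>" "schwartz \<psi>" shows "schwartz (\<lambda>x. \<phi> x + \<psi> x)"
  unfolding schwartz_def
proof (intro conjI allI impI)
  fix bs x assume bs: "set bs \<subseteq> (Basis :: 'a set)"
  show "iter_pdiff bs (\<lambda>x. \<phi> x + \<psi> x) differentiable at x"
    using assms bs by (simp add: iter_pdiff_add schwartz_def)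
next
  fix bs and N :: nat assume bs: "set bs \<subseteq> (Basis :: 'a set)"
  obtain C D where C: "\<And>x. norm ((1 + norm x) ^ N * norm (iter_pdiff bs \<phi> x)) \<le> C"
     and D: "\<And>x. norm ((1 + norm x) ^ N * norm (iter_pdiff bs \<psi> x)) \<le> D"
    using assms bs unfolding schwartz_def bounded_iff by (metis (no_types, lifting) rangeI)
  have "norm ((1 + norm x) ^ N * norm (iter_pdiff bs \<phi> x + iter_pdiff bs \<psi> x)) \<le> C + D" for x
  proof -
    have "(1 + norm x) ^ N * norm (iter_pdiff bs \<phi> x + iter_pdiff bs \<psi> x) \<le> (1 + norm x) ^ N * (norm (iter_pdiff bs \<phi> x) + norm (iter_pdiff bs \<psi> x))"
      by (intro mult_left_mono norm_triangle_ineq) auto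
    then show ?thesis using C[of x] D[of x] by (simp add: algebra_simps)
  qed
  then show "bounded (range (\<lambda>x. (1 + norm x) ^ N * norm (iter_pdiff bs (\<lambda>x. \<phi> x + \<psi> x) x)))"
    using assms bs by (auto simp: iter_pdiff_add bounded_iff)
qed

lemma schwartz_cmult: assumes "schwartz \<phi>" shows "schwartz (\<lambda>x. c * \<phi> x)"
  unfolding schwartz_def
proof (intro conjI allI impI)
  fix bs x assume bs: "set bs \<subseteq> (Basis :: 'a set)"
  show "iter_pdiff bs (\<lambda>x. c * \<phi> x) differentiable at x"
    using assms bs by (auto simp: iter_pdiff_cmult schwartz_def intro!: differentiable_mult)
next
  fix bs and N :: nat assume bs: "set bs \<subseteq> (Basis :: 'a set)"
  obtain C where C: "\<And>x. norm ((1 + norm x) ^ N * norm (iter_pdiff bs \<phi> x)) \<le> C"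
    using assms bs unfolding schwartz_def bounded_iff by (metis (no_types, lifting) rangeI)
  have "norm ((1 + norm x) ^ N * norm (c * iter_pdiff bs \<phi> x)) \<le> norm c * C" for x
    using mult_left_mono[OF C[of x], of "norm c"] by (simp add: norm_mult algebra_simps)
  then show "bounded (range (\<lambda>x. (1 + norm x) ^ N * norm (iter_pdiff bs (\<lambda>x. c * \<phi> x) x)))"
    using assms bs by (auto simp: iter_pdiff_cmult bounded_iff)
qed

lemma schwartz_zero: "schwartz (\<lambda>_. 0)"
  using schwartz_cmult[OF schwartz_poly_gauss[OF poly_gauss_gauss pi_gt_zero], of 0] by simp

lemma schwartz_sum: "finite I \<Longrightarrow> (\<And>i. i \<in> I \<Longrightarrow> schwartz (\<phi> i)) \<Longrightarrow> schwartz (\<lambda>x. \<Sum>i\<in>I. \<phi> i x)"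
  by (induction rule: finite_induct) (auto intro: schwartz_zero schwartz_add)

lemma schwartz_continuous: "schwartz \<phi> \<Longrightarrow> continuous_on UNIV \<phi>"
  using differentiable_imp_continuous_within[OF schwartz_differentiable]
  by (auto simp: continuous_on_eq_continuous_at)

lemma schwartz_measurable: "schwartz \<phi> \<Longrightarrow> \<phi> \<in> borel_measurable borel"
  by (intro borel_measurable_continuous_onI schwartz_continuous)

lemma integrable_inverse_1_plus_square_real: "integrable lborel (\<lambda>t::real. 1 / (1 + t\<^sup>2))"
  using integrable_inverse_1_plus_square by (simp add: set_integrable_def inverse_eq_divide)

text \<open>Each factor 1 + (x . b)^2 is at most 1 + |x|^2, so DIM copies of the radial weight are
  dominated by a product of integrable functions of one variable.\<close>

lemma
  shows integrable_inverse_1_plus_norm2: "integrable lborel (\<lambda>x::'a::euclidean_space. 1 / (1 + (norm x)\<^sup>2) ^ DIM('a))"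
    and integrable_inverse_1_plus_norm: "integrable lborel (\<lambda>x::'a. 1 / (1 + norm x) ^ (2 * DIM('a)))"
proof -
  have P: "integrable lborel (\<lambda>x::'a. \<Prod>b\<in>Basis. 1 / (1 + (x \<bullet> b)\<^sup>2))"
    by (intro integrable_prod_Basis integrable_inverse_1_plus_square_real)
  have pos: "1 + (t::real)\<^sup>2 > 0" for t using zero_le_power2[of t] by linarith
  have le: "1 / (1 + (norm x)\<^sup>2) ^ DIM('a) \<le> (\<Prod>b\<in>Basis. 1 / (1 + (x \<bullet> b)\<^sup>2))" for x :: 'a
  proof -
    have "(\<Prod>b\<in>(Basis::'a set). 1 / (1 + (norm x)\<^sup>2)) \<le> (\<Prod>b\<in>Basis. 1 / (1 + (x \<bullet> b)\<^sup>2))"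
    proof (intro prod_mono conjI divide_left_mono)
      fix b :: 'a assume "b \<in> Basis"
      then have "\<bar>x \<bullet> b\<bar> \<le> norm x" by (rule Basis_le_norm)
      then show "1 + (x \<bullet> b)\<^sup>2 \<le> 1 + (norm x)\<^sup>2" by (simp add: abs_le_square_iff[symmetric])
    qed (use pos in \<open>auto intro!: mult_pos_pos less_imp_le[OF pos]\<close>)
    then show ?thesis by (simp add: power_one_over)
  qed
  show 1: "integrable lborel (\<lambda>x::'a. 1 / (1 + (norm x)\<^sup>2) ^ DIM('a))"
  proof (rule Bochner_Integration.integrable_bound[OF P])
    show "AE x::'a in lborel. norm (1 / (1 + (norm x)\<^sup>2) ^ DIM('a)) \<le> norm (\<Prod>b\<in>Basis. 1 / (1 + (x \<bullet> b)\<^sup>2))"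
    proof (rule AE_I2)
      fix x :: 'a
      have "norm (1 / (1 + (norm x)\<^sup>2) ^ DIM('a)) = 1 / (1 + (norm x)\<^sup>2) ^ DIM('a)" by simp
      also note le[of x]
      also have "(\<Prod>b\<in>Basis. 1 / (1 + (x \<bullet> b)\<^sup>2)) \<le> norm (\<Prod>b\<in>Basis. 1 / (1 + (x \<bullet> b)\<^sup>2))"
        unfolding real_norm_def by (rule abs_ge_self)
      finally show "norm (1 / (1 + (norm x)\<^sup>2) ^ DIM('a)) \<le> norm (\<Prod>b\<in>Basis. 1 / (1 + (x \<bullet> b)\<^sup>2))" .
    qed
  qed measurable
  show "integrable lborel (\<lambda>x::'a. 1 / (1 + norm x) ^ (2 * DIM('a)))"
  proof (rule Bochner_Integration.integrable_bound[OF 1])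
    show "AE x::'a in lborel. norm (1 / (1 + norm x) ^ (2 * DIM('a))) \<le> norm (1 / (1 + (norm x)\<^sup>2) ^ DIM('a))"
    proof (rule AE_I2)
      fix x :: 'a
      have "(1 + (norm x)\<^sup>2) ^ DIM('a) \<le> ((1 + norm x)\<^sup>2) ^ DIM('a)"
        by (intro power_mono) (auto simp: power2_eq_square algebra_simps)
      then show "norm (1 / (1 + norm x) ^ (2 * DIM('a))) \<le> norm (1 / (1 + (norm x)\<^sup>2) ^ DIM('a))"
        by (auto simp: power_mult abs_of_pos pos intro!: divide_left_mono mult_pos_pos zero_less_power add_pos_nonneg)
    qed
  qed measurable
qed

lemma schwartz_integrable: assumes "schwartz \<phi>" shows "integrable lborel \<phi>"
proof -
  obtain C where C: "C > 0" "\<And>x. (1 + norm x) ^ (2 * DIM('a)) * norm (\<phi> x) \<le> C"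
    using schwartz_decay[OF assms] by blast
  have pos: "(1 + norm x) ^ (2 * DIM('a)) > 0" for x :: 'a by (intro zero_less_power) (simp add: add_pos_nonneg)
  show ?thesis
  proof (rule Bochner_Integration.integrable_bound)
    show "integrable lborel (\<lambda>x::'a. C * (1 / (1 + norm x) ^ (2 * DIM('a))))"
      by (intro integrable_mult_right integrable_inverse_1_plus_norm)
    show "AE x in lborel. norm (\<phi> x) \<le> norm (C * (1 / (1 + norm x) ^ (2 * DIM('a))))"
    proof (rule AE_I2)
      fix x :: 'a
      have "norm (\<phi> x) \<le> C / (1 + norm x) ^ (2 * DIM('a))"
        using C(2)[of x] pos[of x] by (simp add: field_simps)
      then show "norm (\<phi> x) \<le> norm (C * (1 / (1 + norm x) ^ (2 * DIM('a))))" using C(1) pos[of x] by simp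
    qed
  qed (use schwartz_measurable[OF assms] in simp)
qed

lemma schwartz_bounded: assumes "schwartz \<phi>" obtains C where "C > 0" "\<And>x. norm (\<phi> x) \<le> C"
  using schwartz_decay[OF assms, of 0] by auto


section \<open>Fourier transforms of derivatives and the Helmholtz operator\<close>

lemma fourier_cis: "fourier \<phi> \<xi> = (LINT x|lborel. \<phi> x * cis (- (2 * pi * (x \<bullet> \<xi>))))"
  by (simp add: fourier_def cis_conv_exp algebra_simps)

lemma inv_fourier_cis: "inv_fourier \<psi> x = (LINT \<xi>|lborel. \<psi> \<xi> * cis (2 * pi * (x \<bullet> \<xi>)))"
  by (simp add: inv_fourier_def cis_conv_exp algebra_simps)

lemma cis_measurable [measurable]: "cis \<in> borel_measurable borel"
  by (intro borel_measurable_continuous_onI continuous_intros)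

lemma integrable_mult_cis:
  fixes \<phi> :: "'w \<Rightarrow> complex"
  assumes "integrable M \<phi>" "t \<in> borel_measurable M"
  shows "integrable M (\<lambda>x. \<phi> x * cis (t x))"
  by (rule Bochner_Integration.integrable_bound[OF assms(1)]) (use assms in \<open>auto simp: norm_mult\<close>)

lemma fourier_measurable [measurable]:
  assumes [measurable]: "\<phi> \<in> borel_measurable borel"
  shows "fourier \<phi> \<in> borel_measurable borel"
  unfolding fourier_cis[abs_def] by measurable

lemma has_vector_derivative_quotient:
  fixes f :: "real \<Rightarrow> 'b::real_normed_vector"
  assumes "(f has_vector_derivative d) (at 0)"
  shows "((\<lambda>t. (f t - f 0) /\<^sub>R t) \<longlongrightarrow> d) (at 0)"
proof -
  have lim: "((\<lambda>t. norm (f (0 + t) - f 0 - t *\<^sub>R d) / norm t) \<longlongrightarrow> 0) (at 0)"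
    using assms unfolding has_vector_derivative_def has_derivative_at by blast
  have "norm (f (0 + t) - f 0 - t *\<^sub>R d) / norm t = norm ((f t - f 0) /\<^sub>R t - d)" if "t \<noteq> 0" for t
  proof -
    have "f (0 + t) - f 0 - t *\<^sub>R d = t *\<^sub>R ((f t - f 0) /\<^sub>R t - d)" using that by (simp add: scaleR_diff_right)
    then show ?thesis using that by simp
  qed
  then have "((\<lambda>t. norm ((f t - f 0) /\<^sub>R t - d)) \<longlongrightarrow> 0) (at 0)"
    by (intro Lim_transform_eventually[OF lim]) (auto simp: eventually_at_filter)
  then show ?thesis by (simp add: tendsto_norm_zero_iff LIM_zero_iff)
qed

text \<open>An integrable majorant, uniform in h, for passing to the limit under the Fourier
  integral. Along the segment 1 + |x| is at most 2 (1 + |x + t b|), which costs the factor 2^(2 DIM)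
  in the mean value estimate.\<close>

lemma schwartz_diff_quotient:
  fixes \<phi> :: "'a::euclidean_space \<Rightarrow> complex"
  assumes \<phi>: "schwartz \<phi>" and b: "b \<in> Basis"
  obtains C where "C > 0"
    "\<And>x h. 0 < h \<Longrightarrow> h \<le> 1 \<Longrightarrow> norm ((\<phi> (x + h *\<^sub>R b) - \<phi> x) / of_real h) \<le> C * (1 / (1 + norm x) ^ (2 * DIM('a)))"
proof -
  obtain C where C: "C > 0" "\<And>x. (1 + norm x) ^ (2 * DIM('a)) * norm (pdiff b \<phi> x) \<le> C"
    using schwartz_decay[OF schwartz_pdiff[OF \<phi> b]] by blast
  show thesis
  proof (rule that[of "C * 2 ^ (2 * DIM('a))"])
    show "C * 2 ^ (2 * DIM('a)) > 0" using C by simp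
    fix x :: 'a and h :: real assume h: "0 < h" "h \<le> 1"
    define P where "P = (1 + norm x) ^ (2 * DIM('a))"
    have P: "P > 0" unfolding P_def by (intro zero_less_power) (simp add: add_pos_nonneg)
    have aux: "1 + a \<le> 2 * (1 + c)" if "a \<le> c + 1" "0 \<le> c" for a c :: real using that by argo
    define B where "B = C * 2 ^ (2 * DIM('a)) / P"
    let ?g = "\<lambda>t. \<phi> (x + t *\<^sub>R b)"
    have "norm (?g h - ?g 0) \<le> B * norm (h - 0)"
    proof (rule differentiable_bound[where S="{0..h}" and f'="\<lambda>t s. s *\<^sub>R pdiff b \<phi> (x + t *\<^sub>R b)"])
      fix t assume t: "t \<in> {0..h}"
      have "(\<phi> has_derivative frechet_derivative \<phi> (at (x + t *\<^sub>R b))) (at (x + t *\<^sub>R b))"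
        using schwartz_differentiable[OF \<phi>] by (simp add: frechet_derivative_works)
      then have "(?g has_derivative (\<lambda>s. frechet_derivative \<phi> (at (x + t *\<^sub>R b)) (s *\<^sub>R b))) (at t within {0..h})"
        by (intro has_derivative_compose[of "\<lambda>t. x + t *\<^sub>R b" "\<lambda>s. s *\<^sub>R b" _ _ \<phi>]) (auto intro!: derivative_eq_intros)
      moreover have "frechet_derivative \<phi> (at y) (s *\<^sub>R b) = s *\<^sub>R pdiff b \<phi> y" for s y
        using linear_frechet_derivative[OF schwartz_differentiable[OF \<phi>, of y]]
        by (simp add: linear_cmul pdiff_def)
      ultimately show "(?g has_derivative (\<lambda>s. s *\<^sub>R pdiff b \<phi> (x + t *\<^sub>R b))) (at t within {0..h})" by simp
      have "norm x \<le> norm (x + t *\<^sub>R b) + norm (t *\<^sub>R b)"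
        using norm_triangle_ineq4[of "x + t *\<^sub>R b" "t *\<^sub>R b"] by simp
      moreover have "norm (t *\<^sub>R b) \<le> 1" using t h b by simp
      ultimately have "norm x \<le> norm (x + t *\<^sub>R b) + 1" by (rule order.trans[OF _ add_left_mono])
      then have "1 + norm x \<le> 2 * (1 + norm (x + t *\<^sub>R b))" using aux[OF _ norm_ge_zero] by blast
      then have "P \<le> (2 * (1 + norm (x + t *\<^sub>R b))) ^ (2 * DIM('a))" unfolding P_def by (intro power_mono) auto
      then have "P * norm (pdiff b \<phi> (x + t *\<^sub>R b)) \<le> (2 * (1 + norm (x + t *\<^sub>R b))) ^ (2 * DIM('a)) * norm (pdiff b \<phi> (x + t *\<^sub>R b))"
        by (intro mult_right_mono) auto
      also have "\<dots> = 2 ^ (2 * DIM('a)) * ((1 + norm (x + t *\<^sub>R b)) ^ (2 * DIM('a)) * norm (pdiff b \<phi> (x + t *\<^sub>R b)))"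
        by (simp only: power_mult_distrib mult.assoc)
      also have "\<dots> \<le> 2 ^ (2 * DIM('a)) * C" using C(2) by (intro mult_left_mono) auto
      finally have *: "norm (pdiff b \<phi> (x + t *\<^sub>R b)) \<le> B" using P by (simp add: B_def field_simps)
      show "onorm (\<lambda>s. s *\<^sub>R pdiff b \<phi> (x + t *\<^sub>R b)) \<le> B"
        by (rule onorm_le) (simp add: mult.commute[of B] mult_left_mono[OF *])
    qed (use h in auto)
    then have "norm (\<phi> (x + h *\<^sub>R b) - \<phi> x) / h \<le> B" using h by (simp add: field_simps)
    then show "norm ((\<phi> (x + h *\<^sub>R b) - \<phi> x) / of_real h) \<le> C * 2 ^ (2 * DIM('a)) * (1 / (1 + norm x) ^ (2 * DIM('a)))"
      using h by (simp add: norm_divide B_def P_def)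
  qed
qed

lemma fourier_translate:
  fixes \<phi> :: "'a::euclidean_space \<Rightarrow> complex"
  assumes [measurable]: "\<phi> \<in> borel_measurable borel"
  shows "fourier (\<lambda>x. \<phi> (x + c)) \<xi> = cis (2 * pi * (c \<bullet> \<xi>)) * fourier \<phi> \<xi>"
proof -
  have "fourier (\<lambda>x. \<phi> (x + c)) \<xi> = (LINT x|lborel. cis (2 * pi * (c \<bullet> \<xi>)) * (\<phi> (x + c) * cis (- (2 * pi * ((x + c) \<bullet> \<xi>)))))"
    unfolding fourier_cis
  proof (intro Bochner_Integration.integral_cong refl)
    fix x
    have "cis (- (2 * pi * (x \<bullet> \<xi>))) = cis (2 * pi * (c \<bullet> \<xi>)) * cis (- (2 * pi * ((x + c) \<bullet> \<xi>)))"
      by (simp add: cis_mult inner_add_left algebra_simps)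
    then show "\<phi> (x + c) * cis (- (2 * pi * (x \<bullet> \<xi>))) = cis (2 * pi * (c \<bullet> \<xi>)) * (\<phi> (x + c) * cis (- (2 * pi * ((x + c) \<bullet> \<xi>))))"
      by simp
  qed
  also have "\<dots> = cis (2 * pi * (c \<bullet> \<xi>)) * (LINT x|lborel. \<phi> (x + c) * cis (- (2 * pi * ((x + c) \<bullet> \<xi>))))" by simp
  also have "(LINT x|lborel. \<phi> (x + c) * cis (- (2 * pi * ((x + c) \<bullet> \<xi>)))) = fourier \<phi> \<xi>"
    using integral_affine[of 1 "\<lambda>x. \<phi> x * cis (- (2 * pi * (x \<bullet> \<xi>)))" c] by (simp add: fourier_cis)
  finally show ?thesis .
qed

text \<open>Instead of integrating by parts, the difference quotient is transformed: translation by
  h b multiplies the transform by a \<open>cis\<close> factor, and both sides converge as h tends to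
  0.\<close>

lemma fourier_pdiff:
  fixes \<phi> :: "'a::euclidean_space \<Rightarrow> complex"
  assumes \<phi>: "schwartz \<phi>" and b: "b \<in> Basis"
  shows "fourier (pdiff b \<phi>) \<xi> = 2 * of_real pi * \<i> * of_real (b \<bullet> \<xi>) * fourier \<phi> \<xi>"
proof -
  have [measurable]: "\<phi> \<in> borel_measurable borel" "pdiff b \<phi> \<in> borel_measurable borel"
    using schwartz_measurable schwartz_pdiff[OF \<phi> b] \<phi> by auto
  obtain C where C: "C > 0"
    "\<And>x h. 0 < h \<Longrightarrow> h \<le> 1 \<Longrightarrow> norm ((\<phi> (x + h *\<^sub>R b) - \<phi> x) / of_real h) \<le> C * (1 / (1 + norm x) ^ (2 * DIM('a)))"
    using schwartz_diff_quotient[OF \<phi> b] by blast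
  define h where "h = (\<lambda>n. 1 / real (Suc n))"
  have h: "h n > 0" "h n \<le> 1" for n by (auto simp: h_def)
  have h0: "h \<longlonglongrightarrow> 0" unfolding h_def using LIMSEQ_inverse_real_of_nat by (simp add: inverse_eq_divide)
  then have hat: "filterlim h (at 0) sequentially"
    using h by (auto simp: filterlim_at intro!: always_eventually less_imp_neq[THEN not_sym])
  have quot: "(\<lambda>n. (\<phi> (x + h n *\<^sub>R b) - \<phi> x) / of_real (h n)) \<longlonglongrightarrow> pdiff b \<phi> x" for x
  proof -
    have "(\<phi> has_derivative frechet_derivative \<phi> (at x)) (at x)"
      using schwartz_differentiable[OF \<phi>] by (simp add: frechet_derivative_works)
    then have "((\<lambda>t. \<phi> (x + t *\<^sub>R b)) has_derivative (\<lambda>s. frechet_derivative \<phi> (at x) (s *\<^sub>R b))) (at 0)"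
      by (intro has_derivative_compose[of "\<lambda>t. x + t *\<^sub>R b" "\<lambda>s. s *\<^sub>R b" _ _ \<phi>]) (auto intro!: derivative_eq_intros)
    moreover have "frechet_derivative \<phi> (at x) (s *\<^sub>R b) = s *\<^sub>R pdiff b \<phi> x" for s
      using linear_frechet_derivative[OF schwartz_differentiable[OF \<phi>, of x]]
      by (simp add: linear_cmul pdiff_def)
    ultimately have "((\<lambda>t. \<phi> (x + t *\<^sub>R b)) has_vector_derivative pdiff b \<phi> x) (at 0)"
      by (simp add: has_vector_derivative_def)
    from has_vector_derivative_quotient[OF this]
    have "((\<lambda>t. (\<phi> (x + t *\<^sub>R b) - \<phi> x) /\<^sub>R t) \<longlongrightarrow> pdiff b \<phi> x) (at 0)" by simp
    from filterlim_compose[OF this hat] show ?thesis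
      by (simp add: scaleR_conv_of_real field_simps)
  qed
  have L1: "(\<lambda>n. LINT x|lborel. (\<phi> (x + h n *\<^sub>R b) - \<phi> x) / of_real (h n) * cis (- (2 * pi * (x \<bullet> \<xi>)))) \<longlonglongrightarrow> (LINT x|lborel. pdiff b \<phi> x * cis (- (2 * pi * (x \<bullet> \<xi>))))"
  proof (rule integral_dominated_convergence[where w="\<lambda>x. C * (1 / (1 + norm x) ^ (2 * DIM('a)))"])
    show "integrable lborel (\<lambda>x::'a. C * (1 / (1 + norm x) ^ (2 * DIM('a))))"
      by (intro integrable_mult_right integrable_inverse_1_plus_norm)
    show "AE x in lborel. (\<lambda>n. (\<phi> (x + h n *\<^sub>R b) - \<phi> x) / of_real (h n) * cis (- (2 * pi * (x \<bullet> \<xi>)))) \<longlonglongrightarrow> pdiff b \<phi> x * cis (- (2 * pi * (x \<bullet> \<xi>)))"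
      by (intro AE_I2 tendsto_mult quot tendsto_const)
    show "AE x in lborel. norm ((\<phi> (x + h n *\<^sub>R b) - \<phi> x) / of_real (h n) * cis (- (2 * pi * (x \<bullet> \<xi>)))) \<le> C * (1 / (1 + norm x) ^ (2 * DIM('a)))" for n
      unfolding norm_mult norm_cis mult_1_right by (intro AE_I2 C(2) h)
  qed measurable
  have eq: "(LINT x|lborel. (\<phi> (x + h n *\<^sub>R b) - \<phi> x) / of_real (h n) * cis (- (2 * pi * (x \<bullet> \<xi>))))
      = (cis (2 * pi * (b \<bullet> \<xi>) * h n) - 1) / of_real (h n) * fourier \<phi> \<xi>" for n
  proof -
    have i1: "integrable lborel (\<lambda>x. \<phi> x * cis (- (2 * pi * (x \<bullet> \<xi>))))"
      by (intro integrable_mult_cis schwartz_integrable[OF \<phi>]) measurable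
    have i0: "integrable lborel (\<lambda>x. \<phi> (x + h n *\<^sub>R b))"
      using integrable_affine_iff[of 1 \<phi> "h n *\<^sub>R b"] schwartz_integrable[OF \<phi>] by simp
    have i2: "integrable lborel (\<lambda>x. \<phi> (x + h n *\<^sub>R b) * cis (- (2 * pi * (x \<bullet> \<xi>))))"
      by (intro integrable_mult_cis i0) measurable
    have "(LINT x|lborel. (\<phi> (x + h n *\<^sub>R b) - \<phi> x) / of_real (h n) * cis (- (2 * pi * (x \<bullet> \<xi>))))
       = (LINT x|lborel. (1 / of_real (h n)) * (\<phi> (x + h n *\<^sub>R b) * cis (- (2 * pi * (x \<bullet> \<xi>))) - \<phi> x * cis (- (2 * pi * (x \<bullet> \<xi>)))))"
      by (intro Bochner_Integration.integral_cong refl) (simp add: algebra_simps diff_divide_distrib)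
    also have "\<dots> = (1 / of_real (h n)) * (fourier (\<lambda>x. \<phi> (x + h n *\<^sub>R b)) \<xi> - fourier \<phi> \<xi>)"
      using i1 i2 by (simp add: fourier_cis)
    also have "\<dots> = (cis (2 * pi * (b \<bullet> \<xi>) * h n) - 1) / of_real (h n) * fourier \<phi> \<xi>"
      by (subst fourier_translate) (auto simp: algebra_simps diff_divide_distrib)
    finally show ?thesis .
  qed
  have "((\<lambda>t. cis (2 * pi * (b \<bullet> \<xi>) * t)) has_vector_derivative (2 * of_real pi * \<i> * of_real (b \<bullet> \<xi>))) (at 0)"
  proof -
    have "((\<lambda>z. exp (2 * of_real pi * \<i> * of_real (b \<bullet> \<xi>) * z)) has_field_derivative (2 * of_real pi * \<i> * of_real (b \<bullet> \<xi>))) (at (of_real 0))"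
      by (auto intro!: derivative_eq_intros)
    from has_vector_derivative_real_field[OF this, of UNIV] show ?thesis
      by (simp add: cis_conv_exp algebra_simps)
  qed
  from has_vector_derivative_quotient[OF this]
  have "((\<lambda>t. (cis (2 * pi * (b \<bullet> \<xi>) * t) - 1) /\<^sub>R t) \<longlongrightarrow> 2 * of_real pi * \<i> * of_real (b \<bullet> \<xi>)) (at 0)" by simp
  from filterlim_compose[OF this hat]
  have "(\<lambda>n. (cis (2 * pi * (b \<bullet> \<xi>) * h n) - 1) / of_real (h n)) \<longlonglongrightarrow> 2 * of_real pi * \<i> * of_real (b \<bullet> \<xi>)"
    by (simp add: scaleR_conv_of_real field_simps)
  from tendsto_mult_right[OF this, of "fourier \<phi> \<xi>"]
  have "(\<lambda>n. (cis (2 * pi * (b \<bullet> \<xi>) * h n) - 1) / of_real (h n) * fourier \<phi> \<xi>) \<longlonglongrightarrow> 2 * of_real pi * \<i> * of_real (b \<bullet> \<xi>) * fourier \<phi> \<xi>" .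
  with L1 show ?thesis unfolding eq fourier_cis[symmetric] by (rule LIMSEQ_unique)
qed

text \<open>Because \<open>fourier\<close> carries 2 pi in its exponent, the operator with symbol 1
  + |\<xi>|^2 is the identity minus the Laplacian divided by 4 pi^2.\<close>

definition helmholtz :: "('a::euclidean_space \<Rightarrow> complex) \<Rightarrow> 'a \<Rightarrow> complex" where
  "helmholtz \<phi> = (\<lambda>x. \<phi> x + (- 1 / (4 * of_real pi ^ 2)) * (\<Sum>b\<in>Basis. pdiff b (pdiff b \<phi>) x))"

lemma schwartz_helmholtz: "schwartz \<phi> \<Longrightarrow> schwartz (helmholtz \<phi>)"
  unfolding helmholtz_def by (intro schwartz_add schwartz_cmult schwartz_sum schwartz_pdiff) auto

lemma fourier_add:
  assumes "integrable lborel \<phi>" "integrable lborel \<psi>"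
  shows "fourier (\<lambda>x. \<phi> x + \<psi> x) \<xi> = fourier \<phi> \<xi> + fourier \<psi> \<xi>"
proof -
  have "integrable lborel (\<lambda>x. \<phi> x * cis (- (2 * pi * (x \<bullet> \<xi>))))" "integrable lborel (\<lambda>x. \<psi> x * cis (- (2 * pi * (x \<bullet> \<xi>))))"
    using assms by (intro integrable_mult_cis; measurable)+
  then show ?thesis unfolding fourier_cis by (simp add: distrib_right)
qed

lemma fourier_cmult: "fourier (\<lambda>x. c * \<phi> x) \<xi> = c * fourier \<phi> \<xi>"
  unfolding fourier_cis by (simp add: mult.assoc)

lemma fourier_sum:
  assumes "finite I" "\<And>i. i \<in> I \<Longrightarrow> integrable lborel (\<phi> i)"
  shows "fourier (\<lambda>x. \<Sum>i\<in>I. \<phi> i x) \<xi> = (\<Sum>i\<in>I. fourier (\<phi> i) \<xi>)"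
  using assms
proof (induction rule: finite_induct)
  case empty show ?case by (simp add: fourier_cis)
next
  case (insert i I)
  then have "fourier (\<lambda>x. \<phi> i x + (\<Sum>i\<in>I. \<phi> i x)) \<xi> = fourier (\<phi> i) \<xi> + fourier (\<lambda>x. \<Sum>i\<in>I. \<phi> i x) \<xi>"
    by (intro fourier_add) auto
  then show ?case using insert by simp
qed

lemma fourier_helmholtz:
  assumes \<phi>: "schwartz \<phi>"
  shows "fourier (helmholtz \<phi>) \<xi> = of_real (1 + (norm \<xi>)\<^sup>2) * fourier \<phi> \<xi>"
proof -
  have s: "schwartz (pdiff b (pdiff b \<phi>))" if "b \<in> Basis" for b using \<phi> that by (intro schwartz_pdiff)
  have *: "fourier (pdiff b (pdiff b \<phi>)) \<xi> = - 4 * of_real pi ^ 2 * of_real ((\<xi> \<bullet> b)\<^sup>2) * fourier \<phi> \<xi>" if b: "b \<in> Basis" for b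
    by (simp add: fourier_pdiff[OF schwartz_pdiff[OF \<phi> b] b] fourier_pdiff[OF \<phi> b] power2_eq_square inner_commute algebra_simps)
  have "fourier (helmholtz \<phi>) \<xi> = fourier \<phi> \<xi> + (- 1 / (4 * of_real pi ^ 2)) * (\<Sum>b\<in>Basis. fourier (pdiff b (pdiff b \<phi>)) \<xi>)"
  proof -
    have i: "integrable lborel (\<lambda>x. (- 1 / (4 * of_real pi ^ 2)) * (\<Sum>b\<in>Basis. pdiff b (pdiff b \<phi>) x))"
      by (intro schwartz_integrable schwartz_cmult schwartz_sum s finite_Basis)
    show ?thesis
      unfolding helmholtz_def fourier_add[OF schwartz_integrable[OF \<phi>] i] fourier_cmult
      using fourier_sum[of Basis "\<lambda>b. pdiff b (pdiff b \<phi>)" \<xi>] schwartz_integrable[OF s] by simp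
  qed
  also have "(\<Sum>b\<in>Basis. fourier (pdiff b (pdiff b \<phi>)) \<xi>) = - 4 * of_real pi ^ 2 * of_real (\<Sum>b\<in>Basis. (\<xi> \<bullet> b)\<^sup>2) * fourier \<phi> \<xi>"
    by (simp add: * sum_distrib_left sum_distrib_right sum_negf)
  also have "(\<Sum>b\<in>Basis. (\<xi> \<bullet> b)\<^sup>2) = (norm \<xi>)\<^sup>2"
    by (simp add: norm_eq_sqrt_inner euclidean_inner[of \<xi> \<xi>] power2_eq_square sum_nonneg)
  finally show ?thesis by (simp add: field_simps)
qed

lemma schwartz_helmholtz_funpow: "schwartz \<phi> \<Longrightarrow> schwartz ((helmholtz ^^ k) \<phi>)"
  by (induction k) (auto intro: schwartz_helmholtz)

lemma fourier_helmholtz_funpow: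
  "schwartz \<phi> \<Longrightarrow> fourier ((helmholtz ^^ k) \<phi>) \<xi> = of_real ((1 + (norm \<xi>)\<^sup>2) ^ k) * fourier \<phi> \<xi>"
  by (induction k) (auto simp: fourier_helmholtz schwartz_helmholtz_funpow)

lemma norm_fourier_le: "norm (fourier \<phi> \<xi>) \<le> (LINT x|lborel. norm (\<phi> x))"
  unfolding fourier_cis
  using integral_norm_bound[of lborel "\<lambda>x. \<phi> x * cis (- (2 * pi * (x \<bullet> \<xi>)))"] by (simp add: norm_mult)

lemma integrable_fourier_schwartz:
  fixes \<phi> :: "'a::euclidean_space \<Rightarrow> complex"
  assumes \<phi>: "schwartz \<phi>"
  shows "integrable lborel (\<lambda>\<xi>. of_real ((1 + (norm \<xi>)\<^sup>2) powr s) * fourier \<phi> \<xi>)"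
proof -
  define k where "k = nat \<lceil>s\<rceil>"
  have k: "s \<le> real k" unfolding k_def by (rule real_nat_ceiling_ge)
  \<comment> \<open>Of the k + DIM powers, k absorb the weight with exponent s and DIM leave an
    integrable remainder.\<close>
  define C where "C = (LINT x|lborel. norm ((helmholtz ^^ (k + DIM('a))) \<phi> x))"
  have C: "(1 + (norm \<xi>)\<^sup>2) ^ (k + DIM('a)) * norm (fourier \<phi> \<xi>) \<le> C" for \<xi>
    using norm_fourier_le[of "(helmholtz ^^ (k + DIM('a))) \<phi>" \<xi>]
    by (simp add: C_def fourier_helmholtz_funpow[OF \<phi>] norm_mult norm_power del: of_real_power of_real_add)
  have [measurable]: "\<phi> \<in> borel_measurable borel" by (rule schwartz_measurable[OF \<phi>])
  have le: "norm (of_real ((1 + (norm \<xi>)\<^sup>2) powr s) * fourier \<phi> \<xi>) \<le> C * (1 / (1 + (norm \<xi>)\<^sup>2) ^ DIM('a))" for \<xi> :: 'a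
  proof -
    define w where "w = 1 + (norm \<xi>)\<^sup>2"
    have w: "w \<ge> 1" "w > 0" by (auto simp: w_def add_pos_nonneg)
    have "w powr s \<le> w powr real k" using w k by (intro powr_mono) auto
    also have "\<dots> = w ^ k" using w by (simp add: powr_realpow)
    finally have "w powr s * norm (fourier \<phi> \<xi>) \<le> w ^ k * norm (fourier \<phi> \<xi>)" by (intro mult_right_mono) auto
    also have "\<dots> = (w ^ (k + DIM('a)) * norm (fourier \<phi> \<xi>)) * (1 / w ^ DIM('a))"
      using w by (simp add: power_add)
    also have "\<dots> \<le> C * (1 / w ^ DIM('a))" using C[of \<xi>] w by (intro mult_right_mono) (auto simp: w_def)
    finally show ?thesis using w by (simp add: norm_mult w_def)
  qed
  show ?thesis
  proof (rule Bochner_Integration.integrable_bound)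
    show "integrable lborel (\<lambda>\<xi>::'a. C * (1 / (1 + (norm \<xi>)\<^sup>2) ^ DIM('a)))"
      by (intro integrable_mult_right integrable_inverse_1_plus_norm2)
    show "AE \<xi> in lborel. norm (of_real ((1 + (norm \<xi>)\<^sup>2) powr s) * fourier \<phi> \<xi>) \<le> norm (C * (1 / (1 + (norm \<xi>)\<^sup>2) ^ DIM('a)))"
      unfolding real_norm_def by (intro AE_I2 order.trans[OF le abs_ge_self])
  qed measurable
qed

lemma integrable_fourier: "schwartz \<phi> \<Longrightarrow> integrable lborel (fourier \<phi>)"
  using integrable_fourier_schwartz[of \<phi> 0] by (simp add: add_nonneg_eq_0_iff)

text \<open>Fourier inversion: insert the convergence factor \<open>gauss (e * \<xi>)\<close> and let \<open>e\<close> tend to \<open>0\<close>.\<close>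

lemma fourier_inversion:
  fixes \<phi> :: "'a::euclidean_space \<Rightarrow> complex"
  assumes \<phi>: "schwartz \<phi>"
  shows "inv_fourier (fourier \<phi>) x = \<phi> x"
proof -
  have m[measurable]: "\<phi> \<in> borel_measurable borel" by (rule schwartz_measurable[OF \<phi>])
  obtain C where C: "C > 0" "\<And>x. norm (\<phi> x) \<le> C" using schwartz_bounded[OF \<phi>] by blast
  define e where "e = (\<lambda>n. 1 / real (Suc n))"
  have e: "e n > 0" for n by (auto simp: e_def)
  have e0: "e \<longlonglongrightarrow> 0" unfolding e_def using LIMSEQ_inverse_real_of_nat by (simp add: inverse_eq_divide)
  have gc: "isCont gauss y" for y :: 'a unfolding gauss_def by (intro continuous_intros)
  have L1: "(\<lambda>n. LINT \<xi>|lborel. fourier \<phi> \<xi> * of_real (gauss (e n *\<^sub>R \<xi>)) * cis (2 * pi * (x \<bullet> \<xi>))) \<longlonglongrightarrow> (LINT \<xi>|lborel. fourier \<phi> \<xi> * of_real 1 * cis (2 * pi * (x \<bullet> \<xi>)))"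
  proof (rule integral_dominated_convergence[where w="\<lambda>\<xi>. norm (fourier \<phi> \<xi>)"])
    show "AE \<xi> in lborel. (\<lambda>n. fourier \<phi> \<xi> * of_real (gauss (e n *\<^sub>R \<xi>)) * cis (2 * pi * (x \<bullet> \<xi>))) \<longlonglongrightarrow> fourier \<phi> \<xi> * of_real 1 * cis (2 * pi * (x \<bullet> \<xi>))"
    proof (rule AE_I2)
      fix \<xi> :: 'a
      have "(\<lambda>n. e n *\<^sub>R \<xi>) \<longlonglongrightarrow> 0 *\<^sub>R \<xi>" using e0 by (intro tendsto_intros)
      then have "(\<lambda>n. gauss (e n *\<^sub>R \<xi>)) \<longlonglongrightarrow> gauss (0 *\<^sub>R \<xi>)" by (rule isCont_tendsto_compose[OF gc])
      then show "(\<lambda>n. fourier \<phi> \<xi> * of_real (gauss (e n *\<^sub>R \<xi>)) * cis (2 * pi * (x \<bullet> \<xi>))) \<longlonglongrightarrow> fourier \<phi> \<xi> * of_real 1 * cis (2 * pi * (x \<bullet> \<xi>))"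
        by (intro tendsto_intros) simp
    qed
    show "AE \<xi> in lborel. norm (fourier \<phi> \<xi> * of_real (gauss (e n *\<^sub>R \<xi>)) * cis (2 * pi * (x \<bullet> \<xi>))) \<le> norm (fourier \<phi> \<xi>)" for n
      by (intro AE_I2) (simp add: norm_mult abs_of_pos gauss_pos gauss_le_1 mult_left_le)
    show "integrable lborel (\<lambda>\<xi>. norm (fourier \<phi> \<xi>))"
      by (intro integrable_norm integrable_fourier \<phi>)
  qed measurable
  \<comment> \<open>Fubini and the self-duality of the Gaussian turn the regularised inverse
    transform into a Gaussian average of \<open>\<phi>\<close> around x at scale
    \<open>e n\<close>.\<close>
  have eq: "(LINT \<xi>|lborel. fourier \<phi> \<xi> * of_real (gauss (e n *\<^sub>R \<xi>)) * cis (2 * pi * (x \<bullet> \<xi>))) = (LINT z|lborel. \<phi> (e n *\<^sub>R z + x) * of_real (gauss z))" for n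
  proof -
    have en: "inverse (e n) * (e n * z) = z" for z using e[of n] by simp
    have ig: "integrable lborel (\<lambda>\<xi>::'a. gauss (e n *\<^sub>R \<xi>))"
      using integrable_affine_iff[of "e n" "gauss :: 'a \<Rightarrow> real" 0] e[of n] integrable_gauss[where 'a='a] by simp
    let ?F = "\<lambda>(y, \<xi>). \<phi> y * of_real (gauss (e n *\<^sub>R \<xi>)) * cis (2 * pi * ((x - y) \<bullet> \<xi>))"
    have I: "integrable (lborel \<Otimes>\<^sub>M lborel) ?F"
    proof (rule lborel_pair.Fubini_integrable)
      show "?F \<in> borel_measurable (lborel \<Otimes>\<^sub>M lborel)" by measurable
      have "(\<lambda>y. \<integral>\<xi>. norm (?F (y, \<xi>)) \<partial>lborel) = (\<lambda>y. norm (\<phi> y) * (LINT \<xi>|lborel. gauss (e n *\<^sub>R (\<xi>::'a))))"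
        by (simp add: norm_mult abs_of_pos gauss_pos)
      then show "integrable lborel (\<lambda>y. \<integral>\<xi>. norm (?F (y, \<xi>)) \<partial>lborel)"
        using schwartz_integrable[OF \<phi>] by simp
      show "AE y in lborel. integrable lborel (\<lambda>\<xi>. ?F (y, \<xi>))"
        using ig by (auto intro!: integrable_mult_cis)
    qed
    have "(LINT \<xi>|lborel. fourier \<phi> \<xi> * of_real (gauss (e n *\<^sub>R \<xi>)) * cis (2 * pi * (x \<bullet> \<xi>)))
       = (LINT \<xi>|lborel. (LINT y|lborel. \<phi> y * of_real (gauss (e n *\<^sub>R \<xi>)) * cis (2 * pi * ((x - y) \<bullet> \<xi>))))"
    proof (intro Bochner_Integration.integral_cong refl)
      fix \<xi> :: 'a
      have "(LINT y|lborel. \<phi> y * of_real (gauss (e n *\<^sub>R \<xi>)) * cis (2 * pi * ((x - y) \<bullet> \<xi>)))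
         = (LINT y|lborel. (of_real (gauss (e n *\<^sub>R \<xi>)) * cis (2 * pi * (x \<bullet> \<xi>))) * (\<phi> y * cis (- (2 * pi * (y \<bullet> \<xi>)))))"
        by (intro Bochner_Integration.integral_cong refl)
           (simp add: inner_diff_left right_diff_distrib cis_divide[symmetric] cis_inverse[symmetric] field_simps)
      also have "\<dots> = (of_real (gauss (e n *\<^sub>R \<xi>)) * cis (2 * pi * (x \<bullet> \<xi>))) * fourier \<phi> \<xi>"
        unfolding fourier_cis by simp
      finally show "fourier \<phi> \<xi> * of_real (gauss (e n *\<^sub>R \<xi>)) * cis (2 * pi * (x \<bullet> \<xi>)) = (LINT y|lborel. \<phi> y * of_real (gauss (e n *\<^sub>R \<xi>)) * cis (2 * pi * ((x - y) \<bullet> \<xi>)))"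
        by simp
    qed
    also have "\<dots> = (LINT y|lborel. (LINT \<xi>|lborel. \<phi> y * of_real (gauss (e n *\<^sub>R \<xi>)) * cis (2 * pi * ((x - y) \<bullet> \<xi>))))"
      using lborel_pair.Fubini_integral[OF I] by simp
    also have "\<dots> = (LINT y|lborel. (1 / e n ^ DIM('a)) *\<^sub>R (\<phi> y * of_real (gauss ((y - x) /\<^sub>R e n))))"
    proof (intro Bochner_Integration.integral_cong refl)
      fix y
      have "(LINT \<xi>|lborel. of_real (gauss (e n *\<^sub>R \<xi>)) * cis (2 * pi * ((x - y) \<bullet> \<xi>)))
         = (LINT \<xi>|lborel. of_real (gauss (e n *\<^sub>R \<xi> + 0)) * cis (- (2 * pi * ((e n *\<^sub>R \<xi> + 0) \<bullet> ((y - x) /\<^sub>R e n)))))"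
        by (intro Bochner_Integration.integral_cong refl) (simp add: en inner_commute inner_diff_left inner_diff_right right_diff_distrib)
      also have "\<dots> = (1 / \<bar>e n\<bar> ^ DIM('a)) *\<^sub>R (LINT \<xi>|lborel. complex_of_real (gauss \<xi>) * cis (- (2 * pi * (\<xi> \<bullet> ((y - x) /\<^sub>R e n)))))"
        using e[of n] by (subst integral_affine[of "e n" "\<lambda>\<xi>. of_real (gauss \<xi>) * cis (- (2 * pi * (\<xi> \<bullet> ((y - x) /\<^sub>R e n))))" 0]) auto
      also have "\<dots> = (1 / e n ^ DIM('a)) *\<^sub>R of_real (gauss ((y - x) /\<^sub>R e n))"
        using e[of n] by (simp only: fourier_gauss abs_of_pos)
      finally show "(LINT \<xi>|lborel. \<phi> y * of_real (gauss (e n *\<^sub>R \<xi>)) * cis (2 * pi * ((x - y) \<bullet> \<xi>))) = (1 / e n ^ DIM('a)) *\<^sub>R (\<phi> y * of_real (gauss ((y - x) /\<^sub>R e n)))"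
        by (simp add: mult.assoc)
    qed
    also have "\<dots> = (1 / e n ^ DIM('a)) *\<^sub>R (LINT y|lborel. \<phi> y * of_real (gauss ((y - x) /\<^sub>R e n)))" by simp
    also have "\<dots> = (LINT z|lborel. \<phi> (e n *\<^sub>R z + x) * of_real (gauss ((e n *\<^sub>R z + x - x) /\<^sub>R e n)))"
      using e[of n] by (subst integral_affine[of "e n" "\<lambda>y. \<phi> y * of_real (gauss ((y - x) /\<^sub>R e n))" x]) auto
    also have "\<dots> = (LINT z|lborel. \<phi> (e n *\<^sub>R z + x) * of_real (gauss z))" using e[of n] by simp
    finally show ?thesis .
  qed
  have L2: "(\<lambda>n. LINT z|lborel. \<phi> (e n *\<^sub>R z + x) * of_real (gauss z)) \<longlonglongrightarrow> (LINT z|lborel. \<phi> x * of_real (gauss (z::'a)))"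
  proof (rule integral_dominated_convergence[where w="\<lambda>z. C * gauss z"])
    show "AE z in lborel. (\<lambda>n. \<phi> (e n *\<^sub>R z + x) * of_real (gauss z)) \<longlonglongrightarrow> \<phi> x * of_real (gauss z)"
    proof (rule AE_I2)
      fix z :: 'a
      have "(\<lambda>n. e n *\<^sub>R z + x) \<longlonglongrightarrow> 0 *\<^sub>R z + x" using e0 by (intro tendsto_intros)
      then have "(\<lambda>n. \<phi> (e n *\<^sub>R z + x)) \<longlonglongrightarrow> \<phi> (0 *\<^sub>R z + x)"
        using schwartz_continuous[OF \<phi>] by (auto simp: continuous_on_eq_continuous_at intro: isCont_tendsto_compose)
      then show "(\<lambda>n. \<phi> (e n *\<^sub>R z + x) * of_real (gauss z)) \<longlonglongrightarrow> \<phi> x * of_real (gauss z)"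
        by (intro tendsto_intros) simp
    qed
    show "AE z in lborel. norm (\<phi> (e n *\<^sub>R z + x) * of_real (gauss z)) \<le> C * gauss z" for n
      by (intro AE_I2) (simp add: norm_mult abs_of_pos gauss_pos mult_right_mono C(2) less_imp_le)
    show "integrable lborel (\<lambda>z::'a. C * gauss z)" by (intro integrable_mult_right integrable_gauss)
  qed measurable
  have "inv_fourier (fourier \<phi>) x = (LINT z|lborel. \<phi> x * of_real (gauss (z::'a)))"
    using LIMSEQ_unique[OF L1] L2 unfolding eq by (simp add: inv_fourier_cis)
  also have "\<dots> = \<phi> x * complex_of_real (LINT z|lborel. gauss (z::'a))"
    by (subst integral_mult_right_zero) simp
  also have "\<dots> = \<phi> x" by (simp only: integral_gauss of_real_1 mult_1_right)
  finally show ?thesis .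
qed

section \<open>Multipliers given by finite signed measures\<close>

text \<open>A finite signed measure on \<open>'a\<close> is represented by a probability measure on pairs (point, weight).
  This avoids Hahn decompositions; sums and mixtures are again images of product measures.\<close>

definition weighted :: "('a::euclidean_space \<times> real) measure \<Rightarrow> bool" where
  "weighted N \<longleftrightarrow> prob_space N \<and> sets N = sets borel \<and> integrable N snd"

definition wchar :: "('a::euclidean_space \<times> real) measure \<Rightarrow> 'a \<Rightarrow> complex" where
  "wchar N \<xi> = (\<integral>w. of_real (snd w) * cis (- (2 * pi * (fst w \<bullet> \<xi>))) \<partial>N)"

definition wconv :: "('a::euclidean_space \<times> real) measure \<Rightarrow> ('a \<Rightarrow> real) \<Rightarrow> 'a \<Rightarrow> real" where
  "wconv N g x = (\<integral>w. snd w * g (x + fst w) \<partial>N)"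

text \<open>Since \<open>wconv\<close> translates by + y, its adjoint translates by - y. It is the
  adjoint, acting on test functions, that multiplies the Fourier transform by
  \<open>wchar N\<close>.\<close>

definition wadj :: "('a::euclidean_space \<times> real) measure \<Rightarrow> ('a \<Rightarrow> complex) \<Rightarrow> 'a \<Rightarrow> complex" where
  "wadj N \<psi> x = (\<integral>w. of_real (snd w) * \<psi> (x - fst w) \<partial>N)"

lemma weighted_sets: "weighted N \<Longrightarrow> sets N = sets (borel \<Otimes>\<^sub>M borel)"
  by (metis weighted_def borel_prod)

lemma weighted_sigma_finite: "weighted N \<Longrightarrow> sigma_finite_measure N"
  by (simp add: weighted_def prob_space_imp_sigma_finite)

lemma weighted_integrable: "weighted N \<Longrightarrow> integrable N snd"
  by (simp add: weighted_def)

text \<open>Young's inequality for a finite signed measure, obtained as a mixture of translates,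
  which all have the same norm. The mass enters once through Jensen with power p - 1 and once
  through the integral.\<close>

lemma
  assumes p: "p > 1" and N: "weighted N" and g: "Lp_fun p g"
  shows wconv_Lp: "Lp_fun p (wconv N g)"
    and wconv_AE: "AE x in lborel. integrable N (\<lambda>w. snd w * g (x + fst w))"
    and wconv_np: "np p (wconv N g) \<le> (\<integral>w. \<bar>snd w\<bar> \<partial>N) powr p * np p g"
proof -
  have [measurable_cong]: "sets N = sets (borel \<Otimes>\<^sub>M borel)" by (rule weighted_sets[OF N])
  have [measurable]: "g \<in> borel_measurable borel" using g by (simp add: Lp_fun_def)
  have m: "(\<lambda>(w, x). g (x + fst w)) \<in> borel_measurable (N \<Otimes>\<^sub>M borel)" by measurable
  have i: "integrable N (\<lambda>w. \<bar>snd w\<bar> * np p (\<lambda>x. g (x + fst w)))"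
    using weighted_integrable[OF N] by (simp add: np_translate[OF g])
  note mix = p weighted_sigma_finite[OF N] m weighted_integrable[OF N] Lp_fun_translate[OF g] i
  show "Lp_fun p (wconv N g)" unfolding wconv_def[abs_def] by (rule Lp_fun_mixture[OF mix])
  show "AE x in lborel. integrable N (\<lambda>w. snd w * g (x + fst w))" by (rule AE_integrable_mixture[OF mix])
  have "np p (wconv N g) \<le> (\<integral>w. \<bar>snd w\<bar> \<partial>N) powr (p - 1) * (\<integral>w. \<bar>snd w\<bar> * np p (\<lambda>x. g (x + fst w)) \<partial>N)"
    unfolding wconv_def[abs_def] by (rule np_mixture_le[OF mix])
  also have "(\<integral>w. \<bar>snd w\<bar> * np p (\<lambda>x. g (x + fst w)) \<partial>N) = (\<integral>w. \<bar>snd w\<bar> \<partial>N) * np p g"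
    by (simp add: np_translate[OF g])
  also have "(\<integral>w. \<bar>snd w\<bar> \<partial>N) powr (p - 1) * ((\<integral>w. \<bar>snd w\<bar> \<partial>N) * np p g) = (\<integral>w. \<bar>snd w\<bar> \<partial>N) powr p * np p g"
  proof -
    have "(\<integral>w. \<bar>snd w\<bar> \<partial>N) powr (p - 1) * (\<integral>w. \<bar>snd w\<bar> \<partial>N) powr 1 = (\<integral>w. \<bar>snd w\<bar> \<partial>N) powr (p - 1 + 1)"
      by (rule powr_add[symmetric])
    then show ?thesis by simp
  qed
  finally show "np p (wconv N g) \<le> (\<integral>w. \<bar>snd w\<bar> \<partial>N) powr p * np p g" .
qed

text \<open>A class of test functions that pairs with L_p, is preserved by \<open>wadj\<close>, and
  contains the images of Schwartz functions under \<open>bessel_op\<close>.\<close>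

definition L1b :: "('a::euclidean_space \<Rightarrow> complex) \<Rightarrow> bool" where
  "L1b \<psi> \<longleftrightarrow> integrable lborel \<psi> \<and> bounded (range \<psi>)"

lemma L1b_schwartz: "schwartz \<phi> \<Longrightarrow> L1b \<phi>"
  unfolding L1b_def using schwartz_integrable schwartz_bounded[of \<phi>] by (metis boundedI rangeE)

lemma
  fixes g :: "'a::euclidean_space \<Rightarrow> real"
  assumes g: "Lp_fun p g" and p: "p > 1" and \<psi>: "integrable lborel \<psi>" and C: "\<And>x. norm (\<psi> x) \<le> C"
  shows integrable_Lp_mult: "integrable lborel (\<lambda>x. of_real (g x) * (\<psi> x :: complex))"
    and integral_Lp_mult_le: "(LINT x|lborel. norm (of_real (g x) * \<psi> x)) \<le> (LINT x|lborel. norm (\<psi> x)) + C * np p g"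
proof -
  have [measurable]: "g \<in> borel_measurable borel" "\<psi> \<in> borel_measurable borel" using g \<psi> by (auto simp: Lp_fun_def)
  have i: "integrable lborel (\<lambda>x. norm (\<psi> x) + C * \<bar>g x\<bar> powr p)"
    using \<psi> g by (auto simp: Lp_fun_def)
  have le: "norm (of_real (g x) * \<psi> x) \<le> norm (\<psi> x) + C * \<bar>g x\<bar> powr p" for x
  proof (cases "\<bar>g x\<bar> \<le> 1")
    case True
    have C0: "C \<ge> 0" using order.trans[OF norm_ge_zero C[of x]] .
    have "\<bar>g x\<bar> * norm (\<psi> x) \<le> 1 * norm (\<psi> x)" using True by (intro mult_right_mono) auto
    moreover have "0 \<le> C * \<bar>g x\<bar> powr p" using C0 by simp
    ultimately show ?thesis by (simp add: norm_mult)
  next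
    case False
    then have "\<bar>g x\<bar> powr 1 \<le> \<bar>g x\<bar> powr p" using p by (intro powr_mono) auto
    then have "\<bar>g x\<bar> * norm (\<psi> x) \<le> \<bar>g x\<bar> powr p * C" using C[of x] False by (intro mult_mono) auto
    then show ?thesis unfolding norm_mult norm_of_real mult.commute[of C] using norm_ge_zero[of "\<psi> x"] by linarith
  qed
  show I: "integrable lborel (\<lambda>x. of_real (g x) * \<psi> x)"
    by (rule Bochner_Integration.integrable_bound[OF i])
       (measurable, intro AE_I2 order.trans[OF le], simp)
  have "(LINT x|lborel. norm (of_real (g x) * \<psi> x)) \<le> (LINT x|lborel. norm (\<psi> x) + C * \<bar>g x\<bar> powr p)"
    using I i le by (intro integral_mono integrable_norm) auto
  also have "\<dots> = (LINT x|lborel. norm (\<psi> x)) + C * np p g"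
    using \<psi> g by (simp add: np_def Lp_fun_def)
  finally show "(LINT x|lborel. norm (of_real (g x) * \<psi> x)) \<le> (LINT x|lborel. norm (\<psi> x)) + C * np p g" .
qed

text \<open>Fubini and the substitution z = x + y. The second form expresses the pairing through
  translates of \<open>\<psi>\<close>: if g annihilates every translate, it annihilates
  \<open>wadj N \<psi>\<close>, which is how uniqueness is proved later.\<close>

lemma
  fixes g :: "'a::euclidean_space \<Rightarrow> real"
  assumes g: "Lp_fun p g" and p: "p > 1" and N: "weighted N" and \<psi>: "L1b \<psi>"
  shows wconv_adjoint: "(LINT x|lborel. of_real (wconv N g x) * \<psi> x) = (LINT z|lborel. of_real (g z) * wadj N \<psi> z)"
    and wadj_pairing: "(LINT z|lborel. of_real (g z) * wadj N \<psi> z) = (\<integral>w. of_real (snd w) * (LINT z|lborel. of_real (g z) * \<psi> (z - fst w)) \<partial>N)"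
proof -
  interpret N: prob_space N using N by (simp add: weighted_def)
  interpret P: pair_sigma_finite N lborel by standard
  have [measurable_cong]: "sets N = sets (borel \<Otimes>\<^sub>M borel)" by (rule weighted_sets[OF N])
  have i\<psi>: "integrable lborel \<psi>" using \<psi> by (simp add: L1b_def)
  obtain C where C: "\<And>x. norm (\<psi> x) \<le> C" using \<psi> by (auto simp: L1b_def bounded_iff)
  have [measurable]: "g \<in> borel_measurable borel" "\<psi> \<in> borel_measurable borel" using g i\<psi> by (auto simp: Lp_fun_def)
  define K where "K = (LINT x|lborel. norm (\<psi> x)) + C * np p g"
  have snd1: "integrable N (\<lambda>w. \<bar>snd w\<bar> * K)" using weighted_integrable[OF N] by simp
  have tr: "integrable lborel (\<lambda>x. \<psi> (x - y))" "(LINT x|lborel. norm (\<psi> (x - y))) = (LINT x|lborel. norm (\<psi> x))" for y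
    using integrable_affine_iff[of 1 \<psi> "- y"] i\<psi> integral_affine[of 1 "\<lambda>x. norm (\<psi> x)" "- y"] by auto
  let ?F = "\<lambda>(w, x). of_real (snd w) * (of_real (g (x + fst w)) * \<psi> x)"
  have b1: "(LINT x|lborel. norm (of_real (g (x + y)) * \<psi> x)) \<le> K" for y
    using integral_Lp_mult_le[OF Lp_fun_translate[OF g] p i\<psi> C, of y] by (simp add: K_def np_translate[OF g])
  have b2: "(LINT x|lborel. norm (of_real (g x) * \<psi> (x - y))) \<le> K" for y
    using integral_Lp_mult_le[OF g p tr(1) C, of y] by (simp add: K_def tr(2))
  have K0: "K \<ge> 0" using order.trans[OF _ b1] by simp
  have IF: "integrable (N \<Otimes>\<^sub>M lborel) ?F"
  proof (rule P.Fubini_integrable)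
    show "?F \<in> borel_measurable (N \<Otimes>\<^sub>M lborel)" by measurable
    show "AE w in N. integrable lborel (\<lambda>x. ?F (w, x))"
      using integrable_Lp_mult[OF Lp_fun_translate[OF g] p i\<psi> C] by (auto intro!: AE_I2)
    have eq: "(LINT x|lborel. norm (?F (w, x))) = \<bar>snd w\<bar> * (LINT x|lborel. norm (of_real (g (x + fst w)) * \<psi> x))" for w
      by (simp add: norm_mult)
    show "integrable N (\<lambda>w. LINT x|lborel. norm (?F (w, x)))"
    proof (rule Bochner_Integration.integrable_bound[OF snd1])
      show "AE w in N. norm (LINT x|lborel. norm (?F (w, x))) \<le> norm (\<bar>snd w\<bar> * K)"
        unfolding eq using b1 K0 by (intro AE_I2) (simp add: abs_mult mult_left_mono)
    qed measurable
  qed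
  let ?G = "\<lambda>(w, z). of_real (snd w) * (of_real (g z) * \<psi> (z - fst w))"
  have IG: "integrable (N \<Otimes>\<^sub>M lborel) ?G"
  proof (rule P.Fubini_integrable)
    show "?G \<in> borel_measurable (N \<Otimes>\<^sub>M lborel)" by measurable
    show "AE w in N. integrable lborel (\<lambda>x. ?G (w, x))"
      using integrable_Lp_mult[OF g p tr(1) C] by (auto intro!: AE_I2)
    have eq: "(LINT x|lborel. norm (?G (w, x))) = \<bar>snd w\<bar> * (LINT x|lborel. norm (of_real (g x) * \<psi> (x - fst w)))" for w
      by (simp add: norm_mult)
    show "integrable N (\<lambda>w. LINT x|lborel. norm (?G (w, x)))"
    proof (rule Bochner_Integration.integrable_bound[OF snd1])
      show "AE w in N. norm (LINT x|lborel. norm (?G (w, x))) \<le> norm (\<bar>snd w\<bar> * K)"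
        unfolding eq using b2 K0 by (intro AE_I2) (simp add: abs_mult mult_left_mono)
    qed measurable
  qed
  have 1: "(LINT x|lborel. of_real (wconv N g x) * \<psi> x) = (\<integral>w. (LINT x|lborel. ?F (w, x)) \<partial>N)"
  proof -
    have "(LINT x|lborel. of_real (wconv N g x) * \<psi> x) = (LINT x|lborel. (\<integral>w. ?F (w, x) \<partial>N))"
    proof (rule Bochner_Integration.integral_cong[OF refl])
      fix x
      have "complex_of_real (wconv N g x) * \<psi> x = (\<integral>w. of_real (snd w * g (x + fst w)) * \<psi> x \<partial>N)"
        unfolding wconv_def by (simp only: integral_complex_of_real[symmetric] integral_mult_left_zero)
      then show "complex_of_real (wconv N g x) * \<psi> x = (\<integral>w. ?F (w, x) \<partial>N)" by (simp add: mult.assoc)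
    qed
    also have "\<dots> = (\<integral>w. (LINT x|lborel. ?F (w, x)) \<partial>N)" using P.Fubini_integral[OF IF] by simp
    finally show ?thesis .
  qed
  have 2: "(LINT x|lborel. ?F (w, x)) = (LINT z|lborel. ?G (w, z))" for w
  proof -
    have "(LINT x|lborel. ?F (w, x)) = (LINT x|lborel. ?G (w, x + fst w))" by simp
    also have "\<dots> = (LINT z|lborel. ?G (w, z))"
      using integral_affine[of 1 "\<lambda>z. ?G (w, z)" "fst w"] by simp
    finally show ?thesis .
  qed
  have 3: "(\<integral>w. (LINT x|lborel. ?G (w, x)) \<partial>N) = (LINT z|lborel. of_real (g z) * wadj N \<psi> z)"
  proof -
    have "(\<integral>w. (LINT x|lborel. ?G (w, x)) \<partial>N) = (LINT z|lborel. (\<integral>w. ?G (w, z) \<partial>N))"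
      using P.Fubini_integral[OF IG] by simp
    also have "\<dots> = (LINT z|lborel. of_real (g z) * wadj N \<psi> z)"
    proof (rule Bochner_Integration.integral_cong[OF refl])
      fix z
      have "(\<integral>w. ?G (w, z) \<partial>N) = (\<integral>w. of_real (g z) * (of_real (snd w) * \<psi> (z - fst w)) \<partial>N)"
        by (intro Bochner_Integration.integral_cong) (auto simp: algebra_simps)
      then show "(\<integral>w. ?G (w, z) \<partial>N) = of_real (g z) * wadj N \<psi> z" by (simp add: wadj_def)
    qed
    finally show ?thesis .
  qed
  show "(LINT x|lborel. of_real (wconv N g x) * \<psi> x) = (LINT z|lborel. of_real (g z) * wadj N \<psi> z)"
    unfolding 1 2 by (rule 3)
  show "(LINT z|lborel. of_real (g z) * wadj N \<psi> z) = (\<integral>w. of_real (snd w) * (LINT z|lborel. of_real (g z) * \<psi> (z - fst w)) \<partial>N)"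
    using 3 by simp
qed

lemma wadj_L1b:
  assumes N: "weighted N" and \<psi>: "L1b \<psi>"
  shows "L1b (wadj N \<psi>)"
proof -
  interpret N: prob_space N using N by (simp add: weighted_def)
  interpret P: pair_sigma_finite N lborel by standard
  have [measurable_cong]: "sets N = sets (borel \<Otimes>\<^sub>M borel)" by (rule weighted_sets[OF N])
  have i\<psi>: "integrable lborel \<psi>" using \<psi> by (simp add: L1b_def)
  obtain C where C: "\<And>x. norm (\<psi> x) \<le> C" using \<psi> by (auto simp: L1b_def bounded_iff)
  have [measurable]: "\<psi> \<in> borel_measurable borel" using i\<psi> by auto
  have tr: "integrable lborel (\<lambda>x. \<psi> (x - y))" "(LINT x|lborel. norm (\<psi> (x - y))) = (LINT x|lborel. norm (\<psi> x))" for y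
    using integrable_affine_iff[of 1 \<psi> "- y"] i\<psi> integral_affine[of 1 "\<lambda>x. norm (\<psi> x)" "- y"] by auto
  let ?G = "\<lambda>(w, z). of_real (snd w) * \<psi> (z - fst w)"
  have IG: "integrable (N \<Otimes>\<^sub>M lborel) ?G"
  proof (rule P.Fubini_integrable)
    show "?G \<in> borel_measurable (N \<Otimes>\<^sub>M lborel)" by measurable
    show "AE w in N. integrable lborel (\<lambda>x. ?G (w, x))" using tr(1) by (auto intro!: AE_I2)
    have "(LINT x|lborel. norm (?G (w, x))) = \<bar>snd w\<bar> * (LINT x|lborel. norm (\<psi> x))" for w
      by (simp add: norm_mult tr(2))
    then show "integrable N (\<lambda>w. LINT x|lborel. norm (?G (w, x)))"
      using weighted_integrable[OF N] by simp
  qed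
  have "integrable lborel (wadj N \<psi>)"
    using P.integrable_snd[OF IG] by (simp add: wadj_def[abs_def])
  moreover have "bounded (range (wadj N \<psi>))"
  proof (rule boundedI)
    fix y assume "y \<in> range (wadj N \<psi>)"
    then obtain x where y: "y = wadj N \<psi> x" by auto
    have "norm (wadj N \<psi> x) \<le> (\<integral>w. norm (complex_of_real (snd w) * \<psi> (x - fst w)) \<partial>N)"
      unfolding wadj_def by (rule integral_norm_bound)
    also have "\<dots> \<le> (\<integral>w. \<bar>snd w\<bar> * C \<partial>N)"
    proof (rule integral_mono)
      show i: "integrable N (\<lambda>w. \<bar>snd w\<bar> * C)" using weighted_integrable[OF N] by simp
      have C0: "C \<ge> 0" using order.trans[OF norm_ge_zero C[of x]] .
      show "integrable N (\<lambda>w. norm (complex_of_real (snd w) * \<psi> (x - fst w)))"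
        by (rule Bochner_Integration.integrable_bound[OF i])
           (measurable, intro AE_I2, simp add: norm_mult abs_mult C0 mult_left_mono C)
    qed (simp add: norm_mult mult_left_mono C)
    finally show "norm y \<le> (\<integral>w. \<bar>snd w\<bar> * C \<partial>N)" by (simp add: y)
  qed
  ultimately show ?thesis by (simp add: L1b_def)
qed

lemma norm_wchar_le: "norm (wchar N \<xi>) \<le> (\<integral>w. \<bar>snd w\<bar> \<partial>N)"
  unfolding wchar_def
  using integral_norm_bound[of N "\<lambda>w. of_real (snd w) * cis (- (2 * pi * (fst w \<bullet> \<xi>)))"] by (simp add: norm_mult)

lemma wchar_measurable:
  assumes N: "weighted N" shows "wchar N \<in> borel_measurable borel"
proof -
  interpret N: prob_space N using N by (simp add: weighted_def)
  have [measurable_cong]: "sets N = sets (borel \<Otimes>\<^sub>M borel)" by (rule weighted_sets[OF N])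
  show ?thesis unfolding wchar_def[abs_def] by measurable
qed

lemma integrable_wchar_mult:
  fixes \<Psi> :: "'a::euclidean_space \<Rightarrow> complex"
  assumes N: "weighted N" and \<Psi>: "integrable lborel \<Psi>"
  shows "integrable lborel (\<lambda>\<xi>. wchar N \<xi> * \<Psi> \<xi>)"
proof (rule Bochner_Integration.integrable_bound)
  have [measurable]: "wchar N \<in> borel_measurable borel" by (rule wchar_measurable[OF N])
  show "integrable lborel (\<lambda>\<xi>. (\<integral>w. \<bar>snd w\<bar> \<partial>N) * norm (\<Psi> \<xi>))" using \<Psi> by simp
  show "(\<lambda>\<xi>. wchar N \<xi> * \<Psi> \<xi>) \<in> borel_measurable lborel" using \<Psi> by measurable
  show "AE \<xi> in lborel. norm (wchar N \<xi> * \<Psi> \<xi>) \<le> norm ((\<integral>w. \<bar>snd w\<bar> \<partial>N) * norm (\<Psi> \<xi>))"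
    by (intro AE_I2) (simp add: norm_mult abs_mult mult_right_mono norm_wchar_le)
qed

lemma wadj_inv_fourier:
  fixes \<Psi> :: "'a::euclidean_space \<Rightarrow> complex"
  assumes N: "weighted N" and \<Psi>: "integrable lborel \<Psi>"
  shows "wadj N (inv_fourier \<Psi>) z = inv_fourier (\<lambda>\<xi>. wchar N \<xi> * \<Psi> \<xi>) z"
proof -
  interpret N: prob_space N using N by (simp add: weighted_def)
  interpret P: pair_sigma_finite N lborel by standard
  have [measurable_cong]: "sets N = sets (borel \<Otimes>\<^sub>M borel)" by (rule weighted_sets[OF N])
  have [measurable]: "\<Psi> \<in> borel_measurable borel" using \<Psi> by auto
  let ?F = "\<lambda>(w, \<xi>). of_real (snd w) * (\<Psi> \<xi> * cis (2 * pi * ((z - fst w) \<bullet> \<xi>)))"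
  have I: "integrable (N \<Otimes>\<^sub>M lborel) ?F"
  proof (rule P.Fubini_integrable)
    show "?F \<in> borel_measurable (N \<Otimes>\<^sub>M lborel)" by measurable
    show "AE w in N. integrable lborel (\<lambda>x. ?F (w, x))"
      using \<Psi> by (auto intro!: AE_I2 integrable_mult_right integrable_mult_cis)
    have "(LINT x|lborel. norm (?F (w, x))) = \<bar>snd w\<bar> * (LINT x|lborel. norm (\<Psi> x))" for w
      by (simp add: norm_mult)
    then show "integrable N (\<lambda>w. LINT x|lborel. norm (?F (w, x)))"
      using weighted_integrable[OF N] by simp
  qed
  have "wadj N (inv_fourier \<Psi>) z = (\<integral>w. (LINT \<xi>|lborel. ?F (w, \<xi>)) \<partial>N)"
    unfolding wadj_def inv_fourier_cis by simp
  also have "\<dots> = (LINT \<xi>|lborel. (\<integral>w. ?F (w, \<xi>) \<partial>N))" using P.Fubini_integral[OF I] by simp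
  also have "\<dots> = (LINT \<xi>|lborel. (wchar N \<xi> * \<Psi> \<xi>) * cis (2 * pi * (z \<bullet> \<xi>)))"
  proof (rule Bochner_Integration.integral_cong[OF refl])
    fix \<xi>
    have "(\<integral>w. ?F (w, \<xi>) \<partial>N) = (\<integral>w. (of_real (snd w) * cis (- (2 * pi * (fst w \<bullet> \<xi>)))) * (\<Psi> \<xi> * cis (2 * pi * (z \<bullet> \<xi>))) \<partial>N)"
    proof (rule Bochner_Integration.integral_cong[OF refl])
      fix w :: "'a \<times> real"
      have "cis (2 * pi * ((z - fst w) \<bullet> \<xi>)) = cis (- (2 * pi * (fst w \<bullet> \<xi>))) * cis (2 * pi * (z \<bullet> \<xi>))"
        by (simp add: cis_mult inner_diff_left algebra_simps)
      then show "?F (w, \<xi>) = (of_real (snd w) * cis (- (2 * pi * (fst w \<bullet> \<xi>)))) * (\<Psi> \<xi> * cis (2 * pi * (z \<bullet> \<xi>)))"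
        by (simp add: mult_ac)
    qed
    also have "\<dots> = wchar N \<xi> * (\<Psi> \<xi> * cis (2 * pi * (z \<bullet> \<xi>)))"
      unfolding wchar_def by (rule integral_mult_left_zero)
    finally show "(\<integral>w. ?F (w, \<xi>) \<partial>N) = (wchar N \<xi> * \<Psi> \<xi>) * cis (2 * pi * (z \<bullet> \<xi>))"
      by (simp only: mult.assoc)
  qed
  finally show ?thesis by (simp add: inv_fourier_cis)
qed

text \<open>Normalise |k| M to a probability measure and take its image under (Y, C sgn k): the
  weight C sgn k restores the mass and the sign. If the total mass C vanishes, a point mass with
  weight 0 serves.\<close>

lemma weighted_exists:
  fixes Y :: "'w \<Rightarrow> 'a::euclidean_space"
  assumes k: "integrable M k" and Y[measurable]: "Y \<in> borel_measurable M"
  shows "\<exists>N. weighted N \<and> (\<forall>\<xi>. wchar N \<xi> = (\<integral>w. of_real (k w) * cis (- (2 * pi * (Y w \<bullet> \<xi>))) \<partial>M))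
     \<and> (\<forall>g\<in>borel_measurable borel. \<forall>x. wconv N g x = (\<integral>w. k w * g (x + Y w) \<partial>M))"
proof -
  have [measurable]: "k \<in> borel_measurable M" using k by auto
  have fs: "fst \<in> (borel :: ('a \<times> real) measure) \<rightarrow>\<^sub>M borel" "snd \<in> (borel :: ('a \<times> real) measure) \<rightarrow>\<^sub>M borel"
    unfolding borel_prod[symmetric] by measurable
  note [measurable] = fs
  define C where "C = (\<integral>w. \<bar>k w\<bar> \<partial>M)"
  show ?thesis
  proof (cases "C = 0")
    case True
    then have k0: "AE w in M. k w = 0"
      using integral_nonneg_eq_0_iff_AE[of M "\<lambda>w. \<bar>k w\<bar>"] k by (auto simp: C_def)
    define N where "N = return borel (0::'a, 0::real)"
    have "weighted N"
      unfolding weighted_def N_def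
      by (auto intro!: prob_space_return simp: integrable_iff_bounded nn_integral_return)
    moreover have "wchar N \<xi> = (\<integral>w. of_real (k w) * cis (- (2 * pi * (Y w \<bullet> \<xi>))) \<partial>M)" for \<xi>
    proof -
      have "(\<integral>w. of_real (k w) * cis (- (2 * pi * (Y w \<bullet> \<xi>))) \<partial>M) = (\<integral>w. 0 \<partial>M)"
        using k0 by (intro integral_cong_AE) (auto elim!: eventually_mono)
      then show ?thesis unfolding wchar_def N_def by (subst integral_return) auto
    qed
    moreover have "wconv N g x = (\<integral>w. k w * g (x + Y w) \<partial>M)" if [measurable]: "g \<in> borel_measurable borel" for g x
    proof -
      have "(\<integral>w. k w * g (x + Y w) \<partial>M) = (\<integral>w. 0 \<partial>M)"
        using k0 by (intro integral_cong_AE) (auto elim!: eventually_mono)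
      then show ?thesis unfolding wconv_def N_def by (subst integral_return) auto
    qed
    ultimately show ?thesis by blast
  next
    case False
    moreover have "C \<ge> 0" by (simp add: C_def)
    ultimately have C: "C > 0" by simp
    define D where "D = density M (\<lambda>w. ennreal (\<bar>k w\<bar> / C))"
    define Z where "Z = (\<lambda>w. (Y w, C * sgn (k w)))"
    have [measurable]: "Z \<in> M \<rightarrow>\<^sub>M borel" unfolding Z_def borel_prod[symmetric] by measurable
    have ZD[measurable]: "Z \<in> D \<rightarrow>\<^sub>M borel" unfolding D_def by measurable
    have pD: "prob_space D"
    proof (rule prob_spaceI)
      have "emeasure D (space D) = (\<integral>\<^sup>+w. ennreal (\<bar>k w\<bar> / C) \<partial>M)"
        unfolding D_def by (subst emeasure_density) (auto intro!: nn_integral_cong simp: indicator_def)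
      also have "\<dots> = ennreal (\<integral>w. \<bar>k w\<bar> / C \<partial>M)"
        using k C by (intro nn_integral_eq_integral) auto
      also have "(\<integral>w. \<bar>k w\<bar> / C \<partial>M) = 1" using C by (simp add: C_def)
      finally show "emeasure D (space D) = 1" by simp
    qed
    define N where "N = distr D borel Z"
    have kk: "\<bar>k w\<bar> / C * C * sgn (k w) = k w" for w using C by (simp add: sgn_if)
    have "weighted N"
      unfolding weighted_def N_def
    proof (intro conjI)
      show "prob_space (distr D borel Z)" by (rule prob_space.prob_space_distr[OF pD ZD])
      have "integrable M (\<lambda>w. (\<bar>k w\<bar> / C) *\<^sub>R snd (Z w))" unfolding Z_def snd_conv real_scaleR_def mult.assoc[symmetric] kk by (rule k)
      then have "integrable D (\<lambda>w. snd (Z w))"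
        unfolding D_def using C by (subst integrable_density) auto
      then show "integrable (distr D borel Z) snd" by (subst integrable_distr_eq) auto
    qed simp
    moreover have "wchar N \<xi> = (\<integral>w. of_real (k w) * cis (- (2 * pi * (Y w \<bullet> \<xi>))) \<partial>M)" for \<xi>
    proof -
      have "wchar N \<xi> = (\<integral>w. of_real (snd (Z w)) * cis (- (2 * pi * (fst (Z w) \<bullet> \<xi>))) \<partial>D)"
        unfolding wchar_def N_def by (subst integral_distr) auto
      also have "\<dots> = (\<integral>w. (\<bar>k w\<bar> / C) *\<^sub>R (of_real (snd (Z w)) * cis (- (2 * pi * (fst (Z w) \<bullet> \<xi>)))) \<partial>M)"
        unfolding D_def using C by (subst integral_density) auto
      also have "\<dots> = (\<integral>w. of_real (k w) * cis (- (2 * pi * (Y w \<bullet> \<xi>))) \<partial>M)"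
        by (intro Bochner_Integration.integral_cong refl)
           (simp only: Z_def fst_conv snd_conv scaleR_conv_of_real mult.assoc[symmetric] of_real_mult[symmetric] kk)
      finally show ?thesis .
    qed
    moreover have "wconv N g x = (\<integral>w. k w * g (x + Y w) \<partial>M)" if [measurable]: "g \<in> borel_measurable borel" for g x
    proof -
      have "wconv N g x = (\<integral>w. snd (Z w) * g (x + fst (Z w)) \<partial>D)"
        unfolding wconv_def N_def by (subst integral_distr) auto
      also have "\<dots> = (\<integral>w. (\<bar>k w\<bar> / C) *\<^sub>R (snd (Z w) * g (x + fst (Z w))) \<partial>M)"
        unfolding D_def using C by (subst integral_density) auto
      also have "\<dots> = (\<integral>w. k w * g (x + Y w) \<partial>M)"
        by (intro Bochner_Integration.integral_cong refl) (simp only: Z_def fst_conv snd_conv real_scaleR_def mult.assoc[symmetric] kk)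
      finally show ?thesis .
    qed
    ultimately show ?thesis by blast
  qed
qed

section \<open>The algebra of symbols\<close>

definition symbol :: "('a::euclidean_space \<Rightarrow> real) \<Rightarrow> bool" where
  "symbol m \<longleftrightarrow> (\<exists>N. weighted N \<and> (\<forall>\<xi>. wchar N \<xi> = of_real (m \<xi>)))"

lemma symbolI:
  fixes Y :: "'w \<Rightarrow> 'a::euclidean_space"
  assumes "integrable M k" "Y \<in> borel_measurable M"
    "\<And>\<xi>. (\<integral>w. of_real (k w) * cis (- (2 * pi * (Y w \<bullet> \<xi>))) \<partial>M) = of_real (m \<xi>)"
  shows "symbol m"
  using weighted_exists[OF assms(1,2)] assms(3) unfolding symbol_def by metis

lemma symbol_const: "symbol (\<lambda>_::'a::euclidean_space. c)"
  by (rule symbolI[of "count_space {()}" "\<lambda>_. c" "\<lambda>_. 0 :: 'a"])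
     (auto simp: lebesgue_integral_count_space_finite integrable_count_space)

lemma symbol_cmult: assumes "symbol m" shows "symbol (\<lambda>\<xi>. c * m \<xi>)"
proof -
  obtain N where N: "weighted N" "\<And>\<xi>. wchar N \<xi> = of_real (m \<xi>)" using assms by (auto simp: symbol_def)
  have [measurable_cong]: "sets N = sets (borel \<Otimes>\<^sub>M borel)" by (rule weighted_sets[OF N(1)])
  show ?thesis
  proof (rule symbolI[of N "\<lambda>w. c * snd w" fst])
    show "integrable N (\<lambda>w. c * snd w)" using weighted_integrable[OF N(1)] by simp
    show "(\<integral>w. of_real (c * snd w) * cis (- (2 * pi * (fst w \<bullet> \<xi>))) \<partial>N) = of_real (c * m \<xi>)" for \<xi>
      using N(2)[of \<xi>] by (simp add: wchar_def mult.assoc)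
  qed measurable
qed

text \<open>The product comes from the convolution of the measures: on the product space the points
  are added and the weights multiplied.\<close>

lemma
  assumes "symbol m1" "symbol m2"
  shows symbol_mult: "symbol (\<lambda>\<xi>. m1 \<xi> * m2 \<xi>)"
    and symbol_add: "symbol (\<lambda>\<xi>. m1 \<xi> + m2 \<xi>)"
proof -
  obtain N1 where N1: "weighted N1" "\<And>\<xi>. wchar N1 \<xi> = of_real (m1 \<xi>)" using assms by (auto simp: symbol_def)
  obtain N2 where N2: "weighted N2" "\<And>\<xi>. wchar N2 \<xi> = of_real (m2 \<xi>)" using assms by (auto simp: symbol_def)
  have [measurable_cong]: "sets N1 = sets (borel \<Otimes>\<^sub>M borel)" "sets N2 = sets (borel \<Otimes>\<^sub>M borel)"
    by (rule weighted_sets[OF N1(1)] weighted_sets[OF N2(1)])+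
  interpret N1: prob_space N1 using N1 by (simp add: weighted_def)
  interpret N2: prob_space N2 using N2 by (simp add: weighted_def)
  interpret P: pair_prob_space N1 N2 by standard
  note i1 = weighted_integrable[OF N1(1)] and i2 = weighted_integrable[OF N2(1)]
  have c1: "integrable N1 (\<lambda>w. of_real (snd w) * cis (- (2 * pi * (fst w \<bullet> \<xi>))))" for \<xi>
    using i1 by (intro integrable_mult_cis) auto
  have c2: "integrable N2 (\<lambda>w. of_real (snd w) * cis (- (2 * pi * (fst w \<bullet> \<xi>))))" for \<xi>
    using i2 by (intro integrable_mult_cis) auto
  show "symbol (\<lambda>\<xi>. m1 \<xi> * m2 \<xi>)"
  proof (rule symbolI[of "N1 \<Otimes>\<^sub>M N2" "\<lambda>(v, w). snd v * snd w" "\<lambda>(v, w). fst v + fst w"])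
    show "integrable (N1 \<Otimes>\<^sub>M N2) (\<lambda>(v, w). snd v * snd w)"
    proof (rule P.Fubini_integrable)
      show "integrable N1 (\<lambda>v. \<integral>w. norm (case (v, w) of (v, w) \<Rightarrow> snd v * snd w) \<partial>N2)"
        using i1 by (simp add: abs_mult)
    qed (use i2 in \<open>auto intro!: AE_I2\<close>)
    fix \<xi>
    have "(\<integral>w. of_real (case w of (v, w) \<Rightarrow> snd v * snd w) * cis (- (2 * pi * ((case w of (v, w) \<Rightarrow> fst v + fst w) \<bullet> \<xi>))) \<partial>(N1 \<Otimes>\<^sub>M N2))
        = (\<integral>x. (of_real (snd (fst x)) * cis (- (2 * pi * (fst (fst x) \<bullet> \<xi>)))) * (of_real (snd (snd x)) * cis (- (2 * pi * (fst (snd x) \<bullet> \<xi>)))) \<partial>(N1 \<Otimes>\<^sub>M N2))"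
    proof (rule Bochner_Integration.integral_cong[OF refl])
      fix x :: "('a \<times> real) \<times> ('a \<times> real)"
      have "cis (- (2 * pi * ((fst (fst x) + fst (snd x)) \<bullet> \<xi>))) = cis (- (2 * pi * (fst (fst x) \<bullet> \<xi>))) * cis (- (2 * pi * (fst (snd x) \<bullet> \<xi>)))"
        by (simp add: cis_mult inner_add_left algebra_simps)
      then show "of_real (case x of (v, w) \<Rightarrow> snd v * snd w) * cis (- (2 * pi * ((case x of (v, w) \<Rightarrow> fst v + fst w) \<bullet> \<xi>)))
        = (of_real (snd (fst x)) * cis (- (2 * pi * (fst (fst x) \<bullet> \<xi>)))) * (of_real (snd (snd x)) * cis (- (2 * pi * (fst (snd x) \<bullet> \<xi>))))"
        by (simp add: case_prod_beta mult_ac)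
    qed
    also have "\<dots> = (\<integral>v. (\<integral>w. (of_real (snd v) * cis (- (2 * pi * (fst v \<bullet> \<xi>)))) * (of_real (snd w) * cis (- (2 * pi * (fst w \<bullet> \<xi>)))) \<partial>N2) \<partial>N1)"
    proof -
      have "integrable (N1 \<Otimes>\<^sub>M N2) (\<lambda>(v, w). (of_real (snd v) * cis (- (2 * pi * (fst v \<bullet> \<xi>)))) * (of_real (snd w) * cis (- (2 * pi * (fst w \<bullet> \<xi>)))))"
      proof (rule P.Fubini_integrable)
        show "integrable N1 (\<lambda>v. \<integral>w. norm (case (v, w) of (v, w) \<Rightarrow> (complex_of_real (snd v) * cis (- (2 * pi * (fst v \<bullet> \<xi>)))) * (of_real (snd w) * cis (- (2 * pi * (fst w \<bullet> \<xi>))))) \<partial>N2)"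
          using i1 by (simp add: norm_mult)
      qed (use c2 in \<open>auto intro!: AE_I2\<close>)
      from P.integral_fst[OF this] show ?thesis by (simp add: case_prod_unfold)
    qed
    also have "\<dots> = of_real (m1 \<xi> * m2 \<xi>)"
      using N1(2)[of \<xi>] N2(2)[of \<xi>] by (simp add: wchar_def)
    finally show "(\<integral>w. of_real (case w of (v, w) \<Rightarrow> snd v * snd w) * cis (- (2 * pi * ((case w of (v, w) \<Rightarrow> fst v + fst w) \<bullet> \<xi>))) \<partial>(N1 \<Otimes>\<^sub>M N2)) = of_real (m1 \<xi> * m2 \<xi>)" .
  qed measurable
  interpret B: sigma_finite_measure "count_space (UNIV :: bool set)"
    by (rule sigma_finite_measure_count_space_countable) simp
  interpret Q: pair_sigma_finite "count_space (UNIV :: bool set)" "N1 \<Otimes>\<^sub>M N2" by standard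
  \<comment> \<open>A disjoint union of N1 and N2, encoded on a product: the boolean selects the
    component, and the other component integrates out because it is a probability measure.\<close>
  let ?v = "\<lambda>(b, v, w). if b then v else w"
  have vm[measurable]: "?v \<in> count_space UNIV \<Otimes>\<^sub>M (N1 \<Otimes>\<^sub>M N2) \<rightarrow>\<^sub>M (borel \<Otimes>\<^sub>M borel)" by measurable
  have fst_int: "integrable (N1 \<Otimes>\<^sub>M N2) (\<lambda>x. f (fst x))" "(\<integral>x. f (fst x) \<partial>(N1 \<Otimes>\<^sub>M N2)) = (\<integral>v. f v \<partial>N1)"
    if f: "integrable N1 f" for f :: "_ \<Rightarrow> complex"
  proof -
    have [measurable]: "f \<in> borel_measurable N1" using f by auto
    have "integrable (N1 \<Otimes>\<^sub>M N2) (\<lambda>(v, w). f v)"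
      by (rule P.Fubini_integrable) (use f in \<open>auto simp: N2.prob_space\<close>)
    then show "integrable (N1 \<Otimes>\<^sub>M N2) (\<lambda>x. f (fst x))" "(\<integral>x. f (fst x) \<partial>(N1 \<Otimes>\<^sub>M N2)) = (\<integral>v. f v \<partial>N1)"
      using P.integral_fst[of "\<lambda>v w. f v"] by (auto simp: case_prod_unfold N2.prob_space)
  qed
  have snd_int: "integrable (N1 \<Otimes>\<^sub>M N2) (\<lambda>x. f (snd x))" "(\<integral>x. f (snd x) \<partial>(N1 \<Otimes>\<^sub>M N2)) = (\<integral>v. f v \<partial>N2)"
    if f: "integrable N2 f" for f :: "_ \<Rightarrow> complex"
  proof -
    have [measurable]: "f \<in> borel_measurable N2" using f by auto
    have "integrable (N1 \<Otimes>\<^sub>M N2) (\<lambda>(v, w). f w)"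
      by (rule P.Fubini_integrable) (use f in \<open>auto simp: N1.prob_space\<close>)
    then show "integrable (N1 \<Otimes>\<^sub>M N2) (\<lambda>x. f (snd x))" "(\<integral>x. f (snd x) \<partial>(N1 \<Otimes>\<^sub>M N2)) = (\<integral>v. f v \<partial>N2)"
      using P.integral_fst[of "\<lambda>v w. f w"] by (auto simp: case_prod_unfold N1.prob_space)
  qed
  have both: "integrable (count_space UNIV \<Otimes>\<^sub>M (N1 \<Otimes>\<^sub>M N2)) (\<lambda>x. f (?v x))
      \<and> (\<integral>x. f (?v x) \<partial>(count_space UNIV \<Otimes>\<^sub>M (N1 \<Otimes>\<^sub>M N2))) = (\<integral>v. f v \<partial>N1) + (\<integral>v. f v \<partial>N2)"
    if f: "integrable N1 f" "integrable N2 f" and [measurable]: "f \<in> borel_measurable (borel \<Otimes>\<^sub>M borel)" for f :: "_ \<Rightarrow> complex"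
  proof -
    let ?g = "\<lambda>(b, x). f (if b then fst x else snd x)"
    have I: "integrable (count_space UNIV \<Otimes>\<^sub>M (N1 \<Otimes>\<^sub>M N2)) ?g"
    proof (rule Q.Fubini_integrable)
      show "?g \<in> borel_measurable (count_space UNIV \<Otimes>\<^sub>M (N1 \<Otimes>\<^sub>M N2))" by measurable
      show "integrable (count_space UNIV) (\<lambda>b. \<integral>y. norm (?g (b, y)) \<partial>(N1 \<Otimes>\<^sub>M N2))"
        by (rule integrable_count_space) simp
      show "AE b in count_space UNIV. integrable (N1 \<Otimes>\<^sub>M N2) (\<lambda>y. ?g (b, y))"
      proof (rule AE_I2)
        fix b show "integrable (N1 \<Otimes>\<^sub>M N2) (\<lambda>y. ?g (b, y))"
          using fst_int(1)[OF f(1)] snd_int(1)[OF f(2)] by (cases b) auto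
      qed
    qed
    have "(\<integral>x. ?g x \<partial>(count_space UNIV \<Otimes>\<^sub>M (N1 \<Otimes>\<^sub>M N2))) = (\<integral>b. (\<integral>y. ?g (b, y) \<partial>(N1 \<Otimes>\<^sub>M N2)) \<partial>count_space UNIV)"
      using Q.integral_fst'[OF I] by simp
    also have "\<dots> = (\<integral>v. f v \<partial>N1) + (\<integral>v. f v \<partial>N2)"
      using fst_int(2)[OF f(1)] snd_int(2)[OF f(2)]
      by (subst lebesgue_integral_count_space_finite) (auto simp: UNIV_bool)
    finally have E: "(\<integral>x. ?g x \<partial>(count_space UNIV \<Otimes>\<^sub>M (N1 \<Otimes>\<^sub>M N2))) = (\<integral>v. f v \<partial>N1) + (\<integral>v. f v \<partial>N2)" .
    have "?g = (\<lambda>x. f (?v x))" by (auto simp: fun_eq_iff)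
    with I E show ?thesis by metis
  qed
  show "symbol (\<lambda>\<xi>. m1 \<xi> + m2 \<xi>)"
  proof (rule symbolI[of "count_space UNIV \<Otimes>\<^sub>M (N1 \<Otimes>\<^sub>M N2)" "\<lambda>x. snd (?v x)" "\<lambda>x. fst (?v x)"])
    have "integrable (count_space UNIV \<Otimes>\<^sub>M (N1 \<Otimes>\<^sub>M N2)) (\<lambda>x. complex_of_real (snd (?v x)))"
      using both[of "\<lambda>v. complex_of_real (snd v)"] i1 i2 by simp
    then show "integrable (count_space UNIV \<Otimes>\<^sub>M (N1 \<Otimes>\<^sub>M N2)) (\<lambda>x. snd (?v x))"
      by (simp only: complex_of_real_integrable_eq)
    show "(\<integral>x. of_real (snd (?v x)) * cis (- (2 * pi * (fst (?v x) \<bullet> \<xi>))) \<partial>(count_space UNIV \<Otimes>\<^sub>M (N1 \<Otimes>\<^sub>M N2))) = of_real (m1 \<xi> + m2 \<xi>)" for \<xi>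
      using both[of "\<lambda>v. complex_of_real (snd v) * cis (- (2 * pi * (fst v \<bullet> \<xi>)))"] c1[of \<xi>] c2[of \<xi>] N1(2)[of \<xi>] N2(2)[of \<xi>]
      by (simp add: wchar_def)
  qed measurable
qed

section \<open>Gaussian mixtures\<close>

text \<open>Each Gaussian factor is the transform of a rescaled Gaussian measure, so the joint law
  of parameter and Gaussian variable represents the mixture. Separate rates for the directions serve
  the tensor symbol, where two groups of coordinates have independent rates.\<close>

lemma symbol_gauss_mixture:
  fixes t :: "'a::euclidean_space \<Rightarrow> 'w \<Rightarrow> real"
  assumes M: "sigma_finite_measure M" and k: "integrable M k"
    and t[measurable]: "\<And>b. b \<in> Basis \<Longrightarrow> t b \<in> borel_measurable M"
    and t0: "\<And>b w. b \<in> Basis \<Longrightarrow> t b w \<ge> 0"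
  shows "symbol (\<lambda>\<xi>::'a. \<integral>w. k w * exp (- (\<Sum>b\<in>Basis. t b w * (\<xi> \<bullet> b)\<^sup>2)) \<partial>M)"
proof -
  interpret M: sigma_finite_measure M by fact
  interpret P: pair_sigma_finite M "lborel :: 'a measure" by standard
  have [measurable]: "k \<in> borel_measurable M" using k by auto
  \<comment> \<open>The rate t in a direction corresponds to the scaling sqrt (t / pi), since
    \<open>gauss \<eta>\<close> is exp (- pi |\<eta>|^2).\<close>
  define Y where "Y = (\<lambda>(w, z::'a). \<Sum>b\<in>Basis. (sqrt (t b w / pi) * (z \<bullet> b)) *\<^sub>R b)"
  have Ym: "Y \<in> borel_measurable (M \<Otimes>\<^sub>M lborel)" unfolding Y_def by measurable
  let ?k = "\<lambda>(w, z::'a). k w * gauss z"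
  have Ik: "integrable (M \<Otimes>\<^sub>M lborel) ?k"
  proof (rule P.Fubini_integrable)
    show "?k \<in> borel_measurable (M \<Otimes>\<^sub>M lborel)" by measurable
    show "integrable M (\<lambda>w. LINT z|lborel. norm (?k (w, z)))"
      using k by (simp add: abs_mult abs_of_pos gauss_pos integral_gauss)
    show "AE w in M. integrable lborel (\<lambda>z. ?k (w, z))"
      by (simp add: integrable_gauss)
  qed
  show ?thesis
  proof (rule symbolI[OF Ik Ym])
    fix \<xi> :: 'a
    have inner: "(LINT z|lborel. complex_of_real (gauss z) * cis (- (2 * pi * (Y (w, z) \<bullet> \<xi>)))) = of_real (exp (- (\<Sum>b\<in>Basis. t b w * (\<xi> \<bullet> b)\<^sup>2)))" for w
    proof -
      define \<eta> where "\<eta> = (\<Sum>b\<in>Basis. (sqrt (t b w / pi) * (\<xi> \<bullet> b)) *\<^sub>R b)"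
      have \<eta>b: "\<eta> \<bullet> b = sqrt (t b w / pi) * (\<xi> \<bullet> b)" if "b \<in> Basis" for b
        using that by (simp add: \<eta>_def)
      have "Y (w, z) \<bullet> \<xi> = z \<bullet> \<eta>" for z
      proof -
        have "Y (w, z) \<bullet> \<xi> = (\<Sum>b\<in>Basis. sqrt (t b w / pi) * (z \<bullet> b) * (b \<bullet> \<xi>))" by (simp add: Y_def inner_sum_left)
        also have "\<dots> = (\<Sum>b\<in>Basis. (z \<bullet> b) * (\<eta> \<bullet> b))" by (intro sum.cong refl) (simp add: \<eta>b inner_commute[of \<xi>])
        finally show ?thesis by (simp only: euclidean_inner[of z \<eta>])
      qed
      then have "(LINT z|lborel. complex_of_real (gauss z) * cis (- (2 * pi * (Y (w, z) \<bullet> \<xi>)))) = of_real (gauss \<eta>)"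
        by (simp add: fourier_gauss)
      also have "gauss \<eta> = exp (- (\<Sum>b\<in>Basis. t b w * (\<xi> \<bullet> b)\<^sup>2))"
      proof -
        have "(norm \<eta>)\<^sup>2 = (\<Sum>b\<in>Basis. (\<eta> \<bullet> b)\<^sup>2)"
          by (simp add: norm_eq_sqrt_inner euclidean_inner[of \<eta> \<eta>] power2_eq_square sum_nonneg)
        also have "\<dots> = (\<Sum>b\<in>Basis. t b w / pi * (\<xi> \<bullet> b)\<^sup>2)"
          using t0 by (intro sum.cong refl) (simp add: \<eta>b power_mult_distrib)
        finally show ?thesis by (simp add: gauss_def sum_distrib_left sum_negf)
      qed
      finally show ?thesis .
    qed
    have I2: "integrable (M \<Otimes>\<^sub>M lborel) (\<lambda>x. of_real (?k x) * cis (- (2 * pi * (Y x \<bullet> \<xi>))))"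
      using Ik Ym by (intro integrable_mult_cis) auto
    have "(\<integral>x. of_real (?k x) * cis (- (2 * pi * (Y x \<bullet> \<xi>))) \<partial>(M \<Otimes>\<^sub>M lborel)) = (\<integral>w. (LINT z|lborel. of_real (?k (w, z)) * cis (- (2 * pi * (Y (w, z) \<bullet> \<xi>)))) \<partial>M)"
      using P.integral_fst'[OF I2] by simp
    also have "\<dots> = (\<integral>w. of_real (k w) * of_real (exp (- (\<Sum>b\<in>Basis. t b w * (\<xi> \<bullet> b)\<^sup>2))) \<partial>M)"
      by (simp add: inner[symmetric] mult.assoc)
    also have "\<dots> = of_real (\<integral>w. k w * exp (- (\<Sum>b\<in>Basis. t b w * (\<xi> \<bullet> b)\<^sup>2)) \<partial>M)"
      by (simp only: of_real_mult[symmetric] integral_complex_of_real)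
    finally show "(\<integral>x. of_real (?k x) * cis (- (2 * pi * (Y x \<bullet> \<xi>))) \<partial>(M \<Otimes>\<^sub>M lborel)) = of_real (\<integral>w. k w * exp (- (\<Sum>b\<in>Basis. t b w * (\<xi> \<bullet> b)\<^sup>2)) \<partial>M)" .
  qed
qed

lemma symbol_power: "symbol m \<Longrightarrow> symbol (\<lambda>\<xi>. m \<xi> ^ n)"
  by (induction n) (auto intro: symbol_const symbol_mult)

lemma symbol_diff: "symbol m1 \<Longrightarrow> symbol m2 \<Longrightarrow> symbol (\<lambda>\<xi>. m1 \<xi> - m2 \<xi>)"
  using symbol_add[OF _ symbol_cmult[of m2 "-1"], of m1] by simp

text \<open>Powers extended by 0 to the negative half-line: integrals over the half-line become
  integrals over \<open>lborel\<close>, and shifted densities in t - m vanish by themselves before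
  m.\<close>

definition ppow :: "real \<Rightarrow> real \<Rightarrow> real" where
  "ppow a t = (if t > 0 then t powr a else 0)"

lemma ppow_measurable [measurable]: "ppow a \<in> borel_measurable borel"
  unfolding ppow_def by measurable

lemma ppow_nonneg [simp]: "ppow a t \<ge> 0"
  by (simp add: ppow_def)

lemma ppow_mult: "A > 0 \<Longrightarrow> ppow a (A * t) = A powr a * ppow a t"
  by (auto simp: ppow_def powr_mult zero_less_mult_iff)

lemma
  fixes f :: "real \<Rightarrow> real"
  assumes "\<And>x. x \<in> S \<Longrightarrow> 0 \<le> f x" "(f has_integral I) S" and [measurable]: "(\<lambda>x. indicator S x * f x) \<in> borel_measurable borel"
  shows integrable_has_integral_nonneg: "integrable lborel (\<lambda>x. indicator S x * f x)"
    and integral_has_integral_nonneg: "(LINT x|lborel. indicator S x * f x) = I"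
proof -
  have nn: "(\<integral>\<^sup>+x. ennreal (indicator S x * f x) \<partial>lborel) = ennreal I"
    by (rule nn_integral_has_integral_lebesgue[OF assms(1,2)])
  have pos: "0 \<le> indicator S x * f x" for x using assms(1) by (auto simp: indicator_def)
  show i: "integrable lborel (\<lambda>x. indicator S x * f x)"
    by (rule integrableI_nonneg) (use nn pos in auto)
  have "ennreal (LINT x|lborel. indicator S x * f x) = ennreal I"
    using nn_integral_eq_integral[OF i] nn pos by simp
  moreover have "I \<ge> 0" by (rule has_integral_nonneg[OF assms(2,1)])
  ultimately show "(LINT x|lborel. indicator S x * f x) = I" using pos by (simp add: integral_nonneg)
qed

lemma
  assumes s: "s > 0" and A: "A > 0"
  shows integrable_gamma: "integrable lborel (\<lambda>t. ppow (s - 1) t * exp (- (A * t)))"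
    and integral_gamma: "(LINT t|lborel. ppow (s - 1) t * exp (- (A * t))) = Gamma s * A powr (- s)"
proof -
  have eq: "(\<lambda>t. indicator {0..} t * (t powr (s - 1) / exp t)) = (\<lambda>t. ppow (s - 1) t * exp (- t))"
    by (auto simp: ppow_def indicator_def fun_eq_iff exp_minus field_simps)
  have m: "(\<lambda>t. indicator {0..} t * (t powr (s - 1) / exp t)) \<in> borel_measurable borel"
    unfolding eq by measurable
  have i1: "integrable lborel (\<lambda>t. ppow (s - 1) t * exp (- t))"
    unfolding eq[symmetric] by (rule integrable_has_integral_nonneg[OF _ Gamma_integral_real[OF s] m]) simp
  have v1: "(LINT t|lborel. ppow (s - 1) t * exp (- t)) = Gamma s"
    unfolding eq[symmetric] by (rule integral_has_integral_nonneg[OF _ Gamma_integral_real[OF s] m]) simp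
  have sc: "ppow (s - 1) (A *\<^sub>R t + 0) * exp (- (A *\<^sub>R t + 0)) = A powr (s - 1) * (ppow (s - 1) t * exp (- (A * t)))" for t
    using A by (simp add: ppow_mult)
  have i2: "integrable lborel (\<lambda>t. A powr (s - 1) * (ppow (s - 1) t * exp (- (A * t))))"
    using i1 integrable_affine_iff[of A "\<lambda>t. ppow (s - 1) t * exp (- t)" 0] A unfolding sc by simp
  then show "integrable lborel (\<lambda>t. ppow (s - 1) t * exp (- (A * t)))" using A by simp
  have "A powr (s - 1) * (LINT t|lborel. ppow (s - 1) t * exp (- (A * t))) = Gamma s / A"
    using v1 integral_affine[of A "\<lambda>t. ppow (s - 1) t * exp (- t)" 0] A unfolding sc by simp
  then have "(LINT t|lborel. ppow (s - 1) t * exp (- (A * t))) = Gamma s / (A * A powr (s - 1))"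
    using A by (simp add: field_simps)
  also have "A * A powr (s - 1) = A powr s" using A by (simp add: powr_diff)
  finally show "(LINT t|lborel. ppow (s - 1) t * exp (- (A * t))) = Gamma s * A powr (- s)"
    by (simp add: powr_minus divide_inverse)
qed

text \<open>For 0 < s < 1 integration by parts gives the value Gamma (1 - s) / s.\<close>

definition frac_const :: "real \<Rightarrow> real" where
  "frac_const s = (LINT \<tau>|lborel. ppow (- 1 - s) \<tau> * (1 - exp (- \<tau>)))"

text \<open>The Levy-Khintchine integral for the power A^s. The factor 1 - exp tames the singularity
  at 0, where the integrand is at most \<tau>^(-s); the factor \<open>exp 1\<close> compensates exp
  (- \<tau>) on the unit interval, so the Gamma integral is a majorant there.\<close>

lemma
  assumes s: "0 < s" "s < 1" and A: "A > 0"
  shows integrable_frac: "integrable lborel (\<lambda>\<tau>. ppow (- 1 - s) \<tau> * (1 - exp (- (A * \<tau>))))"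
    and integral_frac: "(LINT \<tau>|lborel. ppow (- 1 - s) \<tau> * (1 - exp (- (A * \<tau>)))) = frac_const s * A powr s"
proof -
  have b1: "integrable lborel (\<lambda>\<tau>. exp 1 * (ppow (- s) \<tau> * exp (- \<tau>)))"
    using integrable_gamma[of "1 - s" 1] s by simp
  have b2: "integrable lborel (\<lambda>\<tau>::real. indicator {1..} \<tau> * \<tau> powr (- 1 - s))"
    by (rule integrable_has_integral_nonneg[OF _ has_integral_powr_to_inf]) (use s in auto)
  have le: "norm (ppow (- 1 - s) \<tau> * (1 - exp (- \<tau>))) \<le> exp 1 * (ppow (- s) \<tau> * exp (- \<tau>)) + indicator {1..} \<tau> * \<tau> powr (- 1 - s)" for \<tau>
  proof -
    consider "\<tau> \<le> 0" | "0 < \<tau>" "\<tau> < 1" | "\<tau> \<ge> 1" by linarith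
    then show ?thesis
    proof cases
      case 2
      have "1 - exp (- \<tau>) \<le> \<tau>" using exp_ge_add_one_self[of "- \<tau>"] by linarith
      then have "\<tau> powr (- 1 - s) * (1 - exp (- \<tau>)) \<le> \<tau> powr (- 1 - s) * \<tau>" by (intro mult_left_mono) auto
      also have "\<dots> = \<tau> powr (- s)" using 2 by (simp add: powr_diff powr_minus field_simps)
      also have "\<dots> \<le> \<tau> powr (- s) * (exp 1 * exp (- \<tau>))" using 2 by (simp add: exp_add[symmetric])
      finally show ?thesis using 2 by (simp add: ppow_def abs_mult mult_ac)
    next
      case 3
      have "\<tau> powr (- 1 - s) * (1 - exp (- \<tau>)) \<le> \<tau> powr (- 1 - s) * 1" by (intro mult_left_mono) auto
      then have "norm (ppow (- 1 - s) \<tau> * (1 - exp (- \<tau>))) \<le> indicator {1..} \<tau> * \<tau> powr (- 1 - s)" using 3 by (simp add: ppow_def abs_mult)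
      moreover have "0 \<le> exp 1 * (ppow (- s) \<tau> * exp (- \<tau>))" by simp
      ultimately show ?thesis by linarith
    qed (simp add: ppow_def)
  qed
  have i1: "integrable lborel (\<lambda>\<tau>. ppow (- 1 - s) \<tau> * (1 - exp (- \<tau>)))"
    by (rule Bochner_Integration.integrable_bound[OF Bochner_Integration.integrable_add[OF b1 b2]])
       (measurable, intro AE_I2 order.trans[OF le], simp)
  have sc: "ppow (- 1 - s) (A *\<^sub>R \<tau> + 0) * (1 - exp (- (A *\<^sub>R \<tau> + 0))) = A powr (- 1 - s) * (ppow (- 1 - s) \<tau> * (1 - exp (- (A * \<tau>))))" for \<tau>
    using A by (simp add: ppow_mult)
  have "integrable lborel (\<lambda>\<tau>. A powr (- 1 - s) * (ppow (- 1 - s) \<tau> * (1 - exp (- (A * \<tau>)))))"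
    using i1 integrable_affine_iff[of A "\<lambda>\<tau>. ppow (- 1 - s) \<tau> * (1 - exp (- \<tau>))" 0] A unfolding sc by simp
  then show "integrable lborel (\<lambda>\<tau>. ppow (- 1 - s) \<tau> * (1 - exp (- (A * \<tau>))))" using A by simp
  have "A powr (- 1 - s) * (LINT \<tau>|lborel. ppow (- 1 - s) \<tau> * (1 - exp (- (A * \<tau>)))) = frac_const s / A"
    using integral_affine[of A "\<lambda>\<tau>. ppow (- 1 - s) \<tau> * (1 - exp (- \<tau>))" 0] A unfolding sc by (simp add: frac_const_def)
  moreover have "A powr (- 1 - s) = 1 / (A * A powr s)" using A by (simp add: powr_diff powr_minus field_simps)
  ultimately show "(LINT \<tau>|lborel. ppow (- 1 - s) \<tau> * (1 - exp (- (A * \<tau>)))) = frac_const s * A powr s"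
    using A by (simp add: field_simps)
qed

lemma frac_const_pos:
  assumes s: "0 < s" "s < 1" shows "frac_const s > 0"
proof -
  let ?f = "\<lambda>\<tau>. ppow (- 1 - s) \<tau> * (1 - exp (- \<tau>))"
  have pos: "0 \<le> ?f \<tau>" for \<tau> by (auto simp: ppow_def)
  have i: "integrable lborel ?f" using integrable_frac[OF s, of 1] by simp
  have "frac_const s \<ge> 0" unfolding frac_const_def using pos by simp
  moreover have "frac_const s \<noteq> 0"
  proof
    assume "frac_const s = 0"
    then have "AE \<tau> in lborel. ?f \<tau> = 0"
      using integral_nonneg_eq_0_iff_AE[OF i] pos by (auto simp: frac_const_def)
    then have "AE \<tau> in lborel. \<tau> \<notin> {0<..<1::real}" by eventually_elim (auto simp: ppow_def)
    then have "emeasure lborel {0<..<1::real} = 0" by (subst (asm) AE_iff_measurable[of "{0<..<1}"]) auto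
    then show False by simp
  qed
  ultimately show ?thesis by simp
qed

lemma norm2_Basis: "(norm (\<xi>::'a::euclidean_space))\<^sup>2 = (\<Sum>b\<in>Basis. (\<xi> \<bullet> b)\<^sup>2)"
  by (simp add: norm_eq_sqrt_inner euclidean_inner[of \<xi> \<xi>] power2_eq_square sum_nonneg)

text \<open>A^(-s) is the Gamma integral of exp (- A t), hence a mixture of Gaussians. The
  coefficients may vanish, so weights in some of the coordinates are included besides dilated
  norms.\<close>

lemma symbol_bessel:
  fixes c :: "'a::euclidean_space \<Rightarrow> real"
  assumes s: "s \<ge> 0" and c: "\<And>b. b \<in> Basis \<Longrightarrow> c b \<ge> 0"
  shows "symbol (\<lambda>\<xi>. (1 + (\<Sum>b\<in>Basis. c b * (\<xi> \<bullet> b)\<^sup>2)) powr (- s))"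
proof (cases "s = 0")
  case True
  have "1 + (\<Sum>b\<in>Basis. c b * (\<xi> \<bullet> b)\<^sup>2) > 0" for \<xi> :: 'a
    using c by (intro add_pos_nonneg sum_nonneg) auto
  then have "(\<lambda>\<xi>::'a. (1 + (\<Sum>b\<in>Basis. c b * (\<xi> \<bullet> b)\<^sup>2)) powr (- s)) = (\<lambda>_. 1)"
    using True by (simp add: fun_eq_iff less_imp_neq[THEN not_sym])
  then show ?thesis by (simp add: symbol_const)
next
  case False
  then have s: "s > 0" using s by simp
  let ?k = "\<lambda>t. 1 / Gamma s * (ppow (s - 1) t * exp (- t))"
  have k: "integrable lborel ?k" using integrable_gamma[OF s, of 1] by simp
  \<comment> \<open>Rates have to be nonnegative for all t; \<open>max 0 t\<close> differs from t
    only where the density \<open>?k\<close> is 0.\<close>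
  have "symbol (\<lambda>\<xi>::'a. LINT t|lborel. ?k t * exp (- (\<Sum>b\<in>Basis. (c b * max 0 t) * (\<xi> \<bullet> b)\<^sup>2)))"
    by (rule symbol_gauss_mixture[OF sigma_finite_lborel k]) (use c in auto)
  also have "(\<lambda>\<xi>::'a. LINT t|lborel. ?k t * exp (- (\<Sum>b\<in>Basis. (c b * max 0 t) * (\<xi> \<bullet> b)\<^sup>2))) = (\<lambda>\<xi>. (1 + (\<Sum>b\<in>Basis. c b * (\<xi> \<bullet> b)\<^sup>2)) powr (- s))"
  proof
    fix \<xi> :: 'a
    define a where "a = (\<Sum>b\<in>Basis. c b * (\<xi> \<bullet> b)\<^sup>2)"
    have a: "a \<ge> 0" unfolding a_def using c by (intro sum_nonneg) auto
    have e: "(\<Sum>b\<in>Basis. (c b * max 0 t) * (\<xi> \<bullet> b)\<^sup>2) = max 0 t * a" for t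
      by (simp add: a_def sum_distrib_left mult_ac)
    have a1: "1 + a > 0" using a by simp
    have st: "?k t * exp (- (max 0 t * a)) = 1 / Gamma s * (ppow (s - 1) t * exp (- ((1 + a) * t)))" for t
      by (cases "t > 0") (auto simp: ppow_def exp_add[symmetric] algebra_simps)
    have "(LINT t|lborel. ?k t * exp (- (\<Sum>b\<in>Basis. (c b * max 0 t) * (\<xi> \<bullet> b)\<^sup>2))) = 1 / Gamma s * (Gamma s * (1 + a) powr (- s))"
      unfolding e st integral_mult_right_zero integral_gamma[OF s a1] ..
    also have "\<dots> = (1 + a) powr (- s)" using Gamma_real_pos[OF s] by simp
    finally show "(LINT t|lborel. ?k t * exp (- (\<Sum>b\<in>Basis. (c b * max 0 t) * (\<xi> \<bullet> b)\<^sup>2))) = (1 + (\<Sum>b\<in>Basis. c b * (\<xi> \<bullet> b)\<^sup>2)) powr (- s)"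
      by (simp add: a_def)
  qed
  finally show ?thesis .
qed

lemma symbol_bessel_norm:
  assumes "s \<ge> 0" "c \<ge> 0"
  shows "symbol (\<lambda>\<xi>::'a::euclidean_space. (1 + c * (norm \<xi>)\<^sup>2) powr (- s))"
  using symbol_bessel[where 'a='a, OF assms(1), of "\<lambda>_. c"] assms(2) by (simp add: norm2_Basis sum_distrib_left)

text \<open>Both sides of the difference \<open>(1 + c a)\<^sup>s - (c/d)\<^sup>s (1 + d a)\<^sup>s\<close> are integrals of \<open>1 - exp\<close> with the same
  singularity at \<open>0\<close>, so the difference is an absolutely convergent Gaussian mixture.\<close>

lemma symbol_ratio_frac:
  assumes s: "0 < s" "s < 1" and c: "c > 0" and d: "d > 0"
  shows "symbol (\<lambda>\<xi>::'a::euclidean_space. (1 + c * (norm \<xi>)\<^sup>2) powr s * (1 + d * (norm \<xi>)\<^sup>2) powr (- s))"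
proof -
  \<comment> \<open>With r = c/d one has r (1 + d a) = r + c a, so both exponentials share the
    factor exp (- c a \<tau>) and the remaining density does not depend on a.\<close>
  define r where "r = c / d"
  have r: "r > 0" using c d by (simp add: r_def)
  let ?k = "\<lambda>\<tau>. 1 / frac_const s * (ppow (- 1 - s) \<tau> * (1 - exp (- (1 * \<tau>))) - ppow (- 1 - s) \<tau> * (1 - exp (- (r * \<tau>))))"
  have k: "integrable lborel ?k"
    by (intro integrable_mult_right Bochner_Integration.integrable_diff integrable_frac s r zero_less_one)
  have mix: "symbol (\<lambda>\<xi>::'a. LINT \<tau>|lborel. ?k \<tau> * exp (- (\<Sum>b\<in>Basis. (c * max 0 \<tau>) * (\<xi> \<bullet> b)\<^sup>2)))"
    by (rule symbol_gauss_mixture[OF sigma_finite_lborel k]) (use c in auto)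
  have eq: "(LINT \<tau>|lborel. ?k \<tau> * exp (- (\<Sum>b\<in>Basis. (c * max 0 \<tau>) * (\<xi> \<bullet> b)\<^sup>2))) = (1 + c * (norm \<xi>)\<^sup>2) powr s - r powr s * (1 + d * (norm \<xi>)\<^sup>2) powr s" for \<xi> :: 'a
  proof -
    define a where "a = (norm \<xi>)\<^sup>2"
    have a: "a \<ge> 0" by (simp add: a_def)
    have e: "(\<Sum>b\<in>Basis. (c * max 0 \<tau>) * (\<xi> \<bullet> b)\<^sup>2) = c * max 0 \<tau> * a" for \<tau>
      by (simp add: a_def norm2_Basis sum_distrib_left)
    have rd: "r * (1 + d * a) = r + c * a" using d by (simp add: r_def field_simps)
    have u: "1 + c * a > 0" and v: "r * (1 + d * a) > 0" using a c d r by (auto intro!: add_pos_nonneg mult_pos_pos)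
    have st: "?k \<tau> * exp (- (c * max 0 \<tau> * a)) = 1 / frac_const s * (ppow (- 1 - s) \<tau> * (1 - exp (- ((1 + c * a) * \<tau>))) - ppow (- 1 - s) \<tau> * (1 - exp (- ((r * (1 + d * a)) * \<tau>))))" for \<tau>
    proof (cases "\<tau> > 0")
      case True
      have e1: "exp (- ((1 + c * a) * \<tau>)) = exp (- (1 * \<tau>)) * exp (- (c * max 0 \<tau> * a))"
        using True by (simp add: exp_add[symmetric] algebra_simps)
      have e2: "exp (- ((r * (1 + d * a)) * \<tau>)) = exp (- (r * \<tau>)) * exp (- (c * max 0 \<tau> * a))"
        unfolding rd using True by (simp add: exp_add[symmetric] algebra_simps)
      show ?thesis unfolding e1 e2 by (simp only: left_diff_distrib right_diff_distrib mult_1_right mult.assoc)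
    qed (simp add: ppow_def)
    have "(LINT \<tau>|lborel. ?k \<tau> * exp (- (\<Sum>b\<in>Basis. (c * max 0 \<tau>) * (\<xi> \<bullet> b)\<^sup>2))) = 1 / frac_const s * (frac_const s * (1 + c * a) powr s - frac_const s * (r * (1 + d * a)) powr s)"
      unfolding e st integral_mult_right_zero
        Bochner_Integration.integral_diff[OF integrable_frac[OF s u] integrable_frac[OF s v]] integral_frac[OF s u] integral_frac[OF s v] ..
    also have "\<dots> = (1 + c * a) powr s - (r * (1 + d * a)) powr s"
      using frac_const_pos[OF s] by (simp add: field_simps)
    also have "(r * (1 + d * a)) powr s = r powr s * (1 + d * a) powr s" by (rule powr_mult)
    finally show ?thesis by (simp add: a_def)
  qed
  \<comment> \<open>Dividing the difference by (1 + d |\<xi>|^2)^s leaves the quotient minus the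
    constant r^s, which is added back.\<close>
  have "symbol (\<lambda>\<xi>::'a. ((1 + c * (norm \<xi>)\<^sup>2) powr s - r powr s * (1 + d * (norm \<xi>)\<^sup>2) powr s) * (1 + d * (norm \<xi>)\<^sup>2) powr (- s) + r powr s)"
    using mix unfolding eq using s d by (intro symbol_add symbol_mult symbol_bessel_norm symbol_const) auto
  also have "(\<lambda>\<xi>::'a. ((1 + c * (norm \<xi>)\<^sup>2) powr s - r powr s * (1 + d * (norm \<xi>)\<^sup>2) powr s) * (1 + d * (norm \<xi>)\<^sup>2) powr (- s) + r powr s)
     = (\<lambda>\<xi>. (1 + c * (norm \<xi>)\<^sup>2) powr s * (1 + d * (norm \<xi>)\<^sup>2) powr (- s))"
  proof
    fix \<xi> :: 'a
    have v: "1 + d * (norm \<xi>)\<^sup>2 > 0" using d by (intro add_pos_nonneg) auto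
    show "((1 + c * (norm \<xi>)\<^sup>2) powr s - r powr s * (1 + d * (norm \<xi>)\<^sup>2) powr s) * (1 + d * (norm \<xi>)\<^sup>2) powr (- s) + r powr s
       = (1 + c * (norm \<xi>)\<^sup>2) powr s * (1 + d * (norm \<xi>)\<^sup>2) powr (- s)"
      using v by (simp add: algebra_simps powr_minus)
  qed
  finally show ?thesis .
qed

lemma powr_split_floor:
  fixes x s :: real assumes "x > 0" "s \<ge> 0"
  shows "x powr s = x ^ nat \<lfloor>s\<rfloor> * x powr (frac s)"
proof -
  have "x powr s = x powr (real (nat \<lfloor>s\<rfloor>) + frac s)" using assms by (simp add: frac_def)
  also have "\<dots> = x powr real (nat \<lfloor>s\<rfloor>) * x powr frac s" by (rule powr_add)
  finally show ?thesis using assms by (simp only: powr_realpow)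
qed

text \<open>The fractional part of the exponent is the previous lemma. For the integer part, with v
  = 1 + d |\<xi>|^2, the plain quotient is c/d + (1 - c/d) / v, a symbol whose powers are
  symbols.\<close>

lemma symbol_ratio:
  assumes s: "s \<ge> 0" and c: "c > 0" and d: "d > 0"
  shows "symbol (\<lambda>\<xi>::'a::euclidean_space. (1 + c * (norm \<xi>)\<^sup>2) powr s * (1 + d * (norm \<xi>)\<^sup>2) powr (- s))"
proof -
  define n where "n = nat \<lfloor>s\<rfloor>"
  define f where "f = frac s"
  have f: "0 \<le> f" "f < 1" by (auto simp: f_def frac_ge_0 frac_lt_1)
  let ?u = "\<lambda>\<xi>::'a. 1 + c * (norm \<xi>)\<^sup>2" and ?v = "\<lambda>\<xi>::'a. 1 + d * (norm \<xi>)\<^sup>2"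
  have u: "?u \<xi> > 0" and v: "?v \<xi> > 0" for \<xi> using c d by (auto intro!: add_pos_nonneg)
  have F: "symbol (\<lambda>\<xi>. ?u \<xi> powr f * ?v \<xi> powr (- f))"
  proof (cases "f = 0")
    case True
    have "(\<lambda>\<xi>. ?u \<xi> powr f * ?v \<xi> powr (- f)) = (\<lambda>_. 1)" using True u v by (auto simp: fun_eq_iff less_imp_neq[THEN not_sym])
    then show ?thesis by (simp add: symbol_const)
  next
    case False
    then show ?thesis using f c d by (intro symbol_ratio_frac) auto
  qed
  have "symbol (\<lambda>\<xi>. ((1 - c / d) * ?v \<xi> powr (- 1) + c / d) ^ n)"
    using d by (intro symbol_power symbol_add symbol_cmult symbol_const symbol_bessel_norm) auto
  from symbol_mult[OF this F]
  have "symbol (\<lambda>\<xi>. ((1 - c / d) * ?v \<xi> powr (- 1) + c / d) ^ n * (?u \<xi> powr f * ?v \<xi> powr (- f)))" .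
  also have "(\<lambda>\<xi>. ((1 - c / d) * ?v \<xi> powr (- 1) + c / d) ^ n * (?u \<xi> powr f * ?v \<xi> powr (- f))) = (\<lambda>\<xi>. ?u \<xi> powr s * ?v \<xi> powr (- s))"
  proof
    fix \<xi> :: 'a
    have "(1 - c / d) * ?v \<xi> powr (- 1) + c / d = ?u \<xi> / ?v \<xi>"
    proof -
      have "?u \<xi> = c / d * ?v \<xi> + (1 - c / d)" using d by (simp add: field_simps)
      then have "?u \<xi> / ?v \<xi> = (c / d * ?v \<xi> + (1 - c / d)) / ?v \<xi>" by simp
      also have "\<dots> = c / d + (1 - c / d) / ?v \<xi>" using v[of \<xi>] by (simp only: add_divide_distrib) simp
      finally show ?thesis using v[of \<xi>] by (simp add: powr_minus_divide)
    qed
    moreover have "?u \<xi> powr s = ?u \<xi> ^ n * ?u \<xi> powr f" "?v \<xi> powr s = ?v \<xi> ^ n * ?v \<xi> powr f"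
      using powr_split_floor[OF u s] powr_split_floor[OF v s] by (auto simp: n_def f_def)
    ultimately show "((1 - c / d) * ?v \<xi> powr (- 1) + c / d) ^ n * (?u \<xi> powr f * ?v \<xi> powr (- f)) = ?u \<xi> powr s * ?v \<xi> powr (- s)"
      using v[of \<xi>] by (simp add: powr_minus_divide power_divide)
  qed
  finally show ?thesis .
qed

section \<open>The tensor symbol\<close>

lemma
  fixes u v :: "real \<Rightarrow> real"
  assumes u: "integrable lborel u" and v: "integrable lborel v"
  shows integrable_prod_real: "integrable lborel (\<lambda>x. u (fst x) * v (snd x))"
    and integral_prod_real: "(LINT x|lborel. u (fst x) * v (snd x)) = (LINT t|lborel. u t) * (LINT t|lborel. v t)"
proof -
  have [measurable]: "u \<in> borel_measurable borel" "v \<in> borel_measurable borel" using u v by auto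
  have I: "integrable (lborel \<Otimes>\<^sub>M lborel) (\<lambda>x. u (fst x) * v (snd x))"
  proof (rule lborel_pair.Fubini_integrable)
    show "integrable lborel (\<lambda>x. LINT y|lborel. norm (u (fst (x, y)) * v (snd (x, y))))"
      using u by (simp add: abs_mult)
    show "AE x in lborel. integrable lborel (\<lambda>y. u (fst (x, y)) * v (snd (x, y)))" using v by simp
  qed measurable
  then show "integrable lborel (\<lambda>x. u (fst x) * v (snd x))" by (simp add: lborel_prod)
  show "(LINT x|lborel. u (fst x) * v (snd x)) = (LINT t|lborel. u t) * (LINT t|lborel. v t)"
    using lborel_pair.integral_fst'[OF I] by (simp add: lborel_prod)
qed

text \<open>A mixture over three parameters: \<tau>, which couples the two Laplace transforms, and
  one rate for each of them. The integrability assumption is finiteness of the total mass of this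
  mixture.\<close>

lemma symbol_two_var:
  fixes f :: "real \<Rightarrow> real \<Rightarrow> real" and I :: "'a::euclidean_space set"
  assumes I: "I \<subseteq> Basis" "j \<in> Basis" "j \<notin> I"
    and f[measurable]: "(\<lambda>x. f (fst x) (snd x)) \<in> borel_measurable (borel \<Otimes>\<^sub>M borel)"
    and fi: "\<And>\<tau>. integrable lborel (f \<tau>)" and f0: "\<And>\<tau> t. t \<le> 0 \<Longrightarrow> f \<tau> t = 0"
    and w[measurable]: "w \<in> borel_measurable borel"
    and int: "integrable lborel (\<lambda>\<tau>. \<bar>w \<tau>\<bar> * (LINT t|lborel. \<bar>f \<tau> t\<bar>)\<^sup>2)"
  shows "symbol (\<lambda>\<xi>::'a. LINT \<tau>|lborel. w \<tau> * ((LINT t|lborel. f \<tau> t * exp (- (t * (\<Sum>b\<in>I. (\<xi> \<bullet> b)\<^sup>2))))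
     * (LINT t|lborel. f \<tau> t * exp (- (t * (\<xi> \<bullet> j)\<^sup>2)))))"
proof -
  have [measurable]: "(\<lambda>x. f (u x) (v x)) \<in> borel_measurable M" if [measurable]: "u \<in> borel_measurable M" "v \<in> borel_measurable M" for u v and M :: "'c measure"
    using measurable_compose[of "\<lambda>x. (u x, v x)" M "borel \<Otimes>\<^sub>M borel" "\<lambda>x. f (fst x) (snd x)" borel] by simp
  let ?k = "\<lambda>x::real \<times> (real \<times> real). w (fst x) * (f (fst x) (fst (snd x)) * f (fst x) (snd (snd x)))"
  have m1: "?k \<in> borel_measurable (lborel \<Otimes>\<^sub>M lborel)"
    unfolding lborel_prod[symmetric] by measurable
  have fa: "integrable lborel (\<lambda>t. \<bar>f \<tau> t\<bar>)" for \<tau> using fi by simp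
  have Ik: "integrable (lborel \<Otimes>\<^sub>M lborel) ?k"
  proof (rule lborel_pair.Fubini_integrable[OF m1])
    have "(LINT y|lborel. norm (?k (\<tau>, y))) = \<bar>w \<tau>\<bar> * (LINT t|lborel. \<bar>f \<tau> t\<bar>)\<^sup>2" for \<tau>
      using integral_prod_real[OF fa fa, of \<tau> \<tau>] by (simp add: abs_mult power2_eq_square)
    then show "integrable lborel (\<lambda>\<tau>. LINT y|lborel. norm (?k (\<tau>, y)))" using int by simp
    show "AE \<tau> in lborel. integrable lborel (\<lambda>y. ?k (\<tau>, y))"
      using integrable_prod_real[OF fi fi] by simp
  qed
  then have k: "integrable lborel ?k" by (simp add: lborel_prod)
  \<comment> \<open>The second coordinate is the rate for the directions in I, the third the rate
    for j; all other directions have rate 0.\<close>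
  let ?t = "\<lambda>b (x::real \<times> (real \<times> real)). if b \<in> I then max 0 (fst (snd x)) else if b = j then max 0 (snd (snd x)) else 0"
  have tm: "?t b \<in> borel_measurable lborel" for b
    unfolding lborel_prod[symmetric] by measurable
  have S: "symbol (\<lambda>\<xi>::'a. LINT x|lborel. ?k x * exp (- (\<Sum>b\<in>Basis. ?t b x * (\<xi> \<bullet> b)\<^sup>2)))"
    by (rule symbol_gauss_mixture[OF sigma_finite_lborel k tm]) auto
  have eq: "(LINT x|lborel. ?k x * exp (- (\<Sum>b\<in>Basis. ?t b x * (\<xi> \<bullet> b)\<^sup>2)))
      = (LINT \<tau>|lborel. w \<tau> * ((LINT t|lborel. f \<tau> t * exp (- (t * (\<Sum>b\<in>I. (\<xi> \<bullet> b)\<^sup>2)))) * (LINT t|lborel. f \<tau> t * exp (- (t * (\<xi> \<bullet> j)\<^sup>2)))))" for \<xi> :: 'a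
  proof -
    define \<alpha> where "\<alpha> = (\<Sum>b\<in>I. (\<xi> \<bullet> b)\<^sup>2)"
    define \<beta> where "\<beta> = (\<xi> \<bullet> j)\<^sup>2"
    have ab: "\<alpha> \<ge> 0" "\<beta> \<ge> 0" by (auto simp: \<alpha>_def \<beta>_def intro: sum_nonneg)
    have sm: "(\<Sum>b\<in>Basis. ?t b x * (\<xi> \<bullet> b)\<^sup>2) = max 0 (fst (snd x)) * \<alpha> + max 0 (snd (snd x)) * \<beta>" for x
    proof -
      have "(\<Sum>b\<in>Basis. ?t b x * (\<xi> \<bullet> b)\<^sup>2) = (\<Sum>b\<in>Basis. (if b \<in> I then max 0 (fst (snd x)) * (\<xi> \<bullet> b)\<^sup>2 else 0) + (if b = j then max 0 (snd (snd x)) * (\<xi> \<bullet> b)\<^sup>2 else 0))"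
        using I(3) by (intro sum.cong) auto
      also have "\<dots> = (\<Sum>b\<in>Basis \<inter> I. max 0 (fst (snd x)) * (\<xi> \<bullet> b)\<^sup>2) + max 0 (snd (snd x)) * (\<xi> \<bullet> j)\<^sup>2"
        using I(2) by (simp add: sum.distrib sum.inter_restrict)
      also have "Basis \<inter> I = I" using I by auto
      finally show ?thesis by (simp add: \<alpha>_def \<beta>_def sum_distrib_left)
    qed
    let ?a = "\<lambda>\<tau> t. f \<tau> t * exp (- (t * \<alpha>))" and ?b = "\<lambda>\<tau> t. f \<tau> t * exp (- (t * \<beta>))"
    have bnd: "integrable lborel (\<lambda>t. f \<tau> t * exp (- (t * c)))" if "c \<ge> 0" for c \<tau>
    proof (rule Bochner_Integration.integrable_bound[OF fi])
      have "\<bar>f \<tau> t\<bar> * exp (- (t * c)) \<le> \<bar>f \<tau> t\<bar>" for t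
        using f0[of t \<tau>] that by (cases "t \<le> 0") (auto simp: mult_left_le)
      then show "AE t in lborel. norm (f \<tau> t * exp (- (t * c))) \<le> norm (f \<tau> t)" by (simp add: abs_mult)
    qed measurable
    have kk: "?k x * exp (- (\<Sum>b\<in>Basis. ?t b x * (\<xi> \<bullet> b)\<^sup>2)) = w (fst x) * (?a (fst x) (fst (snd x)) * ?b (fst x) (snd (snd x)))" for x
    proof (cases "fst (snd x) \<le> 0 \<or> snd (snd x) \<le> 0")
      case True then show ?thesis using f0 by auto
    next
      case False
      moreover have "exp (- (u * \<alpha> + v * \<beta>)) = exp (- (u * \<alpha>)) * exp (- (v * \<beta>))" for u v :: real
        by (simp add: exp_add[symmetric])
      ultimately show ?thesis unfolding sm by (simp add: max_def)
    qed
    have Ik2: "integrable (lborel \<Otimes>\<^sub>M lborel) (\<lambda>x. w (fst x) * (?a (fst x) (fst (snd x)) * ?b (fst x) (snd (snd x))))"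
    proof (rule Bochner_Integration.integrable_bound[OF Ik])
      show "(\<lambda>x. w (fst x) * (?a (fst x) (fst (snd x)) * ?b (fst x) (snd (snd x)))) \<in> borel_measurable (lborel \<Otimes>\<^sub>M lborel)"
        unfolding lborel_prod[symmetric] by measurable
      have "norm (w (fst x) * (?a (fst x) (fst (snd x)) * ?b (fst x) (snd (snd x)))) \<le> norm (?k x)" for x
      proof -
        have 1: "\<bar>?a (fst x) (fst (snd x))\<bar> \<le> \<bar>f (fst x) (fst (snd x))\<bar>"
          using f0[of "fst (snd x)" "fst x"] ab by (cases "fst (snd x) \<le> 0") (auto simp: mult_left_le abs_mult)
        have 2: "\<bar>?b (fst x) (snd (snd x))\<bar> \<le> \<bar>f (fst x) (snd (snd x))\<bar>"
          using f0[of "snd (snd x)" "fst x"] ab by (cases "snd (snd x) \<le> 0") (auto simp: mult_left_le abs_mult)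
        show ?thesis unfolding real_norm_def abs_mult[of "w _"] abs_mult[of "?a _ _"] abs_mult[of "f _ _" "f _ _"]
          using 1 2 by (intro mult_left_mono mult_mono) auto
      qed
      then show "AE x in lborel \<Otimes>\<^sub>M lborel. norm (w (fst x) * (?a (fst x) (fst (snd x)) * ?b (fst x) (snd (snd x)))) \<le> norm (?k x)" by simp
    qed
    have "(LINT x|lborel. ?k x * exp (- (\<Sum>b\<in>Basis. ?t b x * (\<xi> \<bullet> b)\<^sup>2))) = (\<integral>x. w (fst x) * (?a (fst x) (fst (snd x)) * ?b (fst x) (snd (snd x))) \<partial>(lborel \<Otimes>\<^sub>M lborel))"
      unfolding kk by (simp add: lborel_prod)
    also have "\<dots> = (LINT \<tau>|lborel. (LINT y|lborel. w \<tau> * (?a \<tau> (fst y) * ?b \<tau> (snd y))))"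
      using lborel_pair.integral_fst'[OF Ik2] by simp
    also have "\<dots> = (LINT \<tau>|lborel. w \<tau> * ((LINT t|lborel. ?a \<tau> t) * (LINT t|lborel. ?b \<tau> t)))"
      using integral_prod_real[OF bnd[OF ab(1)] bnd[OF ab(2)]] by simp
    finally show ?thesis by (simp add: \<alpha>_def \<beta>_def)
  qed
  show ?thesis using S unfolding eq .
qed

lemma
  assumes s: "s > 0" and A: "A > 0" and m: "m \<ge> 0"
  shows integrable_gamma_shift: "integrable lborel (\<lambda>t. ppow (s - 1) (t - m) * exp (- (A * t)))"
    and integral_gamma_shift: "(LINT t|lborel. ppow (s - 1) (t - m) * exp (- (A * t))) = Gamma s * A powr (- s) * exp (- (A * m))"
proof -
  let ?f = "\<lambda>t. ppow (s - 1) t * exp (- (A * t))"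
  have eq: "ppow (s - 1) (t - m) * exp (- (A * t)) = exp (- (A * m)) * ?f (1 *\<^sub>R t + - m)" for t
    by (simp add: exp_add[symmetric] algebra_simps)
  show "integrable lborel (\<lambda>t. ppow (s - 1) (t - m) * exp (- (A * t)))"
    unfolding eq using integrable_affine_iff[of 1 ?f "- m"] integrable_gamma[OF s A] by simp
  show "(LINT t|lborel. ppow (s - 1) (t - m) * exp (- (A * t))) = Gamma s * A powr (- s) * exp (- (A * m))"
    unfolding eq using integral_affine[of 1 ?f "- m"] integral_gamma[OF s A] by simp
qed

text \<open>The function d is the density whose Laplace transform is Gamma s A^(-s) (1 - exp (- A
  m)). Its L_1 norm is O(m^s), so its square against m^(-1 - s) behaves like m^(s - 1), integrable
  at 0; the second bound handles large m.\<close>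

lemma ppow_diff_L1:
  assumes s: "0 < s" "s < 1" and m: "m \<ge> 0"
  defines "d \<equiv> \<lambda>t. (ppow (s - 1) t - ppow (s - 1) (t - m)) * exp (- t)"
  shows "integrable lborel d" "(LINT t|lborel. \<bar>d t\<bar>) \<le> 2 * m powr s / s" "(LINT t|lborel. \<bar>d t\<bar>) \<le> 2 * Gamma s"
proof -
  have i1: "integrable lborel (\<lambda>t. ppow (s - 1) t * exp (- t))" and v1: "(LINT t|lborel. ppow (s - 1) t * exp (- t)) = Gamma s"
    using integrable_gamma[OF s(1), of 1] integral_gamma[OF s(1), of 1] by auto
  have i2: "integrable lborel (\<lambda>t. ppow (s - 1) (t - m) * exp (- t))" and v2: "(LINT t|lborel. ppow (s - 1) (t - m) * exp (- t)) = Gamma s * exp (- m)"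
    using integrable_gamma_shift[OF s(1) zero_less_one m] integral_gamma_shift[OF s(1) zero_less_one m] by auto
  have d: "d t = ppow (s - 1) t * exp (- t) - ppow (s - 1) (t - m) * exp (- t)" for t
    by (simp add: d_def left_diff_distrib)
  show di: "integrable lborel d" unfolding d[abs_def] using i1 i2 by simp
  have hi: "((\<lambda>x::real. x powr (s - 1)) has_integral (m powr (s - 1 + 1) / (s - 1 + 1))) {0..m}"
    using s m by (intro has_integral_powr_from_0) auto
  have i3: "integrable lborel (\<lambda>t::real. indicator {0..m} t * t powr (s - 1))"
    by (rule integrable_has_integral_nonneg[OF _ hi]) auto
  have v3: "(LINT t|lborel. indicator {0..m} t * t powr (s - 1)) = m powr s / s"
    using integral_has_integral_nonneg[OF _ hi] by simp
  have G: "Gamma s > 0" using Gamma_real_pos[OF s(1)] .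
  \<comment> \<open>Since s < 1 the power decreases, so beyond m the difference is at most 0 and its
    absolute value is the reversed difference; twice the part on [0, m] corrects the sign
    there.\<close>
  have le: "\<bar>d t\<bar> \<le> ppow (s - 1) (t - m) * exp (- t) - ppow (s - 1) t * exp (- t) + 2 * (indicator {0..m} t * t powr (s - 1))" for t
  proof -
    consider "t \<le> 0" | "0 < t" "t \<le> m" | "m < t" using m by linarith
    then show ?thesis
    proof cases
      case 1 then show ?thesis using m by (auto simp: d ppow_def indicator_def)
    next
      case 2
      have "t powr (s - 1) * exp (- t) \<le> t powr (s - 1) * 1" using 2 by (intro mult_left_mono) auto
      then show ?thesis using 2 by (simp add: d ppow_def abs_mult)
    next
      case 3
      then have t: "t > 0" using m by simp
      have "t powr (s - 1) \<le> (t - m) powr (s - 1)" using 3 m s by (intro powr_mono2') auto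
      then have "t powr (s - 1) * exp (- t) \<le> (t - m) powr (s - 1) * exp (- t)" by (intro mult_right_mono) auto
      then show ?thesis using 3 t by (simp add: d ppow_def)
    qed
  qed
  have "(LINT t|lborel. \<bar>d t\<bar>) \<le> (LINT t|lborel. ppow (s - 1) (t - m) * exp (- t) - ppow (s - 1) t * exp (- t) + 2 * (indicator {0..m} t * t powr (s - 1)))"
    using di i1 i2 i3 le by (intro integral_mono) auto
  also have "\<dots> = Gamma s * exp (- m) - Gamma s + 2 * (m powr s / s)"
    using i1 i2 i3 by (simp add: v1 v2 v3)
  also have "\<dots> \<le> 2 * m powr s / s" using G m by (simp add: mult_left_le)
  finally show "(LINT t|lborel. \<bar>d t\<bar>) \<le> 2 * m powr s / s" .
  have "(LINT t|lborel. \<bar>d t\<bar>) \<le> (LINT t|lborel. ppow (s - 1) t * exp (- t) + ppow (s - 1) (t - m) * exp (- t))"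
    using di i1 i2 by (intro integral_mono) (auto simp: d intro!: order.trans[OF abs_triangle_ineq4])
  also have "\<dots> = Gamma s + Gamma s * exp (- m)" using i1 i2 by (simp add: v1 v2)
  also have "\<dots> \<le> 2 * Gamma s" using G m by simp
  finally show "(LINT t|lborel. \<bar>d t\<bar>) \<le> 2 * Gamma s" .
qed

text \<open>With \<open>A = 1 + \<alpha>\<close> and \<open>B = 1 + \<beta>\<close>, the function \<open>A\<^sup>-\<^sup>s + B\<^sup>-\<^sup>s - (A + B - 1)\<^sup>s A\<^sup>-\<^sup>s B\<^sup>-\<^sup>s\<close> is a multiple of
  \<open>\<integral> \<tau>\<^sup>-\<^sup>1\<^sup>-\<^sup>s A\<^sup>-\<^sup>s B\<^sup>-\<^sup>s ((1 - e\<^sup>-\<^sup>\<tau>\<^sup>A)(1 - e\<^sup>-\<^sup>\<tau>\<^sup>B) + (e\<^sup>\<tau> - 1) e\<^sup>-\<^sup>\<tau>\<^sup>A\<^sup>-\<^sup>\<tau>\<^sup>B) d\<tau>\<close>; subtracting the two marginal limits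
  \<open>A\<^sup>-\<^sup>s\<close>, \<open>B\<^sup>-\<^sup>s\<close> first is what makes the representing measure finite.\<close>

lemma symbol_tensor_step_frac:
  fixes I :: "'a::euclidean_space set"
  assumes s: "0 < s" "s < 1" and I: "I \<subseteq> Basis" "j \<in> Basis" "j \<notin> I"
  shows "symbol (\<lambda>\<xi>::'a. (1 + (\<Sum>b\<in>I. (\<xi> \<bullet> b)\<^sup>2) + (\<xi> \<bullet> j)\<^sup>2) powr s
     * ((1 + (\<Sum>b\<in>I. (\<xi> \<bullet> b)\<^sup>2)) powr (- s) * (1 + (\<xi> \<bullet> j)\<^sup>2) powr (- s)))"
proof -
  define G where "G = Gamma s"
  have G: "G > 0" using Gamma_real_pos[OF s(1)] by (simp add: G_def)
  let ?\<alpha> = "\<lambda>\<xi>::'a. \<Sum>b\<in>I. (\<xi> \<bullet> b)\<^sup>2" and ?\<beta> = "\<lambda>\<xi>::'a. (\<xi> \<bullet> j)\<^sup>2"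
  have al: "?\<alpha> \<xi> \<ge> 0" for \<xi> by (intro sum_nonneg) auto
  \<comment> \<open>With A = 1 + a, up to the factor Gamma s, \<open>d \<tau>\<close> and
    \<open>e \<tau>\<close> are the densities behind A^(-s) (1 - exp (- \<tau> A)) and A^(-s) exp (-
    \<tau> A).\<close>
  define d where "d = (\<lambda>\<tau> t. (ppow (s - 1) t - ppow (s - 1) (t - max 0 \<tau>)) * exp (- t))"
  define e where "e = (\<lambda>\<tau> t. ppow (s - 1) (t - max 0 \<tau>) * exp (- t))"
  have dm[measurable]: "(\<lambda>x. d (fst x) (snd x)) \<in> borel_measurable (borel \<Otimes>\<^sub>M borel)" unfolding d_def by measurable
  have em[measurable]: "(\<lambda>x. e (fst x) (snd x)) \<in> borel_measurable (borel \<Otimes>\<^sub>M borel)" unfolding e_def by measurable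
  have dL: "integrable lborel (d \<tau>)" "(LINT t|lborel. \<bar>d \<tau> t\<bar>) \<le> 2 * max 0 \<tau> powr s / s" "(LINT t|lborel. \<bar>d \<tau> t\<bar>) \<le> 2 * G" for \<tau>
    using ppow_diff_L1[OF s, of "max 0 \<tau>"] by (auto simp: d_def G_def)
  have eL: "integrable lborel (e \<tau>)" "(LINT t|lborel. \<bar>e \<tau> t\<bar>) = G * exp (- max 0 \<tau>)" for \<tau>
    using integrable_gamma_shift[OF s(1) zero_less_one, of "max 0 \<tau>"] integral_gamma_shift[OF s(1) zero_less_one, of "max 0 \<tau>"]
    by (auto simp: e_def abs_mult G_def)
  have d0: "d \<tau> t = 0" "e \<tau> t = 0" if "t \<le> 0" for \<tau> t using that by (auto simp: d_def e_def ppow_def)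
  have eV: "(LINT t|lborel. e \<tau> t * exp (- (t * a))) = G * (1 + a) powr (- s) * exp (- ((1 + a) * \<tau>))" if "a \<ge> 0" "\<tau> > 0" for a \<tau>
  proof -
    have "e \<tau> t * exp (- (t * a)) = ppow (s - 1) (t - \<tau>) * exp (- ((1 + a) * t))" for t
      using that by (simp add: e_def exp_add[symmetric] algebra_simps)
    then show ?thesis using integral_gamma_shift[OF s(1), of "1 + a" \<tau>] that by (simp add: G_def)
  qed
  have dV: "(LINT t|lborel. d \<tau> t * exp (- (t * a))) = G * (1 + a) powr (- s) * (1 - exp (- ((1 + a) * \<tau>)))" if "a \<ge> 0" "\<tau> > 0" for a \<tau>
  proof -
    have a: "1 + a > 0" using that by simp
    have st: "d \<tau> t * exp (- (t * a)) = ppow (s - 1) t * exp (- ((1 + a) * t)) - ppow (s - 1) (t - \<tau>) * exp (- ((1 + a) * t))" for t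
    proof -
      have "exp (- ((1 + a) * t)) = exp (- t) * exp (- (t * a))" by (simp add: exp_add[symmetric] algebra_simps)
      then show ?thesis using that by (simp add: d_def left_diff_distrib mult.assoc)
    qed
    have \<tau>: "\<tau> \<ge> 0" using that by simp
    show ?thesis
      unfolding st Bochner_Integration.integral_diff[OF integrable_gamma[OF s(1) a] integrable_gamma_shift[OF s(1) a \<tau>]]
        integral_gamma[OF s(1) a] integral_gamma_shift[OF s(1) a \<tau>]
      by (simp add: G_def right_diff_distrib)
  qed
  define w where "w = ppow (- 1 - s)"
  define w2 where "w2 = (\<lambda>\<tau>. ppow (- 1 - s) \<tau> * (exp \<tau> - 1))"
  have [measurable]: "w \<in> borel_measurable borel" "w2 \<in> borel_measurable borel" unfolding w_def w2_def by measurable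
  have fr: "integrable lborel (\<lambda>\<tau>. ppow (- 1 - s) \<tau> * (1 - exp (- \<tau>)))" using integrable_frac[OF s, of 1] by simp
  have S1: "symbol (\<lambda>\<xi>. LINT \<tau>|lborel. w \<tau> * ((LINT t|lborel. d \<tau> t * exp (- (t * ?\<alpha> \<xi>))) * (LINT t|lborel. d \<tau> t * exp (- (t * ?\<beta> \<xi>)))))"
  proof (rule symbol_two_var[OF I dm dL(1) d0(1)])
    \<comment> \<open>The lower bound of 1 - exp (- \<tau>) for \<tau> above 1, which lets the
      integrable function of \<open>fr\<close> dominate the tail.\<close>
    define C where "C = 1 - exp (- 1 :: real)"
    have C: "C > 0" by (simp add: C_def)
    have b: "integrable lborel (\<lambda>\<tau>. 4 / s\<^sup>2 * exp 1 * (ppow (s - 1) \<tau> * exp (- (1 * \<tau>))) + 4 * G\<^sup>2 / C * (ppow (- 1 - s) \<tau> * (1 - exp (- \<tau>))))"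
      using integrable_gamma[OF s(1) zero_less_one] fr by (intro Bochner_Integration.integrable_add integrable_mult_right)
    have nm[measurable]: "(\<lambda>\<tau>. LINT t|lborel. \<bar>d \<tau> t\<bar>) \<in> borel_measurable borel" unfolding d_def by measurable
    show "integrable lborel (\<lambda>\<tau>. \<bar>w \<tau>\<bar> * (LINT t|lborel. \<bar>d \<tau> t\<bar>)\<^sup>2)"
    proof (rule Bochner_Integration.integrable_bound[OF b])
      have le: "norm (\<bar>w \<tau>\<bar> * (LINT t|lborel. \<bar>d \<tau> t\<bar>)\<^sup>2) \<le> 4 / s\<^sup>2 * exp 1 * (ppow (s - 1) \<tau> * exp (- (1 * \<tau>))) + 4 * G\<^sup>2 / C * (ppow (- 1 - s) \<tau> * (1 - exp (- \<tau>)))" for \<tau>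
      proof -
        have n0: "0 \<le> (LINT t|lborel. \<bar>d \<tau> t\<bar>)" by simp
        consider "\<tau> \<le> 0" | "0 < \<tau>" "\<tau> \<le> 1" | "1 < \<tau>" by linarith
        then show ?thesis
        proof cases
          case 1 then show ?thesis by (simp add: w_def ppow_def)
        next
          case 2
          have "(LINT t|lborel. \<bar>d \<tau> t\<bar>)\<^sup>2 \<le> (2 * \<tau> powr s / s)\<^sup>2"
            using dL(2)[of \<tau>] n0 2 by (intro power_mono) auto
          also have "\<dots> = 4 / s\<^sup>2 * \<tau> powr (2 * s)"
          proof -
            have "(\<tau> powr s)\<^sup>2 = \<tau> powr (2 * s)" by (simp add: power2_eq_square powr_add[symmetric])
            then show ?thesis by (simp add: power_divide power_mult_distrib)
          qed
          finally have "\<tau> powr (- 1 - s) * (LINT t|lborel. \<bar>d \<tau> t\<bar>)\<^sup>2 \<le> \<tau> powr (- 1 - s) * (4 / s\<^sup>2 * \<tau> powr (2 * s))"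
            by (intro mult_left_mono) auto
          also have "\<dots> = 4 / s\<^sup>2 * (\<tau> powr (- 1 - s) * \<tau> powr (2 * s))" by simp
          also have "\<tau> powr (- 1 - s) * \<tau> powr (2 * s) = \<tau> powr (s - 1)" by (simp add: powr_add[symmetric])
          also have "4 / s\<^sup>2 * \<tau> powr (s - 1) \<le> 4 / s\<^sup>2 * \<tau> powr (s - 1) * (exp 1 * exp (- \<tau>))"

          proof -
            have "1 \<le> exp 1 * exp (- \<tau>)" using 2 by (simp add: exp_add[symmetric])
            then have "4 / s\<^sup>2 * \<tau> powr (s - 1) * 1 \<le> 4 / s\<^sup>2 * \<tau> powr (s - 1) * (exp 1 * exp (- \<tau>))" by (intro mult_left_mono) auto
            then show ?thesis by simp
          qed
          finally have "norm (\<bar>w \<tau>\<bar> * (LINT t|lborel. \<bar>d \<tau> t\<bar>)\<^sup>2) \<le> 4 / s\<^sup>2 * exp 1 * (ppow (s - 1) \<tau> * exp (- (1 * \<tau>)))"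
            using 2 by (simp add: w_def ppow_def abs_mult mult_ac)
          moreover have "0 \<le> 4 * G\<^sup>2 / C * (ppow (- 1 - s) \<tau> * (1 - exp (- \<tau>)))" using C 2 by simp
          ultimately show ?thesis by linarith
        next
          case 3
          have "(LINT t|lborel. \<bar>d \<tau> t\<bar>)\<^sup>2 \<le> (2 * G)\<^sup>2" using dL(3)[of \<tau>] n0 by (intro power_mono) auto
          then have "\<tau> powr (- 1 - s) * (LINT t|lborel. \<bar>d \<tau> t\<bar>)\<^sup>2 \<le> \<tau> powr (- 1 - s) * (4 * G\<^sup>2)"
            by (intro mult_left_mono) (auto simp: power_mult_distrib)
          also have "\<dots> \<le> \<tau> powr (- 1 - s) * (4 * G\<^sup>2) * ((1 - exp (- \<tau>)) / C)"
          proof -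
            have "1 \<le> (1 - exp (- \<tau>)) / C" using 3 C by (simp add: C_def)
            then have "\<tau> powr (- 1 - s) * (4 * G\<^sup>2) * 1 \<le> \<tau> powr (- 1 - s) * (4 * G\<^sup>2) * ((1 - exp (- \<tau>)) / C)"
              by (intro mult_left_mono) auto
            then show ?thesis by simp
          qed
          finally have "norm (\<bar>w \<tau>\<bar> * (LINT t|lborel. \<bar>d \<tau> t\<bar>)\<^sup>2) \<le> 4 * G\<^sup>2 / C * (ppow (- 1 - s) \<tau> * (1 - exp (- \<tau>)))"
            using 3 by (simp add: w_def ppow_def abs_mult mult_ac)
          moreover have "0 \<le> 4 / s\<^sup>2 * exp 1 * (ppow (s - 1) \<tau> * exp (- (1 * \<tau>)))" by simp
          ultimately show ?thesis by linarith
        qed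
      qed
      show "AE \<tau> in lborel. norm (\<bar>w \<tau>\<bar> * (LINT t|lborel. \<bar>d \<tau> t\<bar>)\<^sup>2) \<le> norm (4 / s\<^sup>2 * exp 1 * (ppow (s - 1) \<tau> * exp (- (1 * \<tau>))) + 4 * G\<^sup>2 / C * (ppow (- 1 - s) \<tau> * (1 - exp (- \<tau>))))"
        by (rule AE_I2, rule order.trans[OF le], unfold real_norm_def, rule abs_ge_self)
    qed measurable
  qed (auto simp: w_def)
  have S2: "symbol (\<lambda>\<xi>. LINT \<tau>|lborel. w2 \<tau> * ((LINT t|lborel. e \<tau> t * exp (- (t * ?\<alpha> \<xi>))) * (LINT t|lborel. e \<tau> t * exp (- (t * ?\<beta> \<xi>)))))"
  proof (rule symbol_two_var[OF I em eL(1) d0(2)])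
    show "integrable lborel (\<lambda>\<tau>. \<bar>w2 \<tau>\<bar> * (LINT t|lborel. \<bar>e \<tau> t\<bar>)\<^sup>2)"
    proof (rule Bochner_Integration.integrable_bound)
      show "integrable lborel (\<lambda>\<tau>. G\<^sup>2 * (ppow (- 1 - s) \<tau> * (1 - exp (- \<tau>))))" using fr by simp
      have "norm (\<bar>w2 \<tau>\<bar> * (LINT t|lborel. \<bar>e \<tau> t\<bar>)\<^sup>2) \<le> norm (G\<^sup>2 * (ppow (- 1 - s) \<tau> * (1 - exp (- \<tau>))))" for \<tau>
      proof (cases "\<tau> > 0")
        case True
        have x: "(exp \<tau> - 1) * (exp (- \<tau>))\<^sup>2 = (1 - exp (- \<tau>)) * exp (- \<tau>)"
          by (simp add: power2_eq_square algebra_simps exp_minus_inverse flip: exp_add)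
        have "(exp \<tau> - 1) * (exp (- \<tau>))\<^sup>2 \<le> 1 - exp (- \<tau>)"
          unfolding x using True by (intro mult_right_le_one_le) auto
        then have "(ppow (- 1 - s) \<tau> * G\<^sup>2) * ((exp \<tau> - 1) * (exp (- \<tau>))\<^sup>2) \<le> (ppow (- 1 - s) \<tau> * G\<^sup>2) * (1 - exp (- \<tau>))"
          by (intro mult_left_mono) auto
        then show ?thesis using True by (simp add: w2_def eL(2) abs_mult power_mult_distrib mult_ac)
      qed (simp add: w2_def ppow_def)
      then show "AE \<tau> in lborel. norm (\<bar>w2 \<tau>\<bar> * (LINT t|lborel. \<bar>e \<tau> t\<bar>)\<^sup>2) \<le> norm (G\<^sup>2 * (ppow (- 1 - s) \<tau> * (1 - exp (- \<tau>))))" by simp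
      show "(\<lambda>\<tau>. \<bar>w2 \<tau>\<bar> * (LINT t|lborel. \<bar>e \<tau> t\<bar>)\<^sup>2) \<in> borel_measurable lborel"
        unfolding eL(2) by measurable
    qed
  qed auto
  let ?A = "\<lambda>\<xi>. 1 + ?\<alpha> \<xi>" and ?B = "\<lambda>\<xi>. 1 + ?\<beta> \<xi>"
  define c where "c = frac_const s"
  have c: "c > 0" using frac_const_pos[OF s] by (simp add: c_def)
  have A: "?A \<xi> > 0" and B: "?B \<xi> > 0" for \<xi> using al[of \<xi>] by (auto intro!: add_pos_nonneg)
  have V1: "(LINT \<tau>|lborel. w \<tau> * ((LINT t|lborel. d \<tau> t * exp (- (t * ?\<alpha> \<xi>))) * (LINT t|lborel. d \<tau> t * exp (- (t * ?\<beta> \<xi>)))))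
    = G\<^sup>2 * ?A \<xi> powr (- s) * ?B \<xi> powr (- s) * (c * (?A \<xi> powr s + ?B \<xi> powr s - (?A \<xi> + ?B \<xi>) powr s))" for \<xi>
  proof -
    have AB: "?A \<xi> + ?B \<xi> > 0" using A[of \<xi>] B[of \<xi>] by simp
    define p where "p = ?A \<xi>" define q where "q = ?B \<xi>"
    have pq: "p > 0" "q > 0" "p + q > 0" using A[of \<xi>] B[of \<xi>] by (auto simp: p_def q_def)
    have st: "w \<tau> * ((LINT t|lborel. d \<tau> t * exp (- (t * ?\<alpha> \<xi>))) * (LINT t|lborel. d \<tau> t * exp (- (t * ?\<beta> \<xi>))))
      = G\<^sup>2 * p powr (- s) * q powr (- s) * (ppow (- 1 - s) \<tau> * (1 - exp (- (p * \<tau>))) + ppow (- 1 - s) \<tau> * (1 - exp (- (q * \<tau>))) - ppow (- 1 - s) \<tau> * (1 - exp (- ((p + q) * \<tau>))))" for \<tau>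
    proof (cases "\<tau> > 0")
      case True
      have ex: "exp (- ((p + q) * \<tau>)) = exp (- (p * \<tau>)) * exp (- (q * \<tau>))" by (simp add: exp_add[symmetric] algebra_simps)
      have "(1 - exp (- (p * \<tau>))) * (1 - exp (- (q * \<tau>))) = (1 - exp (- (p * \<tau>))) + (1 - exp (- (q * \<tau>))) - (1 - exp (- ((p + q) * \<tau>)))"
        unfolding ex by (simp add: algebra_simps)
      then show ?thesis using dV[OF al True, of \<xi>] dV[OF zero_le_power2 True, of "\<xi> \<bullet> j"]
        unfolding p_def[symmetric] q_def[symmetric] w_def
        by (simp add: power2_eq_square mult_ac distrib_left[symmetric] right_diff_distrib[symmetric])
    qed (simp add: w_def ppow_def)
    show ?thesis
      unfolding st p_def[symmetric] q_def[symmetric] c_def integral_mult_right_zero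
        Bochner_Integration.integral_diff[OF Bochner_Integration.integrable_add[OF integrable_frac[OF s pq(1)] integrable_frac[OF s pq(2)]] integrable_frac[OF s pq(3)]]
        Bochner_Integration.integral_add[OF integrable_frac[OF s pq(1)] integrable_frac[OF s pq(2)]]
        integral_frac[OF s pq(1)] integral_frac[OF s pq(2)] integral_frac[OF s pq(3)]
      by (simp add: algebra_simps)
  qed
  have V2: "(LINT \<tau>|lborel. w2 \<tau> * ((LINT t|lborel. e \<tau> t * exp (- (t * ?\<alpha> \<xi>))) * (LINT t|lborel. e \<tau> t * exp (- (t * ?\<beta> \<xi>)))))
    = G\<^sup>2 * ?A \<xi> powr (- s) * ?B \<xi> powr (- s) * (c * ((?A \<xi> + ?B \<xi>) powr s - (?A \<xi> + ?B \<xi> - 1) powr s))" for \<xi>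
  proof -
    define p where "p = ?A \<xi>" define q where "q = ?B \<xi>"
    have pq: "p + q > 0" "p + q - 1 > 0" using A[of \<xi>] B[of \<xi>] al[of \<xi>] by (auto simp: p_def q_def intro!: add_pos_nonneg)
    have st: "w2 \<tau> * ((LINT t|lborel. e \<tau> t * exp (- (t * ?\<alpha> \<xi>))) * (LINT t|lborel. e \<tau> t * exp (- (t * ?\<beta> \<xi>))))
      = G\<^sup>2 * p powr (- s) * q powr (- s) * (ppow (- 1 - s) \<tau> * (1 - exp (- ((p + q) * \<tau>))) - ppow (- 1 - s) \<tau> * (1 - exp (- ((p + q - 1) * \<tau>))))" for \<tau>
    proof (cases "\<tau> > 0")
      case True
      have ex: "exp (- ((p + q) * \<tau>)) = exp (- (p * \<tau>)) * exp (- (q * \<tau>))"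
          "exp (- ((p + q - 1) * \<tau>)) = exp \<tau> * (exp (- (p * \<tau>)) * exp (- (q * \<tau>)))" by (simp_all add: exp_add[symmetric] algebra_simps)
      have "(exp \<tau> - 1) * (exp (- (p * \<tau>)) * exp (- (q * \<tau>))) = (1 - exp (- ((p + q) * \<tau>))) - (1 - exp (- ((p + q - 1) * \<tau>)))"
        unfolding ex by (simp add: algebra_simps)
      then show ?thesis using eV[OF al True, of \<xi>] eV[OF zero_le_power2 True, of "\<xi> \<bullet> j"]
        unfolding p_def[symmetric] q_def[symmetric] w2_def
        by (simp add: power2_eq_square mult_ac distrib_left[symmetric] right_diff_distrib[symmetric])
    qed (simp add: w2_def ppow_def)
    show ?thesis
      unfolding st p_def[symmetric] q_def[symmetric] c_def integral_mult_right_zero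
        Bochner_Integration.integral_diff[OF integrable_frac[OF s pq(1)] integrable_frac[OF s pq(2)]]
        integral_frac[OF s pq(1)] integral_frac[OF s pq(2)]
      by (simp add: algebra_simps)
  qed
  have SA: "symbol (\<lambda>\<xi>. ?A \<xi> powr (- s))"
    using symbol_bessel[of s "\<lambda>b. if b \<in> I then 1 else 0"] s I(1)
    by (simp add: if_distrib[of "\<lambda>c. c * _"] sum.inter_restrict[symmetric] Int_absorb1 cong: if_cong)
  have SB: "symbol (\<lambda>\<xi>. ?B \<xi> powr (- s))"
    using symbol_bessel[of s "\<lambda>b. if b = j then 1 else 0"] s I(2)
    by (simp add: if_distrib[of "\<lambda>c. c * _"] cong: if_cong)
  \<comment> \<open>In the sum of the two integrals the terms (A + B)^s cancel. The terms A^s and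
    B^s, divided by A^s B^s, cancel the two marginals, and the quotient with (A + B - 1)^s
    remains.\<close>
  have "symbol (\<lambda>\<xi>. (?A \<xi> powr (- s) + ?B \<xi> powr (- s)) - 1 / (G\<^sup>2 * c) *
      (G\<^sup>2 * ?A \<xi> powr (- s) * ?B \<xi> powr (- s) * (c * (?A \<xi> powr s + ?B \<xi> powr s - (?A \<xi> + ?B \<xi>) powr s))
      + G\<^sup>2 * ?A \<xi> powr (- s) * ?B \<xi> powr (- s) * (c * ((?A \<xi> + ?B \<xi>) powr s - (?A \<xi> + ?B \<xi> - 1) powr s))))"
    using S1 S2 unfolding V1 V2 by (intro symbol_diff symbol_add symbol_cmult SA SB)
  also have "(\<lambda>\<xi>. (?A \<xi> powr (- s) + ?B \<xi> powr (- s)) - 1 / (G\<^sup>2 * c) *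
      (G\<^sup>2 * ?A \<xi> powr (- s) * ?B \<xi> powr (- s) * (c * (?A \<xi> powr s + ?B \<xi> powr s - (?A \<xi> + ?B \<xi>) powr s))
      + G\<^sup>2 * ?A \<xi> powr (- s) * ?B \<xi> powr (- s) * (c * ((?A \<xi> + ?B \<xi>) powr s - (?A \<xi> + ?B \<xi> - 1) powr s))))
    = (\<lambda>\<xi>. (1 + ?\<alpha> \<xi> + ?\<beta> \<xi>) powr s * (?A \<xi> powr (- s) * ?B \<xi> powr (- s)))"
  proof
    fix \<xi>
    define p where "p = ?A \<xi>" define q where "q = ?B \<xi>"
    define x where "x = p powr s" define y where "y = q powr s"
    have xy: "x > 0" "y > 0" using A[of \<xi>] B[of \<xi>] by (auto simp: x_def y_def p_def q_def)
    define z where "z = (p + q - 1) powr s"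
    have z: "(1 + ?\<alpha> \<xi> + ?\<beta> \<xi>) powr s = z" by (simp add: z_def p_def q_def algebra_simps)
    define v where "v = (p + q) powr s"
    have xm: "p powr (- s) = 1 / x" "q powr (- s) = 1 / y" by (simp_all add: x_def y_def powr_minus_divide)
    show "(?A \<xi> powr (- s) + ?B \<xi> powr (- s)) - 1 / (G\<^sup>2 * c) *
      (G\<^sup>2 * ?A \<xi> powr (- s) * ?B \<xi> powr (- s) * (c * (?A \<xi> powr s + ?B \<xi> powr s - (?A \<xi> + ?B \<xi>) powr s))
      + G\<^sup>2 * ?A \<xi> powr (- s) * ?B \<xi> powr (- s) * (c * ((?A \<xi> + ?B \<xi>) powr s - (?A \<xi> + ?B \<xi> - 1) powr s)))
      = (1 + ?\<alpha> \<xi> + ?\<beta> \<xi>) powr s * (?A \<xi> powr (- s) * ?B \<xi> powr (- s))"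
      unfolding z unfolding p_def[symmetric] q_def[symmetric] unfolding xm z_def[symmetric] v_def[symmetric] x_def[symmetric] y_def[symmetric]
      using xy G c by (simp add: field_simps)
  qed
  finally show ?thesis .
qed

text \<open>The fractional part of s is the previous lemma. For the integer part, A + B - 1 divided
  by A B is 1/A + 1/B - 1/(A B), which is a symbol together with its powers.\<close>

lemma symbol_tensor_step:
  fixes I :: "'a::euclidean_space set"
  assumes s: "s \<ge> 0" and I: "I \<subseteq> Basis" "j \<in> Basis" "j \<notin> I"
  shows "symbol (\<lambda>\<xi>::'a. (1 + (\<Sum>b\<in>I. (\<xi> \<bullet> b)\<^sup>2) + (\<xi> \<bullet> j)\<^sup>2) powr s
     * ((1 + (\<Sum>b\<in>I. (\<xi> \<bullet> b)\<^sup>2)) powr (- s) * (1 + (\<xi> \<bullet> j)\<^sup>2) powr (- s)))"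
proof -
  let ?A = "\<lambda>\<xi>::'a. 1 + (\<Sum>b\<in>I. (\<xi> \<bullet> b)\<^sup>2)" and ?B = "\<lambda>\<xi>::'a. 1 + (\<xi> \<bullet> j)\<^sup>2"
  let ?C = "\<lambda>\<xi>::'a. 1 + (\<Sum>b\<in>I. (\<xi> \<bullet> b)\<^sup>2) + (\<xi> \<bullet> j)\<^sup>2"
  have pos: "?A \<xi> > 0" "?B \<xi> > 0" "?C \<xi> > 0" for \<xi> by (auto intro!: add_pos_nonneg sum_nonneg)
  define n where "n = nat \<lfloor>s\<rfloor>"
  define f where "f = frac s"
  have f: "0 \<le> f" "f < 1" by (auto simp: f_def frac_ge_0 frac_lt_1)
  have F: "symbol (\<lambda>\<xi>. ?C \<xi> powr f * (?A \<xi> powr (- f) * ?B \<xi> powr (- f)))"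
  proof (cases "f = 0")
    case True
    have "(\<lambda>\<xi>. ?C \<xi> powr f * (?A \<xi> powr (- f) * ?B \<xi> powr (- f))) = (\<lambda>_. 1)"
      using pos True by (simp add: fun_eq_iff less_imp_neq[THEN not_sym])
    then show ?thesis by (simp add: symbol_const)
  next
    case False
    then show ?thesis using f I by (intro symbol_tensor_step_frac) auto
  qed
  have SA: "symbol (\<lambda>\<xi>. ?A \<xi> powr (- 1))"
    using symbol_bessel[of 1 "\<lambda>b. if b \<in> I then 1 else 0"] s I(1)
    by (simp add: if_distrib[of "\<lambda>c. c * _"] sum.inter_restrict[symmetric] Int_absorb1 cong: if_cong)
  have SB: "symbol (\<lambda>\<xi>. ?B \<xi> powr (- 1))"
    using symbol_bessel[of 1 "\<lambda>b. if b = j then 1 else 0"] s I(2)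
    by (simp add: if_distrib[of "\<lambda>c. c * _"] cong: if_cong)
  have "symbol (\<lambda>\<xi>. ((?A \<xi> powr (- 1) + ?B \<xi> powr (- 1)) - ?A \<xi> powr (- 1) * ?B \<xi> powr (- 1)) ^ n)"
    by (intro symbol_power symbol_diff symbol_add symbol_mult SA SB)
  from symbol_mult[OF this F]
  have "symbol (\<lambda>\<xi>. ((?A \<xi> powr (- 1) + ?B \<xi> powr (- 1)) - ?A \<xi> powr (- 1) * ?B \<xi> powr (- 1)) ^ n * (?C \<xi> powr f * (?A \<xi> powr (- f) * ?B \<xi> powr (- f))))" .
  also have "(\<lambda>\<xi>. ((?A \<xi> powr (- 1) + ?B \<xi> powr (- 1)) - ?A \<xi> powr (- 1) * ?B \<xi> powr (- 1)) ^ n * (?C \<xi> powr f * (?A \<xi> powr (- f) * ?B \<xi> powr (- f))))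
     = (\<lambda>\<xi>. ?C \<xi> powr s * (?A \<xi> powr (- s) * ?B \<xi> powr (- s)))"
  proof
    fix \<xi>
    have C: "?C \<xi> = ?A \<xi> + ?B \<xi> - 1" by simp
    have base: "(?A \<xi> powr (- 1) + ?B \<xi> powr (- 1)) - ?A \<xi> powr (- 1) * ?B \<xi> powr (- 1) = ?C \<xi> / (?A \<xi> * ?B \<xi>)"
    proof -
      define p where "p = ?A \<xi>" define q where "q = ?B \<xi>"
      have "p > 0" "q > 0" using pos[of \<xi>] by (auto simp: p_def q_def)
      then show ?thesis unfolding C unfolding p_def[symmetric] q_def[symmetric] by (simp add: powr_minus_divide field_simps)
    qed
    have sp: "x powr s = x ^ n * x powr f" if "x > 0" for x using powr_split_floor[OF that s] by (simp add: n_def f_def)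
    show "((?A \<xi> powr (- 1) + ?B \<xi> powr (- 1)) - ?A \<xi> powr (- 1) * ?B \<xi> powr (- 1)) ^ n * (?C \<xi> powr f * (?A \<xi> powr (- f) * ?B \<xi> powr (- f)))
       = ?C \<xi> powr s * (?A \<xi> powr (- s) * ?B \<xi> powr (- s))"
      unfolding base unfolding powr_minus_divide sp[OF pos(1)] sp[OF pos(2)] sp[OF pos(3)]
      by (simp add: power_divide power_mult_distrib)
  qed
  finally show ?thesis .
qed

text \<open>Coordinates are added one at a time, and the full quotient is the telescoping product of
  the quotients of the single steps.\<close>

lemma symbol_tensor:
  assumes s: "s \<ge> 0"
  shows "symbol (\<lambda>\<xi>::'a::euclidean_space. (1 + (norm \<xi>)\<^sup>2) powr s * (\<Prod>b\<in>Basis. (1 + (\<xi> \<bullet> b)\<^sup>2) powr (- s)))"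
proof -
  have "symbol (\<lambda>\<xi>::'a. (1 + (\<Sum>b\<in>I. (\<xi> \<bullet> b)\<^sup>2)) powr s * (\<Prod>b\<in>I. (1 + (\<xi> \<bullet> b)\<^sup>2) powr (- s)))" if "I \<subseteq> Basis" for I
    using finite_subset[OF that finite_Basis] that
  proof (induction rule: finite_induct)
    case empty show ?case by (simp add: symbol_const)
  next
    case (insert j I)
    have pos: "1 + (\<Sum>b\<in>I. (\<xi> \<bullet> b)\<^sup>2) > 0" for \<xi> :: 'a by (intro add_pos_nonneg sum_nonneg) auto
    have st: "symbol (\<lambda>\<xi>::'a. (1 + (\<Sum>b\<in>I. (\<xi> \<bullet> b)\<^sup>2) + (\<xi> \<bullet> j)\<^sup>2) powr s
        * ((1 + (\<Sum>b\<in>I. (\<xi> \<bullet> b)\<^sup>2)) powr (- s) * (1 + (\<xi> \<bullet> j)\<^sup>2) powr (- s)))"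
      using insert by (intro symbol_tensor_step s) auto
    have IH: "symbol (\<lambda>\<xi>::'a. (1 + (\<Sum>b\<in>I. (\<xi> \<bullet> b)\<^sup>2)) powr s * (\<Prod>b\<in>I. (1 + (\<xi> \<bullet> b)\<^sup>2) powr (- s)))"
      using insert by simp
    have "(\<lambda>\<xi>::'a. (1 + (\<Sum>b\<in>insert j I. (\<xi> \<bullet> b)\<^sup>2)) powr s * (\<Prod>b\<in>insert j I. (1 + (\<xi> \<bullet> b)\<^sup>2) powr (- s)))
      = (\<lambda>\<xi>. ((1 + (\<Sum>b\<in>I. (\<xi> \<bullet> b)\<^sup>2)) powr s * (\<Prod>b\<in>I. (1 + (\<xi> \<bullet> b)\<^sup>2) powr (- s))) *
        ((1 + (\<Sum>b\<in>I. (\<xi> \<bullet> b)\<^sup>2) + (\<xi> \<bullet> j)\<^sup>2) powr s * ((1 + (\<Sum>b\<in>I. (\<xi> \<bullet> b)\<^sup>2)) powr (- s) * (1 + (\<xi> \<bullet> j)\<^sup>2) powr (- s))))"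
    proof
      fix \<xi> :: 'a
      have "(1 + (\<Sum>b\<in>I. (\<xi> \<bullet> b)\<^sup>2)) powr s * (1 + (\<Sum>b\<in>I. (\<xi> \<bullet> b)\<^sup>2)) powr (- s) = 1"
        using pos[of \<xi>] by (simp add: powr_minus)
      then show "(1 + (\<Sum>b\<in>insert j I. (\<xi> \<bullet> b)\<^sup>2)) powr s * (\<Prod>b\<in>insert j I. (1 + (\<xi> \<bullet> b)\<^sup>2) powr (- s))
        = ((1 + (\<Sum>b\<in>I. (\<xi> \<bullet> b)\<^sup>2)) powr s * (\<Prod>b\<in>I. (1 + (\<xi> \<bullet> b)\<^sup>2) powr (- s))) *
        ((1 + (\<Sum>b\<in>I. (\<xi> \<bullet> b)\<^sup>2) + (\<xi> \<bullet> j)\<^sup>2) powr s * ((1 + (\<Sum>b\<in>I. (\<xi> \<bullet> b)\<^sup>2)) powr (- s) * (1 + (\<xi> \<bullet> j)\<^sup>2) powr (- s)))"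
        using insert.hyps by (simp add: algebra_simps)
    qed
    then show ?case using symbol_mult[OF IH st] by simp
  qed
  from this[of Basis] show ?thesis by (simp add: norm2_Basis)
qed

section \<open>Bessel potentials\<close>

lemma weighted_unit:
  shows "weighted (return borel (0::'a::euclidean_space, 1))"
    and "wchar (return borel (0::'a, 1)) \<xi> = 1"
    and "g \<in> borel_measurable borel \<Longrightarrow> wconv (return borel (0::'a, 1)) g = g"
proof -
  have [measurable]: "fst \<in> (borel :: ('a \<times> real) measure) \<rightarrow>\<^sub>M borel" "snd \<in> (borel :: ('a \<times> real) measure) \<rightarrow>\<^sub>M borel"
    unfolding borel_prod[symmetric] by measurable
  show "weighted (return borel (0::'a, 1))"
    unfolding weighted_def by (auto intro!: prob_space_return simp: integrable_iff_bounded nn_integral_return)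
  show "wchar (return borel (0::'a, 1)) \<xi> = 1"
    unfolding wchar_def by (subst integral_return) auto
  show "wconv (return borel (0::'a, 1)) g = g" if [measurable]: "g \<in> borel_measurable borel"
    unfolding wconv_def[abs_def] by (subst integral_return) auto
qed

lemma symbolE:
  assumes "symbol m" obtains N where "weighted N" "\<And>\<xi>. wchar N \<xi> = of_real (m \<xi>)"
  using assms by (auto simp: symbol_def)

lemma bessel_weight_pos: "1 + (norm \<xi>)\<^sup>2 > (0::real)"
  by (intro add_pos_nonneg) auto

lemma wadj_schwartz:
  assumes N: "weighted N" and \<phi>: "schwartz \<phi>"
  shows "wadj N \<phi> = inv_fourier (\<lambda>\<xi>. wchar N \<xi> * fourier \<phi> \<xi>)"
proof -
  have "inv_fourier (fourier \<phi>) = \<phi>" using fourier_inversion[OF \<phi>] by (simp add: fun_eq_iff)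
  then have "wadj N \<phi> = wadj N (inv_fourier (fourier \<phi>))" by simp
  then show ?thesis using wadj_inv_fourier[OF N integrable_fourier[OF \<phi>]] by (simp add: fun_eq_iff)
qed

text \<open>With k at least \<gamma>/2, the operator is k applications of \<open>helmholtz\<close>,
  which stay in the Schwartz class, followed by a potential of nonnegative order, which preserves
  \<open>L1b\<close>.\<close>

lemma L1b_bessel_op:
  fixes \<phi> :: "'a::euclidean_space \<Rightarrow> complex"
  assumes \<phi>: "schwartz \<phi>"
  shows "L1b (bessel_op \<gamma> \<phi>)"
proof -
  define k where "k = nat \<lceil>\<gamma> / 2\<rceil>"
  have k: "real k - \<gamma> / 2 \<ge> 0" using real_nat_ceiling_ge[of "\<gamma> / 2"] by (simp add: k_def)
  obtain N where N: "weighted N" "\<And>\<xi>::'a. wchar N \<xi> = of_real ((1 + 1 * (norm \<xi>)\<^sup>2) powr (- (real k - \<gamma> / 2)))"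
    using symbol_bessel_norm[where 'a='a, OF k zero_le_one] by (rule symbolE) blast
  let ?\<psi> = "(helmholtz ^^ k) \<phi>"
  have \<psi>: "schwartz ?\<psi>" by (rule schwartz_helmholtz_funpow[OF \<phi>])
  have "wchar N \<xi> * fourier ?\<psi> \<xi> = of_real ((1 + (norm \<xi>)\<^sup>2) powr (\<gamma> / 2)) * fourier \<phi> \<xi>" for \<xi>
  proof -
    have "(1 + (norm \<xi>)\<^sup>2) powr (- (real k - \<gamma> / 2)) * (1 + (norm \<xi>)\<^sup>2) ^ k = (1 + (norm \<xi>)\<^sup>2) powr (\<gamma> / 2)"
      using bessel_weight_pos[of \<xi>] by (simp add: powr_realpow[symmetric] powr_add[symmetric])
    then have "complex_of_real ((1 + (norm \<xi>)\<^sup>2) powr (- (real k - \<gamma> / 2))) * of_real ((1 + (norm \<xi>)\<^sup>2) ^ k) = of_real ((1 + (norm \<xi>)\<^sup>2) powr (\<gamma> / 2))"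
      by (simp only: of_real_mult[symmetric])
    then show ?thesis
      unfolding N(2) fourier_helmholtz_funpow[OF \<phi>] mult_1 by (simp only: mult.assoc[symmetric])
  qed
  then have "bessel_op \<gamma> \<phi> = wadj N ?\<psi>"
    unfolding bessel_op_def wadj_schwartz[OF N(1) \<psi>] by simp
  then show ?thesis using wadj_L1b[OF N(1) L1b_schwartz[OF \<psi>]] by simp
qed

lemma bessel_op_translate:
  assumes [measurable]: "\<phi> \<in> borel_measurable borel"
  shows "bessel_op \<gamma> (\<lambda>x. \<phi> (x + c)) x = bessel_op \<gamma> \<phi> (x + c)"
  unfolding bessel_op_def inv_fourier_cis
proof (intro Bochner_Integration.integral_cong refl)
  fix \<xi>
  have "cis (2 * pi * (c \<bullet> \<xi>)) * cis (2 * pi * (x \<bullet> \<xi>)) = cis (2 * pi * ((x + c) \<bullet> \<xi>))"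
    by (simp add: cis_mult inner_add_left algebra_simps)
  then show "of_real ((1 + (norm \<xi>)\<^sup>2) powr (\<gamma> / 2)) * fourier (\<lambda>x. \<phi> (x + c)) \<xi> * cis (2 * pi * (x \<bullet> \<xi>))
      = of_real ((1 + (norm \<xi>)\<^sup>2) powr (\<gamma> / 2)) * fourier \<phi> \<xi> * cis (2 * pi * ((x + c) \<bullet> \<xi>))"
    by (simp add: fourier_translate mult_ac)
qed

text \<open>The multiplier identity is moved to the test function by duality. Explicit representers
  come from here, usually with N2 a point mass at 0 or a quotient symbol.\<close>

lemma bessel_rep_wconv:
  assumes p: "p > 1" and N1: "weighted N1" and N2: "weighted N2"
    and ch: "\<And>\<xi>. wchar N1 \<xi> * of_real ((1 + (norm \<xi>)\<^sup>2) powr (\<gamma> / 2)) = wchar N2 \<xi>" and g: "Lp_fun p g"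
  shows "bessel_rep \<gamma> p (wconv N1 g) (wconv N2 g)"
  unfolding bessel_rep_def
proof (intro conjI allI impI wconv_Lp p N1 N2 g)
  fix \<phi> :: "'a \<Rightarrow> complex" assume \<phi>: "schwartz \<phi>"
  have "wadj N1 (bessel_op \<gamma> \<phi>) = inv_fourier (\<lambda>\<xi>. wchar N1 \<xi> * (of_real ((1 + (norm \<xi>)\<^sup>2) powr (\<gamma> / 2)) * fourier \<phi> \<xi>))"
    unfolding bessel_op_def using wadj_inv_fourier[OF N1 integrable_fourier_schwartz[OF \<phi>]] by (simp add: fun_eq_iff)
  also have "\<dots> = wadj N2 \<phi>" unfolding wadj_schwartz[OF N2 \<phi>] by (simp only: mult.assoc[symmetric] ch)
  finally have eq: "wadj N1 (bessel_op \<gamma> \<phi>) = wadj N2 \<phi>" .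
  show "(LINT x|lborel. complex_of_real (wconv N1 g x) * bessel_op \<gamma> \<phi> x) = (LINT x|lborel. complex_of_real (wconv N2 g x) * \<phi> x)"
    unfolding wconv_adjoint[OF g p N1 L1b_bessel_op[OF \<phi>]] wconv_adjoint[OF g p N2 L1b_schwartz[OF \<phi>]] eq ..
qed

text \<open>Gaussians of every centre and scale suffice as tests: after a substitution the pairings
  are the averages of F over an approximate identity.\<close>

lemma gauss_test_zero:
  fixes F :: "'a::euclidean_space \<Rightarrow> real"
  assumes F: "Lp_fun p F" and p: "p > 1"
    and z: "\<And>c a. c > 0 \<Longrightarrow> (LINT x|lborel. complex_of_real (F x) * of_real (gauss ((x - a) /\<^sub>R c))) = 0"
  shows "AE x in lborel. F x = 0"
proof (rule kernel_vanish_imp_zero[OF F p integrable_gauss integral_gauss])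
  fix c :: real assume c: "c > 0"
  have [measurable]: "F \<in> borel_measurable borel" using F by (simp add: Lp_fun_def)
  show "AE x in lborel. (LINT z|lborel. gauss z * F (x + c *\<^sub>R z)) = 0"
  proof (rule AE_I2)
    fix a :: 'a
    have "complex_of_real (LINT x|lborel. F x * gauss ((x - a) /\<^sub>R c)) = 0"
      using z[OF c, of a] by (simp only: of_real_mult[symmetric] integral_complex_of_real)
    then have "(LINT x|lborel. F x * gauss ((x - a) /\<^sub>R c)) = 0" by (simp only: of_real_eq_0_iff)
    moreover have "(LINT z|lborel. F (c *\<^sub>R z + a) * gauss ((c *\<^sub>R z + a - a) /\<^sub>R c)) = (1 / \<bar>c\<bar> ^ DIM('a)) *\<^sub>R (LINT x|lborel. F x * gauss ((x - a) /\<^sub>R c))"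
      using c by (intro integral_affine) auto
    ultimately show "(LINT z|lborel. gauss z * F (a + c *\<^sub>R z)) = 0"
      using c by (simp add: add.commute mult.commute)
  qed
qed

text \<open>The difference F of f and the potential annihilates all
  \<open>bessel_op \<gamma> \<phi>\<close>. This operator commutes with translations, and a Gaussian
  \<open>\<phi>\<close> is \<open>wadj N\<close> of \<open>bessel_op \<gamma> \<phi>\<close>, a
  superposition of translates that F annihilates.\<close>

lemma bessel_rep_imp_wconv:
  fixes f g :: "'a::euclidean_space \<Rightarrow> real"
  assumes p: "p > 1" and N: "weighted N" "\<And>\<xi>. wchar N \<xi> = of_real ((1 + (norm \<xi>)\<^sup>2) powr (- (\<gamma> / 2)))"
    and fg: "bessel_rep \<gamma> p f g"
  shows "AE x in lborel. f x = wconv N g x"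
proof -
  have f: "Lp_fun p f" and g: "Lp_fun p g"
    and rep: "\<And>\<phi>. schwartz \<phi> \<Longrightarrow> (LINT x|lborel. complex_of_real (f x) * bessel_op \<gamma> \<phi> x) = (LINT x|lborel. complex_of_real (g x) * \<phi> x)"
    using fg by (auto simp: bessel_rep_def)
  have gm: "g \<in> borel_measurable borel" using g by (simp add: Lp_fun_def)
  have w1: "(1 + (norm \<xi>)\<^sup>2) powr (- (\<gamma> / 2)) * (1 + (norm \<xi>)\<^sup>2) powr (\<gamma> / 2) = 1" for \<xi> :: 'a
    using bessel_weight_pos[of \<xi>] by (simp add: powr_add[symmetric] less_imp_neq[THEN not_sym])
  have ch: "wchar N \<xi> * of_real ((1 + (norm \<xi>)\<^sup>2) powr (\<gamma> / 2)) = 1" for \<xi>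
    unfolding N(2) by (simp only: of_real_mult[symmetric] w1 of_real_1)
  have br: "bessel_rep \<gamma> p (wconv N g) g"
  proof -
    have "bessel_rep \<gamma> p (wconv N g) (wconv (return borel (0, 1)) g)"
      by (rule bessel_rep_wconv[OF p N(1) weighted_unit(1) _ g]) (simp add: ch weighted_unit(2))
    then show ?thesis by (simp add: weighted_unit(3)[OF gm])
  qed
  define F where "F = (\<lambda>x. f x - wconv N g x)"
  have F: "Lp_fun p F" unfolding F_def using p by (intro Lp_fun_diff f wconv_Lp N g) auto
  have F0: "(LINT x|lborel. complex_of_real (F x) * bessel_op \<gamma> \<phi> x) = 0" if \<phi>: "schwartz \<phi>" for \<phi>
  proof -
    obtain C where C: "\<And>x. norm (bessel_op \<gamma> \<phi> x) \<le> C" using L1b_bessel_op[OF \<phi>, of \<gamma>] by (auto simp: L1b_def bounded_iff)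
    have i: "integrable lborel (bessel_op \<gamma> \<phi>)" using L1b_bessel_op[OF \<phi>, of \<gamma>] by (simp add: L1b_def)
    have "(LINT x|lborel. complex_of_real (F x) * bessel_op \<gamma> \<phi> x) = (LINT x|lborel. complex_of_real (f x) * bessel_op \<gamma> \<phi> x) - (LINT x|lborel. complex_of_real (wconv N g x) * bessel_op \<gamma> \<phi> x)"
      unfolding F_def of_real_diff left_diff_distrib
      by (intro Bochner_Integration.integral_diff integrable_Lp_mult[OF f p i C] integrable_Lp_mult[OF wconv_Lp[OF p N(1) g] p i C])
    also have "\<dots> = 0" using rep[OF \<phi>] br \<phi> by (simp add: bessel_rep_def)
    finally show ?thesis .
  qed
  have "AE x in lborel. F x = 0"
  proof (rule gauss_test_zero[OF F p])
    fix c :: real and a :: 'a assume c: "c > 0"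
    define \<phi> where "\<phi> = (\<lambda>x::'a. complex_of_real (gauss ((x - a) /\<^sub>R c)))"
    have \<phi>: "schwartz \<phi>" unfolding \<phi>_def by (rule schwartz_gauss_shift[OF c])
    let ?\<psi> = "bessel_op \<gamma> \<phi>"
    have "wadj N ?\<psi> = inv_fourier (\<lambda>\<xi>. wchar N \<xi> * (of_real ((1 + (norm \<xi>)\<^sup>2) powr (\<gamma> / 2)) * fourier \<phi> \<xi>))"
      unfolding bessel_op_def using wadj_inv_fourier[OF N(1) integrable_fourier_schwartz[OF \<phi>]] by (simp add: fun_eq_iff)
    also have "\<dots> = \<phi>" by (simp add: mult.assoc[symmetric] ch fourier_inversion[OF \<phi>] fun_eq_iff)
    finally have eq: "wadj N ?\<psi> = \<phi>" .
    have sh: "(LINT z|lborel. complex_of_real (F z) * ?\<psi> (z - y)) = 0" for y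
    proof -
      have s: "schwartz (\<lambda>x. \<phi> (x + - y))"
        using schwartz_gauss_shift[OF c, of "a + y"] by (simp add: \<phi>_def algebra_simps)
      have "?\<psi> (z - y) = bessel_op \<gamma> (\<lambda>x. \<phi> (x + - y)) z" for z
        using bessel_op_translate[OF schwartz_measurable[OF \<phi>], of \<gamma> "- y" z] by simp
      then show ?thesis using F0[OF s] by simp
    qed
    have "(LINT x|lborel. complex_of_real (F x) * \<phi> x) = 0"
      using wadj_pairing[OF F p N(1) L1b_bessel_op[OF \<phi>, of \<gamma>]] unfolding eq sh by simp
    then show "(LINT x|lborel. complex_of_real (F x) * of_real (gauss ((x - a) /\<^sub>R c))) = 0" by (simp add: \<phi>_def)
  qed
  then show ?thesis by (auto simp: F_def elim!: eventually_mono)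
qed

text \<open>Composition is identified by its action on Gaussians, where only the transforms of the
  measures enter. Any measure with the product transform can serve as N3.\<close>

lemma wconv_comp:
  fixes g :: "'a::euclidean_space \<Rightarrow> real"
  assumes p: "p > 1" and N: "weighted N1" "weighted N2" "weighted N3" and g: "Lp_fun p g"
    and ch: "\<And>\<xi>. wchar N1 \<xi> * wchar N2 \<xi> = wchar N3 \<xi>"
  shows "AE x in lborel. wconv N1 (wconv N2 g) x = wconv N3 g x"
proof -
  define F where "F = (\<lambda>x. wconv N1 (wconv N2 g) x - wconv N3 g x)"
  have g2: "Lp_fun p (wconv N2 g)" by (rule wconv_Lp[OF p N(2) g])
  have g12: "Lp_fun p (wconv N1 (wconv N2 g))" by (rule wconv_Lp[OF p N(1) g2])
  have g3: "Lp_fun p (wconv N3 g)" by (rule wconv_Lp[OF p N(3) g])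
  have F: "Lp_fun p F" unfolding F_def using p by (intro Lp_fun_diff g12 g3) auto
  have "AE x in lborel. F x = 0"
  proof (rule gauss_test_zero[OF F p])
    fix c :: real and a :: 'a assume c: "c > 0"
    define \<phi> where "\<phi> = (\<lambda>x::'a. complex_of_real (gauss ((x - a) /\<^sub>R c)))"
    have \<phi>: "schwartz \<phi>" unfolding \<phi>_def by (rule schwartz_gauss_shift[OF c])
    have L: "L1b \<phi>" by (rule L1b_schwartz[OF \<phi>])
    obtain C where C: "\<And>x. norm (\<phi> x) \<le> C" using L by (auto simp: L1b_def bounded_iff)
    have i: "integrable lborel \<phi>" using L by (simp add: L1b_def)
    have "wadj N2 (wadj N1 \<phi>) = inv_fourier (\<lambda>\<xi>. wchar N2 \<xi> * (wchar N1 \<xi> * fourier \<phi> \<xi>))"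
      unfolding wadj_schwartz[OF N(1) \<phi>]
      using wadj_inv_fourier[OF N(2) integrable_wchar_mult[OF N(1) integrable_fourier[OF \<phi>]]] by (simp add: fun_eq_iff)
    also have "\<dots> = wadj N3 \<phi>" unfolding wadj_schwartz[OF N(3) \<phi>] ch[symmetric] by (simp add: mult_ac)
    finally have eq: "wadj N2 (wadj N1 \<phi>) = wadj N3 \<phi>" .
    have "(LINT x|lborel. complex_of_real (F x) * \<phi> x) = (LINT x|lborel. complex_of_real (wconv N1 (wconv N2 g) x) * \<phi> x) - (LINT x|lborel. complex_of_real (wconv N3 g x) * \<phi> x)"
      unfolding F_def of_real_diff left_diff_distrib
      by (intro Bochner_Integration.integral_diff integrable_Lp_mult[OF g12 p i C] integrable_Lp_mult[OF g3 p i C])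
    also have "\<dots> = 0"
      unfolding wconv_adjoint[OF g2 p N(1) L] wconv_adjoint[OF g p N(2) wadj_L1b[OF N(1) L]] wconv_adjoint[OF g p N(3) L] eq by simp
    finally show "(LINT x|lborel. complex_of_real (F x) * of_real (gauss ((x - a) /\<^sub>R c))) = 0" by (simp add: \<phi>_def)
  qed
  then show ?thesis by (auto simp: F_def elim!: eventually_mono)
qed

lemma bessel_rep_cong_AE:
  assumes "bessel_rep \<gamma> p f g" and [measurable]: "f' \<in> borel_measurable borel" and ae: "AE x in lborel. f x = f' x"
  shows "bessel_rep \<gamma> p f' g"
proof -
  have f: "Lp_fun p f" using assms by (simp add: bessel_rep_def)
  have [measurable]: "f \<in> borel_measurable borel" using f by (simp add: Lp_fun_def)
  have "Lp_fun p f'" by (rule Lp_fun_cong_AE[OF f _ ae]) measurable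
  moreover have "(LINT x|lborel. complex_of_real (f' x) * bessel_op \<gamma> \<phi> x) = (LINT x|lborel. complex_of_real (f x) * bessel_op \<gamma> \<phi> x)" if "schwartz \<phi>" for \<phi>
  proof (rule integral_cong_AE)
    have [measurable]: "bessel_op \<gamma> \<phi> \<in> borel_measurable borel" using L1b_bessel_op[OF that, of \<gamma>] by (auto simp: L1b_def)
    show "(\<lambda>x. complex_of_real (f' x) * bessel_op \<gamma> \<phi> x) \<in> borel_measurable lborel" by measurable
    show "(\<lambda>x. complex_of_real (f x) * bessel_op \<gamma> \<phi> x) \<in> borel_measurable lborel" by measurable
  qed (use ae in \<open>auto elim!: eventually_mono\<close>)
  ultimately show ?thesis using assms(1) by (simp add: bessel_rep_def)
qed

lemma bessel_rep_linear:
  assumes p: "p > 1" and 1: "bessel_rep \<gamma> p f1 g1" and 2: "bessel_rep \<gamma> p f2 g2"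
  shows "bessel_rep \<gamma> p (\<lambda>x. c * f1 x + d * f2 x) (\<lambda>x. c * g1 x + d * g2 x)"
proof -
  have L: "Lp_fun p f1" "Lp_fun p g1" "Lp_fun p f2" "Lp_fun p g2" using 1 2 by (auto simp: bessel_rep_def)
  have lin: "(LINT x|lborel. complex_of_real (c * u x + d * v x) * \<psi> x) = of_real c * (LINT x|lborel. complex_of_real (u x) * \<psi> x) + of_real d * (LINT x|lborel. complex_of_real (v x) * \<psi> x)"
    if u: "Lp_fun p u" and v: "Lp_fun p v" and \<psi>: "L1b \<psi>" for u v \<psi>
  proof -
    obtain C where C: "\<And>x. norm (\<psi> x) \<le> C" using \<psi> by (auto simp: L1b_def bounded_iff)
    have i: "integrable lborel \<psi>" using \<psi> by (simp add: L1b_def)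
    show ?thesis
      using integrable_Lp_mult[OF u p i C] integrable_Lp_mult[OF v p i C] by (simp add: distrib_right mult.assoc)
  qed
  show ?thesis
    unfolding bessel_rep_def
  proof (intro conjI allI impI)
    show "Lp_fun p (\<lambda>x. c * f1 x + d * f2 x)" "Lp_fun p (\<lambda>x. c * g1 x + d * g2 x)"
      using p by (auto intro!: Lp_fun_add Lp_fun_cmult L)
    fix \<phi> :: "'a \<Rightarrow> complex" assume \<phi>: "schwartz \<phi>"
    show "(LINT x|lborel. complex_of_real (c * f1 x + d * f2 x) * bessel_op \<gamma> \<phi> x) = (LINT x|lborel. complex_of_real (c * g1 x + d * g2 x) * \<phi> x)"
      unfolding lin[OF L(1,3) L1b_bessel_op[OF \<phi>]] lin[OF L(2,4) L1b_schwartz[OF \<phi>]]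
      using 1 2 \<phi> by (simp add: bessel_rep_def)
  qed
qed

lemma bessel_rep_zero: "bessel_rep \<gamma> p (\<lambda>_. 0) (\<lambda>_. 0)"
  by (simp add: bessel_rep_def)

definition bessel_potential :: "real \<Rightarrow> ('a::euclidean_space \<times> real) measure" where
  "bessel_potential \<gamma> = (SOME N. weighted N \<and> (\<forall>\<xi>. wchar N \<xi> = of_real ((1 + (norm \<xi>)\<^sup>2) powr (- (\<gamma> / 2)))))"

lemma
  assumes "\<gamma> \<ge> 0"
  shows weighted_bessel_potential: "weighted (bessel_potential \<gamma> :: ('a::euclidean_space \<times> real) measure)"
    and wchar_bessel_potential: "wchar (bessel_potential \<gamma>) \<xi> = of_real ((1 + (norm (\<xi>::'a))\<^sup>2) powr (- (\<gamma> / 2)))"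
proof -
  obtain N where "weighted N" "\<And>\<xi>::'a. wchar N \<xi> = of_real ((1 + 1 * (norm \<xi>)\<^sup>2) powr (- (\<gamma> / 2)))"
    by (rule symbolE[OF symbol_bessel_norm[where 'a='a, of "\<gamma> / 2" 1]]) (use assms in auto)
  then have "\<exists>N. weighted N \<and> (\<forall>\<xi>::'a. wchar N \<xi> = of_real ((1 + (norm \<xi>)\<^sup>2) powr (- (\<gamma> / 2))))" by auto
  from someI_ex[OF this] show "weighted (bessel_potential \<gamma> :: ('a \<times> real) measure)"
    "wchar (bessel_potential \<gamma>) \<xi> = of_real ((1 + (norm (\<xi>::'a))\<^sup>2) powr (- (\<gamma> / 2)))"
    unfolding bessel_potential_def by auto
qed

text \<open>Replaces the duality with test functions by a formula: f is almost everywhere the Bessel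
  potential of its representer. Translation, dilation and tensor products are handled through this
  form.\<close>

lemma bessel_rep_iff:
  fixes f g :: "'a::euclidean_space \<Rightarrow> real"
  assumes p: "p > 1" and \<gamma>: "\<gamma> \<ge> 0"
  shows "bessel_rep \<gamma> p f g \<longleftrightarrow> Lp_fun p g \<and> f \<in> borel_measurable borel \<and> (AE x in lborel. f x = wconv (bessel_potential \<gamma>) g x)"
proof
  assume fg: "bessel_rep \<gamma> p f g"
  then show "Lp_fun p g \<and> f \<in> borel_measurable borel \<and> (AE x in lborel. f x = wconv (bessel_potential \<gamma>) g x)"
    using bessel_rep_imp_wconv[OF p weighted_bessel_potential[OF \<gamma>] wchar_bessel_potential[OF \<gamma>] fg]
    by (auto simp: bessel_rep_def Lp_fun_def)
next
  assume *: "Lp_fun p g \<and> f \<in> borel_measurable borel \<and> (AE x in lborel. f x = wconv (bessel_potential \<gamma>) g x)"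
  then have g: "Lp_fun p g" and gm: "g \<in> borel_measurable borel" by (auto simp: Lp_fun_def)
  have w1: "(1 + (norm \<xi>)\<^sup>2) powr (- (\<gamma> / 2)) * (1 + (norm \<xi>)\<^sup>2) powr (\<gamma> / 2) = 1" for \<xi> :: 'a
    using bessel_weight_pos[of \<xi>] by (simp add: powr_add[symmetric] less_imp_neq[THEN not_sym])
  have ch: "wchar (bessel_potential \<gamma>) \<xi> * of_real ((1 + (norm \<xi>)\<^sup>2) powr (\<gamma> / 2)) = 1" for \<xi> :: 'a
    unfolding wchar_bessel_potential[OF \<gamma>] by (simp only: of_real_mult[symmetric] w1 of_real_1)
  have "bessel_rep \<gamma> p (wconv (bessel_potential \<gamma>) g) g"
  proof -
    have "bessel_rep \<gamma> p (wconv (bessel_potential \<gamma>) g) (wconv (return borel (0, 1)) g)"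
      by (rule bessel_rep_wconv[OF p weighted_bessel_potential[OF \<gamma>] weighted_unit(1) _ g]) (simp add: ch weighted_unit(2))
    then show ?thesis by (simp add: weighted_unit(3)[OF gm])
  qed
  then show "bessel_rep \<gamma> p f g"
    by (rule bessel_rep_cong_AE) (use * in \<open>auto elim!: eventually_mono\<close>)
qed

lemma bessel_rep_translate:
  assumes p: "p > 1" and \<gamma>: "\<gamma> \<ge> 0" and fg: "bessel_rep \<gamma> p f g"
  shows "bessel_rep \<gamma> p (\<lambda>x. f (x + t)) (\<lambda>x. g (x + t))"
proof -
  have *: "Lp_fun p g" "f \<in> borel_measurable borel" "AE x in lborel. f x = wconv (bessel_potential \<gamma>) g x"
    using fg bessel_rep_iff[OF p \<gamma>] by auto
  have [measurable]: "f \<in> borel_measurable borel" by (rule *(2))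
  have "AE x in lborel. f (1 *\<^sub>R x + t) = wconv (bessel_potential \<gamma>) g (1 *\<^sub>R x + t)"
    by (rule AE_affine[OF _ *(3)]) simp
  then have "AE x in lborel. f (x + t) = wconv (bessel_potential \<gamma>) (\<lambda>x. g (x + t)) x"
    by (simp add: wconv_def add_ac)
  then show ?thesis unfolding bessel_rep_iff[OF p \<gamma>] using Lp_fun_translate[OF *(1)] by simp
qed

section \<open>Density in dimension one\<close>

lemma Lp_lin_cmultD: "Lp_lin p X \<Longrightarrow> g \<in> X \<Longrightarrow> (\<lambda>x. c * g x) \<in> X"
  by (simp add: Lp_lin_def)

definition shift_inv :: "('a::euclidean_space \<Rightarrow> real) set \<Rightarrow> bool" where
  "shift_inv X \<longleftrightarrow> (\<forall>g\<in>X. \<forall>t. (\<lambda>x. g (x + t)) \<in> X)"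

lemma shift_inv_cl:
  assumes X: "Lp_lin p X" "shift_inv X" and p: "p > 1"
  shows "shift_inv (Lp_cl p X)"
  unfolding shift_inv_def
proof (intro ballI allI)
  fix g and t :: 'a assume g: "g \<in> Lp_cl p X"
  show "(\<lambda>x. g (x + t)) \<in> Lp_cl p X"
    unfolding Lp_cl_def
  proof (intro CollectI conjI allI impI)
    show "Lp_fun p (\<lambda>x. g (x + t))" by (rule Lp_fun_translate[OF Lp_cl_Lp[OF g]])
    fix e :: real assume "e > 0"
    then obtain h where h: "h \<in> X" "np p (\<lambda>x. g x - h x) < e" using g by (auto simp: Lp_cl_def)
    have "Lp_fun p (\<lambda>x. g x - h x)" using X h(1) p by (intro Lp_fun_diff Lp_cl_Lp[OF g]) (auto simp: Lp_lin_def)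
    from np_translate[OF this, of t] show "\<exists>k\<in>X. np p (\<lambda>x. g (x + t) - k x) < e"
      using h X by (intro bexI[of _ "\<lambda>x. h (x + t)"]) (auto simp: shift_inv_def)
  qed
qed

text \<open>A finite signed measure acts by superposing translates, and closures of
  translation-invariant spaces absorb superpositions.\<close>

lemma wconv_in_cl:
  fixes g :: "'a::euclidean_space \<Rightarrow> real"
  assumes X: "Lp_lin p X" "shift_inv X" and p: "p > 1" and N: "weighted N" and g: "g \<in> Lp_cl p X"
  shows "wconv N g \<in> Lp_cl p X"
proof -
  have [measurable_cong]: "sets N = sets (borel \<Otimes>\<^sub>M borel)" by (rule weighted_sets[OF N])
  have "(\<lambda>x. \<integral>w. snd w * g (1 *\<^sub>R x + fst w) \<partial>N) \<in> Lp_cl p X"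
  proof (rule affine_mixture_in_Lp_cl[OF p X(1) Lp_cl_Lp[OF g] weighted_sigma_finite[OF N]])
    show "(\<lambda>x. g (1 *\<^sub>R x + fst w)) \<in> Lp_cl p X" for w
      using shift_inv_cl[OF X p] g by (simp add: shift_inv_def)
    show "integrable N (\<lambda>w. snd w * \<bar>1::real\<bar> powr (- real DIM('a) / p))" using weighted_integrable[OF N] by simp
  qed simp_all
  then show ?thesis by (simp add: wconv_def[abs_def])
qed

lemma kernel_in_cl:
  fixes g k :: "'a::euclidean_space \<Rightarrow> real"
  assumes X: "Lp_lin p X" "shift_inv X" and p: "p > 1" and k: "integrable lborel k" and g: "g \<in> Lp_cl p X"
  shows "(\<lambda>x. LINT v|lborel. k v * g (x - v)) \<in> Lp_cl p X"
proof -
  have [measurable]: "k \<in> borel_measurable borel" using k by auto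
  have "(\<lambda>x. \<integral>v. k v * g (1 *\<^sub>R x + (- v)) \<partial>lborel) \<in> Lp_cl p X"
  proof (rule affine_mixture_in_Lp_cl[OF p X(1) Lp_cl_Lp[OF g] sigma_finite_lborel])
    show "(\<lambda>x. g (1 *\<^sub>R x + (- w))) \<in> Lp_cl p X" for w
      using shift_inv_cl[OF X p] g unfolding shift_inv_def scaleR_one by blast
    show "integrable lborel (\<lambda>w. k w * \<bar>1::real\<bar> powr (- real DIM('a) / p))" using k by simp
  qed simp_all
  then show ?thesis by simp
qed

text \<open>A continuous function of compact support is approximated by its convolution with a
  dilate of K. Read with the roles exchanged, the convolution superposes translates of that dilate,
  which lie in the closure, with an integrable weight.\<close>

lemma dense_if_kernels:
  fixes g K :: "'a::euclidean_space \<Rightarrow> real"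
  assumes X: "Lp_lin p X" "shift_inv X" and p: "p > 1"
    and K: "integrable lborel K" "(LINT z|lborel. K z) = 1" "\<And>z. K (- z) = K z"
    and KX: "\<And>c. c > 0 \<Longrightarrow> (\<lambda>x. K (x /\<^sub>R c)) \<in> Lp_cl p X" and g: "Lp_fun p g"
  shows "g \<in> Lp_cl p X"
proof (rule Lp_cl_idem[OF p _ g])
  show "\<forall>g\<in>X. Lp_fun p g" using X by (simp add: Lp_lin_def)
  fix e :: real assume e: "e > 0"
  define d where "d = e / (2 * 2 powr p)"
  have d: "d > 0" using e by (simp add: d_def)
  obtain \<theta> where \<theta>: "Cc \<theta>" "np p (\<lambda>x. g x - \<theta> x) < d" using Lp_approx_Cc[OF g p d] by blast
  have L\<theta>: "Lp_fun p \<theta>" by (rule Cc_Lp[OF \<theta>(1) p])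
  have [measurable]: "\<theta> \<in> borel_measurable borel" "K \<in> borel_measurable borel" using \<theta>(1) K(1) by (auto intro: Cc_measurable)
  have lim: "(\<lambda>n. 1 / real (Suc n)) \<longlonglongrightarrow> 0" using LIMSEQ_inverse_real_of_nat by (simp add: inverse_eq_divide)
  obtain n :: nat where n: "np p (\<lambda>x. (LINT z|lborel. K z * \<theta> (x + (1 / real (Suc n)) *\<^sub>R z)) - \<theta> x) < d"
    using order_tendstoD(2)[OF approx_identity[OF L\<theta> p K(1,2) lim] d] by (auto simp: eventually_sequentially)
  define c where "c = 1 / real (Suc n)"
  have c: "c > 0" by (simp add: c_def)
  define h where "h = (\<lambda>x. LINT z|lborel. K z * \<theta> (x + c *\<^sub>R z))"
  have "h x = (LINT v|lborel. (1 / c ^ DIM('a) * \<theta> v) * K ((x - v) /\<^sub>R c))" for x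
  proof -
    have "(LINT z|lborel. \<theta> (c *\<^sub>R z + x) * K ((x - (c *\<^sub>R z + x)) /\<^sub>R c)) = (1 / \<bar>c\<bar> ^ DIM('a)) *\<^sub>R (LINT v|lborel. \<theta> v * K ((x - v) /\<^sub>R c))"
      using c by (intro integral_affine) auto
    moreover have "K ((x - (c *\<^sub>R z + x)) /\<^sub>R c) = K z" for z using c by (simp add: K(3))
    ultimately show ?thesis using c by (simp add: h_def add.commute mult.commute mult.assoc)
  qed
  then have heq: "h = (\<lambda>x. LINT v|lborel. (1 / c ^ DIM('a) * \<theta> v) * K ((x - v) /\<^sub>R c))" by auto
  have hX: "h \<in> Lp_cl p X"
    unfolding heq by (rule kernel_in_cl[OF X p _ KX[OF c]]) (use Cc_integrable[OF \<theta>(1)] in simp)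
  have "np p (\<lambda>x. (g x - \<theta> x) + (\<theta> x - h x)) \<le> 2 powr p * (np p (\<lambda>x. g x - \<theta> x) + np p (\<lambda>x. \<theta> x - h x))"
    using p by (intro np_add_le Lp_fun_diff g L\<theta> Lp_cl_Lp[OF hX]) auto
  also have "\<dots> < 2 powr p * (d + d)"
    using \<theta>(2) n by (intro mult_strict_left_mono add_strict_mono) (auto simp: h_def c_def np_minus_commute[of p \<theta>])
  also have "\<dots> = e" by (simp add: d_def)
  finally show "\<exists>h\<in>Lp_cl p X. np p (\<lambda>x. g x - h x) < e" using hX by auto
qed

text \<open>Absolute convergence at almost every x, which permits Fubini when such a superposition
  is to be evaluated explicitly. The rescaled functions have constant norm, as in the closure
  argument.\<close>

lemma affine_mixture_AE:
  fixes g :: "'a::euclidean_space \<Rightarrow> real"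
  assumes p: "p > 1" and g: "Lp_fun p g" and N: "sigma_finite_measure N"
    and m[measurable]: "k \<in> borel_measurable N" "L \<in> borel_measurable N" "B \<in> borel_measurable N"
    and L: "\<And>w. w \<in> space N \<Longrightarrow> L w \<noteq> 0"
    and int: "integrable N (\<lambda>w. k w * \<bar>L w\<bar> powr (- real DIM('a) / p))"
  shows "AE x in lborel. integrable N (\<lambda>w. k w * g (L w *\<^sub>R x + B w))"
proof -
  have [measurable]: "g \<in> borel_measurable borel" using g by (simp add: Lp_fun_def)
  define q where "q = DIM('a) / p"
  have int': "integrable N (\<lambda>w. k w * \<bar>L w\<bar> powr (- q))" using int by (simp add: q_def)
  have npq: "np p (\<lambda>x. \<bar>l\<bar> powr q * g (l *\<^sub>R x + b)) = np p g" if "l \<noteq> 0" for l b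
  proof -
    have "np p (\<lambda>x. \<bar>l\<bar> powr q * g (l *\<^sub>R x + b)) = \<bar>l\<bar> powr (q * p) * (np p g / \<bar>l\<bar> ^ DIM('a))"
      by (simp add: np_cmult[OF Lp_fun_affine[OF that g]] np_affine[OF that g] powr_powr)
    also have "q * p = DIM('a)" using p by (simp add: q_def)
    also have "\<bar>l\<bar> powr DIM('a) = \<bar>l\<bar> ^ DIM('a)" using that by (simp add: powr_realpow)
    finally show ?thesis using that by simp
  qed
  have "AE x in lborel. integrable N (\<lambda>w. (k w * \<bar>L w\<bar> powr (- q)) * (\<bar>L w\<bar> powr q * g (L w *\<^sub>R x + B w)))"
  proof (rule AE_integrable_mixture[OF p N _ int'])
    show "Lp_fun p (\<lambda>x. \<bar>L w\<bar> powr q * g (L w *\<^sub>R x + B w))" if "w \<in> space N" for w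
      by (intro Lp_fun_cmult Lp_fun_affine L that g)
    have "integrable N (\<lambda>w. \<bar>k w * \<bar>L w\<bar> powr (- q)\<bar> * np p g)" using int' by (intro integrable_mult_left integrable_abs)
    then show "integrable N (\<lambda>w. \<bar>k w * \<bar>L w\<bar> powr (- q)\<bar> * np p (\<lambda>x. \<bar>L w\<bar> powr q * g (L w *\<^sub>R x + B w)))"
      by (rule Bochner_Integration.integrable_cong[THEN iffD1, rotated -1]) (auto simp: npq L)
  qed measurable
  then show ?thesis
  proof eventually_elim
    case (elim x)
    show ?case
      by (rule Bochner_Integration.integrable_cong[THEN iffD1, rotated -1, OF elim]) (use L in \<open>auto simp: powr_minus\<close>)
  qed
qed

section \<open>The ray kernel and its integrals along lines\<close>

lemma
  assumes s: "s > 0"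
  shows integrable_half_line: "integrable lborel (\<lambda>l. indicator {0<..} l *\<^sub>R (1 / (Complex s y + of_real l * Complex 1 X)\<^sup>2))"
    and integral_half_line: "(LINT l|lborel. indicator {0<..} l *\<^sub>R (1 / (Complex s y + of_real l * Complex 1 X)\<^sup>2)) = 1 / (Complex s y * Complex 1 X)"
proof -
  let ?z = "\<lambda>l. Complex s y + of_real l * Complex 1 X"
  let ?f = "\<lambda>l. 1 / (?z l)\<^sup>2"
  \<comment> \<open>A primitive: with z(l) = s + i y + l (1 + i X), the derivative of -1/z is (1 + i
    X) / z^2. Its value at 0 gives the integral, since it vanishes at infinity.\<close>
  let ?F = "\<lambda>l. - (1 / (?z l * Complex 1 X))"
  have re: "Re (?z l) = s + l" for l by simp
  have z0: "?z l \<noteq> 0" if "l \<ge> 0" for l using that s re[of l] by (metis add_pos_nonneg less_irrefl zero_complex.simps(1))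
  have c0: "Complex 1 X \<noteq> 0" by (simp add: complex_eq_iff)
  \<comment> \<open>Makes m (1 + l^2) at most (s + l)^2 for l > 0, comparing the integrand with 1 /
    (1 + l^2).\<close>
  define m where "m = min 1 (s\<^sup>2)"
  have m: "m > 0" using s by (simp add: m_def)
  have nf: "norm (?f l) \<le> 1 / m * (1 / (1 + l\<^sup>2))" if "l > 0" for l
  proof -
    have "s + l \<le> norm (?z l)" using complex_Re_le_cmod[of "?z l"] by (simp only: re)
    then have "(s + l)\<^sup>2 \<le> (norm (?z l))\<^sup>2" using that s by (intro power_mono) auto
    moreover have "m * (1 + l\<^sup>2) \<le> (s + l)\<^sup>2"
    proof -
      have "m * (1 + l\<^sup>2) = m + m * l\<^sup>2" by (simp add: algebra_simps)
      also have "\<dots> \<le> s\<^sup>2 + 1 * l\<^sup>2" by (intro add_mono mult_right_mono) (auto simp: m_def)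
      also have "\<dots> \<le> (s + l)\<^sup>2" using that s by (simp add: power2_sum)
      finally show ?thesis .
    qed
    ultimately have "m * (1 + l\<^sup>2) \<le> (norm (?z l))\<^sup>2" by linarith
    moreover have "m * (1 + l\<^sup>2) > 0" using m by (intro mult_pos_pos add_pos_nonneg) auto
    ultimately have "1 / (norm (?z l))\<^sup>2 \<le> 1 / (m * (1 + l\<^sup>2))" by (intro frac_le) auto
    then show ?thesis by (simp add: norm_divide norm_power)
  qed
  show I: "integrable lborel (\<lambda>l. indicator {0<..} l *\<^sub>R ?f l)"
  proof (rule Bochner_Integration.integrable_bound)
    show "integrable lborel (\<lambda>l::real. 1 / m * (1 / (1 + l\<^sup>2)))" by (intro integrable_mult_right integrable_inverse_1_plus_square_real)
    show "AE l in lborel. norm (indicator {0<..} l *\<^sub>R ?f l) \<le> norm (1 / m * (1 / (1 + l\<^sup>2)))"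
    proof (rule AE_I2)
      fix l :: real
      have "0 \<le> 1 / m * (1 / (1 + l\<^sup>2))" using m by simp
      then show "norm (indicator {0<..} l *\<^sub>R ?f l) \<le> norm (1 / m * (1 / (1 + l\<^sup>2)))"
        using nf[of l] by (cases "l > 0") (simp_all add: indicator_def)
    qed
  qed measurable
  have at0: "((?F \<circ> real_of_ereal) \<longlongrightarrow> ?F 0) (at_right (ereal 0))"
  proof -
    have "isCont ?F 0" using z0[of 0] c0 by (intro continuous_intros) auto
    then have "(?F \<longlongrightarrow> ?F 0) (at_right 0)" by (simp add: continuous_at_imp_continuous_within isCont_def filterlim_at_split)
    then show ?thesis by (simp add: ereal_tendsto_simps)
  qed
  have atinf: "((?F \<circ> real_of_ereal) \<longlongrightarrow> 0) (at_left \<infinity>)"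
  proof -
    have "filterlim (\<lambda>l::real. s + l) at_top at_top" by (rule filterlim_tendsto_add_at_top[OF tendsto_const filterlim_ident])
    then have "((\<lambda>l::real. 1 / (s + l)) \<longlongrightarrow> 0) at_top" by (rule tendsto_divide_0[OF tendsto_const filterlim_at_top_imp_at_infinity])
    then have t: "((\<lambda>l::real. 1 / (s + l) * (1 / norm (Complex 1 X))) \<longlongrightarrow> 0) at_top" by (rule tendsto_mult_left_zero)
    have "(?F \<longlongrightarrow> 0) at_top"
    proof (rule Lim_null_comparison[OF _ t])
      show "\<forall>\<^sub>F l in at_top. norm (?F l) \<le> 1 / (s + l) * (1 / norm (Complex 1 X))"
      proof (rule eventually_at_top_linorderI[of 0])
        fix l :: real assume l: "0 \<le> l"
        have "s + l \<le> norm (?z l)" using complex_Re_le_cmod[of "?z l"] by (simp only: re)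
        then have "1 / norm (?z l) \<le> 1 / (s + l)" using l s by (intro frac_le) auto
        then have "1 / norm (?z l) * (1 / norm (Complex 1 X)) \<le> 1 / (s + l) * (1 / norm (Complex 1 X))" by (intro mult_right_mono) auto
        then show "norm (?F l) \<le> 1 / (s + l) * (1 / norm (Complex 1 X))" by (simp add: norm_divide norm_mult)
      qed
    qed
    then show ?thesis by (simp add: ereal_tendsto_simps)
  qed
  have "(LBINT l=ereal 0..\<infinity>. ?f l) = 0 - ?F 0"
  proof (rule interval_integral_FTC_integrable)
    fix x :: real assume x: "ereal 0 < ereal x"
    then have zx: "?z x \<noteq> 0" using z0[of x] by simp
    have "((\<lambda>w. - (1 / ((Complex s y + w * Complex 1 X) * Complex 1 X))) has_field_derivative ?f x) (at (of_real x))"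
      using zx c0 by (auto intro!: derivative_eq_intros simp: power2_eq_square divide_simps)
    from has_vector_derivative_real_field[OF this, of UNIV]
    show "(?F has_vector_derivative ?f x) (at x)" by simp
    show "isCont ?f x" using zx by (intro continuous_intros) auto
  next
    show "set_integrable lborel (einterval (ereal 0) \<infinity>) ?f"
      using I by (simp add: set_integrable_def einterval_eq)
  qed (use at0 atinf in simp_all)
  then show "(LINT l|lborel. indicator {0<..} l *\<^sub>R ?f l) = 1 / (Complex s y * Complex 1 X)"
    by (simp add: interval_lebesgue_integral_def set_lebesgue_integral_def einterval_eq)
qed

text \<open>The kernel whose integral along every line \<open>b = v - l X\<close> of the parameter plane factorises: this is what
  extracts the Poisson kernel from superpositions of the functions \<open>g (l x + b)\<close>.\<close>

definition ray_kernel :: "real \<Rightarrow> real \<Rightarrow> real \<Rightarrow> real" where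
  "ray_kernel s l b = Re (1 / (Complex (\<bar>l\<bar> + s) (- b))\<^sup>2)"

lemma ray_kernel_measurable [measurable]:
  "(\<lambda>x. ray_kernel s (u x) (v x)) \<in> borel_measurable M" if [measurable]: "u \<in> borel_measurable M" "v \<in> borel_measurable M"
  unfolding ray_kernel_def Complex_eq by measurable

lemma abs_ray_kernel_le:
  assumes "s > 0" shows "\<bar>ray_kernel s l b\<bar> \<le> 1 / ((\<bar>l\<bar> + s)\<^sup>2 + b\<^sup>2)"
proof -
  have "\<bar>ray_kernel s l b\<bar> \<le> norm (1 / (Complex (\<bar>l\<bar> + s) (- b))\<^sup>2)" unfolding ray_kernel_def by (rule abs_Re_le_cmod)
  also have "\<dots> = 1 / ((\<bar>l\<bar> + s)\<^sup>2 + b\<^sup>2)" by (simp add: norm_divide norm_power cmod_power2)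
  finally show ?thesis .
qed

text \<open>The half-line l < 0 gives the formula for l > 0 with X replaced by - X; this is the
  purpose of |l| in the kernel. The two contributions add up to the real factor 2 / (1 + X^2), so
  the real part can be taken in the other factor alone and is the Poisson kernel.\<close>

lemma integral_ray_kernel:
  assumes s: "s > 0"
  shows "(LINT l|lborel. ray_kernel s l (y - l * X)) = 2 / (1 + X\<^sup>2) * (s / (s\<^sup>2 + y\<^sup>2))"
proof -
  let ?P = "\<lambda>X l. indicator {0<..} l *\<^sub>R (1 / (Complex s (- y) + of_real l * Complex 1 X)\<^sup>2)"
  have I: "integrable lborel (?P X)" for X by (rule integrable_half_line[OF s])
  have V: "(LINT l|lborel. ?P X l) = 1 / (Complex s (- y) * Complex 1 X)" for X by (rule integral_half_line[OF s])
  have I': "integrable lborel (\<lambda>l. ?P X (- l))" "(LINT l|lborel. ?P X (- l)) = (LINT l|lborel. ?P X l)" for X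
    using integrable_affine_iff[of "-1" "?P X" 0] integral_affine[of "-1" "?P X" 0] I by auto
  have "(LINT l|lborel. ray_kernel s l (y - l * X)) = (LINT l|lborel. Re (?P X l + ?P (- X) (- l)))"
  proof (rule integral_cong_AE)
    show "AE l in lborel. ray_kernel s l (y - l * X) = Re (?P X l + ?P (- X) (- l))"
      using AE_lborel_singleton[of 0]
    proof eventually_elim
      case (elim l)
      have "Complex (\<bar>l\<bar> + s) (- (y - l * X)) = Complex s (- y) + of_real l * Complex 1 X" if "l > 0"
        using that by (simp add: complex_eq_iff)
      moreover have "Complex (\<bar>l\<bar> + s) (- (y - l * X)) = Complex s (- y) + of_real (- l) * Complex 1 (- X)" if "l < 0"
        using that by (simp add: complex_eq_iff)
      ultimately show ?case using elim unfolding ray_kernel_def by (cases "l > 0") auto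
    qed
  qed measurable
  also have "\<dots> = Re (LINT l|lborel. ?P X l + ?P (- X) (- l))"
    using I I' by (subst integral_Re) auto
  also have "(LINT l|lborel. ?P X l + ?P (- X) (- l)) = 1 / (Complex s (- y) * Complex 1 X) + 1 / (Complex s (- y) * Complex 1 (- X))"
    using I I' V by simp
  also have "\<dots> = of_real (2 / (1 + X\<^sup>2)) * (1 / Complex s (- y))"
  proof -
    have c: "Complex 1 X \<noteq> 0" "Complex 1 (- X) \<noteq> 0" by (auto simp: complex_eq_iff)
    have p: "1 + X\<^sup>2 > 0" by (intro add_pos_nonneg) auto
    have "Complex 1 X * Complex 1 (- X) = of_real (1 + X\<^sup>2)" "Complex 1 X + Complex 1 (- X) = 2" by (auto simp: complex_eq_iff power2_eq_square)
    then have "1 / Complex 1 X + 1 / Complex 1 (- X) = of_real (2 / (1 + X\<^sup>2))"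
      using c p by (simp add: add_frac_eq add.commute)
    then have "1 / Complex s (- y) * (1 / Complex 1 X + 1 / Complex 1 (- X)) = 1 / Complex s (- y) * of_real (2 / (1 + X\<^sup>2))" by simp
    then show ?thesis by (simp add: distrib_left mult.commute)
  qed
  also have "Re (of_real (2 / (1 + X\<^sup>2)) * (1 / Complex s (- y))) = 2 / (1 + X\<^sup>2) * (s / (s\<^sup>2 + y\<^sup>2))"
  proof -
    have "Re (of_real a * z) = a * Re z" for a z by simp
    moreover have "Re (1 / Complex s (- y)) = s / (s\<^sup>2 + y\<^sup>2)" by (simp add: Re_divide)
    ultimately show ?thesis by (simp only:)
  qed
  finally show ?thesis .
qed


section \<open>Sums of affine images of the activation function\<close>

definition ridge :: "(real \<Rightarrow> real) \<Rightarrow> (real \<times> real \<times> real) list \<Rightarrow> real \<Rightarrow> real" where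
  "ridge \<sigma> ts x = (\<Sum>(a, l, b)\<leftarrow>ts. a * \<sigma> (l * x + b))"

text \<open>The image of these sums under the Bessel operator of order \<gamma>; density of the sums
  in the Bessel space is density of this set in L_p.\<close>

definition ridge_reps :: "real \<Rightarrow> real \<Rightarrow> (real \<Rightarrow> real) \<Rightarrow> (real \<Rightarrow> real) set" where
  "ridge_reps \<gamma> p \<sigma> = {g. \<exists>ts. (\<forall>(a, l, b)\<in>set ts. l \<noteq> 0) \<and> bessel_rep \<gamma> p (ridge \<sigma> ts) g}"

lemma ridge_append: "ridge \<sigma> (ts @ us) x = ridge \<sigma> ts x + ridge \<sigma> us x"
  by (simp add: ridge_def)

lemma ridge_scale: "ridge \<sigma> (map (\<lambda>(a, l, b). (c * a, l, b)) ts) x = c * ridge \<sigma> ts x"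
  by (induction ts) (auto simp: ridge_def algebra_simps)

lemma ridge_shift: "ridge \<sigma> (map (\<lambda>(a, l, b). (a, l, l * t + b)) ts) x = ridge \<sigma> ts (x + t)"
  by (induction ts) (auto simp: ridge_def algebra_simps)

lemma Lp_lin_ridge_reps:
  assumes p: "p > 1" shows "Lp_lin p (ridge_reps \<gamma> p \<sigma>)"
  unfolding Lp_lin_def
proof (intro conjI ballI allI)
  show "Lp_fun p g" if "g \<in> ridge_reps \<gamma> p \<sigma>" for g using that by (auto simp: ridge_reps_def bessel_rep_def)
  show "(\<lambda>_. 0) \<in> ridge_reps \<gamma> p \<sigma>"
    unfolding ridge_reps_def using bessel_rep_zero by (auto intro!: exI[of _ "[]"] simp: ridge_def[abs_def])
next
  fix g h assume "g \<in> ridge_reps \<gamma> p \<sigma>" "h \<in> ridge_reps \<gamma> p \<sigma>"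
  then obtain ts us where ts: "\<forall>(a, l, b)\<in>set ts. l \<noteq> 0" "bessel_rep \<gamma> p (ridge \<sigma> ts) g"
     and us: "\<forall>(a, l, b)\<in>set us. l \<noteq> 0" "bessel_rep \<gamma> p (ridge \<sigma> us) h" by (auto simp: ridge_reps_def)
  have "ridge \<sigma> (ts @ us) = (\<lambda>x. 1 * ridge \<sigma> ts x + 1 * ridge \<sigma> us x)" by (auto simp: ridge_append)
  then have "bessel_rep \<gamma> p (ridge \<sigma> (ts @ us)) (\<lambda>x. g x + h x)"
    using bessel_rep_linear[OF p ts(2) us(2), of 1 1] by simp
  then show "(\<lambda>x. g x + h x) \<in> ridge_reps \<gamma> p \<sigma>"
    unfolding ridge_reps_def using ts(1) us(1) by (intro CollectI exI[of _ "ts @ us"]) auto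
next
  fix c g assume "g \<in> ridge_reps \<gamma> p \<sigma>"
  then obtain ts where ts: "\<forall>(a, l, b)\<in>set ts. l \<noteq> 0" "bessel_rep \<gamma> p (ridge \<sigma> ts) g" by (auto simp: ridge_reps_def)
  have "ridge \<sigma> (map (\<lambda>(a, l, b). (c * a, l, b)) ts) = (\<lambda>x. c * ridge \<sigma> ts x)" by (intro ext ridge_scale)
  then have "bessel_rep \<gamma> p (ridge \<sigma> (map (\<lambda>(a, l, b). (c * a, l, b)) ts)) (\<lambda>x. c * g x)"
    using bessel_rep_linear[OF p ts(2) ts(2), of c 0] by simp
  then show "(\<lambda>x. c * g x) \<in> ridge_reps \<gamma> p \<sigma>"
    unfolding ridge_reps_def using ts(1) by (intro CollectI exI[of _ "map (\<lambda>(a, l, b). (c * a, l, b)) ts"]) auto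
qed

lemma shift_inv_ridge_reps:
  assumes p: "p > 1" and \<gamma>: "\<gamma> \<ge> 0" shows "shift_inv (ridge_reps \<gamma> p \<sigma>)"
  unfolding shift_inv_def
proof (intro ballI allI)
  fix g t assume "g \<in> ridge_reps \<gamma> p \<sigma>"
  then obtain ts where ts: "\<forall>(a, l, b)\<in>set ts. l \<noteq> 0" "bessel_rep \<gamma> p (ridge \<sigma> ts) g" by (auto simp: ridge_reps_def)
  have "ridge \<sigma> (map (\<lambda>(a, l, b). (a, l, l * t + b)) ts) = (\<lambda>x. ridge \<sigma> ts (x + t))" by (intro ext ridge_shift)
  then have "bessel_rep \<gamma> p (ridge \<sigma> (map (\<lambda>(a, l, b). (a, l, l * t + b)) ts)) (\<lambda>x. g (x + t))"
    using bessel_rep_translate[OF p \<gamma> ts(2), of t] by simp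
  then show "(\<lambda>x. g (x + t)) \<in> ridge_reps \<gamma> p \<sigma>"
    unfolding ridge_reps_def using ts(1) by (intro CollectI exI[of _ "map (\<lambda>(a, l, b). (a, l, l * t + b)) ts"]) auto
qed

text \<open>The representer of \<sigma> (l x + b) is not g0 (l x + b) but its image under the
  quotient symbol of N2. N3 carries the inverse quotient, and the closure is stable under
  convolution with it, so the composition returns g0 (l x + b).\<close>

lemma affine_in_ridge_cl:
  assumes p: "p > 1" and \<gamma>: "\<gamma> \<ge> 0" and \<sigma>: "bessel_rep \<gamma> p \<sigma> g0" and l: "l \<noteq> 0"
  shows "(\<lambda>x. g0 (l * x + b)) \<in> Lp_cl p (ridge_reps \<gamma> p \<sigma>)"
proof -
  let ?X = "ridge_reps \<gamma> p \<sigma>"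
  define g1 where "g1 = (\<lambda>x. g0 (l * x + b))"
  have g0: "Lp_fun p g0" and sm: "\<sigma> \<in> borel_measurable borel" and ae: "AE x in lborel. \<sigma> x = wconv (bessel_potential \<gamma>) g0 x"
    using \<sigma> bessel_rep_iff[OF p \<gamma>] by auto
  have g1: "Lp_fun p g1" using Lp_fun_affine[OF l g0, of b] by (simp add: g1_def)
  have g1m: "g1 \<in> borel_measurable borel" using g1 by (simp add: Lp_fun_def)
  have wB: "weighted (bessel_potential \<gamma> :: (real \<times> real) measure)" by (rule weighted_bessel_potential[OF \<gamma>])
  have [measurable_cong]: "sets (bessel_potential \<gamma> :: (real \<times> real) measure) = sets (borel \<Otimes>\<^sub>M borel)" by (rule weighted_sets[OF wB])
  have "\<exists>N. weighted N \<and> (\<forall>\<xi>. wchar N \<xi> = (\<integral>w. of_real (snd w) * cis (- (2 * pi * ((fst w / l) \<bullet> \<xi>))) \<partial>bessel_potential \<gamma>))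
     \<and> (\<forall>g\<in>borel_measurable borel. \<forall>x. wconv N g x = (\<integral>w. snd w * g (x + fst w / l) \<partial>bessel_potential \<gamma>))"
    by (rule weighted_exists[OF weighted_integrable[OF wB]]) measurable
  then obtain N1 where N1: "weighted N1"
    "\<And>\<xi>. wchar N1 \<xi> = (\<integral>w. of_real (snd w) * cis (- (2 * pi * ((fst w / l) \<bullet> \<xi>))) \<partial>bessel_potential \<gamma>)"
    "\<And>x. wconv N1 g1 x = (\<integral>w. snd w * g1 (x + fst w / l) \<partial>bessel_potential \<gamma>)"
    using g1m by blast
  \<comment> \<open>Dividing the points of the measure by l replaces \<xi> by \<xi>/l in its
    transform.\<close>
  define d where "d = 1 / l\<^sup>2"
  have d: "d > 0" using l by (simp add: d_def)
  have N1c: "wchar N1 \<xi> = of_real ((1 + d * (norm \<xi>)\<^sup>2) powr (- (\<gamma> / 2)))" for \<xi>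
  proof -
    have "wchar N1 \<xi> = wchar (bessel_potential \<gamma>) (\<xi> / l)" unfolding N1(2) by (simp add: wchar_def)
    then show ?thesis using wchar_bessel_potential[OF \<gamma>, of "\<xi> / l"] by (simp add: d_def power_divide)
  qed
  have s: "\<gamma> / 2 \<ge> 0" using \<gamma> by simp
  obtain N2 where N2: "weighted N2" "\<And>\<xi>::real. wchar N2 \<xi> = of_real ((1 + 1 * (norm \<xi>)\<^sup>2) powr (\<gamma> / 2) * (1 + d * (norm \<xi>)\<^sup>2) powr (- (\<gamma> / 2)))"
    by (rule symbolE[OF symbol_ratio[where 'a=real, OF s zero_less_one d]]) blast
  obtain N3 where N3: "weighted N3" "\<And>\<xi>::real. wchar N3 \<xi> = of_real ((1 + d * (norm \<xi>)\<^sup>2) powr (\<gamma> / 2) * (1 + 1 * (norm \<xi>)\<^sup>2) powr (- (\<gamma> / 2)))"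
    by (rule symbolE[OF symbol_ratio[where 'a=real, OF s d zero_less_one]]) blast
  have rep: "bessel_rep \<gamma> p (wconv N1 g1) (wconv N2 g1)"
    by (rule bessel_rep_wconv[OF p N1(1) N2(1) _ g1]) (simp add: N1c N2(2) flip: of_real_mult)
  have "AE x in lborel. \<sigma> (l *\<^sub>R x + b) = wconv (bessel_potential \<gamma>) g0 (l *\<^sub>R x + b)"
    by (rule AE_affine[OF l ae])
  moreover have "wconv (bessel_potential \<gamma>) g0 (l *\<^sub>R x + b) = wconv N1 g1 x" for x
  proof -
    have "l * (x + y / l) = l * x + y" for y using l by (simp add: field_simps)
    then have "g1 (x + y / l) = g0 (l *\<^sub>R x + b + y)" for y by (simp add: g1_def add_ac)
    then show ?thesis unfolding N1(3) by (simp add: wconv_def)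
  qed
  ultimately have "AE x in lborel. wconv N1 g1 x = ridge \<sigma> [(1, l, b)] x" by (simp add: ridge_def eq_commute)
  moreover have "ridge \<sigma> [(1, l, b)] \<in> borel_measurable borel" using sm by (simp add: ridge_def[abs_def])
  ultimately have "bessel_rep \<gamma> p (ridge \<sigma> [(1, l, b)]) (wconv N2 g1)"
    by (intro bessel_rep_cong_AE[OF rep])
  then have "wconv N2 g1 \<in> ?X" unfolding ridge_reps_def using l by (intro CollectI exI[of _ "[(1, l, b)]"]) auto
  then have "wconv N2 g1 \<in> Lp_cl p ?X" using wconv_Lp[OF p N2(1) g1] by (rule subset_Lp_cl)
  then have in3: "wconv N3 (wconv N2 g1) \<in> Lp_cl p ?X"
    by (rule wconv_in_cl[OF Lp_lin_ridge_reps[OF p] shift_inv_ridge_reps[OF p \<gamma>] p N3(1)])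
  have ch: "wchar N3 \<xi> * wchar N2 \<xi> = wchar (return borel (0, 1)) \<xi>" for \<xi>
  proof -
    define u where "u = 1 + d * (norm \<xi>)\<^sup>2" define v where "v = 1 + (norm \<xi>)\<^sup>2"
    have uv: "u > 0" "v > 0" using d by (auto simp: u_def v_def intro!: add_pos_nonneg)
    have "(u powr (\<gamma> / 2) * v powr (- (\<gamma> / 2))) * (v powr (\<gamma> / 2) * u powr (- (\<gamma> / 2))) = 1"
      using uv by (simp add: powr_minus field_simps)
    then show ?thesis unfolding N2(2) N3(2) weighted_unit(2) mult_1
      unfolding u_def[symmetric] v_def[symmetric] of_real_mult[symmetric] by simp
  qed
  have "AE x in lborel. wconv N3 (wconv N2 g1) x = g1 x"
    using wconv_comp[OF p N3(1) N2(1) weighted_unit(1) g1 ch] by (simp add: weighted_unit(3)[OF g1m])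
  then have "g1 \<in> Lp_cl p ?X"
    by (rule Lp_cl_cong_AE[OF in3 _ g1m]) (use Lp_lin_ridge_reps[OF p] in \<open>auto simp: Lp_lin_def\<close>)
  then show ?thesis by (simp add: g1_def)
qed

text \<open>The power |l|^(-1/p) is the norm of a dilate and 1 / (|l| + s) the order of the mass of
  the ray kernel in b. At 0 integrability follows from p > 1; at infinity the exponent is -1 -
  1/p.\<close>

lemma integrable_abs_powr_weight:
  assumes p: "p > 1" and s: "s > 0"
  shows "integrable lborel (\<lambda>l::real. 1 / (\<bar>l\<bar> + s) * \<bar>l\<bar> powr (- (1 / p)))"
proof -
  have q: "0 < 1 / p" "1 / p < 1" using p by auto
  let ?u = "\<lambda>l. exp 1 / s * (ppow (1 - 1 / p - 1) l * exp (- (1 * l))) + indicator {1..} l * l powr (- 1 - 1 / p)"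
  have i: "integrable lborel ?u"
    using q by (intro Bochner_Integration.integrable_add integrable_mult_right integrable_gamma
        integrable_has_integral_nonneg[OF _ has_integral_powr_to_inf]) auto
  have i2: "integrable lborel (\<lambda>l. ?u (- l))" using integrable_affine_iff[of "-1" ?u 0] i by simp
  have u0: "0 \<le> ?u l" for l using s by (auto intro!: add_nonneg_nonneg mult_nonneg_nonneg)
  have le: "1 / (l + s) * l powr (- (1 / p)) \<le> ?u l" if l: "l > 0" for l
  proof (cases "l \<le> 1")
    case True
    have "1 / (l + s) \<le> 1 / s" using l s by (intro frac_le) auto
    also have "\<dots> \<le> exp 1 / s * exp (- (1 * l))" using True s by (simp add: exp_add[symmetric] divide_right_mono)
    finally have "1 / (l + s) * l powr (- (1 / p)) \<le> exp 1 / s * exp (- (1 * l)) * l powr (- (1 / p))" by (intro mult_right_mono) auto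
    also have "\<dots> = exp 1 / s * (ppow (1 - 1 / p - 1) l * exp (- (1 * l)))" using l by (simp add: ppow_def)
    also have "\<dots> \<le> ?u l" by simp
    finally show ?thesis .
  next
    case False
    have "1 / (l + s) \<le> 1 / l" using l s by (intro frac_le) auto
    also have "\<dots> = l powr (- 1)" using l by (simp add: powr_minus_divide)
    finally have "1 / (l + s) * l powr (- (1 / p)) \<le> l powr (- 1) * l powr (- (1 / p))" by (intro mult_right_mono) auto
    also have "\<dots> = l powr (- 1 - 1 / p)" unfolding powr_add[symmetric] by simp
    also have "\<dots> = indicator {1..} l * l powr (- 1 - 1 / p)" using False by simp
    also have "\<dots> \<le> ?u l" using s by simp
    finally show ?thesis .
  qed
  have fle: "norm (1 / (\<bar>l\<bar> + s) * \<bar>l\<bar> powr (- (1 / p))) \<le> norm (?u l + ?u (- l))" for l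
  proof -
    have "1 / (\<bar>l\<bar> + s) * \<bar>l\<bar> powr (- (1 / p)) \<le> ?u l + ?u (- l)"
    proof -
      consider "l > 0" | "l < 0" | "l = 0" by linarith
      then show ?thesis
      proof cases
        case 1 then show ?thesis using le[of l] u0[of "- l"] by simp
      next
        case 2 then show ?thesis using le[of "- l"] u0[of l] by simp
      next
        case 3 then show ?thesis using u0[of 0] by simp
      qed
    qed
    moreover have "0 \<le> 1 / (\<bar>l\<bar> + s) * \<bar>l\<bar> powr (- (1 / p))" using s by simp
    ultimately show ?thesis by (simp only: real_norm_def)
  qed
  show ?thesis
    by (rule Bochner_Integration.integrable_bound[OF Bochner_Integration.integrable_add[OF i i2]])
       (measurable, intro AE_I2 fle)
qed

text \<open>The functions g0 (l \<mu> x + b) are superposed with the ray kernel. In the variable v =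
  b + l \<mu> x the inner integral runs along a line of the parameter plane and factorises; the
  constant factor left is a Poisson integral of g0, and \<mu> provides the dilates.\<close>

lemma poisson_in_ridge_cl:
  assumes p: "p > 1" and \<gamma>: "\<gamma> \<ge> 0" and \<sigma>: "bessel_rep \<gamma> p \<sigma> g0" and s: "s > 0" and \<mu>: "\<mu> > 0"
  shows "(\<lambda>x. 2 / (1 + (\<mu> * x)\<^sup>2) * (LINT v|lborel. g0 v * (s / (s\<^sup>2 + (v - b0)\<^sup>2)))) \<in> Lp_cl p (ridge_reps \<gamma> p \<sigma>)"
proof -
  let ?X = "ridge_reps \<gamma> p \<sigma>"
  have g0: "Lp_fun p g0" using \<sigma> by (simp add: bessel_rep_def)
  have [measurable]: "g0 \<in> borel_measurable borel" using g0 by (simp add: Lp_fun_def)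
  \<comment> \<open>The value 1 at l = 0 satisfies the condition that L never vanishes; it is
    assumed on a null set only.\<close>
  define L where "L = (\<lambda>w::real \<times> real. if fst w = 0 then 1 else fst w * \<mu>)"
  define k where "k = (\<lambda>w. ray_kernel s (fst w) (snd w - b0))"
  have Lm[measurable]: "L \<in> borel_measurable (lborel \<Otimes>\<^sub>M lborel)" unfolding L_def by measurable
  have km[measurable]: "k \<in> borel_measurable (lborel \<Otimes>\<^sub>M lborel)" unfolding k_def by measurable
  have L0: "L w \<noteq> 0" for w using \<mu> by (simp add: L_def)
  define C where "C = (LINT u|lborel. 1 / (1 + (u::real)\<^sup>2))"
  have C: "C \<ge> 0" unfolding C_def by (intro integral_nonneg_AE) (auto intro!: AE_I2)
  have inner: "integrable lborel (\<lambda>b. 1 / (A\<^sup>2 + (b - b0)\<^sup>2))" "(LINT b|lborel. 1 / (A\<^sup>2 + (b - b0)\<^sup>2)) = C / A" if A: "A > 0" for A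
  proof -
    have eq: "1 / (A\<^sup>2 + (b - b0)\<^sup>2) = 1 / A\<^sup>2 * (1 / (1 + ((1 / A) *\<^sub>R b + - (b0 / A))\<^sup>2))" for b
    proof -
      have "A\<^sup>2 + (b - b0)\<^sup>2 = A\<^sup>2 * (1 + ((1 / A) *\<^sub>R b + - (b0 / A))\<^sup>2)" using A by (simp add: field_simps power2_eq_square)
      then show ?thesis by simp
    qed
    show "integrable lborel (\<lambda>b. 1 / (A\<^sup>2 + (b - b0)\<^sup>2))"
      unfolding eq using integrable_affine_iff[of "1 / A" "\<lambda>u::real. 1 / (1 + u\<^sup>2)" "- (b0 / A)"] integrable_inverse_1_plus_square_real A
      by (intro integrable_mult_right) simp
    show "(LINT b|lborel. 1 / (A\<^sup>2 + (b - b0)\<^sup>2)) = C / A"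
    proof -
      have "(LINT b|lborel. 1 / (1 + ((1 / A) *\<^sub>R b + - (b0 / A))\<^sup>2)) = (1 / \<bar>1 / A\<bar> ^ DIM(real)) *\<^sub>R C"
        unfolding C_def using A by (intro integral_affine) auto
      then show ?thesis unfolding eq integral_mult_right_zero using A by (simp add: power2_eq_square)
    qed
  qed
  have kle: "\<bar>k (l, b)\<bar> \<le> 1 / ((\<bar>l\<bar> + s)\<^sup>2 + (b - b0)\<^sup>2)" for l b using abs_ray_kernel_le[OF s] by (simp add: k_def)
  have Apos: "\<bar>l\<bar> + s > 0" for l :: real using s by simp
  have kint: "integrable lborel (\<lambda>b. k (l, b))" for l
    by (rule Bochner_Integration.integrable_bound[OF inner(1)[OF Apos[of l]]])
       (simp add: k_def, intro AE_I2, use kle[of l] in \<open>simp add: abs_of_nonneg\<close>)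
  have klm: "(LINT b|lborel. \<bar>k (l, b)\<bar>) \<le> C / (\<bar>l\<bar> + s)" for l
    unfolding inner(2)[OF Apos[of l], symmetric] using kint[of l] kle by (intro integral_mono inner(1)[OF Apos]) auto
  have Ik: "integrable (lborel \<Otimes>\<^sub>M lborel) (\<lambda>w. k w * \<bar>L w\<bar> powr (- real DIM(real) / p))"
  proof (rule lborel_pair.Fubini_integrable)
    have eqn: "(LINT b|lborel. norm (k (l, b) * \<bar>L (l, b)\<bar> powr (- real DIM(real) / p))) = \<bar>L (l, 0)\<bar> powr (- (1 / p)) * (LINT b|lborel. \<bar>k (l, b)\<bar>)" for l
      by (simp add: L_def abs_mult mult.commute)
    show "integrable lborel (\<lambda>l. LINT b|lborel. norm (k (l, b) * \<bar>L (l, b)\<bar> powr (- real DIM(real) / p)))"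
    proof (rule Bochner_Integration.integrable_bound)
      show "integrable lborel (\<lambda>l. C * \<mu> powr (- (1 / p)) * (1 / (\<bar>l\<bar> + s) * \<bar>l\<bar> powr (- (1 / p))))"
        by (intro integrable_mult_right integrable_abs_powr_weight p s)
      show "(\<lambda>l. LINT b|lborel. norm (k (l, b) * \<bar>L (l, b)\<bar> powr (- real DIM(real) / p))) \<in> borel_measurable lborel"
        unfolding k_def L_def by measurable
      show "AE l in lborel. norm (LINT b|lborel. norm (k (l, b) * \<bar>L (l, b)\<bar> powr (- real DIM(real) / p)))
          \<le> norm (C * \<mu> powr (- (1 / p)) * (1 / (\<bar>l\<bar> + s) * \<bar>l\<bar> powr (- (1 / p))))"
        using AE_lborel_singleton[of 0]
      proof eventually_elim
        case (elim l)
        have Leq: "\<bar>L (l, 0)\<bar> powr (- (1 / p)) = \<mu> powr (- (1 / p)) * \<bar>l\<bar> powr (- (1 / p))"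
          using elim \<mu> by (simp add: L_def abs_mult powr_mult mult.commute)
        show ?case unfolding eqn Leq
          using mult_left_mono[OF klm[of l], of "\<mu> powr (- (1 / p)) * \<bar>l\<bar> powr (- (1 / p))"] C s by (simp add: abs_mult mult_ac)
      qed
    qed
    show "AE l in lborel. integrable lborel (\<lambda>b. k (l, b) * \<bar>L (l, b)\<bar> powr (- real DIM(real) / p))"
      by (intro AE_I2, unfold L_def fst_conv, intro integrable_mult_left kint)
  qed measurable
  have sf: "sigma_finite_measure (lborel \<Otimes>\<^sub>M lborel :: (real \<times> real) measure)"
    by (simp add: lborel_prod sigma_finite_lborel)
  have sndm: "(snd :: real \<times> real \<Rightarrow> real) \<in> borel_measurable (lborel \<Otimes>\<^sub>M lborel)" by measurable
  define f where "f = (\<lambda>x. \<integral>w. k w * g0 (L w *\<^sub>R x + snd w) \<partial>(lborel \<Otimes>\<^sub>M lborel))"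
  have fcl: "f \<in> Lp_cl p ?X"
    unfolding f_def
    by (rule affine_mixture_in_Lp_cl[OF p Lp_lin_ridge_reps[OF p] g0 sf km Lm sndm L0 _ Ik])
       (use affine_in_ridge_cl[OF p \<gamma> \<sigma> L0] in simp)
  have "AE x in lborel. integrable (lborel \<Otimes>\<^sub>M lborel) (\<lambda>w. k w * g0 (L w *\<^sub>R x + snd w))"
    by (rule affine_mixture_AE[OF p g0 sf km Lm sndm L0 Ik])
  then have ae: "AE x in lborel. f x = 2 / (1 + (\<mu> * x)\<^sup>2) * (LINT v|lborel. g0 v * (s / (s\<^sup>2 + (v - b0)\<^sup>2)))"
  proof eventually_elim
    case (elim x)
    let ?F = "\<lambda>w. k w * g0 (L w *\<^sub>R x + snd w)"
    define t where "t = (\<lambda>l. L (l, 0) * x)"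
    have Lt: "L (l, b) *\<^sub>R x + b = b + t l" for l b by (simp add: L_def t_def)
    have [measurable]: "t \<in> borel_measurable borel" unfolding t_def L_def fst_conv by measurable
    let ?G = "\<lambda>(l, v). ray_kernel s l (v - t l - b0) * g0 v"
    have sh: "?F (l, b) = ?G (l, b + t l)" for l b unfolding Lt k_def snd_conv by (simp add: k_def)
    have tr: "integrable lborel (\<lambda>b. ?G (l, b + t l)) \<longleftrightarrow> integrable lborel (\<lambda>v. ?G (l, v))"
         "(LINT b|lborel. ?G (l, b + t l)) = (LINT v|lborel. ?G (l, v))"
         "(LINT b|lborel. norm (?G (l, b + t l))) = (LINT v|lborel. norm (?G (l, v)))" for l
      using integrable_affine_iff[of 1 "\<lambda>v. ?G (l, v)" "t l"] integral_affine[of 1 "\<lambda>v. ?G (l, v)" "t l"]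
        integral_affine[of 1 "\<lambda>v. norm (?G (l, v))" "t l"] by auto
    \<comment> \<open>Absolute integrability in (l, b) is carried over slice by slice by the
      translation b + t l, because the order of integration is exchanged in (l, v).\<close>
    have IG: "integrable (lborel \<Otimes>\<^sub>M lborel) ?G"
    proof (rule lborel_pair.Fubini_integrable)
      show "integrable lborel (\<lambda>l. LINT v|lborel. norm (?G (l, v)))"
        using lborel_pair.integrable_fst'[OF integrable_norm[OF elim]] unfolding sh tr(3) .
      show "AE l in lborel. integrable lborel (\<lambda>v. ?G (l, v))"
        using lborel_pair.AE_integrable_fst'[OF elim] unfolding sh tr(1) .
    qed measurable
    have "f x = (LINT l|lborel. (LINT b|lborel. ?F (l, b)))"
      unfolding f_def using lborel_pair.integral_fst'[OF elim] by simp
    also have "\<dots> = (LINT l|lborel. (LINT v|lborel. ?G (l, v)))" unfolding sh tr(2) ..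
    also have "\<dots> = (LINT v|lborel. (LINT l|lborel. ?G (l, v)))"
      using lborel_pair.Fubini_integral[OF IG] by simp
    also have "\<dots> = (LINT v|lborel. 2 / (1 + (\<mu> * x)\<^sup>2) * (g0 v * (s / (s\<^sup>2 + (v - b0)\<^sup>2))))"
    proof (rule Bochner_Integration.integral_cong[OF refl])
      fix v
      have "(LINT l|lborel. ?G (l, v)) = (LINT l|lborel. ray_kernel s l (v - t l - b0)) * g0 v" by simp
      also have "(LINT l|lborel. ray_kernel s l (v - t l - b0)) = (LINT l|lborel. ray_kernel s l ((v - b0) - l * (\<mu> * x)))"
      proof (rule integral_cong_AE)
        show "AE l in lborel. ray_kernel s l (v - t l - b0) = ray_kernel s l ((v - b0) - l * (\<mu> * x))"
          using AE_lborel_singleton[of 0] by eventually_elim (simp add: t_def L_def algebra_simps)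
      qed measurable
      finally show "(LINT l|lborel. ?G (l, v)) = 2 / (1 + (\<mu> * x)\<^sup>2) * (g0 v * (s / (s\<^sup>2 + (v - b0)\<^sup>2)))"
        by (simp add: integral_ray_kernel[OF s])
    qed
    finally show ?case unfolding integral_mult_right_zero .
  qed
  show ?thesis
    by (rule Lp_cl_cong_AE[OF fcl ae]) (use Lp_lin_ridge_reps[OF p] in \<open>auto simp: Lp_lin_def\<close>)
qed

lemma integral_inverse_1_plus_square: "(LINT x|lborel. 1 / (1 + (x::real)\<^sup>2)) = pi"
  using LBINT_inverse_1_plus_square
  by (simp add: interval_lebesgue_integral_def set_lebesgue_integral_def inverse_eq_divide)

theorem ridge_dense:
  assumes p: "p > 1" and \<gamma>: "\<gamma> \<ge> 0" and \<sigma>: "bessel_rep \<gamma> p \<sigma> g0" and nz: "\<not> (AE t in lborel. \<sigma> t = 0)"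
    and g: "Lp_fun p g"
  shows "g \<in> Lp_cl p (ridge_reps \<gamma> p \<sigma>)"
proof -
  let ?X = "ridge_reps \<gamma> p \<sigma>"
  define K where "K = (\<lambda>z::real. 1 / pi * (1 / (1 + z\<^sup>2)))"
  have K: "integrable lborel K" "(LINT z|lborel. K z) = 1" "\<And>z. K (- z) = K z"
  proof -
    show "integrable lborel K" unfolding K_def by (intro integrable_mult_right integrable_inverse_1_plus_square_real)
    show "(LINT z|lborel. K z) = 1" unfolding K_def integral_mult_right_zero integral_inverse_1_plus_square by simp
  qed (simp add: K_def)
  have g0: "Lp_fun p g0" using \<sigma> by (simp add: bessel_rep_def)
  have [measurable]: "g0 \<in> borel_measurable borel" using g0 by (simp add: Lp_fun_def)
  have nz0: "\<not> (AE x in lborel. g0 x = 0)"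
  proof
    assume ae: "AE x in lborel. g0 x = 0"
    have "np p g0 = np p (\<lambda>_::real. 0)" by (rule np_cong_AE) (use ae in auto)
    then have "np p g0 = 0" by simp
    then have "np p (wconv (bessel_potential \<gamma>) g0) \<le> 0"
      using wconv_np[OF p weighted_bessel_potential[OF \<gamma>] g0] by simp
    then have "np p (wconv (bessel_potential \<gamma>) g0) = 0" using np_nonneg[of p "wconv (bessel_potential \<gamma>) g0"] by linarith
    then have "AE x in lborel. wconv (bessel_potential \<gamma>) g0 x = 0"
      by (rule np_eq_0D[OF wconv_Lp[OF p weighted_bessel_potential[OF \<gamma>] g0]])
    moreover have "AE x in lborel. \<sigma> x = wconv (bessel_potential \<gamma>) g0 x" using \<sigma> bessel_rep_iff[OF p \<gamma>] by auto
    ultimately have "AE x in lborel. \<sigma> x = 0" by eventually_elim simp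
    then show False using nz by simp
  qed
  have "\<exists>s b0. s > 0 \<and> (LINT v|lborel. g0 v * (s / (s\<^sup>2 + (v - b0)\<^sup>2))) \<noteq> 0"
  proof (rule ccontr)
    assume *: "\<not> (\<exists>s b0. s > 0 \<and> (LINT v|lborel. g0 v * (s / (s\<^sup>2 + (v - b0)\<^sup>2))) \<noteq> 0)"
    have "AE x in lborel. g0 x = 0"
    \<comment> \<open>Averages of g0 against dilates of K are, up to a constant, Poisson integrals,
      the scale c being the height s.\<close>
    proof (rule kernel_vanish_imp_zero[OF g0 p K(1,2)], rule AE_I2)
      fix c x :: real assume c: "c > 0"
      let ?h = "\<lambda>v. g0 v * (c / (c\<^sup>2 + (v - x)\<^sup>2))"
      have "(LINT z|lborel. ?h (c *\<^sub>R z + x)) = (1 / \<bar>c\<bar> ^ DIM(real)) *\<^sub>R (LINT v|lborel. ?h v)"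
        using c by (intro integral_affine) auto
      also have "(LINT v|lborel. ?h v) = 0" using * c by auto
      finally have h0: "(LINT z|lborel. ?h (c *\<^sub>R z + x)) = 0" by simp
      have Kh: "K z * g0 (x + c *\<^sub>R z) = c / pi * ?h (c *\<^sub>R z + x)" for z
      proof -
        have "c\<^sup>2 + (c * z)\<^sup>2 = c * (c * (1 + z\<^sup>2))" by (simp add: power2_eq_square algebra_simps)
        then have "c / (c\<^sup>2 + (c * z)\<^sup>2) = 1 / (c * (1 + z\<^sup>2))" using c by simp
        then show ?thesis using c by (simp add: K_def add.commute)
      qed
      show "(LINT z|lborel. K z * g0 (x + c *\<^sub>R z)) = 0" unfolding Kh integral_mult_right_zero h0 by simp
    qed
    then show False using nz0 by simp
  qed
  then obtain s b0 where s: "s > 0" and I0: "(LINT v|lborel. g0 v * (s / (s\<^sup>2 + (v - b0)\<^sup>2))) \<noteq> 0" by blast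
  define I where "I = (LINT v|lborel. g0 v * (s / (s\<^sup>2 + (v - b0)\<^sup>2)))"
  have lin: "Lp_lin p (Lp_cl p ?X)" by (rule Lp_lin_cl[OF p Lp_lin_ridge_reps[OF p]])
  show ?thesis
  proof (rule dense_if_kernels[OF Lp_lin_ridge_reps[OF p] shift_inv_ridge_reps[OF p \<gamma>] p K _ g])
    fix c :: real assume c: "c > 0"
    have "(\<lambda>x. 2 / (1 + ((1 / c) * x)\<^sup>2) * I) \<in> Lp_cl p ?X"
      unfolding I_def by (rule poisson_in_ridge_cl[OF p \<gamma> \<sigma> s]) (use c in simp)
    from Lp_lin_cmultD[OF lin this]
    have "(\<lambda>x. (1 / (2 * pi * I)) * (2 / (1 + ((1 / c) * x)\<^sup>2) * I)) \<in> Lp_cl p ?X" .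
    also have "(\<lambda>x. (1 / (2 * pi * I)) * (2 / (1 + ((1 / c) * x)\<^sup>2) * I)) = (\<lambda>x. K (x /\<^sub>R c))"
    proof
      fix x
      have x: "x /\<^sub>R c = (1 / c) * x" by (simp add: divide_inverse)
      have "I \<noteq> 0" using I0 by (simp add: I_def)
      then show "(1 / (2 * pi * I)) * (2 / (1 + ((1 / c) * x)\<^sup>2) * I) = K (x /\<^sub>R c)" unfolding x K_def by simp
    qed
    finally show "(\<lambda>x. K (x /\<^sub>R c)) \<in> Lp_cl p ?X" .
  qed
qed

section \<open>Density in dimension $m$\<close>

lemma Basis_vec_eq: "(Basis :: (real^'m) set) = range (\<lambda>i. axis i 1)"
  by (auto simp: Basis_vec_def)

lemma inj_axis_one: "inj (\<lambda>i. axis i (1::real))"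
  by (auto simp: inj_def axis_eq_axis)

lemma prod_Basis_vec: "(\<Prod>b\<in>(Basis :: (real^'m) set). h b) = (\<Prod>i\<in>UNIV. h (axis i 1))"
  unfolding Basis_vec_eq by (subst prod.reindex[OF inj_axis_one]) simp

lemma
  fixes f :: "'m::finite \<Rightarrow> real \<Rightarrow> real"
  assumes f: "\<And>i. integrable lborel (f i)"
  shows integrable_prod_vec: "integrable lborel (\<lambda>x::real^'m. \<Prod>i\<in>UNIV. f i (x $ i))"
    and integral_prod_vec: "(LINT x|lborel. (\<Prod>i\<in>UNIV. f i ((x::real^'m) $ i))) = (\<Prod>i\<in>UNIV. (LINT t|lborel. f i t))"
proof -
  define h where "h = (\<lambda>b::real^'m. f (inv (\<lambda>i. axis i 1) b))"
  have h: "h (axis i 1) = f i" for i by (simp add: h_def inv_f_f[OF inj_axis_one])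
  have hb: "integrable lborel (h b)" for b unfolding h_def by (rule f)
  have eq: "(\<Prod>b\<in>Basis. h b (x \<bullet> b)) = (\<Prod>i\<in>UNIV. f i (x $ i))" for x :: "real^'m"
    unfolding prod_Basis_vec by (simp add: h inner_axis)
  show "integrable lborel (\<lambda>x::real^'m. \<Prod>i\<in>UNIV. f i (x $ i))"
    using integrable_prod_Basis[of h] hb unfolding eq by simp
  show "(LINT x|lborel. (\<Prod>i\<in>UNIV. f i ((x::real^'m) $ i))) = (\<Prod>i\<in>UNIV. (LINT t|lborel. f i t))"
    using integral_prod_Basis[of h] hb unfolding eq unfolding prod_Basis_vec by (simp add: h)
qed

lemma
  fixes g :: "'m::finite \<Rightarrow> real \<Rightarrow> real"
  assumes g: "\<And>i. Lp_fun p (g i)"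
  shows Lp_fun_tensor: "Lp_fun p (\<lambda>x::real^'m. \<Prod>i\<in>UNIV. g i (x $ i))"
    and np_tensor: "np p (\<lambda>x::real^'m. \<Prod>i\<in>UNIV. g i (x $ i)) = (\<Prod>i\<in>UNIV. np p (g i))"
proof -
  have [measurable]: "g i \<in> borel_measurable borel" for i using g by (simp add: Lp_fun_def)
  have eq: "\<bar>\<Prod>i\<in>UNIV. g i (x $ i)\<bar> powr p = (\<Prod>i\<in>UNIV. \<bar>g i (x $ i)\<bar> powr p)" for x :: "real^'m"
    by (simp add: abs_prod prod_powr_distrib)
  have i: "integrable lborel (\<lambda>t. \<bar>g i t\<bar> powr p)" for i using g by (simp add: Lp_fun_def)
  show "Lp_fun p (\<lambda>x::real^'m. \<Prod>i\<in>UNIV. g i (x $ i))"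
    unfolding Lp_fun_def eq using integrable_prod_vec[OF i] by simp
  show "np p (\<lambda>x::real^'m. \<Prod>i\<in>UNIV. g i (x $ i)) = (\<Prod>i\<in>UNIV. np p (g i))"
    unfolding np_def eq by (rule integral_prod_vec[OF i])
qed

text \<open>The cylinder over a null set is intersected with the boxes [-n, n]^m, where the product
  formula for integrals applies to indicators, one of which has integral 0.\<close>

lemma AE_coordinate:
  fixes i :: "'m::finite"
  assumes "AE t in lborel. P (t::real)"
  shows "AE x in lborel. P ((x::real^'m) $ i)"
proof -
  from assms obtain N where N: "{t. \<not> P t} \<subseteq> N" "emeasure lborel N = 0" "N \<in> sets lborel" by (auto elim!: AE_E)
  have "AE x::real^'m in lborel. x $ i \<notin> N \<or> \<not> (\<forall>j. \<bar>x $ j\<bar> \<le> real n)" for n :: nat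
  proof -
    define f where "f = (\<lambda>(j::'m) t. indicator (if j = i then N \<inter> {- real n..real n} else {- real n..real n}) t :: real)"
    have fi: "integrable lborel (f j)" for j
      unfolding f_def by (rule integrable_real_indicator) (use N(3) emeasure_mono[of "N \<inter> {- real n..real n}" N lborel] N(2) in \<open>auto simp: order.strict_trans1\<close>)
    have int0: "(LINT t|lborel. f i t) = 0"
    proof -
      have "emeasure lborel (N \<inter> {- real n..real n}) = 0"
        using emeasure_mono[of "N \<inter> {- real n..real n}" N lborel] N by auto
      then show ?thesis by (simp add: measure_def f_def)
    qed
    have "(LINT x|lborel. (\<Prod>j\<in>UNIV. f j ((x::real^'m) $ j))) = 0"
      unfolding integral_prod_vec[of f, OF fi] using int0 by (intro prod_zero) auto
    moreover have "AE x::real^'m in lborel. 0 \<le> (\<Prod>j\<in>UNIV. f j (x $ j))" by (intro AE_I2 prod_nonneg) (simp add: f_def)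
    ultimately have "AE x::real^'m in lborel. (\<Prod>j\<in>UNIV. f j (x $ j)) = 0"
      using integral_nonneg_eq_0_iff_AE[OF integrable_prod_vec[of f, OF fi]] by blast
    then show ?thesis
    proof eventually_elim
      case (elim x)
      then obtain j where "f j (x $ j) = 0" by (auto simp: prod_zero_iff)
      then show ?case unfolding f_def by (cases "j = i") (auto simp: indicator_def split: if_splits intro!: exI[of _ j])
    qed
  qed
  then have "AE x::real^'m in lborel. \<forall>n::nat. x $ i \<notin> N \<or> \<not> (\<forall>j. \<bar>x $ j\<bar> \<le> real n)" by (subst AE_all_countable) blast
  then show ?thesis
  proof eventually_elim
    case (elim x)
    obtain n :: nat where "norm x \<le> real n" using real_arch_simple by blast
    then have "\<bar>x $ j\<bar> \<le> real n" for j using component_le_norm_cart[of x j] by linarith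
    with elim have "x $ i \<notin> N" by auto
    then show ?case using N(1) by auto
  qed
qed

lemma AE_all_coordinates:
  assumes "\<And>i. AE t in lborel. P i (t::real)"
  shows "AE x in lborel. \<forall>i. P i ((x::real^'m) $ i)"
  using AE_coordinate[OF assms] by (intro AE_finite_allI[of UNIV, simplified]) auto

text \<open>The difference has norm 0, and the norm bound for convolution passes this on to its
  image.\<close>

lemma wconv_cong_AE:
  fixes g h :: "'a::euclidean_space \<Rightarrow> real"
  assumes p: "p > 1" and N: "weighted N" and g: "Lp_fun p g" and h: "Lp_fun p h" and ae: "AE x in lborel. g x = h x"
  shows "AE x in lborel. wconv N g x = wconv N h x"
proof -
  have d: "Lp_fun p (\<lambda>x. g x - h x)" using p by (intro Lp_fun_diff g h) auto
  have "np p (\<lambda>x. g x - h x) = np p (\<lambda>_::'a. 0)"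
    by (rule np_cong_AE) (use d ae in \<open>auto simp: Lp_fun_def\<close>)
  then have "np p (wconv N (\<lambda>x. g x - h x)) \<le> 0" using wconv_np[OF p N d] by simp
  then have "np p (wconv N (\<lambda>x. g x - h x)) = 0" using np_nonneg[of p "wconv N (\<lambda>x. g x - h x)"] by linarith
  then have "AE x in lborel. wconv N (\<lambda>x. g x - h x) x = 0" by (rule np_eq_0D[OF wconv_Lp[OF p N d]])
  with wconv_AE[OF p N g] wconv_AE[OF p N h] show ?thesis
    by eventually_elim (simp add: wconv_def right_diff_distrib)
qed

text \<open>The coordinates are convolved one after the other, each time with the one-dimensional potential
  transported to a coordinate axis.\<close>

lemma tensor_wconv:
  assumes p: "p > 1" and \<gamma>: "\<gamma> \<ge> 0"
  shows "\<exists>N :: ((real^'m) \<times> real) measure. weighted N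
    \<and> (\<forall>\<xi>. wchar N \<xi> = of_real (\<Prod>i\<in>I. (1 + (\<xi> $ i)\<^sup>2) powr (- (\<gamma> / 2))))
    \<and> (\<forall>g. (\<forall>i. Lp_fun p (g i)) \<longrightarrow> (AE x in lborel.
        (\<Prod>i\<in>UNIV. (if i \<in> I then wconv (bessel_potential \<gamma>) (g i) else g i) (x $ i)) = wconv N (\<lambda>x. \<Prod>i\<in>UNIV. g i (x $ i)) x))"
proof -
  let ?\<kappa> = "bessel_potential \<gamma> :: (real \<times> real) measure"
  have w\<kappa>: "weighted ?\<kappa>" by (rule weighted_bessel_potential[OF \<gamma>])
  have [measurable_cong]: "sets ?\<kappa> = sets (borel \<Otimes>\<^sub>M borel)" by (rule weighted_sets[OF w\<kappa>])
  have "finite I" by simp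
  then show ?thesis
  proof (induction I rule: finite_induct)
    case empty
    have "(\<lambda>x::real^'m. \<Prod>i\<in>UNIV. g i (x $ i)) \<in> borel_measurable borel" if "\<forall>i. Lp_fun p (g i)" for g
      using Lp_fun_tensor[of p g] that by (simp add: Lp_fun_def)
    then show ?case
      by (intro exI[of _ "return borel (0, 1)"]) (auto simp: weighted_unit)
  next
    case (insert j I)
    then obtain N where N: "weighted N" "\<And>\<xi>::real^'m. wchar N \<xi> = of_real (\<Prod>i\<in>I. (1 + (\<xi> $ i)\<^sup>2) powr (- (\<gamma> / 2)))"
      "\<And>g. \<forall>i. Lp_fun p (g i) \<Longrightarrow> AE x in lborel.
        (\<Prod>i\<in>UNIV. (if i \<in> I then wconv ?\<kappa> (g i) else g i) (x $ i)) = wconv N (\<lambda>x. \<Prod>i\<in>UNIV. g i (x $ i)) x"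
      by blast
    have "\<exists>M. weighted M \<and> (\<forall>\<xi>::real^'m. wchar M \<xi> = (\<integral>w. of_real (snd w) * cis (- (2 * pi * ((fst w *\<^sub>R axis j 1) \<bullet> \<xi>))) \<partial>?\<kappa>))
       \<and> (\<forall>g\<in>borel_measurable borel. \<forall>x. wconv M g x = (\<integral>w. snd w * g (x + fst w *\<^sub>R axis j 1) \<partial>?\<kappa>))"
      by (rule weighted_exists[OF weighted_integrable[OF w\<kappa>]]) measurable
    then obtain M where M: "weighted M"
      "\<And>\<xi>::real^'m. wchar M \<xi> = (\<integral>w. of_real (snd w) * cis (- (2 * pi * ((fst w *\<^sub>R axis j 1) \<bullet> \<xi>))) \<partial>?\<kappa>)"
      "\<And>g x. g \<in> borel_measurable borel \<Longrightarrow> wconv M g x = (\<integral>w. snd w * g (x + fst w *\<^sub>R axis j 1) \<partial>?\<kappa>)"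
      by blast
    have Mc: "wchar M \<xi> = of_real ((1 + (\<xi> $ j)\<^sup>2) powr (- (\<gamma> / 2)))" for \<xi>
    proof -
      have "wchar M \<xi> = wchar ?\<kappa> (\<xi> $ j)" unfolding M(2) by (simp add: wchar_def inner_axis')
      then show ?thesis using wchar_bessel_potential[OF \<gamma>, of "\<xi> $ j"] by simp
    qed
    have "symbol (\<lambda>\<xi>::real^'m. (1 + (\<xi> $ j)\<^sup>2) powr (- (\<gamma> / 2)) * (\<Prod>i\<in>I. (1 + (\<xi> $ i)\<^sup>2) powr (- (\<gamma> / 2))))"
      by (rule symbol_mult) (use Mc M(1) N in \<open>auto simp: symbol_def\<close>)
    then obtain N' where N': "weighted N'" "\<And>\<xi>::real^'m. wchar N' \<xi> = of_real ((1 + (\<xi> $ j)\<^sup>2) powr (- (\<gamma> / 2)) * (\<Prod>i\<in>I. (1 + (\<xi> $ i)\<^sup>2) powr (- (\<gamma> / 2))))"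
      by (rule symbolE) blast
    have ch: "wchar M \<xi> * wchar N \<xi> = wchar N' \<xi>" for \<xi> unfolding Mc N(2) N'(2) by simp
    show ?case
    proof (intro exI[of _ N'] conjI allI impI)
      show "wchar N' \<xi> = of_real (\<Prod>i\<in>insert j I. (1 + (\<xi> $ i)\<^sup>2) powr (- (\<gamma> / 2)))" for \<xi>
        unfolding N'(2) using insert.hyps by simp
      fix g :: "'m \<Rightarrow> real \<Rightarrow> real" assume g: "\<forall>i. Lp_fun p (g i)"
      define f where "f = (\<lambda>i. if i \<in> I then wconv ?\<kappa> (g i) else g i)"
      have f: "Lp_fun p (f i)" for i using g wconv_Lp[OF p w\<kappa>] by (auto simp: f_def)
      let ?G = "\<lambda>x::real^'m. \<Prod>i\<in>UNIV. f i (x $ i)"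
      have G: "Lp_fun p ?G" by (rule Lp_fun_tensor[OF f])
      have Gm: "?G \<in> borel_measurable borel" using G by (simp add: Lp_fun_def)
      have G0: "Lp_fun p (\<lambda>x::real^'m. \<Prod>i\<in>UNIV. g i (x $ i))" using Lp_fun_tensor[of p g] g by simp
      have step: "wconv M ?G x = (\<Prod>i\<in>UNIV. (if i \<in> insert j I then wconv ?\<kappa> (g i) else g i) (x $ i))" for x
      proof -
        have split: "(\<Prod>i\<in>UNIV. h i) = h j * (\<Prod>i\<in>UNIV - {j}. h i)" for h :: "'m \<Rightarrow> real"
          by (rule prod.remove) auto
        have "?G (x + y *\<^sub>R axis j 1) = (\<Prod>i\<in>UNIV - {j}. f i (x $ i)) * g j (x $ j + y)" for y
          unfolding split using insert.hyps by (simp add: f_def axis_def mult.commute)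
        then have "wconv M ?G x = (\<integral>w. (\<Prod>i\<in>UNIV - {j}. f i (x $ i)) * (snd w * g j (x $ j + fst w)) \<partial>?\<kappa>)"
          unfolding M(3)[OF Gm] by (simp add: mult_ac)
        also have "\<dots> = (\<Prod>i\<in>UNIV - {j}. f i (x $ i)) * wconv ?\<kappa> (g j) (x $ j)"
          unfolding wconv_def by (rule integral_mult_right_zero)
        also have "\<dots> = (\<Prod>i\<in>UNIV. (if i \<in> insert j I then wconv ?\<kappa> (g i) else g i) (x $ i))"
          unfolding split by (auto simp: f_def mult.commute intro!: prod.cong)
        finally show ?thesis .
      qed
      have "AE x in lborel. ?G x = wconv N (\<lambda>x. \<Prod>i\<in>UNIV. g i (x $ i)) x"
        using N(3)[OF g] by (simp add: f_def)
      then have "AE x in lborel. wconv M ?G x = wconv M (wconv N (\<lambda>x. \<Prod>i\<in>UNIV. g i (x $ i))) x"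
        by (rule wconv_cong_AE[OF p M(1) G wconv_Lp[OF p N(1) G0]])
      with wconv_comp[OF p M(1) N(1) N'(1) G0 ch]
      show "AE x in lborel. (\<Prod>i\<in>UNIV. (if i \<in> insert j I then wconv ?\<kappa> (g i) else g i) (x $ i)) = wconv N' (\<lambda>x. \<Prod>i\<in>UNIV. g i (x $ i)) x"
        unfolding step by eventually_elim simp
    qed (rule N'(1))
  qed
qed

text \<open>The product of one-dimensional potentials has symbol the product of the weights;
  multiplying by the full weight gives the tensor symbol, so M produces the representer of the
  product. The constant, the p-th power of the mass of M, is the same for all factors, so one small
  factor makes the whole product small.\<close>

theorem tensor_bessel_rep:
  assumes p: "p > 1" and \<gamma>: "\<gamma> \<ge> 0"
  shows "\<exists>C\<ge>0. \<forall>f g. (\<forall>i. bessel_rep \<gamma> p (f i) (g i)) \<longrightarrow>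
    (\<exists>G. bessel_rep \<gamma> p (\<lambda>x::real^'m. \<Prod>i\<in>UNIV. f i (x $ i)) G \<and> np p G \<le> C * (\<Prod>i\<in>UNIV. np p (g i)))"
proof -
  obtain N where N: "weighted N" "\<And>\<xi>::real^'m. wchar N \<xi> = of_real (\<Prod>i\<in>UNIV. (1 + (\<xi> $ i)\<^sup>2) powr (- (\<gamma> / 2)))"
    "\<And>g. \<forall>i. Lp_fun p (g i) \<Longrightarrow> AE x in lborel. (\<Prod>i\<in>UNIV. wconv (bessel_potential \<gamma>) (g i) (x $ i)) = wconv N (\<lambda>x. \<Prod>i\<in>UNIV. g i (x $ i)) x"
    using tensor_wconv[OF p \<gamma>, of "UNIV :: 'm set"] by auto
  have s: "\<gamma> / 2 \<ge> 0" using \<gamma> by simp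
  obtain M where M: "weighted M" "\<And>\<xi>::real^'m. wchar M \<xi> = of_real ((1 + (norm \<xi>)\<^sup>2) powr (\<gamma> / 2) * (\<Prod>b\<in>Basis. (1 + (\<xi> \<bullet> b)\<^sup>2) powr (- (\<gamma> / 2))))"
    by (rule symbolE[OF symbol_tensor[where 'a="real^'m", OF s]]) blast
  have ch: "wchar N \<xi> * of_real ((1 + (norm \<xi>)\<^sup>2) powr (\<gamma> / 2)) = wchar M \<xi>" for \<xi>
    unfolding N(2) M(2) prod_Basis_vec by (simp add: inner_axis mult.commute)
  define C where "C = (\<integral>w. \<bar>snd w\<bar> \<partial>M) powr p"
  show ?thesis
  proof (intro exI[of _ C] conjI allI impI)
    show "C \<ge> 0" by (simp add: C_def)
    fix f g :: "'m \<Rightarrow> real \<Rightarrow> real" assume fg: "\<forall>i. bessel_rep \<gamma> p (f i) (g i)"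
    then have g: "\<And>i. Lp_fun p (g i)" and f: "\<And>i. f i \<in> borel_measurable borel" and ae: "\<And>i. AE x in lborel. f i x = wconv (bessel_potential \<gamma>) (g i) x"
      using bessel_rep_iff[OF p \<gamma>] by auto
    note [measurable] = f
    let ?G = "\<lambda>x::real^'m. \<Prod>i\<in>UNIV. g i (x $ i)"
    have G: "Lp_fun p ?G" by (rule Lp_fun_tensor[OF g])
    have rep: "bessel_rep \<gamma> p (wconv N ?G) (wconv M ?G)" by (rule bessel_rep_wconv[OF p N(1) M(1) ch G])
    have "AE x::real^'m in lborel. \<forall>i. f i (x $ i) = wconv (bessel_potential \<gamma>) (g i) (x $ i)"
      by (rule AE_all_coordinates[OF ae])
    moreover have "AE x in lborel. (\<Prod>i\<in>UNIV. wconv (bessel_potential \<gamma>) (g i) (x $ i)) = wconv N ?G x" using N(3) g by blast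
    ultimately have "AE x in lborel. wconv N ?G x = (\<Prod>i\<in>UNIV. f i (x $ i))" by eventually_elim simp
    then have "bessel_rep \<gamma> p (\<lambda>x::real^'m. \<Prod>i\<in>UNIV. f i (x $ i)) (wconv M ?G)"
      by (intro bessel_rep_cong_AE[OF rep]) measurable
    moreover have "np p (wconv M ?G) \<le> C * (\<Prod>i\<in>UNIV. np p (g i))"
      using wconv_np[OF p M(1) G] by (simp add: C_def np_tensor[OF g])
    ultimately show "\<exists>G. bessel_rep \<gamma> p (\<lambda>x::real^'m. \<Prod>i\<in>UNIV. f i (x $ i)) G \<and> np p G \<le> C * (\<Prod>i\<in>UNIV. np p (g i))" by blast
  qed
qed

section \<open>Closure properties of the network class\<close>

lemma nn_classI:
  fixes n :: nat and w :: "'m::finite \<Rightarrow> nat \<Rightarrow> real^'m"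
  shows "n \<ge> 1 \<Longrightarrow> (\<And>j. j \<in> {1..n} \<Longrightarrow> invertible (\<chi> i. w i j)) \<Longrightarrow>
   (\<lambda>x. \<Sum>j=1..n. \<alpha> j * (\<Prod>i\<in>UNIV. \<sigma> (w i j \<bullet> x + b i j))) \<in> nn_class \<sigma>"
  unfolding nn_class_def mem_Collect_eq by (intro exI[of _ n] exI[of _ \<alpha>] exI[of _ w] exI[of _ b]) auto

lemma nn_classE:
  fixes F :: "real^'m \<Rightarrow> real"
  assumes "F \<in> nn_class \<sigma>"
  obtains n :: nat and \<alpha> :: "nat \<Rightarrow> real" and w :: "'m \<Rightarrow> nat \<Rightarrow> real^'m" and b :: "'m \<Rightarrow> nat \<Rightarrow> real" where "n \<ge> 1" "\<And>j. j \<in> {1..n} \<Longrightarrow> invertible (\<chi> i. w i j)"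
    "F = (\<lambda>x. \<Sum>j=1..n. \<alpha> j * (\<Prod>i\<in>UNIV. \<sigma> (w i j \<bullet> x + b i j)))"
  using assms unfolding nn_class_def mem_Collect_eq by (elim exE conjE) (rule that, auto)

lemma nn_class_cmult:
  fixes F :: "real^'m \<Rightarrow> real"
  assumes "F \<in> nn_class \<sigma>" shows "(\<lambda>x. c * F x) \<in> nn_class \<sigma>"
proof -
  obtain n :: nat and \<alpha> and w :: "'m \<Rightarrow> nat \<Rightarrow> real^'m" and b where n: "n \<ge> 1" "\<And>j. j \<in> {1..n} \<Longrightarrow> invertible (\<chi> i. w i j)"
    "F = (\<lambda>x. \<Sum>j=1..n. \<alpha> j * (\<Prod>i\<in>UNIV. \<sigma> (w i j \<bullet> x + b i j)))" by (rule nn_classE[OF assms]) blast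
  have "(\<lambda>x. c * F x) = (\<lambda>x. \<Sum>j=1..n. (c * \<alpha> j) * (\<Prod>i\<in>UNIV. \<sigma> (w i j \<bullet> x + b i j)))"
    unfolding n(3) by (simp add: sum_distrib_left mult.assoc)
  then show ?thesis using nn_classI[OF n(1,2), where \<alpha>="\<lambda>j. c * \<alpha> j" and \<sigma>=\<sigma> and b=b] by simp
qed

lemma nn_class_add:
  fixes F :: "real^'m \<Rightarrow> real"
  assumes "F \<in> nn_class \<sigma>" "G \<in> nn_class \<sigma>" shows "(\<lambda>x. F x + G x) \<in> nn_class \<sigma>"
proof -
  obtain n :: nat and \<alpha> and w :: "'m \<Rightarrow> nat \<Rightarrow> real^'m" and b where n: "n \<ge> 1" "\<And>j. j \<in> {1..n} \<Longrightarrow> invertible (\<chi> i. w i j)"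
    "F = (\<lambda>x. \<Sum>j=1..n. \<alpha> j * (\<Prod>i\<in>UNIV. \<sigma> (w i j \<bullet> x + b i j)))" by (rule nn_classE[OF assms(1)]) blast
  obtain k :: nat and \<beta> and v :: "'m \<Rightarrow> nat \<Rightarrow> real^'m" and c where k: "k \<ge> 1" "\<And>j. j \<in> {1..k} \<Longrightarrow> invertible (\<chi> i. v i j)"
    "G = (\<lambda>x. \<Sum>j=1..k. \<beta> j * (\<Prod>i\<in>UNIV. \<sigma> (v i j \<bullet> x + c i j)))" by (rule nn_classE[OF assms(2)]) blast
  let ?\<alpha> = "\<lambda>j. if j \<le> n then \<alpha> j else \<beta> (j - n)"
  let ?w = "\<lambda>i j. if j \<le> n then w i j else v i (j - n)"
  let ?b = "\<lambda>i j. if j \<le> n then b i j else c i (j - n)"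
  let ?t = "\<lambda>x j. ?\<alpha> j * (\<Prod>i\<in>UNIV. \<sigma> (?w i j \<bullet> x + ?b i j))"
  have "(\<Sum>j=1..n + k. ?t x j) = F x + G x" for x
  proof -
    have "(\<Sum>j=1..n + k. ?t x j) = (\<Sum>j=1..n. ?t x j) + (\<Sum>j=n + 1..n + k. ?t x j)"
      using n(1) by (intro sum.ub_add_nat) auto
    also have "(\<Sum>j=1..n. ?t x j) = F x" unfolding n(3) by (intro sum.cong) auto
    also have "(\<Sum>j=n + 1..n + k. ?t x j) = (\<Sum>j=1..k. ?t x (j + n))"
      using sum.shift_bounds_cl_nat_ivl[of "?t x" 1 n k] by (simp add: add.commute)
    also have "\<dots> = G x" unfolding k(3) by (intro sum.cong) auto
    finally show ?thesis .
  qed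
  moreover have "invertible (\<chi> i. ?w i j)" if "j \<in> {1..n + k}" for j
    using n(2)[of j] k(2)[of "j - n"] that by (cases "j \<le> n") (auto simp: le_diff_conv)
  ultimately show ?thesis using nn_classI[of "n + k" ?w ?\<alpha> \<sigma> ?b] n(1) by simp
qed

lemma nn_class_shift:
  fixes F :: "real^'m \<Rightarrow> real"
  assumes "F \<in> nn_class \<sigma>" shows "(\<lambda>x. F (x + t)) \<in> nn_class \<sigma>"
proof -
  obtain n :: nat and \<alpha> and w :: "'m \<Rightarrow> nat \<Rightarrow> real^'m" and b where n: "n \<ge> 1" "\<And>j. j \<in> {1..n} \<Longrightarrow> invertible (\<chi> i. w i j)"
    "F = (\<lambda>x. \<Sum>j=1..n. \<alpha> j * (\<Prod>i\<in>UNIV. \<sigma> (w i j \<bullet> x + b i j)))" by (rule nn_classE[OF assms]) blast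
  have "(\<lambda>x. F (x + t)) = (\<lambda>x. \<Sum>j=1..n. \<alpha> j * (\<Prod>i\<in>UNIV. \<sigma> (w i j \<bullet> x + (w i j \<bullet> t + b i j))))"
    unfolding n(3) by (simp add: inner_add_right add.assoc)
  then show ?thesis using nn_classI[OF n(1,2), where \<alpha>=\<alpha> and \<sigma>=\<sigma> and b="\<lambda>i j. w i j \<bullet> t + b i j"] by simp
qed

lemma nn_class_diag:
  fixes l b :: "'m::finite \<Rightarrow> real"
  assumes l: "\<And>i. l i \<noteq> 0"
  shows "(\<lambda>x::real^'m. a * (\<Prod>i\<in>UNIV. \<sigma> (l i * x $ i + b i))) \<in> nn_class \<sigma>"
proof -
  let ?A = "(\<chi> i. l i *\<^sub>R axis i 1) :: real^'m^'m" and ?B = "(\<chi> i. (1 / l i) *\<^sub>R axis i 1) :: real^'m^'m"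
  have "?A ** ?B = mat 1" "?B ** ?A = mat 1"
    using l by (auto simp: matrix_matrix_mult_def mat_def vec_eq_iff axis_def if_distrib[of "\<lambda>x. x * _"] if_distrib[of "\<lambda>x. _ * x"] cong: if_cong)
  then have "invertible ?A" unfolding invertible_def by blast
  from nn_classI[of "1::nat" "\<lambda>i j. l i *\<^sub>R axis i 1" "\<lambda>_. a" \<sigma> "\<lambda>i j. b i"] this
  show ?thesis by (simp add: inner_axis')
qed

lemma nn_class_zero: "(\<lambda>_. 0) \<in> nn_class \<sigma>"
  using nn_class_diag[of "\<lambda>_. 1" 0 \<sigma> "\<lambda>_. 0"] by simp

lemma nn_class_sum: "finite S \<Longrightarrow> (\<And>c. c \<in> S \<Longrightarrow> F c \<in> nn_class \<sigma>) \<Longrightarrow> (\<lambda>x. \<Sum>c\<in>S. F c x) \<in> nn_class \<sigma>"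
  by (induction rule: finite_induct) (auto intro: nn_class_zero nn_class_add)

text \<open>Expanding the product gives one term for each choice of a summand in every coordinate;
  the chosen slopes form a diagonal matrix with nonzero entries.\<close>

lemma nn_class_prod_ridge:
  assumes ts: "\<forall>(a, l, b)\<in>set ts. l \<noteq> 0"
  shows "(\<lambda>x::real^'m. \<Prod>i\<in>UNIV. ridge \<sigma> ts (x $ i)) \<in> nn_class \<sigma>"
proof -
  define n where "n = length ts"
  define a where "a = (\<lambda>k. fst (ts ! k))"
  define l where "l = (\<lambda>k. fst (snd (ts ! k)))"
  define b where "b = (\<lambda>k. snd (snd (ts ! k)))"
  have r: "ridge \<sigma> ts y = (\<Sum>k<n. a k * \<sigma> (l k * y + b k))" for y
    unfolding ridge_def by (simp add: sum_list_sum_nth n_def a_def l_def b_def case_prod_beta atLeast0LessThan)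
  have l0: "l k \<noteq> 0" if "k < n" for k using ts that nth_mem[of k ts] unfolding l_def n_def by (auto simp: case_prod_beta)
  have "(\<Prod>i\<in>UNIV. ridge \<sigma> ts (x $ i)) = (\<Sum>c\<in>PiE UNIV (\<lambda>_. {..<n}). (\<Prod>i\<in>UNIV. a (c i)) * (\<Prod>i\<in>UNIV. \<sigma> (l (c i) * x $ i + b (c i))))" for x :: "real^'m"
    unfolding r by (subst prod_sum_PiE) (auto simp: prod.distrib)
  moreover have "(\<lambda>x::real^'m. \<Sum>c\<in>PiE UNIV (\<lambda>_. {..<n}). (\<Prod>i\<in>UNIV. a (c i)) * (\<Prod>i\<in>UNIV. \<sigma> (l (c i) * x $ i + b (c i)))) \<in> nn_class \<sigma>"
    by (intro nn_class_sum nn_class_diag finite_PiE) (auto intro!: l0)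
  ultimately show ?thesis by simp
qed

text \<open>A Gaussian is the Bessel potential of order \<open>2k \<ge> \<gamma>\<close> of the Schwartz function \<open>(1 - \<Delta>)\<^sup>k\<close> applied to it.\<close>

lemma bessel_rep_gauss:
  assumes p: "p > 1" and \<gamma>: "\<gamma> \<ge> 0" and c: "c > 0"
  shows "\<exists>g. bessel_rep \<gamma> p (\<lambda>x::'a::euclidean_space. gauss (x /\<^sub>R c)) g"
proof -
  define \<phi> where "\<phi> = (\<lambda>x::'a. complex_of_real (gauss (x /\<^sub>R c)))"
  define k where "k = nat \<lceil>\<gamma> / 2\<rceil>"
  define \<psi> where "\<psi> = (helmholtz ^^ k) \<phi>"
  have k: "real k \<ge> \<gamma> / 2" unfolding k_def by linarith
  have \<phi>: "schwartz \<phi>" using schwartz_gauss_shift[of c "0::'a"] c by (simp add: \<phi>_def)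
  have \<psi>: "schwartz \<psi>" unfolding \<psi>_def by (rule schwartz_helmholtz_funpow[OF \<phi>])
  have L1: "L1b \<psi>" by (rule L1b_schwartz[OF \<psi>])
  have \<psi>i: "integrable lborel \<psi>" using L1 by (simp add: L1b_def)
  then have \<psi>m[measurable]: "\<psi> \<in> borel_measurable borel" by auto
  obtain C where C: "\<And>x. norm (\<psi> x) \<le> C" using L1 by (auto simp: L1b_def bounded_iff)
  have C0: "C \<ge> 0" using order_trans[OF norm_ge_zero C[of 0]] .
  \<comment> \<open>Test functions are complex valued, whereas representers are real; since the
    Gaussian and the weights of N are real, taking real parts commutes with the potential.\<close>
  define u where "u = (\<lambda>x. Re (\<psi> x))"
  have [measurable]: "u \<in> borel_measurable borel" unfolding u_def by measurable
  have u: "Lp_fun p u" unfolding Lp_fun_def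
  proof (intro conjI)
    show "integrable lborel (\<lambda>x. \<bar>u x\<bar> powr p)"
    proof (rule Bochner_Integration.integrable_bound[of _ "\<lambda>x. C powr (p - 1) * norm (\<psi> x)"])
      show "AE x in lborel. norm (\<bar>u x\<bar> powr p) \<le> norm (C powr (p - 1) * norm (\<psi> x))"
      proof (rule AE_I2)
        fix x
        have a: "\<bar>u x\<bar> \<le> norm (\<psi> x)" by (simp add: u_def abs_Re_le_cmod)
        have "\<bar>u x\<bar> powr p = \<bar>u x\<bar> powr (p - 1) * \<bar>u x\<bar>"
          using powr_add[of "\<bar>u x\<bar>" "p - 1" 1] by (cases "u x = 0") (auto simp: powr_one)
        also have "\<dots> \<le> C powr (p - 1) * norm (\<psi> x)"
          using a C[of x] p by (intro mult_mono powr_mono2) auto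
        finally show "norm (\<bar>u x\<bar> powr p) \<le> norm (C powr (p - 1) * norm (\<psi> x))" by simp
      qed
    qed (use \<psi>i in \<open>auto intro!: integrable_mult_right\<close>)
  qed simp
  obtain N where N: "weighted N" "\<And>\<xi>::'a. wchar N \<xi> = of_real ((1 + 1 * (norm \<xi>)\<^sup>2) powr (- real k))"
    by (rule symbolE[OF symbol_bessel_norm[where 'a='a, of "real k" 1]]) auto
  have [measurable_cong]: "sets N = sets (borel \<Otimes>\<^sub>M borel)" by (rule weighted_sets[OF N(1)])
  have "wadj N \<psi> = inv_fourier (\<lambda>\<xi>. wchar N \<xi> * fourier \<psi> \<xi>)" by (rule wadj_schwartz[OF N(1) \<psi>])
  also have "(\<lambda>\<xi>. wchar N \<xi> * fourier \<psi> \<xi>) = fourier \<phi>"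
  proof
    fix \<xi> :: 'a
    have "1 + (norm \<xi>)\<^sup>2 > 0" by (simp add: add_pos_nonneg)
    then have "(1 + (norm \<xi>)\<^sup>2) powr (- real k) * (1 + (norm \<xi>)\<^sup>2) ^ k = 1"
      by (simp add: powr_minus powr_realpow)
    then have "complex_of_real ((1 + (norm \<xi>)\<^sup>2) powr (- real k)) * complex_of_real ((1 + (norm \<xi>)\<^sup>2) ^ k) = 1"
      by (metis of_real_1 of_real_mult)
    then show "wchar N \<xi> * fourier \<psi> \<xi> = fourier \<phi> \<xi>"
      unfolding N(2) \<psi>_def fourier_helmholtz_funpow[OF \<phi>] by (simp only: mult.assoc[symmetric] mult_1_left)
  qed
  finally have adj: "wadj N \<psi> x = \<phi> x" for x using fourier_inversion[OF \<phi>] by simp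
  \<comment> \<open>The reflected measure: \<open>wconv\<close> translates by + y but
    \<open>wadj\<close> by - y, and the Gaussian has been recovered through
    \<open>wadj\<close>.\<close>
  have "\<exists>N'. weighted N' \<and> (\<forall>\<xi>::'a. wchar N' \<xi> = (\<integral>w. of_real (snd w) * cis (- (2 * pi * ((- fst w) \<bullet> \<xi>))) \<partial>N))
       \<and> (\<forall>g\<in>borel_measurable borel. \<forall>x. wconv N' g x = (\<integral>w. snd w * g (x + (- fst w)) \<partial>N))"
    by (rule weighted_exists[OF weighted_integrable[OF N(1)]]) measurable
  then obtain N' where N': "weighted N'"
    "\<And>\<xi>::'a. wchar N' \<xi> = (\<integral>w. of_real (snd w) * cis (- (2 * pi * ((- fst w) \<bullet> \<xi>))) \<partial>N)"
    "\<And>x. wconv N' u x = (\<integral>w. snd w * u (x + (- fst w)) \<partial>N)"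
    using \<open>u \<in> borel_measurable borel\<close> by blast
  have ch: "wchar N' \<xi> = of_real ((1 + (norm \<xi>)\<^sup>2) powr (- real k))" for \<xi>
  proof -
    have "wchar N' \<xi> = wchar N (- \<xi>)" unfolding N'(2) by (simp add: wchar_def)
    then show ?thesis by (simp add: N(2))
  qed
  have val: "wconv N' u x = gauss (x /\<^sub>R c)" for x
  proof -
    have i: "integrable N (\<lambda>w. of_real (snd w) * \<psi> (x - fst w))"
    proof (rule Bochner_Integration.integrable_bound[of _ "\<lambda>w. C * snd w"])
      show "AE w in N. norm (of_real (snd w) * \<psi> (x - fst w)) \<le> norm (C * snd w)"
        using C C0 by (intro AE_I2) (simp add: norm_mult abs_mult mult.commute[of C] mult_left_mono)
    qed (use weighted_integrable[OF N(1)] in auto)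
    have "wconv N' u x = (\<integral>w. Re (of_real (snd w) * \<psi> (x - fst w)) \<partial>N)"
      unfolding N'(3) by (intro Bochner_Integration.integral_cong) (auto simp: u_def)
    also have "\<dots> = Re (wadj N \<psi> x)" unfolding wadj_def by (rule integral_Re[OF i])
    finally show ?thesis by (simp add: adj \<phi>_def)
  qed
  have s: "real k - \<gamma> / 2 \<ge> 0" using k by simp
  obtain N2 where N2: "weighted N2" "\<And>\<xi>::'a. wchar N2 \<xi> = of_real ((1 + 1 * (norm \<xi>)\<^sup>2) powr (- (real k - \<gamma> / 2)))"
    by (rule symbolE[OF symbol_bessel_norm[where 'a='a, OF s, of 1]]) auto
  have "wchar N' \<xi> * of_real ((1 + (norm \<xi>)\<^sup>2) powr (\<gamma> / 2)) = wchar N2 \<xi>" for \<xi>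
    unfolding ch N2(2) of_real_mult[symmetric] powr_add[symmetric] by (simp add: algebra_simps)
  from bessel_rep_wconv[OF p N'(1) N2(1) this u] show ?thesis
    unfolding val[abs_def] by blast
qed

text \<open>Each added summand costs one factor 2 * 2 powr p in the quasi-triangle inequality for
  \<open>np\<close>. The count of summands is fixed, so this growth is harmless.\<close>

lemma bessel_rep_sum_bound:
  assumes p: "p > 1" and "finite S" and \<eta>: "\<eta> \<ge> 0" and "\<And>B. B \<in> S \<Longrightarrow> \<exists>G. bessel_rep \<gamma> p (T B) G \<and> np p G \<le> \<eta>"
  shows "\<exists>G. bessel_rep \<gamma> p (\<lambda>x. \<Sum>B\<in>S. T B x) G \<and> np p G \<le> (2 * 2 powr p) ^ card S * \<eta>"
  using assms(2,4)
proof (induction rule: finite_induct)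
  case empty
  show ?case using bessel_rep_zero[of \<gamma> p] \<eta> by (intro exI[of _ "\<lambda>_. 0"]) simp
next
  case (insert B S)
  obtain G where G: "bessel_rep \<gamma> p (\<lambda>x. \<Sum>B\<in>S. T B x) G" "np p G \<le> (2 * 2 powr p) ^ card S * \<eta>"
    using insert.IH insert.prems by blast
  obtain H where H: "bessel_rep \<gamma> p (T B) H" "np p H \<le> \<eta>" using insert.prems by blast
  have r: "bessel_rep \<gamma> p (\<lambda>x. \<Sum>B\<in>insert B S. T B x) (\<lambda>x. H x + G x)"
    using bessel_rep_linear[OF p H(1) G(1), of 1 1] insert.hyps by simp
  have "1 \<le> 2 powr p" using p by (intro ge_one_powr_ge_zero) auto
  then have "1 \<le> (2 * 2 powr p) ^ card S" by (intro one_le_power) simp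
  then have h: "np p H \<le> (2 * 2 powr p) ^ card S * \<eta>" using H(2) \<eta> mult_right_mono[of 1 "(2 * 2 powr p) ^ card S" \<eta>] by simp
  have "np p (\<lambda>x. H x + G x) \<le> 2 powr p * (np p H + np p G)"
    using H(1) G(1) p by (intro np_add_le) (auto simp: bessel_rep_def)
  also have "\<dots> \<le> 2 powr p * ((2 * 2 powr p) ^ card S * \<eta> + (2 * 2 powr p) ^ card S * \<eta>)"
    using h G(2) by (intro mult_left_mono add_mono) auto
  also have "\<dots> = (2 * 2 powr p) ^ card (insert B S) * \<eta>" using insert.hyps by simp
  finally show ?case using r by blast
qed

lemma
  fixes \<sigma> :: "real \<Rightarrow> real"
  assumes p: "p > 1" and \<gamma>: "\<gamma> \<ge> 0"
  defines "X \<equiv> {g. \<exists>F\<in>nn_class \<sigma>. bessel_rep \<gamma> p F (g :: real^'m \<Rightarrow> real)}"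
  shows Lp_lin_nn_class: "Lp_lin p X" and shift_inv_nn_class: "shift_inv X"
proof -
  show "shift_inv X" unfolding shift_inv_def X_def using bessel_rep_translate[OF p \<gamma>] nn_class_shift by blast
  show "Lp_lin p X" unfolding Lp_lin_def
  proof (intro conjI ballI allI)
    show "Lp_fun p g" if "g \<in> X" for g using that by (auto simp: X_def bessel_rep_def)
    show "(\<lambda>_. 0) \<in> X" unfolding X_def using nn_class_zero bessel_rep_zero by blast
    show "(\<lambda>x. g x + h x) \<in> X" if gh: "g \<in> X" "h \<in> X" for g h
    proof -
      obtain F G where F: "F \<in> nn_class \<sigma>" "bessel_rep \<gamma> p F g" "G \<in> nn_class \<sigma>" "bessel_rep \<gamma> p G h" using gh by (auto simp: X_def)
      show ?thesis using bessel_rep_linear[OF p F(2,4), of 1 1] nn_class_add[OF F(1,3)] by (auto simp: X_def)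
    qed
    show "(\<lambda>x. c * g x) \<in> X" if g: "g \<in> X" for g c
    proof -
      obtain F where F: "F \<in> nn_class \<sigma>" "bessel_rep \<gamma> p F g" using g by (auto simp: X_def)
      show ?thesis using bessel_rep_linear[OF p F(2,2), of c 0] nn_class_cmult[OF F(1)] by (auto simp: X_def)
    qed
  qed
qed

text \<open>A Gaussian is the product of one-dimensional Gaussians h, each approximated in the
  Bessel norm by the same sum of affine images of \<sigma>. Their product over the coordinates is in
  the class; expanding it around the product of the h, every correction term contains a small
  factor.\<close>

theorem nn_class_dense:
  fixes \<sigma> :: "real \<Rightarrow> real" and g :: "real^'m \<Rightarrow> real"
  assumes p: "p > 1" and \<gamma>: "\<gamma> \<ge> 0" and \<sigma>: "bessel_rep \<gamma> p \<sigma> g0" and nz: "\<not> (AE t in lborel. \<sigma> t = 0)"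
    and g: "Lp_fun p g"
  shows "g \<in> Lp_cl p {g. \<exists>F\<in>nn_class \<sigma>. bessel_rep \<gamma> p F g}"
proof -
  let ?X = "{g :: real^'m \<Rightarrow> real. \<exists>F\<in>nn_class \<sigma>. bessel_rep \<gamma> p F g}"
  have Xl: "Lp_lin p ?X" and Xs: "shift_inv ?X"
    by (rule Lp_lin_nn_class[OF p \<gamma>], rule shift_inv_nn_class[OF p \<gamma>])
  have XL: "\<forall>g\<in>?X. Lp_fun p g" using Xl by (simp add: Lp_lin_def)
  obtain C where C: "C \<ge> 0" "\<And>f g. (\<forall>i::'m. bessel_rep \<gamma> p (f i) (g i)) \<Longrightarrow>
    (\<exists>G. bessel_rep \<gamma> p (\<lambda>x::real^'m. \<Prod>i\<in>UNIV. f i (x $ i)) G \<and> np p G \<le> C * (\<Prod>i\<in>UNIV. np p (g i)))"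
    using tensor_bessel_rep[OF p \<gamma>, where 'm='m] by blast
  have "(\<lambda>x::real^'m. gauss (x /\<^sub>R c)) \<in> Lp_cl p ?X" if c: "c > 0" for c
  proof -
    obtain k where k: "bessel_rep \<gamma> p (\<lambda>x::real. gauss (x /\<^sub>R c)) k" using bessel_rep_gauss[OF p \<gamma> c, where 'a=real] by blast
    define h where "h = (\<lambda>x::real. gauss (x /\<^sub>R c))"
    define H where "H = (\<lambda>x::real^'m. gauss (x /\<^sub>R c))"
    have kh: "bessel_rep \<gamma> p h k" using k by (simp add: h_def)
    have Hh: "H x = (\<Prod>i\<in>UNIV. h (x $ i))" for x
      unfolding H_def h_def gauss_prod[of "x /\<^sub>R c"] prod_Basis_vec by (simp add: inner_axis)
    obtain G where G: "bessel_rep \<gamma> p H G" using C(2)[of "\<lambda>_. h" "\<lambda>_. k"] kh unfolding Hh[abs_def] by blast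
    \<comment> \<open>The lower bound 1 serves twice: powers of D increase with the exponent, and D
      also bounds the representers of the errors, whose \<open>np\<close> is at most \<delta>,
      itself at most 1.\<close>
    define D where "D = max 1 (np p k)"
    have D: "D \<ge> 1" "np p k \<le> D" by (auto simp: D_def)
    define S where "S = Pow (UNIV::'m set) - {{}}"
    define A where "A = (2 * 2 powr p) ^ card S * (C * D ^ CARD('m))"
    have A: "A \<ge> 0" unfolding A_def using C(1) D(1) by simp
    have "G \<in> Lp_cl p ?X" unfolding Lp_cl_def
    proof (intro CollectI conjI allI impI)
      show "Lp_fun p G" using G by (simp add: bessel_rep_def)
      fix e :: real assume e: "e > 0"
      define \<delta> where "\<delta> = min 1 (e / (2 * (A + 1)))"
      have \<delta>: "\<delta> > 0" "\<delta> \<le> 1" using e A by (auto simp: \<delta>_def)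
      have Ad: "A * \<delta> < e"
      proof -
        have "A * \<delta> \<le> (A + 1) * (e / (2 * (A + 1)))" unfolding \<delta>_def using A e by (intro mult_mono) auto
        also have "\<dots> = e / 2" using A by (simp add: field_simps)
        finally show ?thesis using e by simp
      qed
      have "k \<in> Lp_cl p (ridge_reps \<gamma> p \<sigma>)" using kh by (intro ridge_dense[OF p \<gamma> \<sigma> nz]) (simp add: bessel_rep_def)
      then obtain r where r: "r \<in> ridge_reps \<gamma> p \<sigma>" "np p (\<lambda>x. k x - r x) < \<delta>" using \<delta>(1) unfolding Lp_cl_def by blast
      from r(1) obtain ts where ts: "\<forall>(a, l, b)\<in>set ts. l \<noteq> 0" "bessel_rep \<gamma> p (ridge \<sigma> ts) r" by (auto simp: ridge_reps_def)
      let ?d = "\<lambda>x. ridge \<sigma> ts x - h x" and ?dr = "\<lambda>x. r x - k x"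
      have dr: "bessel_rep \<gamma> p ?d ?dr" using bessel_rep_linear[OF p ts(2) kh, of 1 "-1"] by simp
      have dn: "np p ?dr \<le> \<delta>" using r(2) np_minus_commute[of p r k] by simp
      \<comment> \<open>The term of the expansion in which the coordinates of B contribute the
        error; the empty set gives the Gaussian itself.\<close>
      define T where "T = (\<lambda>B (x::real^'m). (\<Prod>i\<in>B. ?d (x $ i)) * (\<Prod>i\<in>UNIV - B. h (x $ i)))"
      have T: "\<exists>G. bessel_rep \<gamma> p (T B) G \<and> np p G \<le> C * D ^ CARD('m) * \<delta>" if B: "B \<in> S" for B
      proof -
        let ?f = "\<lambda>i::'m. if i \<in> B then ?d else h" and ?g = "\<lambda>i::'m. if i \<in> B then ?dr else k"
        have "\<forall>i. bessel_rep \<gamma> p (?f i) (?g i)" using dr kh by simp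
        from C(2)[OF this] obtain G where G: "bessel_rep \<gamma> p (\<lambda>x::real^'m. \<Prod>i\<in>UNIV. ?f i (x $ i)) G" "np p G \<le> C * (\<Prod>i\<in>UNIV. np p (?g i))" by blast
        have Teq: "(\<Prod>i\<in>UNIV. ?f i (x $ i)) = T B x" for x
        proof -
          have "(\<Prod>i\<in>UNIV. ?f i (x $ i)) = (\<Prod>i\<in>UNIV - B. ?f i (x $ i)) * (\<Prod>i\<in>B. ?f i (x $ i))"
            by (rule prod.subset_diff) auto
          also have "\<dots> = (\<Prod>i\<in>UNIV - B. h (x $ i)) * (\<Prod>i\<in>B. ?d (x $ i))"
            by (intro arg_cong2[where f="(*)"] prod.cong) auto
          finally show ?thesis by (simp add: T_def mult.commute)
        qed
        obtain i0 where i0: "i0 \<in> B" using B by (auto simp: S_def)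
        have "(\<Prod>i\<in>UNIV. np p (?g i)) = np p (?g i0) * (\<Prod>i\<in>UNIV - {i0}. np p (?g i))" by (rule prod.remove) auto
        also have "\<dots> \<le> \<delta> * (\<Prod>i\<in>UNIV - {i0}. D)"
          using i0 dn D \<delta> by (intro mult_mono prod_mono prod_nonneg) (auto simp: np_nonneg intro: order_trans)
        also have "\<dots> \<le> \<delta> * D ^ CARD('m)" using D \<delta> by (auto intro!: mult_left_mono power_increasing)
        finally have "C * (\<Prod>i\<in>UNIV. np p (?g i)) \<le> C * D ^ CARD('m) * \<delta>" using C(1) mult_left_mono by (fastforce simp: mult_ac)
        then show ?thesis using G unfolding Teq[abs_def] by (intro exI[of _ G]) auto
      qed
      have "\<exists>E. bessel_rep \<gamma> p (\<lambda>x. \<Sum>B\<in>S. T B x) E \<and> np p E \<le> (2 * 2 powr p) ^ card S * (C * D ^ CARD('m) * \<delta>)"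
        by (rule bessel_rep_sum_bound[OF p _ _ T]) (use C(1) D \<delta> in \<open>auto simp: S_def\<close>)
      then obtain E where E: "bessel_rep \<gamma> p (\<lambda>x. \<Sum>B\<in>S. T B x) E" "np p E \<le> A * \<delta>" by (auto simp: A_def mult_ac)
      have "(\<Prod>i\<in>UNIV. ridge \<sigma> ts (x $ i)) = H x + (\<Sum>B\<in>S. T B x)" for x :: "real^'m"
      proof -
        have "(\<Prod>i\<in>UNIV. ?d (x $ i) + h (x $ i)) = (\<Sum>B\<in>Pow UNIV. T B x)" unfolding T_def by (rule prod_add) simp
        also have "\<dots> = T {} x + (\<Sum>B\<in>S. T B x)" unfolding S_def by (rule sum.remove) auto
        finally show ?thesis by (simp add: T_def Hh)
      qed
      then have "bessel_rep \<gamma> p (\<lambda>x::real^'m. \<Prod>i\<in>UNIV. ridge \<sigma> ts (x $ i)) (\<lambda>x. G x + E x)"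
        using bessel_rep_linear[OF p G E(1), of 1 1] by simp
      then have "(\<lambda>x. G x + E x) \<in> ?X" using nn_class_prod_ridge[OF ts(1), of \<sigma>] by blast
      moreover have "np p (\<lambda>x. G x - (G x + E x)) < e"
      proof -
        have "np p (\<lambda>x. G x - (G x + E x)) = np p E" by (simp add: np_def)
        then show ?thesis using E(2) Ad by simp
      qed
      ultimately show "\<exists>h\<in>?X. np p (\<lambda>x. G x - h x) < e" by (intro bexI[of _ "\<lambda>x. G x + E x"])
    qed
    \<comment> \<open>So far the closure contains the representer G of the Gaussian H. It is stable
      under the potential, hence contains H, whose dilates form an approximate identity.\<close>
    then have "wconv (bessel_potential \<gamma>) G \<in> Lp_cl p ?X"
      by (rule wconv_in_cl[OF Xl Xs p weighted_bessel_potential[OF \<gamma>]])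
    moreover have "AE x in lborel. wconv (bessel_potential \<gamma>) G x = H x" "H \<in> borel_measurable borel"
      using bessel_rep_iff[OF p \<gamma>, of H G] G by auto
    ultimately have "H \<in> Lp_cl p ?X" using XL by (rule Lp_cl_cong_AE)
    then show ?thesis by (simp add: H_def)
  qed
  from dense_if_kernels[OF Xl Xs p integrable_gauss integral_gauss gauss_minus this g] show ?thesis by blast
qed

section \<open>Zygmund estimates\<close>

text \<open>The mean value inequality bounds the remainder quotient by 2 G; along any sequence
  tending to 0, dominated convergence then gives the Frechet derivative. A majorant near x0
  suffices.\<close>

lemma has_derivative_integral:
  fixes K :: "'w \<Rightarrow> 'a::euclidean_space \<Rightarrow> real"
  assumes \<delta>: "\<delta> > 0" and K: "\<And>x. integrable M (\<lambda>w. K w x)"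
    and D: "\<And>w x. x \<in> ball x0 \<delta> \<Longrightarrow> (K w has_derivative D w x) (at x)"
    and Dm[measurable]: "\<And>h. (\<lambda>w. D w x0 h) \<in> borel_measurable M"
    and G: "integrable M G" "\<And>w x h. x \<in> ball x0 \<delta> \<Longrightarrow> \<bar>D w x h\<bar> \<le> G w * norm h"
  shows "((\<lambda>x. \<integral>w. K w x \<partial>M) has_derivative (\<lambda>h. \<integral>w. D w x0 h \<partial>M)) (at x0)"
proof -
  have x0: "x0 \<in> ball x0 \<delta>" using \<delta> by simp
  have G0: "G w \<ge> 0" for w
  proof -
    obtain b :: 'a where "b \<in> Basis" using nonempty_Basis by blast
    then show ?thesis using G(2)[OF x0, of w b] abs_ge_zero[of "D w x0 b"] by (simp del: abs_ge_zero)
  qed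
  have Di: "integrable M (\<lambda>w. D w x0 h)" for h
    by (rule Bochner_Integration.integrable_bound[OF integrable_mult_left[OF G(1), of "norm h"]])
       (use G(2)[OF x0] G0 in \<open>auto simp: abs_mult\<close>)
  have lin: "linear (D w x0)" for w using D[OF x0] has_derivative_linear by blast
  have bl: "bounded_linear (\<lambda>h. \<integral>w. D w x0 h \<partial>M)"
  proof (rule bounded_linear_intro)
    show "(\<integral>w. D w x0 (h + k) \<partial>M) = (\<integral>w. D w x0 h \<partial>M) + (\<integral>w. D w x0 k \<partial>M)" for h k
      by (simp add: linear_add[OF lin] Di)
    show "(\<integral>w. D w x0 (c *\<^sub>R h) \<partial>M) = c *\<^sub>R (\<integral>w. D w x0 h \<partial>M)" for c h
      by (simp add: linear_scale[OF lin])
    show "norm (\<integral>w. D w x0 h \<partial>M) \<le> norm h * (\<integral>w. G w \<partial>M)" for h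
    proof -
      have "norm (\<integral>w. D w x0 h \<partial>M) \<le> (\<integral>w. G w * norm h \<partial>M)"
        by (rule order_trans[OF integral_norm_bound integral_mono]) (use Di G(1) G(2)[OF x0] in \<open>auto intro!: integrable_mult_left\<close>)
      then show ?thesis by (simp add: mult.commute)
    qed
  qed
  show ?thesis
    unfolding has_derivative_at
  proof (intro conjI bl, unfold tendsto_at_iff_sequentially, intro allI impI)
    fix X :: "nat \<Rightarrow> 'a" assume X0: "\<forall>i. X i \<in> UNIV - {0}" and X: "X \<longlonglongrightarrow> 0"
    \<comment> \<open>Set to 0 outside the ball where the derivative is controlled, so that the
      majorant holds for every n.\<close>
    define q where "q = (\<lambda>n w. if norm (X n) < \<delta> then (K w (x0 + X n) - K w x0 - D w x0 (X n)) / norm (X n) else 0)"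
    have Km[measurable]: "(\<lambda>w. K w x) \<in> borel_measurable M" for x using K by blast
    have "(\<lambda>n. \<integral>w. q n w \<partial>M) \<longlonglongrightarrow> (\<integral>w. 0 \<partial>M)"
    proof (rule integral_dominated_convergence[where w="\<lambda>w. 2 * G w"])
      show "q n \<in> borel_measurable M" for n unfolding q_def by measurable
      show "integrable M (\<lambda>w. 2 * G w)" using G(1) by simp
      show "AE w in M. (\<lambda>n. q n w) \<longlonglongrightarrow> 0"
      proof (rule AE_I2)
        fix w
        have "(\<lambda>h. norm (K w (x0 + h) - K w x0 - D w x0 h) / norm h) \<midarrow>0\<rightarrow> 0"
          using D[OF x0, of w] by (simp add: has_derivative_at)
        then have "((\<lambda>h. norm (K w (x0 + h) - K w x0 - D w x0 h) / norm h) \<circ> X) \<longlonglongrightarrow> 0"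
          using X0 X unfolding tendsto_at_iff_sequentially by blast
        then show "(\<lambda>n. q n w) \<longlonglongrightarrow> 0"
          by (rule Lim_null_comparison[rotated]) (auto simp: q_def)
      qed
      show "AE w in M. norm (q n w) \<le> 2 * G w" for n
      proof (rule AE_I2)
        fix w
        show "norm (q n w) \<le> 2 * G w"
        proof (cases "norm (X n) < \<delta>")
          case True
          have nz: "norm (X n) > 0" using X0 by auto
          have "norm (K w (x0 + X n) - K w x0) \<le> G w * norm (x0 + X n - x0)"
          proof (rule differentiable_bound[of "ball x0 \<delta>" "K w" "D w"])
            show "(K w has_derivative D w x) (at x within ball x0 \<delta>)" if "x \<in> ball x0 \<delta>" for x
              using D[OF that] by (rule has_derivative_at_withinI)
            show "onorm (D w x) \<le> G w" if "x \<in> ball x0 \<delta>" for x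
              by (rule onorm_le) (use G(2)[OF that] in simp)
          qed (use True x0 in \<open>auto simp: dist_norm\<close>)
          moreover have "\<bar>D w x0 (X n)\<bar> \<le> G w * norm (X n)" by (rule G(2)[OF x0])
          ultimately have "\<bar>K w (x0 + X n) - K w x0 - D w x0 (X n)\<bar> \<le> 2 * G w * norm (X n)" by simp
          then show ?thesis using True nz by (simp add: q_def divide_le_eq)
        qed (use G0 in \<open>simp add: q_def\<close>)
      qed
    qed simp
    then have lim: "(\<lambda>n. norm (\<integral>w. q n w \<partial>M)) \<longlonglongrightarrow> 0" using tendsto_norm_zero by fastforce
    have "eventually (\<lambda>n. norm (X n) < \<delta>) sequentially"
      using X \<delta> by (simp add: tendsto_iff dist_norm)
    then have "eventually (\<lambda>n. norm (\<integral>w. q n w \<partial>M) =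
      norm ((\<integral>w. K w (x0 + X n) \<partial>M) - (\<integral>w. K w x0 \<partial>M) - (\<integral>w. D w x0 (X n) \<partial>M)) / norm (X n)) sequentially"
      by eventually_elim (simp add: q_def K Di)
    with lim have "(\<lambda>n. norm ((\<integral>w. K w (x0 + X n) \<partial>M) - (\<integral>w. K w x0 \<partial>M) - (\<integral>w. D w x0 (X n) \<partial>M)) / norm (X n)) \<longlonglongrightarrow> 0"
      by (rule Lim_transform_eventually)
    then show "((\<lambda>h. norm ((\<integral>w. K w (x0 + h) \<partial>M) - (\<integral>w. K w x0 \<partial>M) - (\<integral>w. D w x0 h \<partial>M)) / norm h) \<circ> X) \<longlonglongrightarrow> 0"
      by (simp add: comp_def)
  qed
qed

lemma continuous_on_integral_dominated:
  fixes K :: "'w \<Rightarrow> 'a::euclidean_space \<Rightarrow> real"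
  assumes K: "\<And>w. continuous_on UNIV (K w)" "\<And>x. (\<lambda>w. K w x) \<in> borel_measurable M"
    and G: "integrable M G" "\<And>w x. \<bar>K w x\<bar> \<le> G w"
  shows "continuous_on UNIV (\<lambda>x. \<integral>w. K w x \<partial>M)"
  unfolding continuous_on_sequentially
proof (intro allI ballI impI, elim conjE)
  fix X and x :: 'a assume X: "X \<longlonglongrightarrow> x"
  have "(\<lambda>n. \<integral>w. K w (X n) \<partial>M) \<longlonglongrightarrow> (\<integral>w. K w x \<partial>M)"
  proof (rule integral_dominated_convergence[OF K(2) K(2) G(1)])
    show "AE w in M. (\<lambda>n. K w (X n)) \<longlonglongrightarrow> K w x"
    proof (rule AE_I2)
      fix w
      have "isCont (K w) x" using K(1) by (simp add: continuous_on_eq_continuous_at)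
      then show "(\<lambda>n. K w (X n)) \<longlonglongrightarrow> K w x" using X by (rule isCont_tendsto_compose)
    qed
  qed (use G(2) in simp)
  then show "((\<lambda>x. \<integral>w. K w x \<partial>M) \<circ> X) \<longlonglongrightarrow> (\<integral>w. K w x \<partial>M)" by (simp add: comp_def)
qed

lemma sum_Basis_mult_le:
  fixes h :: "'a::euclidean_space"
  assumes "\<And>b. b \<in> Basis \<Longrightarrow> \<bar>u b\<bar> \<le> B"
  shows "\<bar>\<Sum>b\<in>Basis. (h \<bullet> b) * u b\<bar> \<le> (real DIM('a) * B) * norm h"
proof -
  have "\<bar>\<Sum>b\<in>Basis. (h \<bullet> b) * u b\<bar> \<le> (\<Sum>b\<in>(Basis::'a set). norm h * B)"
    using assms by (intro sum_norm_le[where f="\<lambda>b. (h \<bullet> b) * u b", simplified]) (simp add: abs_mult Basis_le_norm mult_mono)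
  then show ?thesis by (simp add: mult_ac)
qed

text \<open>Replaces a minimum by 1 - exp, so that \<open>integral_frac\<close> evaluates the
  integral over t in the second difference estimate.\<close>

lemma min_one_le_exp: fixes y :: real assumes "y \<ge> 0" shows "min y 1 \<le> 2 * (1 - exp (- y))"
proof -
  have "exp (- y) \<le> 1 / (1 + y)" using exp_ge_add_one_self[of y] assms by (simp add: exp_minus field_simps)
  moreover have "min y 1 \<le> 2 * (1 - 1 / (1 + y))" using assms mult_left_le[of y y] by (auto simp: min_def field_simps)
  ultimately show ?thesis by argo
qed

lemma zyg_k_alpha:
  assumes "s > 0"
  shows "real (zyg_k s) < s" "0 < zyg_alpha s" "zyg_alpha s \<le> 1"
  using assms unfolding zyg_alpha_def zyg_k_def by linarith+

text \<open>The second difference is V x - V (x - h) for V y = w (y + h) - w y. The mean value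
  inequality is used once for the first partial derivatives and once for V, each time with a factor
  DIM from summing over coordinates.\<close>

lemma second_difference_le:
  fixes w :: "'a::euclidean_space \<Rightarrow> real"
  assumes d1: "\<And>x. (w has_derivative (\<lambda>h. \<Sum>b\<in>Basis. (h \<bullet> b) * w1 b x)) (at x)"
    and d2: "\<And>b x. b \<in> Basis \<Longrightarrow> (w1 b has_derivative (\<lambda>h. \<Sum>c\<in>Basis. (h \<bullet> c) * w2 c b x)) (at x)"
    and B: "\<And>b c x. b \<in> Basis \<Longrightarrow> c \<in> Basis \<Longrightarrow> \<bar>w2 c b x\<bar> \<le> B"
  shows "\<bar>w (x + h) + w (x - h) - 2 * w x\<bar> \<le> (real DIM('a))\<^sup>2 * B * (norm h)\<^sup>2"
proof -
  have 1: "\<bar>w1 b y - w1 b z\<bar> \<le> real DIM('a) * B * norm (y - z)" if b: "b \<in> Basis" for b y z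
  proof -
    have "norm (w1 b y - w1 b z) \<le> real DIM('a) * B * norm (y - z)"
      by (rule differentiable_bound[OF convex_UNIV has_derivative_at_withinI[OF d2[OF b]]])
         (auto intro!: onorm_le sum_Basis_mult_le B b simp: real_norm_def)
    then show ?thesis by simp
  qed
  define V where "V = (\<lambda>y. w (y + h) - w y)"
  have dV: "(V has_derivative (\<lambda>u. \<Sum>b\<in>Basis. (u \<bullet> b) * (w1 b (y + h) - w1 b y))) (at y)" for y
  proof -
    have "((\<lambda>y. w (y + h)) has_derivative (\<lambda>u. \<Sum>b\<in>Basis. (u \<bullet> b) * w1 b (y + h))) (at y)"
      by (rule has_derivative_compose[OF _ d1, of "\<lambda>y. y + h" "\<lambda>u. u", simplified]) (auto intro!: derivative_eq_intros)
    from has_derivative_diff[OF this d1[of y]] show ?thesis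
      unfolding V_def by (simp add: right_diff_distrib sum_subtractf)
  qed
  have "norm (V x - V (x - h)) \<le> real DIM('a) * (real DIM('a) * B * norm h) * norm (x - (x - h))"
    by (rule differentiable_bound[OF convex_UNIV has_derivative_at_withinI[OF dV]])
       (use 1[of _ "y + h" y for y] in \<open>auto intro!: onorm_le sum_Basis_mult_le simp: real_norm_def\<close>)
  then show ?thesis by (simp add: V_def power2_eq_square algebra_simps)
qed

text \<open>A second difference of \<open>W bs t\<close> is bounded both by its size and by its second derivative; the former bound
  is better for \<open>t \<le> (norm h)\<^sup>2\<close> and the latter for larger \<open>t\<close>, and the integral of their minimum over \<open>t\<close> is a
  multiple of \<open>norm h powr zyg_alpha s\<close>.\<close>

lemma
  fixes W :: "'a::euclidean_space list \<Rightarrow> real \<Rightarrow> 'a \<Rightarrow> real"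
  assumes s: "s > 0" and A: "A \<ge> 0"
    and Wm[measurable]: "\<And>bs x. (\<lambda>t. W bs t x) \<in> borel_measurable borel"
    and Wd: "\<And>bs t x. set bs \<subseteq> Basis \<Longrightarrow> (W bs t has_derivative (\<lambda>h. \<Sum>b\<in>Basis. (h \<bullet> b) * W (b # bs) t x)) (at x)"
    and Wb: "\<And>bs t x. set bs \<subseteq> Basis \<Longrightarrow> length bs \<le> zyg_k s + 2 \<Longrightarrow>
      \<bar>W bs t x\<bar> \<le> A * (ppow ((s - real (length bs)) / 2 - 1) t * exp (- t))"
  shows zygmund_mixture: "zygmund s (\<lambda>x. LINT t|lborel. W [] t x)"
    and zyg_norm_mixture: "zyg_norm s (\<lambda>x. LINT t|lborel. W [] t x) \<le>
      ((\<Sum>j\<le>zyg_k s. Gamma ((s - real j) / 2)) + (4 + (real DIM('a))\<^sup>2) * 2 * frac_const (1 - zyg_alpha s / 2)) * A"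
proof -
  define k where "k = zyg_k s"
  define \<alpha> where "\<alpha> = zyg_alpha s"
  define \<omega> where "\<omega> = (\<lambda>(j::nat) t. ppow ((s - real j) / 2 - 1) t * exp (- t))"
  define F where "F = (\<lambda>bs x. LINT t|lborel. W bs t x)"
  have ks: "real k < s" and \<alpha>: "0 < \<alpha>" "\<alpha> \<le> 1" and sk: "s = real k + \<alpha>"
    using zyg_k_alpha[OF s] by (auto simp: k_def \<alpha>_def zyg_alpha_def)
  \<comment> \<open>Orders k + 1 and k + 2 are included although their weights are not integrable at
    t = 0; the second of them is used at a fixed t only.\<close>
  have Wb': "\<bar>W bs t x\<bar> \<le> A * \<omega> (length bs) t" if "set bs \<subseteq> Basis" "length bs \<le> k + 2" for bs t x
    using Wb[OF that[unfolded k_def]] by (simp add: \<omega>_def)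
  have \<omega>i: "integrable lborel (\<omega> j)" and \<omega>I: "(LINT t|lborel. \<omega> j t) = Gamma ((s - real j) / 2)" if "j \<le> k" for j
    using integrable_gamma[of "(s - real j) / 2" 1] integral_gamma[of "(s - real j) / 2" 1] ks that by (auto simp: \<omega>_def)
  have Wi: "integrable lborel (\<lambda>t. W bs t x)" if "set bs \<subseteq> Basis" "length bs \<le> k" for bs x
    by (rule Bochner_Integration.integrable_bound[OF integrable_mult_right[OF \<omega>i[OF that(2)], of A]])
       (use Wb'[OF that(1), of _ x] that in \<open>auto intro!: AE_I2 intro: order_trans[OF _ abs_ge_self]\<close>)
  have Fle: "\<bar>F bs x\<bar> \<le> A * Gamma ((s - real (length bs)) / 2)" if "set bs \<subseteq> Basis" "length bs \<le> k" for bs x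
  proof -
    have "norm (F bs x) \<le> (LINT t|lborel. A * \<omega> (length bs) t)"
      unfolding F_def by (rule order_trans[OF integral_norm_bound integral_mono])
         (use Wb'[OF that(1), of _ x] that \<omega>i Wi in \<open>auto intro!: integrable_mult_right\<close>)
    then show ?thesis using \<omega>I[OF that(2)] by simp
  qed
  have Fd: "(F bs has_derivative (\<lambda>h. \<Sum>b\<in>Basis. (h \<bullet> b) * F (b # bs) x)) (at x)" if bs: "set bs \<subseteq> Basis" "length bs < k" for bs x
  proof -
    have "((\<lambda>x. LINT t|lborel. W bs t x) has_derivative (\<lambda>h. LINT t|lborel. (\<Sum>b\<in>Basis. (h \<bullet> b) * W (b # bs) t x))) (at x)"
    proof (rule has_derivative_integral[where D="\<lambda>t x h. \<Sum>b\<in>Basis. (h \<bullet> b) * W (b # bs) t x" and G="\<lambda>t. real DIM('a) * (A * \<omega> (Suc (length bs)) t)" and \<delta>=1])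
      show "integrable lborel (\<lambda>t. W bs t x)" for x using bs by (intro Wi) auto
      show "integrable lborel (\<lambda>t. real DIM('a) * (A * \<omega> (Suc (length bs)) t))"
        using bs by (intro integrable_mult_right \<omega>i) auto
      show "\<bar>\<Sum>b\<in>Basis. (h \<bullet> b) * W (b # bs) t x\<bar> \<le> real DIM('a) * (A * \<omega> (Suc (length bs)) t) * norm h" for t x and h :: 'a
        by (rule sum_Basis_mult_le) (use Wb'[of "b # bs" t x for b] bs in auto)
    qed (use Wd[OF bs(1)] in auto)
    moreover have "(LINT t|lborel. (\<Sum>b\<in>Basis. (h \<bullet> b) * W (b # bs) t x)) = (\<Sum>b\<in>Basis. (h \<bullet> b) * F (b # bs) x)" for h
      unfolding F_def using bs Wi[of "b # bs" x for b] by (subst Bochner_Integration.integral_sum) auto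
    ultimately show ?thesis by (simp add: F_def)
  qed
  have it: "iter_pdiff bs (F []) = F bs" if "set bs \<subseteq> Basis" "length bs \<le> k" for bs
    using that
  proof (induction bs)
    case (Cons b bs)
    have "pdiff b (F bs) x = F (b # bs) x" for x
    proof -
      have "pdiff b (F bs) x = (\<Sum>c\<in>Basis. (b \<bullet> c) * F (c # bs) x)"
        unfolding pdiff_def using frechet_derivative_at[OF Fd[of bs x]] Cons.prems by (auto simp: fun_eq_iff)
      also have "\<dots> = (\<Sum>c\<in>Basis. if c = b then F (c # bs) x else 0)"
        using Cons.prems by (intro sum.cong) (auto simp: inner_Basis)
      finally show ?thesis using Cons.prems by simp
    qed
    then have "pdiff b (F bs) = F (b # bs)" by blast
    then show ?case using Cons by simp
  qed simp
  have cont: "continuous_on UNIV (F bs)" if bs: "set bs \<subseteq> Basis" "length bs \<le> k" for bs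
    unfolding F_def
  proof (rule continuous_on_integral_dominated[where G="\<lambda>t. A * \<omega> (length bs) t"])
    show "continuous_on UNIV (W bs t)" for t
      using Wd[OF bs(1)] by (intro continuous_at_imp_continuous_on ballI has_derivative_continuous) blast
    show "integrable lborel (\<lambda>t. A * \<omega> (length bs) t)" using \<omega>i[OF bs(2)] by simp
    show "\<bar>W bs t x\<bar> \<le> A * \<omega> (length bs) t" for t x using Wb'[OF bs(1)] bs by simp
  qed simp
  \<comment> \<open>4 is the sum of the coefficients 1, 1, 2 of the second difference, DIM^2 comes
    from second derivatives, 2 from \<open>min_one_le_exp\<close>, and \<open>frac_const\<close>
    from the integral over t.\<close>
  define c0 where "c0 = (4 + (real DIM('a))\<^sup>2) * 2 * frac_const (1 - \<alpha> / 2)"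
  have z2: "zyg_diff2 s (F []) bs x h \<le> c0 * A" if bs: "bs \<in> multi_idx k" and h: "h \<noteq> 0" for bs x h
  proof -
    have b: "set bs \<subseteq> Basis" "length bs = k" using bs by (auto simp: multi_idx_def)
    define c where "c = (norm h)\<^sup>2"
    have c: "c > 0" using h by (simp add: c_def)
    define B where "B = (4 + (real DIM('a))\<^sup>2) * A * (2 * c)"
    have s': "0 < 1 - \<alpha> / 2" "1 - \<alpha> / 2 < 1" using \<alpha> by auto
    \<comment> \<open>The exponent is \<alpha>/2 - 2, that of the weight of order k + 2, and the
      scale c = |h|^2 makes the integral produce c^(\<alpha>/2) = |h|^\<alpha>.\<close>
    let ?g = "\<lambda>t. ppow (- 1 - (1 - \<alpha> / 2)) t * (1 - exp (- (1 / c * t)))"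
    let ?d = "\<lambda>t. W bs t (x + h) + W bs t (x - h) - 2 * W bs t x"
    have gi: "integrable lborel ?g" and gI: "(LINT t|lborel. ?g t) = frac_const (1 - \<alpha> / 2) * (1 / c) powr (1 - \<alpha> / 2)"
      using integrable_frac[OF s', of "1 / c"] integral_frac[OF s', of "1 / c"] c by auto
    have le: "norm (?d t) \<le> B * ?g t" for t
    proof (cases "t > 0")
      case False
      then have "W bs t y = 0" for y using Wb'[OF b(1), of t y] b(2) by (simp add: \<omega>_def ppow_def)
      then show ?thesis using False by (simp add: ppow_def)
    next
      case True
      \<comment> \<open>The weights of order k and k + 2 are at most v t and v, so the two bounds
        for the second difference combine to a multiple of A v times the minimum of t and
        |h|^2.\<close>
      define v where "v = t powr (\<alpha> / 2 - 2)"
      have v: "v > 0" using True by (simp add: v_def)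
      have "\<alpha> / 2 - 1 = (\<alpha> / 2 - 2) + 1" by simp
      then have vt: "t powr (\<alpha> / 2 - 1) = v * t" unfolding v_def using True by (simp only: powr_add powr_one)
      have e: "exp (- t) \<le> 1" using True by simp
      have w0: "\<omega> k t \<le> v * t"
        using True e v vt mult_left_mono[OF e, of "v * t"] by (simp add: \<omega>_def ppow_def sk)
      have w2: "\<omega> (k + 2) t \<le> v"
      proof -
        have "(s - real (k + 2)) / 2 - 1 = \<alpha> / 2 - 2" by (simp add: sk field_simps)
        then have "\<omega> (k + 2) t = v * exp (- t)" using True by (simp only: \<omega>_def ppow_def v_def if_True)
        then show ?thesis using v mult_left_mono[OF e, of v] by simp
      qed
      have "\<bar>W bs t y\<bar> \<le> A * (v * t)" for y
        using Wb'[OF b(1), of t y] b(2) mult_left_mono[OF w0 A] by simp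
      from this[of "x + h"] this[of "x - h"] this[of x] have d0: "\<bar>?d t\<bar> \<le> 4 * (A * (v * t))" by linarith
      have "\<bar>?d t\<bar> \<le> (real DIM('a))\<^sup>2 * (A * v) * (norm h)\<^sup>2"
      proof (rule second_difference_le[where ?w1.0="\<lambda>b. W (b # bs) t" and ?w2.0="\<lambda>c b. W (c # b # bs) t"])
        show "\<bar>W (c # d # bs) t y\<bar> \<le> A * v" if "d \<in> Basis" "c \<in> Basis" for c d y
          using Wb'[of "c # d # bs" t y] b that mult_left_mono[OF w2 A] by simp
      qed (use Wd b in auto)
      then have d2: "\<bar>?d t\<bar> \<le> (real DIM('a))\<^sup>2 * (A * (v * c))" by (simp add: c_def mult_ac)
      have "\<bar>?d t\<bar> \<le> (4 + (real DIM('a))\<^sup>2) * (A * (v * min t c))"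
      proof (cases "t \<le> c")
        case True
        have "0 \<le> (real DIM('a))\<^sup>2 * (A * (v * t))" using A v \<open>t > 0\<close> by simp
        then show ?thesis unfolding min_absorb1[OF True] distrib_right using d0 by linarith
      next
        case False
        have "0 \<le> 4 * (A * (v * c))" using A v c by simp
        moreover have "min t c = c" using False by simp
        ultimately show ?thesis unfolding distrib_right using d2 by (simp only:)
      qed
      also have "min t c = c * min (t / c) 1" using c by (auto simp: min_def field_simps)
      also have "(4 + (real DIM('a))\<^sup>2) * (A * (v * (c * min (t / c) 1))) \<le> (4 + (real DIM('a))\<^sup>2) * (A * (v * (c * (2 * (1 - exp (- (t / c)))))))"
        using min_one_le_exp[of "t / c"] A v c True by (intro mult_left_mono) auto
      also have "\<dots> = B * ?g t"
      proof -
        have "ppow (- 1 - (1 - \<alpha> / 2)) t = v" "1 / c * t = t / c" using True by (simp_all add: ppow_def v_def)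
        then show ?thesis unfolding B_def by (simp only: mult_ac)
      qed
      finally show ?thesis by simp
    qed
    have Wib: "integrable lborel (\<lambda>t. W bs t y)" for y using b by (intro Wi) auto
    have "\<bar>F bs (x + h) + F bs (x - h) - 2 * F bs x\<bar> = norm (LINT t|lborel. ?d t)"
      unfolding F_def using Wib by simp
    also have "\<dots> \<le> (LINT t|lborel. B * ?g t)"
      by (rule order_trans[OF integral_norm_bound integral_mono]) (use le Wib gi in \<open>auto intro!: integrable_mult_right\<close>)
    also have "\<dots> = B * (frac_const (1 - \<alpha> / 2) * (1 / c) powr (1 - \<alpha> / 2))" using gI by simp
    also have "\<dots> = c0 * A * (c * (1 / c) powr (1 - \<alpha> / 2))" by (simp add: B_def c0_def mult_ac)
    also have "c * (1 / c) powr (1 - \<alpha> / 2) = norm h powr \<alpha>"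
    proof -
      have "(1 / c) powr (1 - \<alpha> / 2) = c powr (\<alpha> / 2 - 1)" using c by (simp add: powr_divide powr_minus_divide[symmetric])
      then have "c * (1 / c) powr (1 - \<alpha> / 2) = c powr 1 * c powr (\<alpha> / 2 - 1)" using c by simp
      also have "\<dots> = c powr (\<alpha> / 2)" by (simp only: powr_add[symmetric]) simp
      also have "\<dots> = norm h powr \<alpha>" using h by (simp add: c_def powr_powr flip: powr_numeral)
      finally show ?thesis .
    qed
    finally show ?thesis
      unfolding zyg_diff2_def \<alpha>_def[symmetric] using it[OF b(1)] b(2) h by (simp add: divide_le_eq)
  qed
  have F0: "F [] = (\<lambda>x. LINT t|lborel. W [] t x)" by (simp add: F_def)
  have "zygmund s (F [])" unfolding zygmund_def k_def[symmetric]
  proof (intro conjI allI impI)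
    fix bs :: "'a list"
    show "iter_pdiff bs (F []) differentiable at x" if "length bs < k" "set bs \<subseteq> Basis" for x
      using Fd[OF that(2,1), of x] it[of bs] that by (auto simp: differentiable_def)
    assume bs: "length bs \<le> k" "set bs \<subseteq> Basis"
    show "continuous_on UNIV (iter_pdiff bs (F []))" using it[of bs] cont[of bs] bs by simp
    show "bounded (range (iter_pdiff bs (F [])))" using it[of bs] bs Fle[of bs] by (auto simp: bounded_iff)
  next
    show "bdd_above {zyg_diff2 s (F []) bs x h |bs x h. bs \<in> multi_idx k \<and> h \<noteq> 0}"
      using z2 by (auto intro!: bdd_aboveI[of _ "c0 * A"])
  qed
  then show "zygmund s (\<lambda>x. LINT t|lborel. W [] t x)" by (simp add: F0)
  obtain b0 :: 'a where b0: "b0 \<in> Basis" using nonempty_Basis by blast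
  have mi: "replicate j b0 \<in> multi_idx j" for j using b0 by (auto simp: multi_idx_def)
  have "(\<Sum>j\<le>k. Sup {\<bar>iter_pdiff bs (F []) x\<bar> |bs x. bs \<in> multi_idx j}) \<le> (\<Sum>j\<le>k. Gamma ((s - real j) / 2) * A)"
  proof (rule sum_mono, rule cSup_least)
    fix j assume "j \<in> {..k}"
    show "{\<bar>iter_pdiff bs (F []) x\<bar> |bs x. bs \<in> multi_idx j} \<noteq> {}" using mi by blast
    fix y assume "y \<in> {\<bar>iter_pdiff bs (F []) x\<bar> |bs x. bs \<in> multi_idx j}"
    then obtain bs x where "y = \<bar>iter_pdiff bs (F []) x\<bar>" "bs \<in> multi_idx j" by blast
    then show "y \<le> Gamma ((s - real j) / 2) * A" using it[of bs] Fle[of bs x] \<open>j \<in> {..k}\<close> by (auto simp: multi_idx_def mult.commute)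
  qed
  moreover have "Sup {zyg_diff2 s (F []) bs x h |bs x h. bs \<in> multi_idx k \<and> h \<noteq> 0} \<le> c0 * A"
  proof (rule cSup_least)
    show "{zyg_diff2 s (F []) bs x h |bs x h. bs \<in> multi_idx k \<and> h \<noteq> 0} \<noteq> {}" using mi[of k] b0 nonzero_Basis by blast
  qed (use z2 in blast)
  ultimately have "zyg_norm s (F []) \<le> ((\<Sum>j\<le>k. Gamma ((s - real j) / 2)) + c0) * A"
    unfolding zyg_norm_def k_def[symmetric] by (simp add: distrib_right sum_distrib_right)
  then show "zyg_norm s (\<lambda>x. LINT t|lborel. W [] t x) \<le>
      ((\<Sum>j\<le>zyg_k s. Gamma ((s - real j) / 2)) + (4 + (real DIM('a))\<^sup>2) * 2 * frac_const (1 - zyg_alpha s / 2)) * A"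
    by (simp add: F0 c0_def k_def \<alpha>_def)
qed

lemma
  fixes g K :: "'a::euclidean_space \<Rightarrow> real"
  assumes p: "p > 1" and g: "Lp_fun p g" and K: "integrable lborel K" and S: "\<And>v. \<bar>K v\<bar> \<le> S"
  shows integrable_bounded_kernel: "integrable lborel (\<lambda>v. K v * g v)"
    and bounded_kernel_le: "\<bar>LINT v|lborel. K v * g v\<bar> \<le> (LINT v|lborel. \<bar>K v\<bar>) powr (1 - 1 / p) * S powr (1 / p) * np p g powr (1 / p)"
proof -
  have [measurable]: "g \<in> borel_measurable borel" "K \<in> borel_measurable borel" using g K by (auto simp: Lp_fun_def)
  have S0: "S \<ge> 0" using order_trans[OF abs_ge_zero S[of 0]] .
  have gi: "integrable lborel (\<lambda>v. \<bar>g v\<bar> powr p)" using g by (simp add: Lp_fun_def)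
  have i: "integrable lborel (\<lambda>v. \<bar>K v\<bar> * \<bar>g v\<bar> powr p)"
    by (rule Bochner_Integration.integrable_bound[OF integrable_mult_right[OF gi, of S]])
       (use S S0 in \<open>auto intro!: AE_I2 simp: abs_mult mult_right_mono\<close>)
  have i1: "integrable lborel (\<lambda>v. \<bar>K v\<bar> * \<bar>g v\<bar>)"
    by (rule jensen_integrable[OF p integrable_abs[OF K] _ _ _ i]) auto
  then show Kg: "integrable lborel (\<lambda>v. K v * g v)"
    by (rule Bochner_Integration.integrable_bound) (auto simp: abs_mult)
  define a where "a = (LINT v|lborel. \<bar>K v\<bar> * \<bar>g v\<bar>)"
  define I where "I = (LINT v|lborel. \<bar>K v\<bar>)"
  have a0: "a \<ge> 0" and I0: "I \<ge> 0" by (auto simp: a_def I_def)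
  have "(LINT v|lborel. \<bar>K v\<bar> * \<bar>g v\<bar> powr p) \<le> (LINT v|lborel. S * \<bar>g v\<bar> powr p)"
    using S i gi by (intro integral_mono) (auto intro!: integrable_mult_right mult_right_mono)
  then have "(LINT v|lborel. \<bar>K v\<bar> * \<bar>g v\<bar> powr p) \<le> S * np p g" by (simp add: np_def)
  then have "a powr p \<le> I powr (p - 1) * (S * np p g)"
    using order_trans[OF jensen_powr[OF p integrable_abs[OF K] _ _ _ i] mult_left_mono] by (simp add: a_def I_def)
  then have "(a powr p) powr (1 / p) \<le> (I powr (p - 1) * (S * np p g)) powr (1 / p)"
    using p by (intro powr_mono2) auto
  also have "(a powr p) powr (1 / p) = a" using a0 p by (simp add: powr_powr)
  also have "(I powr (p - 1) * (S * np p g)) powr (1 / p) = I powr (1 - 1 / p) * S powr (1 / p) * np p g powr (1 / p)"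
    using S0 np_nonneg[of p g] p by (simp add: powr_mult powr_powr diff_divide_distrib)
  finally have "a \<le> I powr (1 - 1 / p) * S powr (1 / p) * np p g powr (1 / p)" .
  moreover have "\<bar>LINT v|lborel. K v * g v\<bar> \<le> a"
    unfolding a_def using integral_norm_bound[of lborel "\<lambda>v. K v * g v"] by (simp add: abs_mult)
  ultimately show "\<bar>LINT v|lborel. K v * g v\<bar> \<le> (LINT v|lborel. \<bar>K v\<bar>) powr (1 - 1 / p) * S powr (1 / p) * np p g powr (1 / p)"
    by (simp add: I_def)
qed

section \<open>Scaled Gaussian kernels acting on L_p\<close>

lemma poly_gauss_continuous: "poly_gauss \<kappa> a f \<Longrightarrow> continuous_on UNIV f"
  by (meson poly_gauss_differentiable differentiable_imp_continuous_within continuous_at_imp_continuous_on)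

lemma poly_gauss_measurable: "poly_gauss \<kappa> a f \<Longrightarrow> f \<in> borel_measurable borel"
  by (rule borel_measurable_continuous_onI[OF poly_gauss_continuous])

lemma poly_gauss_le:
  assumes "poly_gauss \<kappa> a (f :: 'a::euclidean_space \<Rightarrow> real)" "\<kappa> > 0"
  obtains C where "C \<ge> 0" "\<And>x. \<bar>f x\<bar> \<le> C * (1 / (1 + norm x) ^ (2 * DIM('a)))"
proof -
  obtain C where C: "\<And>x. (1 + norm x) ^ (2 * DIM('a)) * \<bar>f x\<bar> \<le> C" using poly_gauss_decay[OF assms] by blast
  have "C \<ge> 0" using order_trans[OF _ C[of 0]] by simp
  moreover have "\<bar>f x\<bar> \<le> C * (1 / (1 + norm x) ^ (2 * DIM('a)))" for x
  proof -
    have "(1 + norm x) ^ (2 * DIM('a)) > 0" by (intro zero_less_power add_pos_nonneg) auto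
    then show ?thesis using C[of x] by (simp add: field_simps)
  qed
  ultimately show ?thesis by (rule that)
qed

lemma inverse_1_plus_norm_le_1: "1 / (1 + norm (x::'a::real_normed_vector)) ^ n \<le> 1"
proof -
  have "1 \<le> (1 + norm x) ^ n" by (intro one_le_power) simp
  then show ?thesis by (simp add: divide_le_eq)
qed

lemma poly_gauss_integrable:
  fixes f :: "'a::euclidean_space \<Rightarrow> real"
  assumes "poly_gauss \<kappa> a f" "\<kappa> > 0" shows "integrable lborel f"
proof -
  obtain C where C: "C \<ge> 0" "\<And>x. \<bar>f x\<bar> \<le> C * (1 / (1 + norm x) ^ (2 * DIM('a)))" using poly_gauss_le[OF assms] by blast
  show ?thesis
    by (rule Bochner_Integration.integrable_bound[OF integrable_mult_right[OF integrable_inverse_1_plus_norm, of C]])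
       (use C poly_gauss_measurable[OF assms(1)] in \<open>auto intro!: AE_I2 order_trans[OF C(2)]\<close>)
qed

text \<open>Scaling leaves the supremum unchanged and divides the L_1 norm by r^DIM; raised to 1 -
  1/p this is the stated exponent.\<close>

lemma scaled_kernel_bound:
  fixes \<psi> :: "'a::euclidean_space \<Rightarrow> real"
  assumes p: "p > 1" and \<psi>: "poly_gauss \<kappa> a \<psi>" "\<kappa> > 0"
  shows "\<exists>C\<ge>0. \<forall>r>0. \<forall>x g. Lp_fun p g \<longrightarrow> integrable lborel (\<lambda>v. \<psi> (r *\<^sub>R (x - v)) * g v) \<and>
    \<bar>LINT v|lborel. \<psi> (r *\<^sub>R (x - v)) * g v\<bar> \<le> C * r powr (real DIM('a) / p - real DIM('a)) * np p g powr (1 / p)"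
proof -
  have i: "integrable lborel \<psi>" by (rule poly_gauss_integrable[OF \<psi>])
  have [measurable]: "\<psi> \<in> borel_measurable borel" by (rule poly_gauss_measurable[OF \<psi>(1)])
  obtain S where S: "S \<ge> 0" "\<And>x. \<bar>\<psi> x\<bar> \<le> S * (1 / (1 + norm x) ^ (2 * DIM('a)))" using poly_gauss_le[OF \<psi>] by blast
  have S1: "\<bar>\<psi> x\<bar> \<le> S" for x
    using S(2)[of x] mult_left_mono[OF inverse_1_plus_norm_le_1[of x "2 * DIM('a)"] S(1)] by simp
  define I where "I = (LINT v|lborel. \<bar>\<psi> v\<bar>)"
  have I: "I \<ge> 0" by (simp add: I_def)
  show ?thesis
  proof (intro exI[of _ "I powr (1 - 1 / p) * S powr (1 / p)"] conjI allI impI)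
    fix r :: real and x :: 'a and g :: "'a \<Rightarrow> real" assume r: "r > 0" and g: "Lp_fun p g"
    have eq: "r *\<^sub>R (x - v) = (- r) *\<^sub>R v + r *\<^sub>R x" for v by (simp add: algebra_simps)
    have Ki: "integrable lborel (\<lambda>v. \<psi> (r *\<^sub>R (x - v)))"
      unfolding eq using i r by (subst integrable_affine_iff) auto
    show "integrable lborel (\<lambda>v. \<psi> (r *\<^sub>R (x - v)) * g v)"
      by (rule integrable_bounded_kernel[OF p g Ki S1])
    have "(LINT v|lborel. \<bar>\<psi> (r *\<^sub>R (x - v))\<bar>) = I / r ^ DIM('a)"
      unfolding eq using integral_affine[of "- r" "\<lambda>z. \<bar>\<psi> z\<bar>" "r *\<^sub>R x"] r by (simp add: I_def)
    then have "(LINT v|lborel. \<bar>\<psi> (r *\<^sub>R (x - v))\<bar>) powr (1 - 1 / p) = I powr (1 - 1 / p) * (r powr (- real DIM('a))) powr (1 - 1 / p)"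
      using r I by (simp add: powr_minus powr_realpow divide_inverse powr_mult)
    also have "(r powr (- real DIM('a))) powr (1 - 1 / p) = r powr (real DIM('a) / p - real DIM('a))"
      by (simp add: powr_powr algebra_simps)
    finally show "\<bar>LINT v|lborel. \<psi> (r *\<^sub>R (x - v)) * g v\<bar> \<le> I powr (1 - 1 / p) * S powr (1 / p) * r powr (real DIM('a) / p - real DIM('a)) * np p g powr (1 / p)"
      using bounded_kernel_le[OF p g Ki S1] by (simp add: mult_ac)
  qed simp
qed

lemma poly_gauss_has_derivative_Basis:
  assumes "poly_gauss \<kappa> a f"
  shows "(f has_derivative (\<lambda>h. \<Sum>b\<in>Basis. (h \<bullet> b) * pdiff b f x)) (at x)"
proof -
  have d: "(f has_derivative (\<lambda>h. pdiff h f x)) (at x)" by (rule poly_gauss_has_derivative[OF assms])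
  have "pdiff h f x = (\<Sum>b\<in>Basis. (h \<bullet> b) * pdiff b f x)" for h
    using Linear_Algebra.linear_componentwise[OF has_derivative_linear[OF d], of h 1] by simp
  then have "(\<lambda>h. pdiff h f x) = (\<lambda>h. \<Sum>b\<in>Basis. (h \<bullet> b) * pdiff b f x)" by blast
  then show ?thesis using d by (simp only:)
qed

text \<open>Differentiation under the integral. The derivatives of the kernel decay rapidly enough
  for a majorant that is independent of the point in the unit ball around x, and each derivative
  releases one factor r.\<close>

lemma scaled_kernel_derivative:
  fixes \<psi> :: "'a::euclidean_space \<Rightarrow> real"
  assumes p: "p > 1" and \<psi>: "poly_gauss \<kappa> a \<psi>" "\<kappa> > 0" and r: "r > 0" and g: "Lp_fun p g"
  shows "((\<lambda>x. LINT v|lborel. \<psi> (r *\<^sub>R (x - v)) * g v) has_derivative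
    (\<lambda>h. \<Sum>b\<in>Basis. (h \<bullet> b) * (r * (LINT v|lborel. pdiff b \<psi> (r *\<^sub>R (x - v)) * g v)))) (at x)"
proof -
  have [measurable]: "g \<in> borel_measurable borel" using g by (simp add: Lp_fun_def)
  have [measurable]: "pdiff b \<psi> \<in> borel_measurable borel" for b by (rule poly_gauss_measurable[OF poly_gauss_pdiff[OF \<psi>(1)]])
  let ?N = "2 * DIM('a)"
  have "\<exists>C. C \<ge> 0 \<and> (\<forall>y. \<bar>pdiff b \<psi> y\<bar> \<le> C * (1 / (1 + norm y) ^ ?N))" for b
    using poly_gauss_le[OF poly_gauss_pdiff[OF \<psi>(1)] \<psi>(2)] by metis
  then obtain C where C: "\<And>b. C b \<ge> 0" "\<And>b y. \<bar>pdiff b \<psi> y\<bar> \<le> C b * (1 / (1 + norm y) ^ ?N)" by metis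
  define B where "B = (\<Sum>b\<in>Basis. C b)"
  have B: "B \<ge> 0" using C(1) by (simp add: B_def sum_nonneg)
  have CB: "C b \<le> B" if "b \<in> Basis" for b unfolding B_def using C(1) that by (intro member_le_sum) auto
  define E where "E = (\<lambda>v. 1 / (1 + norm (r *\<^sub>R (x - v))) ^ ?N * \<bar>g v\<bar>)"
  have int: "integrable lborel (\<lambda>v. \<phi> (r *\<^sub>R (y - v)) * g v)" if "poly_gauss \<kappa> a \<phi>" for \<phi> and y :: 'a
    using scaled_kernel_bound[OF p that \<psi>(2)] r g by blast
  have "((\<lambda>x. LINT v|lborel. \<psi> (r *\<^sub>R (x - v)) * g v) has_derivative
      (\<lambda>h. LINT v|lborel. (\<Sum>b\<in>Basis. (h \<bullet> b) * (r * (pdiff b \<psi> (r *\<^sub>R (x - v)) * g v))))) (at x)"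
  proof (rule has_derivative_integral[where \<delta>=1 and D="\<lambda>v x h. \<Sum>b\<in>Basis. (h \<bullet> b) * (r * (pdiff b \<psi> (r *\<^sub>R (x - v)) * g v))"
        and G="\<lambda>v. real DIM('a) * (r * (B * (1 + r) ^ ?N * E v))"])
    show "integrable lborel (\<lambda>v. \<psi> (r *\<^sub>R (x - v)) * g v)" for x by (rule int[OF \<psi>(1)])
    show "((\<lambda>x. \<psi> (r *\<^sub>R (x - v)) * g v) has_derivative (\<lambda>h. \<Sum>b\<in>Basis. (h \<bullet> b) * (r * (pdiff b \<psi> (r *\<^sub>R (y - v)) * g v)))) (at y)" for v y
    proof -
      have "((\<lambda>x. r *\<^sub>R (x - v)) has_derivative (\<lambda>h. r *\<^sub>R h)) (at y)" by (auto intro!: derivative_eq_intros)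
      from has_derivative_mult_left[OF has_derivative_compose[OF this poly_gauss_has_derivative_Basis[OF \<psi>(1)]], of "g v"]
      show ?thesis by (simp add: sum_distrib_right sum_distrib_left mult_ac)
    qed
    have "integrable lborel (\<lambda>v. 1 / (1 + norm (r *\<^sub>R (x - v))) ^ ?N * g v)"
    proof (rule integrable_bounded_kernel[OF p g])
      have eq: "r *\<^sub>R (x - v) = (- r) *\<^sub>R v + r *\<^sub>R x" for v by (simp add: algebra_simps)
      show "integrable lborel (\<lambda>v. 1 / (1 + norm (r *\<^sub>R (x - v))) ^ ?N)"
        unfolding eq using integrable_inverse_1_plus_norm[where 'a='a] r
        by (subst integrable_affine_iff[where f="\<lambda>z. 1 / (1 + norm z) ^ ?N"]) auto
      show "\<bar>1 / (1 + norm (r *\<^sub>R (x - v))) ^ ?N\<bar> \<le> 1" for v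
        using inverse_1_plus_norm_le_1[of "r *\<^sub>R (x - v)" ?N] by simp
    qed
    from integrable_abs[OF this] have "integrable lborel E" by (simp add: E_def abs_mult)
    then show "integrable lborel (\<lambda>v. real DIM('a) * (r * (B * (1 + r) ^ ?N * E v)))" by simp
    fix v y h assume y: "y \<in> ball x 1"
    show "\<bar>\<Sum>b\<in>Basis. (h \<bullet> b) * (r * (pdiff b \<psi> (r *\<^sub>R (y - v)) * g v))\<bar> \<le> real DIM('a) * (r * (B * (1 + r) ^ ?N * E v)) * norm h"
    proof (rule sum_Basis_mult_le)
      fix b :: 'a assume b: "b \<in> Basis"
      have "norm (x - v) \<le> 1 + norm (y - v)"
        using y norm_triangle_ineq[of "x - y" "y - v"] by (simp add: dist_norm)
      then have "r * norm (x - v) \<le> r * (1 + norm (y - v))" using r by (intro mult_left_mono) auto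
      moreover have "0 \<le> r * (r * norm (y - v))" using r by simp
      \<comment> \<open>Moving the centre from x to a point y within distance 1 changes the weight
        by at most the factor 1 + r, so the decay may be measured from x.\<close>
      ultimately have le: "1 + norm (r *\<^sub>R (x - v)) \<le> (1 + r) * (1 + norm (r *\<^sub>R (y - v)))"
        unfolding norm_scaleR abs_of_pos[OF r] distrib_left distrib_right mult_1_left mult_1_right by linarith
      have pos: "1 + norm (r *\<^sub>R (x - v)) > 0" "1 + norm (r *\<^sub>R (y - v)) > 0" by (auto intro: add_pos_nonneg)
      have "(1 + norm (r *\<^sub>R (x - v))) ^ ?N \<le> (1 + r) ^ ?N * (1 + norm (r *\<^sub>R (y - v))) ^ ?N"
        unfolding power_mult_distrib[symmetric] using le by (intro power_mono) auto
      then have dom: "1 / (1 + norm (r *\<^sub>R (y - v))) ^ ?N \<le> (1 + r) ^ ?N * (1 / (1 + norm (r *\<^sub>R (x - v))) ^ ?N)"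
        using zero_less_power[OF pos(1), of ?N] zero_less_power[OF pos(2), of ?N] by (simp add: divide_simps mult_ac)
      have "\<bar>pdiff b \<psi> (r *\<^sub>R (y - v))\<bar> \<le> C b * (1 / (1 + norm (r *\<^sub>R (y - v))) ^ ?N)" by (rule C(2))
      also have "\<dots> \<le> B * ((1 + r) ^ ?N * (1 / (1 + norm (r *\<^sub>R (x - v))) ^ ?N))"
        using CB[OF b] dom B by (intro mult_mono) auto
      finally have "\<bar>pdiff b \<psi> (r *\<^sub>R (y - v))\<bar> * \<bar>g v\<bar> \<le> B * ((1 + r) ^ ?N * (1 / (1 + norm (r *\<^sub>R (x - v))) ^ ?N)) * \<bar>g v\<bar>"
        by (intro mult_right_mono) auto
      then have "r * (\<bar>pdiff b \<psi> (r *\<^sub>R (y - v))\<bar> * \<bar>g v\<bar>) \<le> r * (B * (1 + r) ^ ?N * E v)"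
        unfolding E_def using r by (intro mult_left_mono) (auto simp only: mult.assoc)
      then show "\<bar>r * (pdiff b \<psi> (r *\<^sub>R (y - v)) * g v)\<bar> \<le> r * (B * (1 + r) ^ ?N * E v)"
        using r by (simp add: abs_mult)
    qed
  qed simp_all
  moreover have "(LINT v|lborel. (\<Sum>b\<in>Basis. (h \<bullet> b) * (r * (pdiff b \<psi> (r *\<^sub>R (x - v)) * g v)))) =
      (\<Sum>b\<in>Basis. (h \<bullet> b) * (r * (LINT v|lborel. pdiff b \<psi> (r *\<^sub>R (x - v)) * g v)))" for h
    using int[OF poly_gauss_pdiff[OF \<psi>(1)]] by (subst Bochner_Integration.integral_sum) auto
  ultimately show ?thesis by simp
qed

text \<open>One slice of the Gamma integral for the Bessel potential: the derivative
  \<open>bs\<close> of the heat semigroup with symbol exp (- t |\<xi>|^2), applied to g. The power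
  of sqrt (pi / t) combines the normalisation of the kernel with one factor for each
  derivative.\<close>

definition heat_layer :: "real \<Rightarrow> ('a::euclidean_space \<Rightarrow> real) \<Rightarrow> 'a list \<Rightarrow> real \<Rightarrow> 'a \<Rightarrow> real" where
  "heat_layer \<gamma> g bs t x = ppow (\<gamma> / 2 - 1) t * exp (- t) / Gamma (\<gamma> / 2) * sqrt (pi / t) ^ (DIM('a) + length bs)
     * (LINT v|lborel. iter_pdiff bs gauss (sqrt (pi / t) *\<^sub>R (x - v)) * g v)"

lemma heat_layer_measurable:
  fixes g :: "'a::euclidean_space \<Rightarrow> real"
  assumes [measurable]: "g \<in> borel_measurable borel"
  shows "(\<lambda>t. heat_layer \<gamma> g bs t x) \<in> borel_measurable borel"
proof -
  have [measurable]: "iter_pdiff bs (gauss :: 'a \<Rightarrow> real) \<in> borel_measurable borel"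
    by (rule poly_gauss_measurable[OF poly_gauss_iter_pdiff[OF poly_gauss_gauss]])
  show ?thesis unfolding heat_layer_def by measurable
qed

lemma heat_layer_derivative:
  fixes g :: "'a::euclidean_space \<Rightarrow> real"
  assumes p: "p > 1" and g: "Lp_fun p g"
  shows "(heat_layer \<gamma> g bs t has_derivative (\<lambda>h. \<Sum>b\<in>Basis. (h \<bullet> b) * heat_layer \<gamma> g (b # bs) t x)) (at x)"
proof (cases "t > 0")
  case True
  define r where "r = sqrt (pi / t)"
  have r: "r > 0" using True by (simp add: r_def)
  have "poly_gauss pi 0 (iter_pdiff bs (gauss :: 'a \<Rightarrow> real))" by (rule poly_gauss_iter_pdiff[OF poly_gauss_gauss])
  from has_derivative_mult_right[OF scaled_kernel_derivative[OF p this pi_gt_zero r g], of "ppow (\<gamma> / 2 - 1) t * exp (- t) / Gamma (\<gamma> / 2) * r ^ (DIM('a) + length bs)"]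
  show ?thesis unfolding heat_layer_def[abs_def] r_def[symmetric] by (simp add: sum_distrib_left sum_divide_distrib mult_ac)
qed (simp add: heat_layer_def[abs_def] ppow_def)

text \<open>With r = sqrt (pi / t) and j derivatives, r^(m + j) from the definition times r^(m/p -
  m) from the kernel bound is r^(j + m/p), that is a constant times t^(-(j + m/p)/2).\<close>

lemma heat_layer_bound:
  fixes bs :: "'a::euclidean_space list"
  assumes p: "p > 1" and \<gamma>: "\<gamma> > 0"
  shows "\<exists>C\<ge>0. \<forall>g t x. Lp_fun p g \<longrightarrow> \<bar>heat_layer \<gamma> g bs t x\<bar> \<le>
    C * np p g powr (1 / p) * (ppow ((\<gamma> - real DIM('a) / p - real (length bs)) / 2 - 1) t * exp (- t))"
proof -
  have "poly_gauss pi 0 (iter_pdiff bs (gauss :: 'a \<Rightarrow> real))" by (rule poly_gauss_iter_pdiff[OF poly_gauss_gauss])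
  from scaled_kernel_bound[OF p this pi_gt_zero] obtain C where C: "C \<ge> 0"
    "\<And>r x g. r > 0 \<Longrightarrow> Lp_fun p g \<Longrightarrow> \<bar>LINT v|lborel. iter_pdiff bs gauss (r *\<^sub>R (x - v)) * g v\<bar> \<le> C * r powr (real DIM('a) / p - real DIM('a)) * np p g powr (1 / p)"
    by blast
  define m where "m = real DIM('a)"
  define j where "j = real (length bs)"
  define c where "c = pi powr ((j + m / p) / 2)"
  have G: "Gamma (\<gamma> / 2) > 0" using \<gamma> by (intro Gamma_real_pos) simp
  show ?thesis
  proof (intro exI[of _ "C * c / Gamma (\<gamma> / 2)"] conjI allI impI)
    show "0 \<le> C * c / Gamma (\<gamma> / 2)" using C(1) G by (simp add: c_def)
    fix g t x assume g: "Lp_fun p (g :: 'a \<Rightarrow> real)"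
    show "\<bar>heat_layer \<gamma> g bs t x\<bar> \<le> C * c / Gamma (\<gamma> / 2) * np p g powr (1 / p) * (ppow ((\<gamma> - real DIM('a) / p - real (length bs)) / 2 - 1) t * exp (- t))"
    proof (cases "t > 0")
      case True
      define r where "r = sqrt (pi / t)"
      have r: "r > 0" using True by (simp add: r_def)
      define U where "U = (LINT v|lborel. iter_pdiff bs gauss (r *\<^sub>R (x - v)) * g v)"
      define a where "a = t powr (\<gamma> / 2 - 1) * exp (- t) / Gamma (\<gamma> / 2)"
      have a: "a \<ge> 0" using G by (simp add: a_def)
      have rm: "r ^ (DIM('a) + length bs) = r powr (m + j)"
        using powr_realpow[OF r, of "DIM('a) + length bs"] by (simp add: m_def j_def)
      have "\<bar>heat_layer \<gamma> g bs t x\<bar> = a * r powr (m + j) * \<bar>U\<bar>"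
        unfolding heat_layer_def r_def[symmetric] U_def[symmetric] rm abs_mult using True G r by (simp add: ppow_def a_def abs_mult)
      also have "\<dots> \<le> a * r powr (m + j) * (C * r powr (m / p - m) * np p g powr (1 / p))"
        unfolding U_def m_def using C(2)[OF r g] a by (intro mult_left_mono) auto
      also have "\<dots> = C * np p g powr (1 / p) * (a * (r powr (m + j) * r powr (m / p - m)))" by (simp only: mult_ac)
      also have "r powr (m + j) * r powr (m / p - m) = (r powr 2) powr ((j + m / p) / 2)"
        unfolding powr_add[symmetric] powr_powr by (rule arg_cong[where f="(powr) r"]) simp
      also have "r powr 2 = r\<^sup>2" using r by simp
      also have "r\<^sup>2 = pi / t" using True unfolding r_def by (intro real_sqrt_pow2) simp
      also have "(pi / t) powr ((j + m / p) / 2) = c * t powr (- ((j + m / p) / 2))"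
        using powr_divide[of pi t "(j + m / p) / 2"] True unfolding c_def powr_minus_divide by simp
      also have "C * np p g powr (1 / p) * (a * (c * t powr (- ((j + m / p) / 2)))) =
          C * c / Gamma (\<gamma> / 2) * np p g powr (1 / p) * ((t powr (\<gamma> / 2 - 1) * t powr (- ((j + m / p) / 2))) * exp (- t))"
        by (simp add: a_def)
      also have "t powr (\<gamma> / 2 - 1) * t powr (- ((j + m / p) / 2)) = t powr ((\<gamma> - m / p - j) / 2 - 1)"
        unfolding powr_add[symmetric] by (rule arg_cong[where f="(powr) t"]) (simp add: field_simps)
      finally show ?thesis using True by (simp add: ppow_def m_def j_def)
    qed (simp add: heat_layer_def ppow_def)
  qed
qed

text \<open>The joint measure of t and the Gaussian variable has the transform of the Bessel
  potential, by the Gamma integral. Integrating out the Gaussian variable first gives the heat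
  layers, at every x where the double integral converges.\<close>

lemma heat_layer_rep:
  fixes g :: "'a::euclidean_space \<Rightarrow> real"
  assumes p: "p > 1" and \<gamma>: "\<gamma> > 0" and g: "Lp_fun p g"
    and m: "(\<lambda>x. LINT t|lborel. heat_layer \<gamma> g [] t x) \<in> borel_measurable borel"
  shows "bessel_rep \<gamma> p (\<lambda>x. LINT t|lborel. heat_layer \<gamma> g [] t x) g"
proof -
  have gm[measurable]: "g \<in> borel_measurable borel" using g by (simp add: Lp_fun_def)
  have G: "Gamma (\<gamma> / 2) > 0" using \<gamma> by (intro Gamma_real_pos) simp
  define \<rho> where "\<rho> = (\<lambda>t. ppow (\<gamma> / 2 - 1) t * exp (- t) / Gamma (\<gamma> / 2))"
  have \<rho>0: "\<rho> t \<ge> 0" for t using G by (simp add: \<rho>_def)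
  have [measurable]: "\<rho> \<in> borel_measurable borel" unfolding \<rho>_def by measurable
  have \<rho>i: "integrable lborel \<rho>" unfolding \<rho>_def using integrable_gamma[of "\<gamma> / 2" 1] \<gamma> by simp
  let ?M = "lborel \<Otimes>\<^sub>M (lborel :: 'a measure) :: (real \<times> 'a) measure"
  define k where "k = (\<lambda>(t, z::'a). \<rho> t * gauss z)"
  define Y where "Y = (\<lambda>(t, z::'a). sqrt (t / pi) *\<^sub>R z)"
  have km[measurable]: "k \<in> borel_measurable ?M" and Ym[measurable]: "Y \<in> borel_measurable ?M" unfolding k_def Y_def by measurable
  have ki: "integrable ?M k"
  proof (rule lborel_pair.Fubini_integrable)
    show "integrable lborel (\<lambda>t. LINT z|lborel. norm (k (t, z)))"
      using \<rho>i \<rho>0 by (simp add: k_def abs_mult abs_of_pos gauss_pos integral_gauss)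
    show "AE t in lborel. integrable lborel (\<lambda>z. k (t, z))" by (simp add: k_def integrable_gauss)
  qed simp
  obtain N where N: "weighted N" "\<And>\<xi>. wchar N \<xi> = (\<integral>w. of_real (k w) * cis (- (2 * pi * (Y w \<bullet> \<xi>))) \<partial>?M)"
    "\<And>x. wconv N g x = (\<integral>w. k w * g (x + Y w) \<partial>?M)"
    using weighted_exists[OF ki Ym] gm by blast
  have ch: "wchar N \<xi> = of_real ((1 + (norm \<xi>)\<^sup>2) powr (- (\<gamma> / 2)))" for \<xi>
  proof -
    have I2: "integrable ?M (\<lambda>w. of_real (k w) * cis (- (2 * pi * (Y w \<bullet> \<xi>))))"
      using ki Ym by (intro integrable_mult_cis) auto
    have "wchar N \<xi> = (LINT t|lborel. (LINT z|lborel. of_real (k (t, z)) * cis (- (2 * pi * (Y (t, z) \<bullet> \<xi>)))))"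
      unfolding N(2) using lborel_pair.integral_fst'[OF I2] by simp
    also have "\<dots> = (LINT t|lborel. of_real (\<rho> t * exp (- ((norm \<xi>)\<^sup>2 * t))))"
    proof (rule Bochner_Integration.integral_cong[OF refl])
      fix t :: real
      have "(LINT z|lborel. of_real (k (t, z)) * cis (- (2 * pi * (Y (t, z) \<bullet> \<xi>)))) = (LINT z|lborel. of_real (\<rho> t) * (complex_of_real (gauss z) * cis (- (2 * pi * (z \<bullet> (sqrt (t / pi) *\<^sub>R \<xi>))))))"
        by (simp add: k_def Y_def mult_ac)
      also have "\<dots> = of_real (\<rho> t) * of_real (gauss (sqrt (t / pi) *\<^sub>R \<xi>))"
        by (simp only: integral_mult_right_zero fourier_gauss)
      also have "\<dots> = of_real (\<rho> t * exp (- ((norm \<xi>)\<^sup>2 * t)))"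
        by (cases "t > 0") (simp_all add: gauss_def power_mult_distrib mult.commute \<rho>_def ppow_def)
      finally show "(LINT z|lborel. of_real (k (t, z)) * cis (- (2 * pi * (Y (t, z) \<bullet> \<xi>)))) = complex_of_real (\<rho> t * exp (- ((norm \<xi>)\<^sup>2 * t)))" .
    qed
    also have "\<dots> = of_real (LINT t|lborel. \<rho> t * exp (- ((norm \<xi>)\<^sup>2 * t)))" by (rule integral_complex_of_real)
    also have "(LINT t|lborel. \<rho> t * exp (- ((norm \<xi>)\<^sup>2 * t))) = (LINT t|lborel. 1 / Gamma (\<gamma> / 2) * (ppow (\<gamma> / 2 - 1) t * exp (- ((1 + (norm \<xi>)\<^sup>2) * t))))"
    proof (rule Bochner_Integration.integral_cong[OF refl])
      fix t :: real
      have "exp (- ((1 + (norm \<xi>)\<^sup>2) * t)) = exp (- t) * exp (- ((norm \<xi>)\<^sup>2 * t))"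
        by (simp add: exp_add[symmetric] distrib_right)
      then show "\<rho> t * exp (- ((norm \<xi>)\<^sup>2 * t)) = 1 / Gamma (\<gamma> / 2) * (ppow (\<gamma> / 2 - 1) t * exp (- ((1 + (norm \<xi>)\<^sup>2) * t)))"
        by (simp add: \<rho>_def)
    qed
    also have "\<dots> = (1 + (norm \<xi>)\<^sup>2) powr (- (\<gamma> / 2))"
      using integral_gamma[of "\<gamma> / 2" "1 + (norm \<xi>)\<^sup>2"] \<gamma> G unfolding integral_mult_right_zero by (simp add: add_pos_nonneg less_imp_neq[OF G, symmetric])
    finally show ?thesis .
  qed
  have "wchar N \<xi> * of_real ((1 + (norm \<xi>)\<^sup>2) powr (\<gamma> / 2)) = wchar (return borel (0, 1)) \<xi>" for \<xi>
  proof -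
    have "1 + (norm \<xi>)\<^sup>2 > 0" by (simp add: add_pos_nonneg)
    then show ?thesis unfolding ch weighted_unit(2) of_real_mult[symmetric] powr_add[symmetric] by simp
  qed
  from bessel_rep_wconv[OF p N(1) weighted_unit(1) this g] have rep: "bessel_rep \<gamma> p (wconv N g) g"
    by (simp add: weighted_unit(3)[OF gm])
  have "AE x in lborel. integrable ?M (\<lambda>w. k w * g (x + Y w))"
  proof (rule AE_integrable_mixture[OF p lborel_pair.sigma_finite_measure_axioms _ ki])
    show "(\<lambda>(w, x). g (x + Y w)) \<in> borel_measurable (?M \<Otimes>\<^sub>M borel)" by measurable
    show "Lp_fun p (\<lambda>x. g (x + Y w))" for w by (rule Lp_fun_translate[OF g])
    show "integrable ?M (\<lambda>w. \<bar>k w\<bar> * np p (\<lambda>x. g (x + Y w)))" using ki by (simp add: np_translate[OF g])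
  qed
  then have "AE x in lborel. wconv N g x = (LINT t|lborel. heat_layer \<gamma> g [] t x)"
  proof eventually_elim
    case (elim x)
    have "wconv N g x = (LINT t|lborel. (LINT z|lborel. k (t, z) * g (x + Y (t, z))))"
      unfolding N(3) using lborel_pair.integral_fst'[OF elim] by simp
    also have "\<dots> = (LINT t|lborel. heat_layer \<gamma> g [] t x)"
    proof (rule Bochner_Integration.integral_cong[OF refl])
      fix t :: real
      show "(LINT z|lborel. k (t, z) * g (x + Y (t, z))) = heat_layer \<gamma> g [] t x"
      proof (cases "t > 0")
        case True
        define c where "c = sqrt (t / pi)"
        have c: "c > 0" using True by (simp add: c_def)
        have r: "sqrt (pi / t) = 1 / c" by (simp add: c_def real_sqrt_divide)
        have "(LINT z|lborel. k (t, z) * g (x + Y (t, z))) = (LINT z|lborel. \<rho> t * (gauss ((1 / c) *\<^sub>R (x - (c *\<^sub>R z + x))) * g (c *\<^sub>R z + x)))"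
          using c by (simp add: k_def Y_def c_def[symmetric] mult.assoc add.commute gauss_minus)
        also have "\<dots> = \<rho> t * ((1 / \<bar>c\<bar> ^ DIM('a)) *\<^sub>R (LINT v|lborel. gauss ((1 / c) *\<^sub>R (x - v)) * g v))"
          using integral_affine[of c "\<lambda>v. gauss ((1 / c) *\<^sub>R (x - v)) * g v" x] c unfolding integral_mult_right_zero by simp
        also have "\<dots> = heat_layer \<gamma> g [] t x"
          unfolding heat_layer_def r using c by (simp add: \<rho>_def power_one_over)
        finally show ?thesis .
      qed (simp add: k_def \<rho>_def heat_layer_def ppow_def)
    qed
    finally show ?case .
  qed
  then show ?thesis by (rule bessel_rep_cong_AE[OF rep m])
qed

text \<open>The bound is linear in the norm of the representer, so applied to an error it turns L_p
  approximation into Zygmund approximation. The witness is the integral of the heat layers; its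
  continuity supplies the measurability that the representation asks for.\<close>

theorem zygmund_embedding:
  fixes p \<gamma> :: real
  assumes p: "p > 1" and s: "\<gamma> - real DIM('a::euclidean_space) / p > 0"
  shows "\<exists>C\<ge>0. \<forall>g::'a \<Rightarrow> real. Lp_fun p g \<longrightarrow> (\<exists>f. bessel_rep \<gamma> p f g \<and>
    zygmund (\<gamma> - real DIM('a) / p) f \<and> zyg_norm (\<gamma> - real DIM('a) / p) f \<le> C * Lp_norm p g)"
proof -
  define s where "s = \<gamma> - real DIM('a) / p"
  have s0: "s > 0" using s by (simp add: s_def)
  have "real DIM('a) / p > 0" using p by simp
  then have \<gamma>: "\<gamma> > 0" using s by linarith
  obtain B where B: "\<And>bs. B bs \<ge> 0" "\<And>(bs::'a list) g t x. Lp_fun p g \<Longrightarrow> \<bar>heat_layer \<gamma> g bs t x\<bar> \<le>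
    B bs * np p g powr (1 / p) * (ppow ((s - real (length bs)) / 2 - 1) t * exp (- t))"
    using heat_layer_bound[OF p \<gamma>, where 'a='a] unfolding s_def by metis
  define L where "L = {bs::'a list. set bs \<subseteq> Basis \<and> length bs \<le> zyg_k s + 2}"
  \<comment> \<open>One constant for all multi-indices up to order k + 2, of which there are
    finitely many.\<close>
  define B0 where "B0 = (\<Sum>bs\<in>L. B bs)"
  have "finite L" unfolding L_def by (rule finite_lists_length_le) simp
  then have BB: "B bs \<le> B0" if "bs \<in> L" for bs unfolding B0_def using B(1) that by (intro member_le_sum) auto
  have B0: "B0 \<ge> 0" unfolding B0_def using B(1) by (simp add: sum_nonneg)
  define D where "D = (\<Sum>j\<le>zyg_k s. Gamma ((s - real j) / 2)) + (4 + (real DIM('a))\<^sup>2) * 2 * frac_const (1 - zyg_alpha s / 2)"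
  show ?thesis unfolding s_def[symmetric]
  proof (intro exI[of _ "\<bar>D\<bar> * B0"] conjI allI impI)
    show "\<bar>D\<bar> * B0 \<ge> 0" using B0 by simp
    fix g :: "'a \<Rightarrow> real" assume g: "Lp_fun p g"
    define f where "f = (\<lambda>x. LINT t|lborel. heat_layer \<gamma> g [] t x)"
    define A where "A = B0 * np p g powr (1 / p)"
    have A: "A \<ge> 0" using B0 by (simp add: A_def)
    have gm: "g \<in> borel_measurable borel" using g by (simp add: Lp_fun_def)
    have bnd: "\<bar>heat_layer \<gamma> g bs t x\<bar> \<le> A * (ppow ((s - real (length bs)) / 2 - 1) t * exp (- t))"
      if "set bs \<subseteq> Basis" "length bs \<le> zyg_k s + 2" for bs t x
    proof -
      have "B bs * np p g powr (1 / p) \<le> A" unfolding A_def using that by (intro mult_right_mono BB) (auto simp: L_def)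
      then show ?thesis by (intro order_trans[OF B(2)[OF g] mult_right_mono]) auto
    qed
    note hyps = s0 A heat_layer_measurable[OF gm] heat_layer_derivative[OF p g] bnd
    have z: "zygmund s f" unfolding f_def by (rule zygmund_mixture[OF hyps])
    have "zyg_norm s f \<le> D * A" unfolding f_def D_def by (rule zyg_norm_mixture[OF hyps])
    also have "\<dots> \<le> \<bar>D\<bar> * A" using A by (intro mult_right_mono) auto
    finally have "zyg_norm s f \<le> \<bar>D\<bar> * B0 * Lp_norm p g" by (simp add: A_def Lp_norm_np mult.assoc)
    moreover have "continuous_on UNIV f" using z unfolding zygmund_def by (metis iter_pdiff.simps(1) empty_subsetI le0 list.set(1) list.size(3))
    then have "f \<in> borel_measurable borel" by (rule borel_measurable_continuous_onI)
    then have "bessel_rep \<gamma> p f g" unfolding f_def by (rule heat_layer_rep[OF p \<gamma> g])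
    ultimately show "\<exists>f. bessel_rep \<gamma> p f g \<and> zygmund s f \<and> zyg_norm s f \<le> \<bar>D\<bar> * B0 * Lp_norm p g" using z by blast
  qed
qed

section \<open>Transfer of density to the Bessel and Zygmund norms\<close>

lemma nn_class_approx:
  fixes f :: "real^'m \<Rightarrow> real"
  assumes p: "p > 1" and \<gamma>: "\<gamma> \<ge> 0" and \<sigma>: "bessel_space \<gamma> p \<sigma>" "\<not> (AE t in lborel. \<sigma> t = 0)"
    and fg: "bessel_rep \<gamma> p f g" and \<epsilon>: "\<epsilon> > 0"
  shows "\<exists>F\<in>nn_class \<sigma>. \<exists>e. bessel_rep \<gamma> p (\<lambda>x. F x - f x) e \<and> Lp_norm p e \<le> \<epsilon>"
proof -
  obtain g0 where g0: "bessel_rep \<gamma> p \<sigma> g0" using \<sigma>(1) by (auto simp: bessel_space_def)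
  have g: "Lp_fun p g" using fg by (simp add: bessel_rep_def)
  have "g \<in> Lp_cl p {g. \<exists>F\<in>nn_class \<sigma>. bessel_rep \<gamma> p F g}" by (rule nn_class_dense[OF p \<gamma> g0 \<sigma>(2) g])
  \<comment> \<open>Closeness in the closure is measured by \<open>np\<close>, the p-th power of the
    norm.\<close>
  moreover have "\<epsilon> powr p > 0" using \<epsilon> by simp
  ultimately obtain F e where F: "F \<in> nn_class \<sigma>" "bessel_rep \<gamma> p F e" "np p (\<lambda>x. g x - e x) < \<epsilon> powr p"
    unfolding Lp_cl_def by blast
  have "np p (\<lambda>x. e x - g x) powr (1 / p) \<le> (\<epsilon> powr p) powr (1 / p)"
    using F(3) p by (intro powr_mono2) (auto simp: np_minus_commute[of p e g] np_nonneg)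
  also have "\<dots> = \<epsilon>" using \<epsilon> p by (simp add: powr_powr)
  finally have "Lp_norm p (\<lambda>x. e x - g x) \<le> \<epsilon>" by (simp add: Lp_norm_np)
  moreover have "bessel_rep \<gamma> p (\<lambda>x. F x - f x) (\<lambda>x. e x - g x)" using bessel_rep_linear[OF p F(2) fg, of 1 "-1"] by simp
  ultimately show ?thesis using F(1) by blast
qed

lemma bessel_rep_unique:
  assumes p: "p > 1" and \<gamma>: "\<gamma> \<ge> 0" and "bessel_rep \<gamma> p f g" "bessel_rep \<gamma> p h g"
  shows "AE x in lborel. f x = h x"
proof -
  have "AE x in lborel. f x = wconv (bessel_potential \<gamma>) g x" "AE x in lborel. h x = wconv (bessel_potential \<gamma>) g x"
    using assms(3,4) bessel_rep_iff[OF p \<gamma>] by blast+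
  then show ?thesis by eventually_elim simp
qed

theorem theorem1p8:
  fixes \<gamma> p :: real and \<sigma> :: "real \<Rightarrow> real" and f :: "real^'m \<Rightarrow> real"
  assumes "\<gamma> \<ge> 0" and "p > 1"
    and "\<not> (AE t in lborel. \<sigma> t = 0)"
    and "bessel_space \<gamma> p \<sigma>"
    and "bessel_space \<gamma> p f"
  shows "(\<forall>\<epsilon>>0. \<exists>F\<in>nn_class \<sigma>. \<exists>g. bessel_rep \<gamma> p (\<lambda>x. F x - f x) g \<and> Lp_norm p g \<le> \<epsilon>)
    \<and> (\<gamma> - real CARD('m) / p > 0 \<longrightarrow>
        (\<exists>f0. (AE x in lborel. f0 x = f x) \<and> zygmund (\<gamma> - real CARD('m) / p) f0 \<and>
           (\<forall>\<epsilon>>0. \<exists>F\<in>nn_class \<sigma>. \<exists>h. (AE x in lborel. h x = F x - f0 x) \<and>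
              zygmund (\<gamma> - real CARD('m) / p) h \<and> zyg_norm (\<gamma> - real CARD('m) / p) h \<le> \<epsilon>)))"
proof -
  note \<gamma> = assms(1) and p = assms(2)
  obtain g where fg: "bessel_rep \<gamma> p f g" using assms(5) by (auto simp: bessel_space_def)
  have g: "Lp_fun p g" using fg by (simp add: bessel_rep_def)
  note approx = nn_class_approx[OF p \<gamma> assms(4,3) fg]
  have "\<exists>f0. (AE x in lborel. f0 x = f x) \<and> zygmund (\<gamma> - real CARD('m) / p) f0 \<and>
           (\<forall>\<epsilon>>0. \<exists>F\<in>nn_class \<sigma>. \<exists>h. (AE x in lborel. h x = F x - f0 x) \<and>
              zygmund (\<gamma> - real CARD('m) / p) h \<and> zyg_norm (\<gamma> - real CARD('m) / p) h \<le> \<epsilon>)"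
    if s: "\<gamma> - real CARD('m) / p > 0"
  proof -
    obtain C where C: "C \<ge> 0" "\<And>g::real^'m \<Rightarrow> real. Lp_fun p g \<Longrightarrow> \<exists>f. bessel_rep \<gamma> p f g \<and>
        zygmund (\<gamma> - real CARD('m) / p) f \<and> zyg_norm (\<gamma> - real CARD('m) / p) f \<le> C * Lp_norm p g"
      using zygmund_embedding[OF p, where 'a="real^'m", of \<gamma>] s by auto
    obtain f0 where f0: "bessel_rep \<gamma> p f0 g" "zygmund (\<gamma> - real CARD('m) / p) f0" using C(2)[OF g] by blast
    have ae: "AE x in lborel. f0 x = f x" by (rule bessel_rep_unique[OF p \<gamma> f0(1) fg])
    show ?thesis
    proof (intro exI[of _ f0] conjI ae f0(2) allI impI)
      fix \<epsilon> :: real assume \<epsilon>: "\<epsilon> > 0"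
      \<comment> \<open>The summand 1 keeps the tolerance defined when C = 0.\<close>
      then have "\<epsilon> / (C + 1) > 0" using C(1) by simp
      \<comment> \<open>The embedding is applied to the representer e of F - f: it yields a regular
        version h of this difference, even where F itself is not continuous.\<close>
      from approx[OF this] obtain F e where F: "F \<in> nn_class \<sigma>" "bessel_rep \<gamma> p (\<lambda>x. F x - f x) e" "Lp_norm p e \<le> \<epsilon> / (C + 1)" by blast
      obtain h where h: "bessel_rep \<gamma> p h e" "zygmund (\<gamma> - real CARD('m) / p) h" "zyg_norm (\<gamma> - real CARD('m) / p) h \<le> C * Lp_norm p e"
        using C(2)[of e] F(2) by (auto simp: bessel_rep_def)
      have "C * Lp_norm p e \<le> (C + 1) * (\<epsilon> / (C + 1))" using F(3) C(1) \<epsilon> by (intro mult_mono) (auto simp: Lp_norm_np)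
      also have "\<dots> = \<epsilon>" using C(1) by simp
      finally have "zyg_norm (\<gamma> - real CARD('m) / p) h \<le> \<epsilon>" using h(3) by simp
      moreover have "AE x in lborel. h x = F x - f0 x"
        using bessel_rep_unique[OF p \<gamma> h(1) F(2)] ae by eventually_elim simp
      ultimately show "\<exists>F\<in>nn_class \<sigma>. \<exists>h. (AE x in lborel. h x = F x - f0 x) \<and>
              zygmund (\<gamma> - real CARD('m) / p) h \<and> zyg_norm (\<gamma> - real CARD('m) / p) h \<le> \<epsilon>" using F(1) h(2) by blast
    qed
  qed
  then show ?thesis using approx by blast
qed

end
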